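(* Let $N\ge1$, let $\phi:\mathbb{P}^N\to\mathbb{P}^N$ be a morphism defined over $\overline{\mathbb{Q}}$ of degree $d\ge2$, let $D$ be a nonzero effective divisor on $\mathbb{P}^N$ defined over $\overline{\mathbb{Q}}$, and let $D^{(n)}_{\mathrm{nc}}$ be the normal-crossings part of $(\phi^{(n)})^*(D)$. Let $k$ be a number field containing the fields of definition of $\phi$ and $D$, let $P\in\mathbb{P}^N(k)$, and let $S\subset M_k$ be a finite set containing the archimedean places. Let $$c=\sup_n\frac{\deg D^{(n)}_{\mathrm{nc}}-(N+1)}{d^n\deg(D)}.$$ Assume that the orbit $\mathcal{O}_\phi(P)$ is generic (in particular, infinite). Assuming Vojta's conjecture for $\mathbb{P}^N$, for all $\epsilon>0$, $$\frac{\sum_{v\notin S}\lambda_v(D,\phi^{(m)}(P))}{\deg(D)\,h(\phi^{(m)}(P))}>c-\epsilon$$ holds for all sufficiently large $m$. In particular: (i) If there exists $n$ such that $\deg D^{(n)}_{\mathrm{nc}}>N+1$, then $\mathcal{O}_\phi(P)\cap(\mathbb{P}^N\setminus D)(R_S)$ is a finite set. (ii) If $c=1$, then $$\lim_{m\to\infty}\frac{\sum_{v\notin S}\lambda_v(D,\phi^{(m)}(P))}{\deg(D)\,h(\phi^{(m)}(P))}$$ exists and is equal to $1$.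
   Context: Iterates and orbits: $\phi^{(m)}$ is the $m$-fold composition of $\phi$ with itself ($\phi^{(0)}=\mathrm{id}$), and $\mathcal{O}_\phi(P)=\{\phi^{(m)}(P):m=0,1,2,\ldots\}$; the index $n$ ranges over nonnegative integers. The degree of $\phi$ is the common degree of the homogeneous polynomials (without common factor) defining it. An infinite set of rational points of $\mathbb{P}^N$ is called generic if every infinite subset of it is Zariski-dense in $\mathbb{P}^N$. Heights: For a number field $k$, $M_k$ is the set of its places; for $v\in M_k$, $|\cdot|_v$ is the $\frac{[k_v:\mathbb{Q}_v]}{[k:\mathbb{Q}]}$-th power of the extension of the normalized absolute value on $\mathbb{Q}$, and $v(x)=-\log|x|_v$ (with $v(0)=+\infty$). The Weil height is $h([x_0:\cdots:x_N])=\sum_{v\in M_k}\log\max_i|x_i|_v$. If an effective divisor $D$ on $\mathbb{P}^N$ defined over $k$ is given by a homogeneous polynomial $F$ with coefficients in the ring of integers of $k$ (fix one choice of $F$), the local height is $\lambda_v(D,[x_0:\cdots:x_N])=v(F(x_0,\ldots,x_N))-\deg(D)\min_i v(x_i)$ (equal to $+\infty$ on $|D|$). Integral points: for a finite set $S\subset M_k$ containing all archimedean places, with ring of $S$-integers $R_S$, $(\mathbb{P}^N\setminus D)(R_S)$ denotes any $(S,D)$-integral set, i.e. any set of the form $\{P\in(\mathbb{P}^N\setminus D)(k):\lambda_v(D,P)\le c'_v\text{ for all }v\notin S\}$ with constants $c'_v$, almost all equal to $0$. Normal crossings: a divisor is normal-crossings if near each point it is defined by $x_1\cdots x_k=0$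 where $x_1,\ldots,x_k$ is part of a local (analytic) coordinate system; in particular each irreducible component has multiplicity $1$. A normal-crossings part $E_{\mathrm{nc}}$ of an effective divisor $E$ is a normal-crossings subdivisor of $E$ over $\overline{\mathbb{Q}}$ (i.e. $E-E_{\mathrm{nc}}$ effective) of highest possible degree; fix one if there are several. Vojta's conjecture for $\mathbb{P}^N$: for every number field $k$, every normal-crossings divisor $E$ on $\mathbb{P}^N$ defined over $k$, every finite set $S\subset M_k$ and every $\epsilon>0$, there exist a finite union $Z_\epsilon$ of hypersurfaces and a constant $C$ such that $\sum_{v\in S}\lambda_v(E,P)<(N+1+\epsilon)h(P)+C$ for all $P\in\mathbb{P}^N(k)\setminus Z_\epsilon$. *)

theory Defs
  imports
    "HOL-Analysis.Analysis"
    "HOL-Library.Poly_Mapping"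
    "HOL-Algebra.Algebraic_Closure_Type"
    "HOL-Algebra.QuotRing"
    "HOL-Algebra.Embedded_Algebras"
begin

section \<open>Number fields inside the complex numbers\<close>

abbreviation complex_ring :: "complex ring" where
  "complex_ring \<equiv> ring_of_type_algebra"

definition Qbar :: "complex set" where
  "Qbar = {z. algebraic z}"

definition number_field :: "complex set \<Rightarrow> bool" where
  "number_field K \<longleftrightarrow> subfield K complex_ring \<and> ring.finite_dimension complex_ring \<rat> K"

definition field_degree :: "complex set \<Rightarrow> nat" where
  "field_degree K = ring.dim complex_ring \<rat> K"

definition ring_of_integers :: "complex set \<Rightarrow> complex set" where
  "ring_of_integers K = {x \<in> K. algebraic_int x}"


section \<open>Places\<close>

definition absolute_value_on :: "complex set \<Rightarrow> (complex \<Rightarrow> real) \<Rightarrow> bool" where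
  "absolute_value_on K v \<longleftrightarrow>
     (\<forall>x\<in>K. 0 \<le> v x \<and> (v x = 0 \<longleftrightarrow> x = 0)) \<and>
     (\<forall>x\<in>K. \<forall>y\<in>K. v (x * y) = v x * v y \<and> v (x + y) \<le> v x + v y)"

definition padic_abs :: "nat \<Rightarrow> rat \<Rightarrow> real" where
  "padic_abs p r = (if r = 0 then 0 else
     (case quotient_of r of (a, b) \<Rightarrow>
       real p powi (int (multiplicity (int p) b) - int (multiplicity (int p) a))))"

definition standard_rat_abs :: "(rat \<Rightarrow> real) set" where
  "standard_rat_abs = insert (\<lambda>r. \<bar>real_of_rat r\<bar>) {padic_abs p |p. Factorial_Ring.prime p}"

text \<open>
  Every place of \<open>K\<close> contains exactly one absolute value whose restriction to the rationals is
  the usual or a normalized \<open>p\<close>-adic one. That absolute value represents the place here;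
  it is made extensional so that distinct elements are distinct places.
\<close>

definition places :: "complex set \<Rightarrow> (complex \<Rightarrow> real) set" where
  "places K = {v \<in> extensional K. absolute_value_on K v \<and>
                 (\<lambda>r. v (of_rat r)) \<in> standard_rat_abs}"

definition archimedean_places :: "complex set \<Rightarrow> (complex \<Rightarrow> real) set" where
  "archimedean_places K = {v \<in> places K. \<forall>r. v (of_rat r) = \<bar>real_of_rat r\<bar>}"

definition cauchy_ring :: "complex set \<Rightarrow> (complex \<Rightarrow> real) \<Rightarrow> (nat \<Rightarrow> complex) ring" where
  "cauchy_ring K v =
     \<lparr>carrier = {s. (\<forall>n. s n \<in> K) \<and>
        (\<forall>\<epsilon>>0. \<exists>n0. \<forall>m\<ge>n0. \<forall>n\<ge>n0. v (s m - s n) < \<epsilon>)},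
      monoid.mult = (\<lambda>s t n. s n * t n), one = (\<lambda>n. 1),
      ring.zero = (\<lambda>n. 0), add = (\<lambda>s t n. s n + t n)\<rparr>"

definition null_sequences :: "complex set \<Rightarrow> (complex \<Rightarrow> real) \<Rightarrow> (nat \<Rightarrow> complex) set" where
  "null_sequences K v = {s \<in> carrier (cauchy_ring K v). (\<lambda>n. v (s n)) \<longlonglongrightarrow> 0}"

definition completion :: "complex set \<Rightarrow> (complex \<Rightarrow> real) \<Rightarrow> (nat \<Rightarrow> complex) set ring" where
  "completion K v = cauchy_ring K v Quot null_sequences K v"

definition rat_completion :: "complex set \<Rightarrow> (complex \<Rightarrow> real) \<Rightarrow> (nat \<Rightarrow> complex) set set" where
  "rat_completion K v =
     (\<lambda>s. null_sequences K v +>\<^bsub>cauchy_ring K v\<^esub> s) `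
       {s \<in> carrier (cauchy_ring K v). \<forall>n. s n \<in> \<rat>}"

text \<open>
  The degree of the completion \<open>K\<^sub>v\<close> over the completion of the rationals, which is embedded
  in \<open>K\<^sub>v\<close> as the classes of rational Cauchy sequences.
\<close>

definition local_degree :: "complex set \<Rightarrow> (complex \<Rightarrow> real) \<Rightarrow> nat" where
  "local_degree K v = ring.dim (completion K v) (rat_completion K v) (carrier (completion K v))"

definition place_abs :: "complex set \<Rightarrow> (complex \<Rightarrow> real) \<Rightarrow> complex \<Rightarrow> real" where
  "place_abs K v x = v x powr (real (local_degree K v) / real (field_degree K))"

definition place_val :: "complex set \<Rightarrow> (complex \<Rightarrow> real) \<Rightarrow> complex \<Rightarrow> ereal" where
  "place_val K v x = (if x = 0 then \<infinity> else ereal (- ln (place_abs K v x)))"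


section \<open>Homogeneous polynomials in the variables 0, ..., N\<close>

type_synonym cpoly = "(nat \<Rightarrow>\<^sub>0 nat) \<Rightarrow>\<^sub>0 complex"

definition poly_eval :: "cpoly \<Rightarrow> (nat \<Rightarrow> complex) \<Rightarrow> complex" where
  "poly_eval F x = (\<Sum>\<alpha>\<in>Poly_Mapping.keys F.
     Poly_Mapping.lookup F \<alpha> * (\<Prod>i\<in>Poly_Mapping.keys \<alpha>. x i ^ Poly_Mapping.lookup \<alpha> i))"

definition poly_subst :: "cpoly \<Rightarrow> (nat \<Rightarrow> cpoly) \<Rightarrow> cpoly" where
  "poly_subst F \<phi> = (\<Sum>\<alpha>\<in>Poly_Mapping.keys F.
     Poly_Mapping.single 0 (Poly_Mapping.lookup F \<alpha>) *
       (\<Prod>i\<in>Poly_Mapping.keys \<alpha>. \<phi> i ^ Poly_Mapping.lookup \<alpha> i))"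

definition monomial_degree :: "(nat \<Rightarrow>\<^sub>0 nat) \<Rightarrow> nat" where
  "monomial_degree \<alpha> = (\<Sum>i\<in>Poly_Mapping.keys \<alpha>. Poly_Mapping.lookup \<alpha> i)"

definition homogeneous :: "nat \<Rightarrow> nat \<Rightarrow> cpoly \<Rightarrow> bool" where
  "homogeneous N e F \<longleftrightarrow>
     (\<forall>\<alpha>\<in>Poly_Mapping.keys F. Poly_Mapping.keys \<alpha> \<subseteq> {..N} \<and> monomial_degree \<alpha> = e)"

definition coeffs_in :: "complex set \<Rightarrow> cpoly \<Rightarrow> bool" where
  "coeffs_in L F \<longleftrightarrow> (\<forall>\<alpha>. Poly_Mapping.lookup F \<alpha> \<in> L)"


section \<open>Projective space\<close>

text \<open>
  Homogeneous coordinate vectors with entries in \<open>L\<close> are functions vanishing beyond \<open>N\<close>;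
  a point is the set of all complex multiples of such a vector.
\<close>

definition coord_vectors :: "nat \<Rightarrow> complex set \<Rightarrow> (nat \<Rightarrow> complex) set" where
  "coord_vectors N L = {x. (\<forall>i\<le>N. x i \<in> L) \<and> (\<forall>i>N. x i = 0) \<and> (\<exists>i. x i \<noteq> 0)}"

definition proj_point :: "(nat \<Rightarrow> complex) \<Rightarrow> (nat \<Rightarrow> complex) set" where
  "proj_point x = {(\<lambda>i. c * x i) |c. c \<noteq> 0}"

definition proj_space :: "nat \<Rightarrow> complex set \<Rightarrow> (nat \<Rightarrow> complex) set set" where
  "proj_space N L = proj_point ` coord_vectors N L"

definition representative :: "nat \<Rightarrow> complex set \<Rightarrow> (nat \<Rightarrow> complex) set \<Rightarrow> nat \<Rightarrow> complex" where
  "representative N K P = (SOME x. x \<in> P \<and> x \<in> coord_vectors N K)"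

definition vanishes_at :: "cpoly \<Rightarrow> (nat \<Rightarrow> complex) set \<Rightarrow> bool" where
  "vanishes_at F P \<longleftrightarrow> (\<forall>x\<in>P. poly_eval F x = 0)"

definition zariski_closed :: "nat \<Rightarrow> (nat \<Rightarrow> complex) set set \<Rightarrow> bool" where
  "zariski_closed N Z \<longleftrightarrow>
     (\<exists>T. (\<forall>H\<in>T. (\<exists>e. homogeneous N e H) \<and> coeffs_in Qbar H) \<and>
          Z = {P \<in> proj_space N Qbar. \<forall>H\<in>T. vanishes_at H P})"

definition zariski_dense :: "nat \<Rightarrow> (nat \<Rightarrow> complex) set set \<Rightarrow> bool" where
  "zariski_dense N A \<longleftrightarrow> (\<forall>Z. zariski_closed N Z \<and> A \<subseteq> Z \<longrightarrow> Z = proj_space N Qbar)"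

definition generic :: "nat \<Rightarrow> (nat \<Rightarrow> complex) set set \<Rightarrow> bool" where
  "generic N A \<longleftrightarrow> A \<subseteq> proj_space N Qbar \<and> infinite A \<and>
     (\<forall>B. B \<subseteq> A \<and> infinite B \<longrightarrow> zariski_dense N B)"


section \<open>Morphisms, iterates and orbits\<close>

text \<open>
  A morphism is given by its tuple of homogeneous polynomials of degree \<open>d\<close> over \<open>L\<close>, which
  have no common zero; the components with index beyond \<open>N\<close> play no role.
\<close>

definition proj_morphism :: "nat \<Rightarrow> complex set \<Rightarrow> nat \<Rightarrow> (nat \<Rightarrow> cpoly) \<Rightarrow> bool" where
  "proj_morphism N L d \<phi> \<longleftrightarrow>
     (\<forall>i\<le>N. homogeneous N d (\<phi> i) \<and> coeffs_in L (\<phi> i)) \<and>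
     (\<forall>x\<in>coord_vectors N Qbar. \<exists>i\<le>N. poly_eval (\<phi> i) x \<noteq> 0)"

definition proj_map :: "nat \<Rightarrow> (nat \<Rightarrow> cpoly) \<Rightarrow> (nat \<Rightarrow> complex) set \<Rightarrow> (nat \<Rightarrow> complex) set" where
  "proj_map N \<phi> P = (\<Union>x\<in>P. proj_point (\<lambda>i. if i \<le> N then poly_eval (\<phi> i) x else 0))"

definition orbit :: "nat \<Rightarrow> (nat \<Rightarrow> cpoly) \<Rightarrow> (nat \<Rightarrow> complex) set \<Rightarrow> (nat \<Rightarrow> complex) set set" where
  "orbit N \<phi> P = {(proj_map N \<phi> ^^ m) P |m. True}"

primrec poly_iterate :: "(nat \<Rightarrow> cpoly) \<Rightarrow> nat \<Rightarrow> nat \<Rightarrow> cpoly" where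
  "poly_iterate \<phi> 0 = (\<lambda>i. Poly_Mapping.single (Poly_Mapping.single i 1) 1)"
| "poly_iterate \<phi> (Suc n) = (\<lambda>i. poly_subst (\<phi> i) (poly_iterate \<phi> n))"


section \<open>Effective divisors\<close>

text \<open>
  An effective divisor on projective space is given by a nonzero homogeneous polynomial,
  unique up to a scalar. Sums of divisors are products of equations, so the difference of
  two divisors is effective iff one equation divides the other; pull-back is substitution;
  nonzero constants define the zero divisor.
\<close>

definition effective_divisor :: "nat \<Rightarrow> complex set \<Rightarrow> cpoly \<Rightarrow> bool" where
  "effective_divisor N L F \<longleftrightarrow> F \<noteq> 0 \<and> (\<exists>e. homogeneous N e F) \<and> coeffs_in L F"

definition divisor_degree :: "cpoly \<Rightarrow> nat" where
  "divisor_degree F = Max (monomial_degree ` Poly_Mapping.keys F)"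

definition pullback :: "(nat \<Rightarrow> cpoly) \<Rightarrow> cpoly \<Rightarrow> cpoly" where
  "pullback \<phi> F = poly_subst F \<phi>"


section \<open>Normal crossings\<close>

text \<open>
  Local analytic functions on complex affine space with finite set \<open>I\<close> of coordinates.
  Points are functions on the naturals; only coordinates in \<open>I\<close> vary near \<open>p\<close>.
\<close>

definition polydisc :: "nat set \<Rightarrow> (nat \<Rightarrow> complex) \<Rightarrow> real \<Rightarrow> (nat \<Rightarrow> complex) set" where
  "polydisc I p r = {z. (\<forall>i\<in>I. cmod (z i - p i) < r) \<and> (\<forall>i. i \<notin> I \<longrightarrow> z i = p i)}"

definition analytic_near :: "nat set \<Rightarrow> ((nat \<Rightarrow> complex) \<Rightarrow> complex) \<Rightarrow> (nat \<Rightarrow> complex) \<Rightarrow> bool" where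
  "analytic_near I f p \<longleftrightarrow>
     (\<exists>r>0. \<exists>a :: (nat \<Rightarrow>\<^sub>0 nat) \<Rightarrow> complex. \<forall>z\<in>polydisc I p r.
        ((\<lambda>\<alpha>. a \<alpha> * (\<Prod>i\<in>I. (z i - p i) ^ Poly_Mapping.lookup \<alpha> i)) has_sum f z)
          {\<alpha>. Poly_Mapping.keys \<alpha> \<subseteq> I})"

text \<open>
  A local coordinate system centred at \<open>p\<close> is the germ of a biholomorphic map \<open>x\<close> to a
  neighbourhood of the origin.
\<close>

definition local_coordinates ::
    "nat set \<Rightarrow> (nat \<Rightarrow> complex) \<Rightarrow> ((nat \<Rightarrow> complex) \<Rightarrow> nat \<Rightarrow> complex) \<Rightarrow> bool" where
  "local_coordinates I p x \<longleftrightarrow>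
     x p = (\<lambda>_. 0) \<and> (\<forall>z i. i \<notin> I \<longrightarrow> x z i = 0) \<and>
     (\<forall>i\<in>I. analytic_near I (\<lambda>z. x z i) p) \<and>
     (\<exists>y. (\<forall>t i. i \<notin> I \<longrightarrow> y t i = p i) \<and>
          (\<forall>i\<in>I. analytic_near I (\<lambda>t. y t i) (\<lambda>_. 0)) \<and>
          (\<exists>r>0. (\<forall>z\<in>polydisc I p r. y (x z) = z) \<and>
                 (\<forall>t\<in>polydisc I (\<lambda>_. 0) r. x (y t) = t)))"

text \<open>
  In the affine chart where the \<open>j\<close>-th coordinate is 1, the remaining coordinates are the
  affine ones and the restriction of \<open>E\<close> is the local equation. Near each point of
  complex projective space it must agree, up to a unit \<open>u\<close>, with a product of distinct members
  of a local coordinate system.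
\<close>

definition normal_crossings :: "nat \<Rightarrow> cpoly \<Rightarrow> bool" where
  "normal_crossings N E \<longleftrightarrow>
     (\<forall>p\<in>coord_vectors N UNIV. \<forall>j\<le>N. p j = 1 \<longrightarrow>
       (\<exists>x A u. local_coordinates ({..N} - {j}) p x \<and> A \<subseteq> {..N} - {j} \<and>
          analytic_near ({..N} - {j}) u p \<and> u p \<noteq> 0 \<and>
          (\<exists>r>0. \<forall>z\<in>polydisc ({..N} - {j}) p r. poly_eval E z = u z * (\<Prod>i\<in>A. x z i))))"

definition nc_part :: "nat \<Rightarrow> cpoly \<Rightarrow> cpoly \<Rightarrow> bool" where
  "nc_part N E G \<longleftrightarrow>
     effective_divisor N Qbar G \<and> normal_crossings N G \<and> G dvd E \<and>
     (\<forall>H. effective_divisor N Qbar H \<and> normal_crossings N H \<and> H dvd E \<longrightarrow>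
          divisor_degree H \<le> divisor_degree G)"


section \<open>Heights, integral points and Vojta's conjecture\<close>

definition weil_height :: "nat \<Rightarrow> complex set \<Rightarrow> (nat \<Rightarrow> complex) set \<Rightarrow> real" where
  "weil_height N K P =
     (\<Sum>\<^sub>\<infinity>v\<in>places K. ln (Max ((\<lambda>i. place_abs K v (representative N K P i)) ` {..N})))"

definition local_height ::
    "nat \<Rightarrow> complex set \<Rightarrow> (complex \<Rightarrow> real) \<Rightarrow> cpoly \<Rightarrow> (nat \<Rightarrow> complex) set \<Rightarrow> ereal" where
  "local_height N K v F P =
     place_val K v (poly_eval F (representative N K P)) -
     ereal (real (divisor_degree F)) *
       Min ((\<lambda>i. place_val K v (representative N K P i)) ` {..N})"

definition integral_set ::
    "nat \<Rightarrow> complex set \<Rightarrow> (complex \<Rightarrow> real) set \<Rightarrow> cpoly \<Rightarrow> (nat \<Rightarrow> complex) set set \<Rightarrow> bool" where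
  "integral_set N K S F I \<longleftrightarrow>
     (\<exists>c :: (complex \<Rightarrow> real) \<Rightarrow> real. finite {v \<in> places K. c v \<noteq> 0} \<and>
        I = {P \<in> proj_space N K. \<not> vanishes_at F P \<and>
               (\<forall>v\<in>places K - S. local_height N K v F P \<le> ereal (c v))})"

definition vojta_conjecture :: "nat \<Rightarrow> bool" where
  "vojta_conjecture N \<longleftrightarrow>
     (\<forall>K E S. \<forall>\<epsilon>::real.
        number_field K \<and> effective_divisor N (ring_of_integers K) E \<and> normal_crossings N E \<and>
        finite S \<and> S \<subseteq> places K \<and> \<epsilon> > 0 \<longrightarrow>
        (\<exists>Z C. finite Z \<and>
           (\<forall>H\<in>Z. effective_divisor N Qbar H \<and> divisor_degree H > 0) \<and>
           (\<forall>P\<in>proj_space N K. (\<forall>H\<in>Z. \<not> vanishes_at H P) \<longrightarrow>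
              (\<Sum>v\<in>S. local_height N K v E P)
                < ereal ((real N + 1 + \<epsilon>) * weil_height N K P + C))))"

end

theory Submission imports Defs "HOL-Real_Asymp.Real_Asymp" begin

text \<open>
  Write \<open>(\<phi>\<^sup>n)\<^sup>* D = G + Q\<close> with \<open>G\<close> the normal-crossings part. At the non-archimedean places \<open>\<lambda>\<^sub>v(G, z)\<close>
  is bounded by \<open>\<lambda>\<^sub>v(D, \<phi>\<^sup>n(z))\<close> up to a constant that vanishes for almost all \<open>v\<close>: \<open>\<lambda>\<^sub>v(Q, z)\<close> is bounded from below,
  and by the Nullstellensatz the coordinates of \<open>\<phi>\<^sup>n(z)\<close> are not much smaller than \<open>|z|^(d^n)\<close>. Vojta's conjecture for \<open>G\<close>
  bounds the part of \<open>deg G h(z) = \<Sum>\<^sub>v \<lambda>\<^sub>v(G, z)\<close> over \<open>S\<close> by \<open>(N + 1 + \<epsilon>) h(z)\<close>. So the part outside \<open>S\<close> for \<open>D\<close> at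
  \<open>\<phi>\<^sup>m\<^sup>+\<^sup>n(P)\<close> is at least \<open>(deg G - N - 1 - \<epsilon>) h(\<phi>\<^sup>m(P)) - C\<close>, where \<open>d\<^sup>n h(\<phi>\<^sup>m(P)) \<ge> h(\<phi>\<^sup>m\<^sup>+\<^sup>n(P)) - B\<close>
  and the heights tend to infinity by Northcott's theorem.

  Heights are computed through embeddings: every place of \<open>K\<close> above a place \<open>u\<close> of the rationals is the pull-back of one
  fixed extension of \<open>u\<close> to the algebraic numbers along an embedding of \<open>K\<close>, and its local degree is the number
  of embeddings that induce it. The product formula and the independence of the field are then sums over embeddings.
\<close>

hide_const (open) up_ring.coeff up_ring.monom Polynomials.degree Polynomials.lead_coeff Module.smult Divisibility.prime Divisibility.irreducible Coset.order

section \<open>Subfields of the complex numbers and polynomials over them\<close>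

text \<open>Places and local degrees are given abstractly, as absolute values and as the dimension
  of a completion. Weak approximation turns both into statements on embeddings: an element close to
  \<open>1\<close> at one place and to \<open>0\<close> at others contradicts its characteristic
  polynomial, or cuts the local part out of a rational trace. The fixed extension of a p-adic
  absolute value comes from a maximal subring without \<open>1/p\<close>; it is real-valued because
  some power of each nonzero algebraic number is a power of \<open>p\<close> up to a unit. The
  normal-crossings part is given over the algebraic numbers only, whereas Vojta's conjecture wants
  an integral equation over a number field. So it is applied over an extension \<open>L\<close>,
  after clearing denominators and with all places above \<open>S\<close>, and the result is brought
  back to \<open>K\<close>. The lower bound for the image is used outside \<open>S\<close>, so the
  ultrametric case suffices. Genericity keeps all but finitely many orbit points off
  \<open>D\<close> and off the exceptional hypersurfaces. Negative thresholds are treated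
  separately, by integrality of the equation of \<open>D\<close>.\<close>

locale csubfield =
  fixes F :: "complex set"
  assumes zero_in [simp, intro]: "0 \<in> F" and one_in [simp, intro]: "1 \<in> F"
    and add_in [intro]: "\<And>x y. x \<in> F \<Longrightarrow> y \<in> F \<Longrightarrow> x + y \<in> F"
    and mult_in [intro]: "\<And>x y. x \<in> F \<Longrightarrow> y \<in> F \<Longrightarrow> x * y \<in> F"
    and uminus_in [intro]: "\<And>x. x \<in> F \<Longrightarrow> - x \<in> F"
    and inverse_in [intro]: "\<And>x. x \<in> F \<Longrightarrow> inverse x \<in> F"
begin

lemma diff_in [intro]: "x \<in> F \<Longrightarrow> y \<in> F \<Longrightarrow> x - y \<in> F"
  using add_in[of x "- y"] uminus_in[of y] by simp

lemma divide_in [intro]: "x \<in> F \<Longrightarrow> y \<in> F \<Longrightarrow> x / y \<in> F"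
  by (auto simp: divide_inverse)

lemma power_in [intro]: "x \<in> F \<Longrightarrow> x ^ n \<in> F"
  by (induction n) auto

lemma sum_in [intro]: "(\<And>i. i \<in> A \<Longrightarrow> f i \<in> F) \<Longrightarrow> sum f A \<in> F"
  by (induction A rule: infinite_finite_induct) auto

lemma prod_in [intro]: "(\<And>i. i \<in> A \<Longrightarrow> f i \<in> F) \<Longrightarrow> prod f A \<in> F"
  by (induction A rule: infinite_finite_induct) auto

lemma of_nat_in [simp, intro]: "of_nat n \<in> F"
  by (induction n) auto

lemma of_int_in [simp, intro]: "of_int n \<in> F"
  by (cases n) (auto simp del: of_nat_Suc)

lemma Rats_subset: "\<rat> \<subseteq> F"
  by (auto elim!: Rats_cases')

lemma of_rat_in [simp, intro]: "of_rat r \<in> F"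
  using Rats_subset by auto

end

lemma csubfield_Rats: "csubfield \<rat>"
  by unfold_locales auto

lemma complex_ring_simps:
  "carrier complex_ring = UNIV" "x \<otimes>\<^bsub>complex_ring\<^esub> y = x * y" "x \<oplus>\<^bsub>complex_ring\<^esub> y = x + y"
  "\<zero>\<^bsub>complex_ring\<^esub> = 0" "\<one>\<^bsub>complex_ring\<^esub> = 1"
  by (simp_all add: ring_of_type_algebra_def)

lemma field_complex_ring: "field complex_ring"
  by (rule field_from_type_algebra)

lemma complex_ring_inv:
  assumes "x \<noteq> 0" shows "inv\<^bsub>complex_ring\<^esub> x = inverse x"
proof -
  interpret R: field complex_ring by (rule field_complex_ring)
  show ?thesis using R.inv_char[of x "inverse x"] assms by (simp add: complex_ring_simps)
qed

lemma complex_ring_a_inv: "\<ominus>\<^bsub>complex_ring\<^esub> x = - x"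
proof -
  interpret R: field complex_ring by (rule field_complex_ring)
  show ?thesis using R.minus_equality[of "- x" x] by (simp add: complex_ring_simps)
qed

text \<open>Number fields are phrased through the record \<open>complex_ring\<close>; this
  equivalence lets the field arithmetic be done with the operations of the type
  \<open>complex\<close>.\<close>

lemma subfield_complex_ring_iff: "subfield F complex_ring \<longleftrightarrow> csubfield F"
proof
  interpret R: field complex_ring by (rule field_complex_ring)
  assume *: "subfield F complex_ring"
  note F = subringE[OF subfieldE(1)[OF *]]
  show "csubfield F"
  proof
    show "inverse x \<in> F" if "x \<in> F" for x
    proof (cases "x = 0")
      case False
      then show ?thesis using R.subfield_m_inv(1)[OF *, of x] that
        by (simp add: complex_ring_inv complex_ring_simps)
    qed (use F in \<open>auto simp: complex_ring_simps\<close>)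
  qed (use F in \<open>auto simp: complex_ring_simps complex_ring_a_inv\<close>)
next
  interpret R: field complex_ring by (rule field_complex_ring)
  assume "csubfield F"
  then interpret csubfield F .
  show "subfield F complex_ring"
  proof (rule R.subfieldI')
    show "subring F complex_ring"
      by (rule R.subringI) (auto simp: complex_ring_simps complex_ring_a_inv)
    show "inv\<^bsub>complex_ring\<^esub> k \<in> F" if "k \<in> F - {\<zero>\<^bsub>complex_ring\<^esub>}" for k
      using that by (auto simp: complex_ring_simps complex_ring_inv)
  qed
qed

text \<open>Polynomials over a subfield remain complex polynomials, so that their roots and factors
  can be used without changing the type.\<close>

definition pover :: "complex set \<Rightarrow> complex poly \<Rightarrow> bool" where
  "pover F p \<longleftrightarrow> (\<forall>i. coeff p i \<in> F)"

lemma pover_coeff: "pover F p \<Longrightarrow> coeff p i \<in> F"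
  by (simp add: pover_def)

context csubfield
begin

lemma pover_0 [simp, intro]: "pover F 0" by (simp add: pover_def)
lemma pover_1 [simp, intro]: "pover F 1" by (auto simp: pover_def coeff_pCons split: nat.split)
lemma pover_add [intro]: "pover F p \<Longrightarrow> pover F q \<Longrightarrow> pover F (p + q)" by (auto simp: pover_def)
lemma pover_diff [intro]: "pover F p \<Longrightarrow> pover F q \<Longrightarrow> pover F (p - q)" by (auto simp: pover_def)
lemma pover_uminus [intro]: "pover F p \<Longrightarrow> pover F (- p)" by (auto simp: pover_def)
lemma pover_mult [intro]: "pover F p \<Longrightarrow> pover F q \<Longrightarrow> pover F (p * q)"
  by (auto simp: pover_def coeff_mult)
lemma pover_smult [intro]: "a \<in> F \<Longrightarrow> pover F p \<Longrightarrow> pover F (smult a p)" by (auto simp: pover_def)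
lemma pover_monom [intro]: "a \<in> F \<Longrightarrow> pover F (monom a n)" by (auto simp: pover_def)
lemma pover_pCons_iff [simp]: "pover F (pCons a p) \<longleftrightarrow> a \<in> F \<and> pover F p"
  by (auto simp: pover_def coeff_pCons split: nat.splits)
lemma pover_power [intro]: "pover F p \<Longrightarrow> pover F (p ^ n)" by (induction n) auto
lemma pover_prod [intro]: "(\<And>i. i \<in> A \<Longrightarrow> pover F (f i)) \<Longrightarrow> pover F (prod f A)"
  by (induction A rule: infinite_finite_induct) auto
lemma pover_pderiv [intro]: "pover F p \<Longrightarrow> pover F (pderiv p)"
  by (auto simp: pover_def coeff_pderiv simp del: of_nat_Suc)
lemma pover_pcompose [intro]: "pover F p \<Longrightarrow> pover F q \<Longrightarrow> pover F (pcompose p q)"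
  by (induction p) (auto simp: pcompose_pCons)
lemma poly_in [intro]: "pover F p \<Longrightarrow> x \<in> F \<Longrightarrow> poly p x \<in> F"
  by (auto simp: poly_altdef pover_def)

lemma pover_division:
  assumes "pover F p" "pover F q" "q \<noteq> 0"
  shows "\<exists>s r. pover F s \<and> pover F r \<and> p = s * q + r \<and> (r = 0 \<or> degree r < degree q)"
  using assms(1)
\<comment> \<open>The measure puts the zero polynomial below the nonzero constants, so that
  cancelling a constant counts as progress.\<close>
proof (induction "if p = 0 then 0 else Suc (degree p)" arbitrary: p rule: less_induct)
  case (less p)
  show ?case
  proof (cases "p = 0 \<or> degree p < degree q")
    case True
    then show ?thesis using less.prems by (intro exI[of _ 0] exI[of _ p]) auto
  next
    case False
    define m where "m = monom (lead_coeff p / lead_coeff q) (degree p - degree q)"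
    have m: "pover F m" using less.prems assms(2) unfolding m_def
      by (intro pover_monom divide_in) (auto simp: pover_coeff)
    define p' where "p' = p - m * q"
    have p': "pover F p'" using less.prems m assms(2) by (auto simp: p'_def)
    have deg: "degree (m * q) = degree p" and lc: "coeff (m * q) (degree p) = lead_coeff p"
      using False assms(3) by (auto simp: m_def degree_mult_eq degree_monom_eq coeff_monom_mult)
    have "p' = 0 \<or> degree p' < degree p"
    proof (cases "degree p = 0")
      case True
      then have "p' = 0"
        using deg lc by (intro poly_eqI) (auto simp: p'_def coeff_eq_0 elim!: degree_eq_zeroE)
      then show ?thesis ..
    next
      case False
      then show ?thesis
      proof -
        have "degree p' \<le> degree p" unfolding p'_def using deg by (intro degree_diff_le) auto
        moreover have "coeff p' (degree p) = 0" using lc by (simp add: p'_def)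
        ultimately show ?thesis by (rule eq_zero_or_degree_less)
      qed
    qed
    then have "(if p' = 0 then 0 else Suc (degree p')) < (if p = 0 then 0 else Suc (degree p))"
      using False by auto
    from less.hyps[OF this p'] obtain s r where
      "pover F s" "pover F r" "p' = s * q + r" "r = 0 \<or> degree r < degree q" by blast
    then show ?thesis using m
      by (intro exI[of _ "s + m"] exI[of _ r]) (auto simp: p'_def algebra_simps)
  qed
qed

lemma pover_dvd_cofactor:
  assumes "pover F p" "pover F q" "q dvd p"
  shows "\<exists>s. pover F s \<and> p = q * s"
proof (cases "q = 0")
  case False
  from pover_division[OF assms(1,2) False] obtain s r where
    sr: "pover F s" "pover F r" "p = s * q + r" "r = 0 \<or> degree r < degree q" by blast
  have "q dvd r" using assms(3) sr(3) by (metis dvd_add_right_iff dvd_triv_right)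
  then have "r = 0" using sr(4) by (metis dvd_imp_degree_le not_le)
  then show ?thesis using sr by (auto simp: mult.commute)
qed (use assms in auto)

text \<open>A nonzero element of least degree in the ideal generated by \<open>p\<close> and
  \<open>q\<close> over \<open>F\<close> divides both. Unlike a gcd taken over the complex numbers,
  it comes with coefficients and cofactors in \<open>F\<close>.\<close>

lemma pover_bezout:
  assumes "pover F p" "pover F q" "p \<noteq> 0 \<or> q \<noteq> 0"
  shows "\<exists>h a b. pover F h \<and> pover F a \<and> pover F b \<and> h = a * p + b * q \<and> h \<noteq> 0 \<and> h dvd p \<and> h dvd q"
proof -
  define I where "I = {a * p + b * q | a b. pover F a \<and> pover F b}"
  have I: "pover F h" if "h \<in> I" for h using that assms by (auto simp: I_def)
  have pq: "p \<in> I" "q \<in> I"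
    unfolding I_def by (rule CollectI, rule exI[of _ 1], rule exI[of _ 0], simp,
      rule CollectI, rule exI[of _ 0], rule exI[of _ 1], simp)
  then have "\<exists>h. h \<in> I \<and> h \<noteq> 0" using assms(3) by auto
  then obtain h where h: "h \<in> I" "h \<noteq> 0" and hmin: "\<And>g. g \<in> I \<Longrightarrow> g \<noteq> 0 \<Longrightarrow> degree h \<le> degree g"
    using ex_has_least_nat[of "\<lambda>h. h \<in> I \<and> h \<noteq> 0" _ Polynomial.degree] by blast
  have dv: "h dvd g" if g: "g \<in> I" for g
  proof -
    from pover_division[OF I[OF g] I[OF h(1)] h(2)] obtain s r where
      sr: "pover F s" "pover F r" "g = s * h + r" "r = 0 \<or> degree r < degree h" by blast
    from g h(1) obtain a b a' b' where ab: "pover F a" "pover F b" "g = a * p + b * q"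
      "pover F a'" "pover F b'" "h = a' * p + b' * q" unfolding I_def by auto
    have "r = (a - s * a') * p + (b - s * b') * q"
      using sr(3) ab by (simp add: algebra_simps)
    then have "r \<in> I" unfolding I_def using ab sr(1) by blast
    have "r = 0"
    proof (rule ccontr)
      assume "r \<noteq> 0"
      then show False using hmin[of r] sr(4) \<open>r \<in> I\<close> by simp
    qed
    then show ?thesis using sr(3) by simp
  qed
  obtain a b where "pover F a" "pover F b" "h = a * p + b * q"
    using h(1) unfolding I_def by blast
  then show ?thesis using h(2) I[OF h(1)] dv[OF pq(1)] dv[OF pq(2)] by blast
qed

end

section \<open>Minimal polynomials\<close>

lemma monic_dvd_antisym:
  fixes p q :: "complex poly"
  assumes "p dvd q" "q dvd p" "lead_coeff p = 1" "lead_coeff q = 1"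
  shows "p = q"
proof -
  from assms(1) obtain k where k: "q = p * k" by blast
  have "p \<noteq> 0" "q \<noteq> 0" using assms by auto
  then have "degree p = degree q" using assms by (simp add: dvd_imp_degree_le le_antisym)
  moreover have "k \<noteq> 0" using k \<open>q \<noteq> 0\<close> by auto
  ultimately have "degree k = 0" using k \<open>p \<noteq> 0\<close> by (simp add: degree_mult_eq)
  then obtain c where c: "k = [:c:]" by (rule degree_eq_zeroE)
  then have q: "q = smult c p" using k by (simp add: mult.commute)
  then have "c = 1" using assms(3,4) by (metis lead_coeff_smult mult.right_neutral)
  then show ?thesis using q by simp
qed

definition algebraic_over :: "complex set \<Rightarrow> complex \<Rightarrow> bool" where
  "algebraic_over F x \<longleftrightarrow> (\<exists>p. pover F p \<and> p \<noteq> 0 \<and> poly p x = 0)"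

lemma algebraic_over_Rats: "algebraic_over \<rat> x \<longleftrightarrow> algebraic x"
  by (auto simp: algebraic_over_def algebraic_altdef pover_def)

text \<open>A relation between \<open>f\<close> and \<open>x\<close>, phrased by divisibility, so
  that the same \<open>f\<close> belongs to each of its roots.\<close>

definition is_minpoly :: "complex set \<Rightarrow> complex poly \<Rightarrow> complex \<Rightarrow> bool" where
  "is_minpoly F f x \<longleftrightarrow> pover F f \<and> lead_coeff f = 1 \<and> poly f x = 0 \<and>
     (\<forall>g. pover F g \<longrightarrow> poly g x = 0 \<longrightarrow> f dvd g)"

context csubfield
begin

lemma minpoly_exists:
  assumes "algebraic_over F x"
  shows "\<exists>f. is_minpoly F f x"
proof -
  let ?P = "\<lambda>p. pover F p \<and> p \<noteq> 0 \<and> poly p x = 0"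
  obtain h where h: "?P h" and hmin: "\<And>g. ?P g \<Longrightarrow> degree h \<le> degree g"
    using ex_has_least_nat[of ?P _ Polynomial.degree] assms unfolding algebraic_over_def by blast
  have dv: "h dvd g" if g: "pover F g" "poly g x = 0" for g
  proof -
    from pover_division[OF g(1)] h obtain s r where
      sr: "pover F s" "pover F r" "g = s * h + r" "r = 0 \<or> degree r < degree h" by blast
    have "poly r x = 0" using sr(3) g h by simp
    have "r = 0"
    proof (rule ccontr)
      assume "r \<noteq> 0"
      then show False using hmin[of r] sr(2,4) \<open>poly r x = 0\<close> by simp
    qed
    then show ?thesis using sr(3) by simp
  qed
  have "is_minpoly F (smult (inverse (lead_coeff h)) h) x"
    unfolding is_minpoly_def
  proof (intro conjI allI impI)
    show "pover F (smult (inverse (lead_coeff h)) h)"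
      using h by (intro pover_smult inverse_in pover_coeff) auto
    show "smult (inverse (lead_coeff h)) h dvd g" if "pover F g" "poly g x = 0" for g
      using dv[OF that] h by (simp add: smult_dvd_iff)
  qed (use h in auto)
  then show ?thesis ..
qed

lemma minpoly_deg_pos:
  assumes "is_minpoly F f x" shows "degree f > 0"
  using assms unfolding is_minpoly_def by (auto elim!: degree_eq_zeroE intro: gr0I)

text \<open>If \<open>h\<close> is the minimal polynomial of \<open>y\<close>, then
  \<open>f = h * s\<close>. If \<open>x\<close> were a root of \<open>s\<close>, then
  \<open>f\<close> would divide \<open>s\<close>, which is impossible because \<open>h\<close> has
  positive degree; hence \<open>x\<close> is a root of \<open>h\<close> and \<open>f\<close> divides
  \<open>h\<close>.\<close>

lemma minpoly_of_root:
  assumes f: "is_minpoly F f x" and "poly f y = 0"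
  shows "is_minpoly F f y"
proof -
  have fne: "f \<noteq> 0" using f by (auto simp: is_minpoly_def)
  have "algebraic_over F y" using assms fne unfolding algebraic_over_def is_minpoly_def by blast
  then obtain h where h: "is_minpoly F h y" using minpoly_exists by blast
  then have "h dvd f" using assms unfolding is_minpoly_def by blast
  with f h obtain s where s: "pover F s" "f = h * s"
    using pover_dvd_cofactor[of f h] unfolding is_minpoly_def by blast
  then have "poly h x = 0 \<or> poly s x = 0" using f by (auto simp: is_minpoly_def)
  then have "f dvd h"
  proof
    assume "poly s x = 0"
    then have "f dvd s" using f s by (auto simp: is_minpoly_def)
    then have "degree f \<le> degree s" using s fne by (intro dvd_imp_degree_le) auto
    moreover have "degree f = degree h + degree s" using s fne by (simp add: degree_mult_eq)
    ultimately show ?thesis using minpoly_deg_pos[OF h] by simp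
  qed (use f h in \<open>auto simp: is_minpoly_def\<close>)
  then have "f = h" using \<open>h dvd f\<close> f h
    by (intro monic_dvd_antisym) (auto simp: is_minpoly_def)
  then show ?thesis using h by simp
qed

lemma minpoly_dvd:
  assumes "is_minpoly F f x" "poly f y = 0" "pover F g" "poly g y = 0"
  shows "f dvd g"
  using minpoly_of_root[OF assms(1,2)] assms(3,4) by (auto simp: is_minpoly_def)

lemma minpoly_simple_roots:
  assumes f: "is_minpoly F f x" "poly f y = 0"
  shows "poly (pderiv f) y \<noteq> 0"
proof
  assume *: "poly (pderiv f) y = 0"
  have "pover F (pderiv f)" using f by (auto simp: is_minpoly_def)
  then have "f dvd pderiv f" using minpoly_dvd[OF f] * by blast
  moreover have "pderiv f \<noteq> 0" using minpoly_deg_pos[OF f(1)] by (simp add: pderiv_eq_0_iff)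
  ultimately have "degree f \<le> degree (pderiv f)" by (rule dvd_imp_degree_le)
  then show False using minpoly_deg_pos[OF f(1)] by (simp add: degree_pderiv)
qed

end

lemma monic_simple_roots_prod:
  fixes f :: "complex poly"
  assumes "lead_coeff f = 1" "\<And>y. poly f y = 0 \<Longrightarrow> poly (pderiv f) y \<noteq> 0"
  shows "f = (\<Prod>b | poly f b = 0. [:-b, 1:])" "card {b. poly f b = 0} = degree f"
proof -
  have ne: "f \<noteq> 0" using assms(1) by auto
  have rsq: "rsquarefree f" unfolding rsquarefree_roots using assms(2) by auto
  show eq: "f = (\<Prod>b | poly f b = 0. [:-b, 1:])"
    using complex_poly_decompose_rsquarefree[OF rsq] assms(1) by simp
  have "degree f = degree (\<Prod>b | poly f b = 0. [:-b, 1:])" using eq by simp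
  also have "\<dots> = card {b. poly f b = 0}"
    by (subst degree_prod_eq_sum_degree) auto
  finally show "card {b. poly f b = 0} = degree f" ..
qed

section \<open>Power sums and symmetric functions\<close>

text \<open>Newton's identities, read off from the logarithmic derivative of
  \<open>\<Prod>(1 - z\<^sub>i X)\<close> as a formal power series.\<close>

lemma newton_fps:
  fixes z :: "'i \<Rightarrow> complex"
  assumes "finite I"
  defines "A \<equiv> \<Prod>i\<in>I. (1 - fps_const (z i) * fps_X)"
  shows "fps_deriv A = - (A * Abs_fps (\<lambda>k. \<Sum>i\<in>I. z i ^ Suc k))"
  unfolding A_def using assms(1)
proof (induction I)
  case empty
  then show ?case by (simp add: fps_zero_def[symmetric])
next
  case (insert j I)
  have geom: "(1 - fps_const (z j) * fps_X) * Abs_fps (\<lambda>k. z j ^ Suc k) = fps_const (z j)"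
  proof (rule fps_ext)
    fix n show "((1 - fps_const (z j) * fps_X) * Abs_fps (\<lambda>k. z j ^ Suc k)) $ n = fps_const (z j) $ n"
      by (cases n) (auto simp: algebra_simps fps_mult_left_const_nth mult.assoc)
  qed
  have split: "Abs_fps (\<lambda>k. \<Sum>i\<in>insert j I. z i ^ Suc k) =
      Abs_fps (\<lambda>k. z j ^ Suc k) + Abs_fps (\<lambda>k. \<Sum>i\<in>I. z i ^ Suc k)"
    by (rule fps_ext) (use insert in simp)
  show ?case (is "_ = - ?R")
  proof -
    let ?q = "1 - fps_const (z j) * fps_X" and ?P = "\<Prod>i\<in>I. (1 - fps_const (z i) * fps_X)"
    have "fps_deriv (?q * ?P) = - fps_const (z j) * ?P + ?q * fps_deriv ?P"
      by (simp add: algebra_simps flip: fps_const_neg)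
    also have "\<dots> = - (?q * ?P * (Abs_fps (\<lambda>k. z j ^ Suc k) + Abs_fps (\<lambda>k. \<Sum>i\<in>I. z i ^ Suc k)))"
    proof -
      have "fps_const (z j) * ?P = ?q * ?P * Abs_fps (\<lambda>k. z j ^ Suc k)"
        by (subst geom[symmetric]) (simp add: mult_ac)
      then show ?thesis unfolding insert.IH
        by (simp add: algebra_simps flip: fps_const_neg)
    qed
    finally show ?thesis unfolding split using insert by simp
  qed
qed

lemma newton_coeff:
  fixes z :: "'i \<Rightarrow> complex"
  assumes "finite I"
  defines "P \<equiv> \<Prod>i\<in>I. [:1, - z i:]"
  shows "of_nat (Suc n) * coeff P (Suc n) = - (\<Sum>k\<le>n. coeff P k * (\<Sum>i\<in>I. z i ^ Suc (n - k)))"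
proof -
  have P: "fps_of_poly P = (\<Prod>i\<in>I. (1 - fps_const (z i) * fps_X))"
    unfolding P_def by (simp add: fps_of_poly_prod fps_of_poly_pCons mult.commute flip: fps_const_neg)
  have "fps_deriv (fps_of_poly P) $ n = - (fps_of_poly P * Abs_fps (\<lambda>k. \<Sum>i\<in>I. z i ^ Suc k)) $ n"
    unfolding P newton_fps[OF assms(1)] by simp
  then show ?thesis
    by (simp add: fps_mult_nth atLeast0AtMost)
qed

lemma reflect_linear_prod:
  "reflect_poly (\<Prod>i\<in>I. [:- z i, 1:]) = (\<Prod>i\<in>I. [:1, - z i :: complex:])"
proof -
  have "reflect_poly [:- z i, 1:] = [:1, - z i:]" for i
    by (cases "z i = 0") (auto simp: reflect_poly_pCons reflect_poly_def)
  then show ?thesis by (simp add: reflect_poly_prod)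
qed

context csubfield
begin

text \<open>Newton's identities concern the product of the \<open>1 - z\<^sub>i X\<close>,
  characteristic polynomials that of the \<open>X - z\<^sub>i\<close>; the coefficient lists are
  reverses of each other.\<close>

lemma pover_linear_prod_iff_reflect:
  assumes "finite I"
  shows "pover F (\<Prod>i\<in>I. [:- z i, 1:]) \<longleftrightarrow> pover F (\<Prod>i\<in>I. [:1, - z i:])"
proof -
  let ?P = "\<Prod>i\<in>I. [:- z i, 1:]"
  have deg: "degree ?P = card I" by (subst degree_prod_eq_sum_degree) auto
  have 1: "coeff (\<Prod>i\<in>I. [:1, - z i:]) k = (if k > card I then 0 else coeff ?P (card I - k))" for k
    unfolding reflect_linear_prod[symmetric] by (simp add: coeff_reflect_poly deg)
  have 2: "coeff ?P k = (if k > card I then 0 else coeff (\<Prod>i\<in>I. [:1, - z i:]) (card I - k))" for k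
    using 1[of "card I - k"] deg by (auto simp: coeff_eq_0)
  show ?thesis unfolding pover_def by (metis 1 2 zero_in)
qed

text \<open>Newton's recursion is solved for the coefficients, which requires dividing by
  \<open>Suc m\<close>; characteristic zero enters here.\<close>

lemma pover_prod_if_power_sums:
  assumes "finite I" "\<And>k. k > 0 \<Longrightarrow> (\<Sum>i\<in>I. z i ^ k) \<in> F"
  shows "pover F (\<Prod>i\<in>I. [:- z i, 1:])"
  unfolding pover_linear_prod_iff_reflect[OF assms(1)]
proof -
  let ?P = "\<Prod>i\<in>I. [:1, - z i:]"
  have "coeff ?P n \<in> F" for n
  proof (induction n rule: less_induct)
    case (less n)
    show ?case
    proof (cases n)
      case 0
      have "coeff ?P 0 = poly ?P 0" by (simp add: poly_0_coeff_0)
      also have "\<dots> = 1" by (simp add: poly_prod)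
      finally show ?thesis using 0 by simp
    next
      case (Suc m)
      have "of_nat (Suc m) * coeff ?P (Suc m) \<in> F"
        unfolding newton_coeff[OF assms(1)] using less.IH Suc
        by (intro uminus_in sum_in[of "{..m}"] mult_in[OF _ assms(2)]) auto
      then have "of_nat (Suc m) * coeff ?P (Suc m) / of_nat (Suc m) \<in> F"
        by (intro divide_in) (auto simp del: of_nat_Suc)
      then show ?thesis using Suc by (simp del: of_nat_Suc)
    qed
  qed
  then show "pover F ?P" by (simp add: pover_def)
qed

text \<open>The same recursion is solved for the power sum of highest index, whose factor is the
  constant coefficient \<open>1\<close>.\<close>

lemma power_sums_if_pover_prod:
  assumes "finite I" "pover F (\<Prod>i\<in>I. [:- z i, 1:])"
  shows "(\<Sum>i\<in>I. z i ^ k) \<in> F"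
proof (cases k)
  case (Suc n)
  let ?P = "\<Prod>i\<in>I. [:1, - z i:]"
  have P: "pover F ?P" using assms pover_linear_prod_iff_reflect by blast
  have "(\<Sum>i\<in>I. z i ^ Suc n) \<in> F" for n
  proof (induction n rule: less_induct)
    case (less n)
    have P0: "coeff ?P 0 = 1" by (simp add: poly_0_coeff_0[symmetric] poly_prod)
    have "{..n} = insert 0 {1..n}" by auto
    then have "of_nat (Suc n) * coeff ?P (Suc n) =
       - ((\<Sum>i\<in>I. z i ^ Suc n) + (\<Sum>k\<in>{1..n}. coeff ?P k * (\<Sum>i\<in>I. z i ^ Suc (n - k))))"
      unfolding newton_coeff[OF assms(1)] by (simp add: P0)
    then have eq: "(\<Sum>i\<in>I. z i ^ Suc n) =
        - (of_nat (Suc n) * coeff ?P (Suc n) + (\<Sum>k\<in>{1..n}. coeff ?P k * (\<Sum>i\<in>I. z i ^ Suc (n - k))))"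
      by (simp add: algebra_simps add_eq_0_iff)
    show ?case unfolding eq
      by (intro uminus_in add_in mult_in sum_in of_nat_in pover_coeff[OF P] less.IH) auto
  qed
  then show ?thesis using Suc by simp
qed simp

lemma poly_sums_if_pover_prod:
  assumes "finite I" "pover F (\<Prod>i\<in>I. [:- z i, 1:])" "pover F g"
  shows "(\<Sum>i\<in>I. poly g (z i)) \<in> F"
proof -
  have "(\<Sum>i\<in>I. poly g (z i)) = (\<Sum>k\<le>degree g. coeff g k * (\<Sum>i\<in>I. z i ^ k))"
    unfolding poly_altdef sum_distrib_left by (rule sum.swap)
  also have "\<dots> \<in> F"
    by (intro sum_in[of "{..degree g}"] mult_in power_sums_if_pover_prod[OF assms(1,2)] pover_coeff[OF assms(3)])
  finally show ?thesis .
qed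

text \<open>In place of the fundamental theorem on symmetric polynomials: the power sums of the
  values \<open>g(z\<^sub>i)\<close> are sums of values of \<open>g ^ k\<close>, hence combinations
  of the power sums of the \<open>z\<^sub>i\<close>.\<close>

lemma pover_prod_poly:
  assumes "finite I" "pover F (\<Prod>i\<in>I. [:- z i, 1:])" "pover F g"
  shows "pover F (\<Prod>i\<in>I. [:- poly g (z i), 1:])"
proof (rule pover_prod_if_power_sums[OF assms(1)])
  fix k :: nat
  have "(\<Sum>i\<in>I. poly (g ^ k) (z i)) \<in> F"
    using assms by (intro poly_sums_if_pover_prod) auto
  then show "(\<Sum>i\<in>I. poly g (z i) ^ k) \<in> F" by simp
qed

lemma minpoly_prod:
  assumes "is_minpoly F f x"
  shows "f = (\<Prod>b | poly f b = 0. [:- b, 1:])" "card {b. poly f b = 0} = degree f"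
    "finite {b. poly f b = 0}"
  using monic_simple_roots_prod[of f] minpoly_simple_roots[OF assms] assms
  by (auto simp: is_minpoly_def intro!: poly_roots_finite)

lemma algebraic_over_of_prod:
  assumes "finite I" "\<And>k. (\<Sum>i\<in>I. z i ^ k) \<in> F" "i \<in> I"
  shows "algebraic_over F (z i)"
  unfolding algebraic_over_def
proof (intro exI conjI)
  show "pover F (\<Prod>i\<in>I. [:- z i, 1:])" using assms by (intro pover_prod_if_power_sums) auto
  show "(\<Prod>i\<in>I. [:- z i, 1:]) \<noteq> 0" using assms(1) by auto
  show "poly (\<Prod>i\<in>I. [:- z i, 1:]) (z i) = 0"
    using assms by (auto simp: poly_prod)
qed

text \<open>All sums of a conjugate of \<open>x\<close> and a conjugate of \<open>y\<close> are
  taken together. By the binomial theorem their power sums are combinations of those of the two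
  families, so the monic polynomial with these roots is over \<open>F\<close>.\<close>

lemma algebraic_over_add:
  assumes "algebraic_over F x" "algebraic_over F y"
  shows "algebraic_over F (x + y)"
proof -
  obtain f g where f: "is_minpoly F f x" and g: "is_minpoly F g y"
    using assms minpoly_exists by blast
  let ?A = "{b. poly f b = 0}" and ?B = "{b. poly g b = 0}"
  have sums: "(\<Sum>a\<in>?A. a ^ k) \<in> F" "(\<Sum>b\<in>?B. b ^ k) \<in> F" for k
    using power_sums_if_pover_prod[of ?A "\<lambda>b. b"] power_sums_if_pover_prod[of ?B "\<lambda>b. b"]
      minpoly_prod[OF f] minpoly_prod[OF g] f g by (auto simp: is_minpoly_def)
  have "(\<Sum>p\<in>?A \<times> ?B. (fst p + snd p) ^ k) \<in> F" for k
  proof -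
    have "(\<Sum>p\<in>?A \<times> ?B. (fst p + snd p) ^ k) = (\<Sum>a\<in>?A. \<Sum>b\<in>?B. (a + b) ^ k)"
      by (simp add: sum.cartesian_product split_beta)
    also have "\<dots> = (\<Sum>a\<in>?A. \<Sum>b\<in>?B. \<Sum>j\<le>k. of_nat (k choose j) * a ^ j * b ^ (k - j))"
      by (simp only: binomial_ring)
    also have "\<dots> = (\<Sum>a\<in>?A. \<Sum>j\<le>k. \<Sum>b\<in>?B. of_nat (k choose j) * a ^ j * b ^ (k - j))"
      by (intro sum.cong refl sum.swap)
    also have "\<dots> = (\<Sum>j\<le>k. \<Sum>a\<in>?A. \<Sum>b\<in>?B. of_nat (k choose j) * a ^ j * b ^ (k - j))"
      by (rule sum.swap)
    also have "\<dots> = (\<Sum>j\<le>k. of_nat (k choose j) * ((\<Sum>a\<in>?A. a ^ j) * (\<Sum>b\<in>?B. b ^ (k - j))))"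
      unfolding sum_product by (simp add: sum_distrib_left mult.assoc)
    also have "\<dots> \<in> F"
      by (intro sum_in[of "{..k}"] mult_in of_nat_in sums)
    finally show ?thesis .
  qed
  from algebraic_over_of_prod[OF _ this, of "(x, y)"] show ?thesis
    using minpoly_prod(3)[OF f] minpoly_prod(3)[OF g] f g by (auto simp: is_minpoly_def)
qed

lemma algebraic_over_mult:
  assumes "algebraic_over F x" "algebraic_over F y"
  shows "algebraic_over F (x * y)"
proof -
  obtain f g where f: "is_minpoly F f x" and g: "is_minpoly F g y"
    using assms minpoly_exists by blast
  let ?A = "{b. poly f b = 0}" and ?B = "{b. poly g b = 0}"
  have sums: "(\<Sum>a\<in>?A. a ^ k) \<in> F" "(\<Sum>b\<in>?B. b ^ k) \<in> F" for k
    using power_sums_if_pover_prod[of ?A "\<lambda>b. b"] power_sums_if_pover_prod[of ?B "\<lambda>b. b"]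
      minpoly_prod[OF f] minpoly_prod[OF g] f g by (auto simp: is_minpoly_def)
  have "(\<Sum>p\<in>?A \<times> ?B. (fst p * snd p) ^ k) \<in> F" for k
  proof -
    have "(\<Sum>p\<in>?A \<times> ?B. (fst p * snd p) ^ k) = (\<Sum>a\<in>?A. a ^ k) * (\<Sum>b\<in>?B. b ^ k)"
      by (simp add: sum.cartesian_product sum_product power_mult_distrib split_beta)
    then show ?thesis using sums by auto
  qed
  from algebraic_over_of_prod[OF _ this, of "(x, y)"] show ?thesis
    using minpoly_prod(3)[OF f] minpoly_prod(3)[OF g] f g by (auto simp: is_minpoly_def)
qed

lemma algebraic_over_base: "x \<in> F \<Longrightarrow> algebraic_over F x"
  unfolding algebraic_over_def by (intro exI[of _ "[:-x, 1:]"]) auto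

end

lemma csubfield_Qbar: "csubfield Qbar"
proof -
  interpret Q: csubfield \<rat> by (rule csubfield_Rats)
  show ?thesis
  proof
    fix x y assume "x \<in> Qbar" "y \<in> Qbar"
    then show "x + y \<in> Qbar" "x * y \<in> Qbar"
      using Q.algebraic_over_add[of x y] Q.algebraic_over_mult[of x y]
      by (auto simp: Qbar_def algebraic_over_Rats)
  qed (auto simp: Qbar_def)
qed

lemma Rats_subset_Qbar: "\<rat> \<subseteq> Qbar"
  by (rule csubfield.Rats_subset[OF csubfield_Qbar])

section \<open>Simple extensions\<close>

text \<open>Polynomial values only, no quotients: for algebraic \<open>x\<close> this is already a
  field.\<close>

definition adj :: "complex set \<Rightarrow> complex \<Rightarrow> complex set" where
  "adj F x = {poly g x | g. pover F g}"

lemma adjI: "pover F g \<Longrightarrow> poly g x \<in> adj F x"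
  by (auto simp: adj_def)

context csubfield
begin

lemma adj_base [intro]: "y \<in> F \<Longrightarrow> y \<in> adj F x"
  using adjI[of F "[:y:]" x] by simp

lemma adj_gen [simp, intro]: "x \<in> adj F x"
  using adjI[of F "[:0, 1:]" x] by simp

lemma csubfield_adj:
  assumes "algebraic_over F x"
  shows "csubfield (adj F x)"
proof
  show "0 \<in> adj F x" "1 \<in> adj F x" by auto
  fix u v assume "u \<in> adj F x" "v \<in> adj F x"
  then obtain g h where gh: "pover F g" "pover F h" "u = poly g x" "v = poly h x"
    by (auto simp: adj_def)
  show "u + v \<in> adj F x" using adjI[of F "g + h" x] gh by auto
  show "u * v \<in> adj F x" using adjI[of F "g * h" x] gh by auto
next
  fix u assume "u \<in> adj F x"
  then obtain g where g: "pover F g" "u = poly g x" by (auto simp: adj_def)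
  show "- u \<in> adj F x" using adjI[of F "- g" x] g by auto
  show "inverse u \<in> adj F x"
  proof (cases "u = 0")
    case False
    from assms obtain f where f: "is_minpoly F f x" using minpoly_exists by blast
    then have fp: "pover F f" "f \<noteq> 0" by (auto simp: is_minpoly_def)
    from pover_bezout[OF g(1) fp(1)] fp(2) obtain h a b where
      h: "pover F h" "pover F a" "h = a * g + b * f" "h \<noteq> 0" "h dvd g" "h dvd f" by blast
    \<comment> \<open>A root of \<open>h\<close> would be a common root of \<open>g\<close> and
      \<open>f\<close>; then \<open>f\<close> divides \<open>g\<close> and \<open>u = 0\<close>. So
      \<open>h\<close> is constant, and the Bezout identity evaluated at \<open>x\<close> inverts
      \<open>u\<close>.\<close>
    have "degree h = 0"
    proof (rule ccontr)
      assume "degree h \<noteq> 0"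
      then obtain y where "poly h y = 0"
        using fundamental_theorem_of_algebra[of h] by (auto simp: constant_degree)
      then have "poly g y = 0" "poly f y = 0" using h(5,6) by (auto elim!: dvdE)
      then have "f dvd g" using minpoly_dvd[OF f] g by blast
      then have "poly g x = 0" using f by (auto simp: is_minpoly_def elim!: dvdE)
      then show False using g False by simp
    qed
    then obtain c where c: "h = [:c:]" by (rule degree_eq_zeroE)
    have "c = poly a x * u" using arg_cong[OF h(3), of "\<lambda>p. poly p x"] c f g
      by (simp add: is_minpoly_def)
    then have "inverse u = poly (smult (inverse c) a) x" using False c h(4) by (simp add: field_simps)
    moreover have "c \<in> F" using h(1) c by simp
    then have "pover F (smult (inverse c) a)" using h(2) by auto
    ultimately show ?thesis using adjI by metis
  qed auto
qed

lemma adj_subset: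
  assumes "csubfield K" "F \<subseteq> K" "x \<in> K"
  shows "adj F x \<subseteq> K"
proof -
  have "pover F g \<Longrightarrow> pover K g" for g using assms(2) by (auto simp: pover_def)
  then show ?thesis using csubfield.poly_in[OF assms(1)] assms(3) by (auto simp: adj_def)
qed

text \<open>The classical choice \<open>z = x + c y\<close>: the gcd of the minimal polynomial \<open>g\<close> of \<open>y\<close> and of
  \<open>f(z - c X)\<close> over \<open>F(z)\<close> has \<open>y\<close> as its only root, for all but finitely many \<open>c\<close>.\<close>

lemma primitive_element:
  assumes "algebraic_over F x" "algebraic_over F y"
  shows "\<exists>c. let z = x + of_nat c * y in algebraic_over F z \<and> x \<in> adj F z \<and> y \<in> adj F z"
proof -
  obtain f g where f: "is_minpoly F f x" and g: "is_minpoly F g y"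
    using assms minpoly_exists by blast
  let ?A = "{b. poly f b = 0}" and ?B = "{b. poly g b = 0}"
  have fin: "finite ((\<lambda>(a, b). (a - x) / (y - b)) ` (?A \<times> ?B))"
    using minpoly_prod(3)[OF f] minpoly_prod(3)[OF g] by auto
  have "infinite (range (of_nat :: nat \<Rightarrow> complex))"
    by (intro range_inj_infinite inj_of_nat)
  then obtain c :: nat where c: "of_nat c \<notin> (\<lambda>(a, b). (a - x) / (y - b)) ` (?A \<times> ?B)"
    using fin by (meson finite_subset image_subsetI)
  define z where "z = x + of_nat c * y"
  have z: "algebraic_over F z" unfolding z_def
    by (intro algebraic_over_add algebraic_over_mult assms algebraic_over_base) auto
  interpret L: csubfield "adj F z" by (rule csubfield_adj[OF z])
  define h where "h = pcompose f [:z, - of_nat c:]"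
  have pf: "pover (adj F z) f" and pg: "pover (adj F z) g" and g0: "g \<noteq> 0"
    using f g by (auto simp: is_minpoly_def pover_def)
  have ph: "pover (adj F z) h" unfolding h_def
    by (rule L.pover_pcompose[OF pf]) (auto simp: L.pover_pCons_iff L.uminus_in)
  have hy: "poly h y = 0" unfolding h_def using f by (simp add: poly_pcompose z_def is_minpoly_def mult.commute)
  from L.pover_bezout[OF pg ph] g0 obtain k a b where
    k: "pover (adj F z) k" "k = a * g + b * h" "k \<noteq> 0" "k dvd g" "k dvd h" by blast
  have ky: "poly k y = 0" using k(2) hy g by (simp add: is_minpoly_def)
  have only: "u = y" if u: "poly k u = 0" for u
  proof (rule ccontr)
    assume ne: "u \<noteq> y"
    have 1: "poly g u = 0" "poly h u = 0" using u k(4,5) by (auto elim!: dvdE)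
    then have 2: "poly f (z - of_nat c * u) = 0"
      by (simp add: h_def poly_pcompose mult.commute)
    have "(z - of_nat c * u - x) / (y - u) = of_nat c"
      using ne by (simp add: z_def field_simps)
    then have "of_nat c \<in> (\<lambda>(a, b). (a - x) / (y - b)) ` (?A \<times> ?B)"
      using 1 2 by (intro image_eqI[of _ _ "(z - of_nat c * u, u)"]) auto
    then show False using c by blast
  qed
  have roots: "{u. poly k u = 0} = {y}" using only ky by blast
  have "rsquarefree k" unfolding rsquarefree_roots
  proof (intro allI notI)
    fix u assume u: "poly k u = 0 \<and> poly (pderiv k) u = 0"
    obtain s where s: "g = k * s" using k(4) by blast
    have "poly g u = 0" "poly (pderiv g) u = 0" using u unfolding s by (auto simp: pderiv_mult)
    then show False using minpoly_simple_roots[OF g] by blast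
  qed
  from complex_poly_decompose_rsquarefree[OF this] have keq: "k = smult (lead_coeff k) [:- y, 1:]"
    by (simp add: roots)
  have "coeff k 0 = - lead_coeff k * y" by (subst keq) simp
  then have "y = - coeff k 0 / lead_coeff k" using k(3) by (simp add: field_simps)
  also have "\<dots> \<in> adj F z"
    by (intro L.divide_in L.uminus_in pover_coeff[OF k(1)])
  finally have y: "y \<in> adj F z" .
  have "x = z - of_nat c * y" by (simp add: z_def)
  also have "\<dots> \<in> adj F z" using y by auto
  finally show ?thesis using y z unfolding z_def Let_def by blast
qed

text \<open>The last clause keeps \<open>z\<close> inside every field that contains \<open>F\<close>
  and \<open>A\<close>. It is what places the generator of a number field inside that field.\<close>

lemma primitive_element_finite:
  assumes "finite A" "\<And>a. a \<in> A \<Longrightarrow> algebraic_over F a"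
  shows "\<exists>z. algebraic_over F z \<and> A \<subseteq> adj F z \<and> (\<forall>K. csubfield K \<longrightarrow> F \<subseteq> K \<longrightarrow> A \<subseteq> K \<longrightarrow> z \<in> K)"
  using assms
proof (induction A rule: finite_induct)
  case empty
  show ?case
    by (intro exI[of _ 0]) (auto intro: algebraic_over_base csubfield.zero_in)
next
  case (insert a A)
  then obtain x where x: "algebraic_over F x" "A \<subseteq> adj F x"
    "\<And>K. csubfield K \<Longrightarrow> F \<subseteq> K \<Longrightarrow> A \<subseteq> K \<Longrightarrow> x \<in> K" by auto
  obtain c where "let z = x + of_nat c * a in algebraic_over F z \<and> x \<in> adj F z \<and> a \<in> adj F z"
    using primitive_element[OF x(1), of a] insert by auto
  then obtain z where z: "z = x + of_nat c * a" "algebraic_over F z" "x \<in> adj F z" "a \<in> adj F z"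
    by (auto simp: Let_def)
  have "adj F x \<subseteq> adj F z" using csubfield_adj z by (intro adj_subset) auto
  moreover have "z \<in> K" if "csubfield K" "F \<subseteq> K" "insert a A \<subseteq> K" for K
  proof -
    interpret K: csubfield K by fact
    show ?thesis using that x(3)[of K] unfolding z by auto
  qed
  ultimately show ?case using x z by (intro exI[of _ z]) auto
qed

lemma adj_repr:
  assumes "is_minpoly F f x" "y \<in> adj F x"
  shows "\<exists>a. (\<forall>i. a i \<in> F) \<and> y = (\<Sum>i<degree f. a i * x ^ i)"
proof -
  from assms(2) obtain g where g: "pover F g" "y = poly g x" by (auto simp: adj_def)
  have f: "pover F f" "f \<noteq> 0" "poly f x = 0" using assms(1) by (auto simp: is_minpoly_def)
  from pover_division[OF g(1) f(1,2)] obtain s r where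
    sr: "pover F r" "g = s * f + r" "r = 0 \<or> degree r < degree f" by blast
  have "y = poly r x" using g sr f by simp
  also have "\<dots> = (\<Sum>i<degree f. coeff r i * x ^ i)"
    unfolding poly_altdef using sr(3) minpoly_deg_pos[OF assms(1)]
    by (intro sum.mono_neutral_left) (auto simp: coeff_eq_0 Suc_le_eq)
  finally show ?thesis using sr(1) by (auto simp: pover_def)
qed

lemma adj_indep:
  assumes "is_minpoly F f x" "\<And>i. i < degree f \<Longrightarrow> a i \<in> F" "(\<Sum>i<degree f. a i * x ^ i) = 0" "i < degree f"
  shows "a i = 0"
proof -
  define p where "p = (\<Sum>i<degree f. monom (a i) i)"
  have c: "coeff p j = (if j < degree f then a j else 0)" for j
    by (auto simp: p_def coeff_sum)
  have "pover F p" using assms(2) by (auto simp: pover_def c)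
  moreover have "poly p x = 0" using assms(3) by (simp add: p_def poly_sum poly_monom)
  ultimately have "f dvd p" using assms(1) by (auto simp: is_minpoly_def)
  have "p = 0"
  proof (rule ccontr)
    assume p: "p \<noteq> 0"
    then have "coeff p (degree p) \<noteq> 0" by simp
    then have "degree p < degree f" unfolding c by (auto split: if_splits)
    then show False using dvd_imp_degree_le[OF \<open>f dvd p\<close> p] by simp
  qed
  then show ?thesis using c[of i] assms(4) by simp
qed

end

lemma (in ring) combine_map_finsum:
  assumes "\<And>i. i < n \<Longrightarrow> a i \<in> carrier R" "\<And>i. i < n \<Longrightarrow> b i \<in> carrier R"
  shows "combine (map a [0..<n]) (map b [0..<n]) = (\<Oplus>i\<in>{..<n}. a i \<otimes> b i)"
  using assms
proof (induction n)
  case (Suc n)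
  have "combine (map a [0..<Suc n]) (map b [0..<Suc n]) =
      combine (map a [0..<n]) (map b [0..<n]) \<oplus> combine [a n] [b n]"
    using Suc.prems by (subst combine_append) auto
  also have "\<dots> = (\<Oplus>i\<in>{..<n}. a i \<otimes> b i) \<oplus> a n \<otimes> b n"
    using Suc by auto
  also have "\<dots> = (\<Oplus>i\<in>{..<Suc n}. a i \<otimes> b i)"
    using Suc.prems by (simp add: lessThan_Suc finsum_insert a_comm)
  finally show ?case .
qed simp

text \<open>A basis criterion with indexed families in place of lists. It serves for simple
  extensions of a subfield as well as for completions.\<close>

lemma (in ring) dimension_basisI:
  assumes K: "subfield K R" and b: "\<And>i. i < n \<Longrightarrow> b i \<in> carrier R"
    and indep: "\<And>a. (\<And>i. i < n \<Longrightarrow> a i \<in> K) \<Longrightarrow> (\<Oplus>i\<in>{..<n}. a i \<otimes> b i) = \<zero> \<Longrightarrow> (\<And>i. i < n \<Longrightarrow> a i = \<zero>)"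
    and E: "\<And>y. y \<in> E \<longleftrightarrow> (\<exists>a. (\<forall>i<n. a i \<in> K) \<and> y = (\<Oplus>i\<in>{..<n}. a i \<otimes> b i))"
  shows "dimension n K E"
proof -
  note Kc = subfieldE(3)[OF K]
  have K0: "\<zero> \<in> K" using subringE(2)[OF subfieldE(1)[OF K]] .
  let ?Us = "map b [0..<n]"
  have Us: "set ?Us \<subseteq> carrier R" using b by auto
  have "independent K ?Us"
  proof (rule trivial_combine_imp_independent[OF K Us])
    fix Ks assume Ks: "set Ks \<subseteq> K" "combine Ks ?Us = \<zero>"
    define a where "a = (\<lambda>i. if i < length Ks then Ks ! i else \<zero>)"
    have aK: "a i \<in> K" for i using Ks K0 by (auto simp: a_def)
    \<comment> \<open>\<open>Ks\<close> may be shorter or longer than the basis. Padding by zeros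
      and cutting at length \<open>n\<close> leaves the linear combination unchanged.\<close>
    have eq: "map a [0..<n] = take n (Ks @ replicate n \<zero>)"
      by (rule nth_equalityI) (auto simp: a_def nth_append)
    have "combine (map a [0..<n]) ?Us = combine (Ks @ replicate n \<zero>) ?Us"
      unfolding eq using combine_take[of ?Us "Ks @ replicate n \<zero>"] by simp
    also have "\<dots> = combine Ks ?Us" by (rule combine_append_replicate[OF Us])
    finally have "(\<Oplus>i\<in>{..<n}. a i \<otimes> b i) = \<zero>"
      using Ks(2) combine_map_finsum[of n a b] aK Kc b by (simp add: subset_iff)
    then have a0: "a i = \<zero>" if "i < n" for i using indep[of a] aK that by blast
    show "set (take (length ?Us) Ks) \<subseteq> {\<zero>}"
    proof
      fix x assume "x \<in> set (take (length ?Us) Ks)"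
      then obtain i where "i < n" "i < length Ks" "x = Ks ! i" by (auto simp: in_set_conv_nth)
      then show "x \<in> {\<zero>}" using a0[of i] by (simp add: a_def)
    qed
  qed
  moreover have "Span K ?Us = E"
    unfolding Span_eq_combine_set_length_version[OF K Us]
  proof (intro equalityI subsetI)
    fix y assume "y \<in> {combine Ks ?Us |Ks. length Ks = length ?Us \<and> set Ks \<subseteq> K}"
    then obtain Ks where Ks: "y = combine Ks ?Us" "length Ks = n" "set Ks \<subseteq> K" by auto
    have "Ks = map (\<lambda>i. Ks ! i) [0..<n]" using Ks(2) by (metis map_nth)
    then have "y = (\<Oplus>i\<in>{..<n}. Ks ! i \<otimes> b i)"
      using combine_map_finsum[of n "\<lambda>i. Ks ! i" b] Ks b Kc by (auto simp: subset_iff)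
    then show "y \<in> E" unfolding E using Ks by (intro exI[of _ "\<lambda>i. Ks ! i"]) auto
  next
    fix y assume "y \<in> E"
    then obtain a where a: "\<forall>i<n. a i \<in> K" "y = (\<Oplus>i\<in>{..<n}. a i \<otimes> b i)" unfolding E by blast
    then have "y = combine (map a [0..<n]) ?Us"
      using combine_map_finsum[of n a b] b Kc by (simp add: subset_iff)
    then show "y \<in> {combine Ks ?Us |Ks. length Ks = length ?Us \<and> set Ks \<subseteq> K}"
      using a(1) by (intro CollectI exI[of _ "map a [0..<n]"]) auto
  qed
  ultimately show ?thesis using dimensionI[OF K] by fastforce
qed

lemma (in ring) dim_eqI:
  assumes "subfield K R" "dimension n K E" shows "dim K E = n"
  using dimI[OF assms] by (simp add: over_def)

lemma complex_ring_finsum: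
  "finsum complex_ring f A = (if finite A then sum f A else 0)"
proof (cases "finite A")
  case True
  interpret R: field complex_ring by (rule field_complex_ring)
  show ?thesis using True
    by (induction A) (auto simp: complex_ring_simps R.finsum_empty R.finsum_insert)
next
  case False
  interpret R: field complex_ring by (rule field_complex_ring)
  show ?thesis using False R.finsum_infinite by (simp add: complex_ring_simps)
qed

context csubfield
begin

lemma dimension_adj:
  assumes "is_minpoly F f x"
  shows "ring.dimension complex_ring (degree f) F (adj F x)"
proof -
  interpret R: field complex_ring by (rule field_complex_ring)
  have alg: "algebraic_over F x" using assms by (auto simp: is_minpoly_def algebraic_over_def)
  show ?thesis
  proof (rule R.dimension_basisI[where b = "\<lambda>i. x ^ i"])
    show "subfield F complex_ring" using subfield_complex_ring_iff csubfield_axioms by blast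
    fix y
    show "y \<in> adj F x \<longleftrightarrow> (\<exists>a. (\<forall>i<degree f. a i \<in> F) \<and>
        y = (\<Oplus>\<^bsub>complex_ring\<^esub>i\<in>{..<degree f}. a i \<otimes>\<^bsub>complex_ring\<^esub> x ^ i))"
      unfolding complex_ring_finsum complex_ring_simps
    proof
      assume "y \<in> adj F x"
      then obtain a where a: "\<forall>i. a i \<in> F" "y = (\<Sum>i<degree f. a i * x ^ i)"
        using adj_repr[OF assms] by blast
      then show "\<exists>a. (\<forall>i<degree f. a i \<in> F) \<and> y = (if finite {..<degree f} then \<Sum>i<degree f. a i * x ^ i else 0)"
        by (intro exI[of _ a]) simp
    next
      interpret L: csubfield "adj F x" by (rule csubfield_adj[OF alg])
      assume "\<exists>a. (\<forall>i<degree f. a i \<in> F) \<and> y = (if finite {..<degree f} then \<Sum>i<degree f. a i * x ^ i else 0)"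
      then show "y \<in> adj F x" by auto
    qed
  next
    fix a i
    assume "\<And>i. i < degree f \<Longrightarrow> a i \<in> F"
      "(\<Oplus>\<^bsub>complex_ring\<^esub>i\<in>{..<degree f}. a i \<otimes>\<^bsub>complex_ring\<^esub> x ^ i) = \<zero>\<^bsub>complex_ring\<^esub>" "i < degree f"
    then show "a i = \<zero>\<^bsub>complex_ring\<^esub>"
      using adj_indep[OF assms, of a i] by (auto simp: complex_ring_finsum complex_ring_simps)
  qed (auto simp: complex_ring_simps)
qed

end

section \<open>Number fields\<close>

lemma number_field_adj:
  assumes "algebraic x"
  shows "number_field (adj \<rat> x)"
proof -
  interpret Q: csubfield \<rat> by (rule csubfield_Rats)
  interpret R: field complex_ring by (rule field_complex_ring)
  obtain f where "is_minpoly \<rat> f x" using assms Q.minpoly_exists algebraic_over_Rats by blast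
  then show ?thesis
    using Q.dimension_adj Q.csubfield_adj[of x] assms
    by (auto simp: number_field_def subfield_complex_ring_iff algebraic_over_Rats R.finite_dimension_def)
qed

lemma number_field_csubfield: "number_field K \<Longrightarrow> csubfield K"
  by (simp add: number_field_def subfield_complex_ring_iff)

text \<open>A transcendental \<open>x\<close> would give \<open>n + 1\<close> independent powers
  inside a space of dimension \<open>n\<close>.\<close>

lemma number_field_algebraic:
  assumes "number_field K" "x \<in> K"
  shows "algebraic x"
proof -
  interpret K: csubfield K by (rule number_field_csubfield[OF assms(1)])
  interpret Q: csubfield \<rat> by (rule csubfield_Rats)
  interpret R: field complex_ring by (rule field_complex_ring)
  have sf: "subfield \<rat> complex_ring" by (simp add: subfield_complex_ring_iff csubfield_Rats)
  obtain n where n: "R.dimension n \<rat> K" using assms by (auto simp: number_field_def)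
  show ?thesis
  proof (rule ccontr)
    assume na: "\<not> algebraic x"
    have "R.dimension (Suc n) \<rat> {y. \<exists>a. (\<forall>i<Suc n. a i \<in> \<rat>) \<and> y = (\<Oplus>\<^bsub>complex_ring\<^esub>i\<in>{..<Suc n}. a i \<otimes>\<^bsub>complex_ring\<^esub> x ^ i)}"
      (is "R.dimension _ _ ?E")
    proof (rule R.dimension_basisI[OF sf, where b = "\<lambda>i. x ^ i"])
      fix a i assume a: "\<And>i. i < Suc n \<Longrightarrow> a i \<in> \<rat>"
        "(\<Oplus>\<^bsub>complex_ring\<^esub>i\<in>{..<Suc n}. a i \<otimes>\<^bsub>complex_ring\<^esub> x ^ i) = \<zero>\<^bsub>complex_ring\<^esub>" "i < Suc n"
      define p where "p = (\<Sum>i<Suc n. monom (a i) i)"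
      have c: "coeff p j = (if j < Suc n then a j else 0)" for j
        by (auto simp: p_def coeff_sum simp del: sum.lessThan_Suc)
      have "\<forall>j. coeff p j \<in> \<rat>" using a(1) by (auto simp: c)
      moreover have "poly p x = 0" using a(2)
        by (simp add: p_def poly_sum poly_monom complex_ring_finsum complex_ring_simps del: sum.lessThan_Suc)
      ultimately have "p = 0" using na unfolding algebraic_altdef by blast
      then show "a i = \<zero>\<^bsub>complex_ring\<^esub>" using c[of i] a(3) by (simp add: complex_ring_simps)
    qed (auto simp: complex_ring_simps)
    then obtain Us where Us: "R.independent \<rat> Us" "length Us = Suc n" "R.Span \<rat> Us = ?E"
      using R.exists_base[OF sf] by blast
    have "?E \<subseteq> K" using K.Rats_subset assms(2)
      by (auto simp: complex_ring_finsum complex_ring_simps simp del: sum.lessThan_Suc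
           intro!: K.sum_in K.mult_in K.power_in)
    moreover have "set Us \<subseteq> R.Span \<rat> Us"
      by (rule R.Span_base_incl[OF sf]) (use R.independent_in_carrier[OF Us(1)] in auto)
    ultimately have "length Us \<le> n"
      using R.independent_length_le_dimension[OF sf n Us(1)] Us(3) by auto
    then show False using Us(2) by simp
  qed
qed

lemma number_field_subset_Qbar: "number_field K \<Longrightarrow> K \<subseteq> Qbar"
  by (auto simp: Qbar_def number_field_algebraic)

text \<open>A basis over the rationals consists of algebraic numbers and is contained in some
  \<open>adj \<rat> x\<close> with \<open>x \<in> K\<close>; both inclusions follow.\<close>

lemma number_field_primitive:
  assumes "number_field K"
  obtains x f where "K = adj \<rat> x" "algebraic x" "is_minpoly \<rat> f x" "field_degree K = degree f"
proof -
  interpret K: csubfield K by (rule number_field_csubfield[OF assms(1)])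
  interpret Q: csubfield \<rat> by (rule csubfield_Rats)
  interpret R: field complex_ring by (rule field_complex_ring)
  have sf: "subfield \<rat> complex_ring" by (simp add: subfield_complex_ring_iff csubfield_Rats)
  obtain n where n: "R.dimension n \<rat> K" using assms by (auto simp: number_field_def)
  then obtain Us where Us: "R.independent \<rat> Us" "R.Span \<rat> Us = K"
    using R.exists_base[OF sf] by blast
  have UsK: "set Us \<subseteq> K"
    using R.Span_base_incl[OF sf, of Us] R.independent_in_carrier[OF Us(1)] Us(2) by auto
  obtain x where x: "algebraic_over \<rat> x" "set Us \<subseteq> adj \<rat> x"
     "\<And>L. csubfield L \<Longrightarrow> \<rat> \<subseteq> L \<Longrightarrow> set Us \<subseteq> L \<Longrightarrow> x \<in> L"
    using Q.primitive_element_finite[of "set Us"] UsK number_field_algebraic[OF assms]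
    by (auto simp: algebraic_over_Rats)
  interpret A: csubfield "adj \<rat> x" by (rule Q.csubfield_adj[OF x(1)])
  have "x \<in> K" using x(3) UsK K.Rats_subset K.csubfield_axioms by blast
  then have 1: "adj \<rat> x \<subseteq> K" using Q.adj_subset K.csubfield_axioms K.Rats_subset by blast
  have comb: "set Vs \<subseteq> adj \<rat> x \<Longrightarrow> set Ks \<subseteq> \<rat> \<Longrightarrow> R.combine Ks Vs \<in> adj \<rat> x" for Ks Vs
    using A.Rats_subset
    by (induction Ks Vs rule: R.combine.induct) (auto simp: complex_ring_simps)
  have "K \<subseteq> adj \<rat> x"
  proof
    fix y assume "y \<in> K"
    then obtain Ks where "y = R.combine Ks Us" "set Ks \<subseteq> \<rat>"
      using R.Span_eq_combine_set[OF sf, of Us] R.independent_in_carrier[OF Us(1)] Us(2) by blast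
    then show "y \<in> adj \<rat> x" using comb[OF x(2)] by simp
  qed
  then have eq: "K = adj \<rat> x" using 1 by auto
  obtain f where f: "is_minpoly \<rat> f x" using x(1) Q.minpoly_exists by blast
  have "field_degree K = degree f"
    unfolding field_degree_def eq by (rule R.dim_eqI[OF sf Q.dimension_adj[OF f]])
  then show ?thesis using that eq f x(1) by (auto simp: algebraic_over_Rats)
qed

section \<open>Number fields with a primitive element, their embeddings, traces and norms\<close>

locale numfield =
  fixes K :: "complex set" and x :: complex and f :: "complex poly"
  assumes K_eq: "K = adj \<rat> x" and f: "is_minpoly \<rat> f x"
begin

lemma alg_x: "algebraic x"
  using f by (auto simp: is_minpoly_def algebraic_altdef pover_def)

lemma numfield: "number_field K"
  unfolding K_eq by (rule number_field_adj[OF alg_x])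

sublocale Q: csubfield \<rat> by (rule csubfield_Rats)
sublocale K: csubfield K by (rule number_field_csubfield[OF numfield])

lemma field_degree_eq: "field_degree K = degree f"
proof -
  interpret R: field complex_ring by (rule field_complex_ring)
  show ?thesis unfolding field_degree_def K_eq
    using R.dim_eqI[OF _ Q.dimension_adj[OF f]] by (simp add: subfield_complex_ring_iff csubfield_Rats)
qed

definition conjs :: "complex set" where "conjs = {b. poly f b = 0}"

text \<open>The embedding of \<open>K\<close> that sends \<open>x\<close> to \<open>b\<close>. For a
  conjugate \<open>b\<close> the choice of the polynomial is immaterial, by
  \<open>emb_poly\<close>.\<close>

definition emb :: "complex \<Rightarrow> complex \<Rightarrow> complex" where
  "emb b y = poly (SOME g. pover \<rat> g \<and> poly g x = y) b"

lemma finite_conjs: "finite conjs" and card_conjs: "card conjs = degree f"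
  and f_prod: "f = (\<Prod>b\<in>conjs. [:-b, 1:])"
  using Q.minpoly_prod[OF f] by (auto simp: conjs_def)

lemma degree_pos: "degree f > 0"
  by (rule Q.minpoly_deg_pos[OF f])

lemma f_over: "pover \<rat> f"
  using f by (simp add: is_minpoly_def)

lemma x_conj: "x \<in> conjs"
  using f by (simp add: conjs_def is_minpoly_def)

lemma x_in [simp]: "x \<in> K"
  unfolding K_eq by (rule Q.adj_gen)

lemma emb_poly:
  assumes "pover \<rat> g" "b \<in> conjs"
  shows "emb b (poly g x) = poly g b"
proof -
  define h where "h = (SOME h. pover \<rat> h \<and> poly h x = poly g x)"
  have h: "pover \<rat> h \<and> poly h x = poly g x"
    unfolding h_def by (rule someI[of _ g]) (use assms in auto)
  have "f dvd (h - g)"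
    using f h assms Q.pover_diff[of h g] by (auto simp: is_minpoly_def)
  then obtain k where "h - g = f * k" by blast
  then have "poly (h - g) b = 0" using assms(2) by (simp add: conjs_def)
  then show ?thesis by (simp add: emb_def h_def)
qed

lemma K_elimE:
  assumes "y \<in> K" obtains g where "pover \<rat> g" "y = poly g x"
  using assms by (auto simp: K_eq adj_def)

lemma emb_add: "b \<in> conjs \<Longrightarrow> y \<in> K \<Longrightarrow> z \<in> K \<Longrightarrow> emb b (y + z) = emb b y + emb b z"
  by (elim K_elimE) (metis emb_poly poly_add Q.pover_add)

lemma emb_mult: "b \<in> conjs \<Longrightarrow> y \<in> K \<Longrightarrow> z \<in> K \<Longrightarrow> emb b (y * z) = emb b y * emb b z"
  by (elim K_elimE) (metis emb_poly poly_mult Q.pover_mult)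

lemma emb_rat: "b \<in> conjs \<Longrightarrow> y \<in> \<rat> \<Longrightarrow> emb b y = y"
  using emb_poly[of "[:y:]" b] by simp

lemma emb_0 [simp]: "b \<in> conjs \<Longrightarrow> emb b 0 = 0" and emb_1 [simp]: "b \<in> conjs \<Longrightarrow> emb b 1 = 1"
  by (simp_all add: emb_rat)

lemma emb_uminus: "b \<in> conjs \<Longrightarrow> y \<in> K \<Longrightarrow> emb b (- y) = - emb b y"
  using emb_add[of b y "- y"] by (auto simp: K.uminus_in add_eq_0_iff)

lemma emb_diff: "b \<in> conjs \<Longrightarrow> y \<in> K \<Longrightarrow> z \<in> K \<Longrightarrow> emb b (y - z) = emb b y - emb b z"
  using emb_add[of b y "- z"] by (auto simp: K.uminus_in emb_uminus)

lemma emb_power: "b \<in> conjs \<Longrightarrow> y \<in> K \<Longrightarrow> emb b (y ^ n) = emb b y ^ n"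
  by (induction n) (auto simp: emb_mult K.power_in)

lemma emb_sum: "b \<in> conjs \<Longrightarrow> (\<And>i. i \<in> A \<Longrightarrow> g i \<in> K) \<Longrightarrow> emb b (sum g A) = (\<Sum>i\<in>A. emb b (g i))"
  by (induction A rule: infinite_finite_induct) (auto simp: emb_add K.sum_in)

lemma emb_eq_0_iff:
  assumes "b \<in> conjs" "y \<in> K" shows "emb b y = 0 \<longleftrightarrow> y = 0"
proof
  assume *: "emb b y = 0"
  show "y = 0"
  proof (rule ccontr)
    assume "y \<noteq> 0"
    then have "emb b y * emb b (inverse y) = 1"
      using assms emb_mult[of b y "inverse y"] by (auto simp: K.inverse_in)
    then show False using * by simp
  qed
qed (use assms in auto)

lemma emb_x: "b \<in> conjs \<Longrightarrow> emb b x = b"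
  using emb_poly[of "[:0, 1:]" b] by simp

lemma emb_id: "y \<in> K \<Longrightarrow> emb x y = y"
  by (elim K_elimE) (simp add: emb_poly x_conj)

lemma emb_poly_gen:
  assumes "pover K p" "b \<in> conjs" "y \<in> K"
  shows "emb b (poly p y) = poly (map_poly (emb b) p) (emb b y)"
proof -
  have "poly (map_poly (emb b) p) (emb b y) = (\<Sum>i\<le>degree p. emb b (coeff p i) * emb b y ^ i)"
    unfolding poly_altdef using assms map_poly_degree_leq[of "emb b" p]
    by (intro sum.mono_neutral_cong_left)
       (auto simp: coeff_map_poly, metis coeff_eq_0 coeff_map_poly emb_0 not_le)
  also have "\<dots> = emb b (poly p y)"
    using assms by (simp add: poly_altdef emb_sum emb_mult emb_power K.mult_in K.power_in pover_coeff)
  finally show ?thesis ..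
qed

lemma f_prod_over: "pover \<rat> (\<Prod>b\<in>conjs. [:-b, 1:])"
  using f_over f_prod by simp

text \<open>The product is the characteristic polynomial of \<open>y\<close> in \<open>K\<close>.
  For \<open>y = g(x)\<close> its roots are the values of \<open>g\<close> at the conjugates of
  \<open>x\<close>, and symmetric functions of conjugates are rational.\<close>

lemma charpoly_over:
  assumes "y \<in> K"
  shows "pover \<rat> (\<Prod>b\<in>conjs. [:- emb b y, 1:])"
proof -
  from assms obtain g where g: "pover \<rat> g" "y = poly g x" by (rule K_elimE)
  have "pover \<rat> (\<Prod>b\<in>conjs. [:- poly g b, 1:])"
    by (rule Q.pover_prod_poly[OF finite_conjs f_prod_over g(1)])
  also have "(\<Prod>b\<in>conjs. [:- poly g b, 1:]) = (\<Prod>b\<in>conjs. [:- emb b y, 1:])"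
    using g by (intro prod.cong) (auto simp: emb_poly)
  finally show ?thesis .
qed

lemma charpoly_root:
  assumes "y \<in> K" shows "poly (\<Prod>b\<in>conjs. [:- emb b y, 1:]) y = 0"
  using finite_conjs x_conj emb_id[OF assms] by (auto simp: poly_prod intro!: bexI[of _ x])

lemma trace_rat: "y \<in> K \<Longrightarrow> (\<Sum>b\<in>conjs. emb b y) \<in> \<rat>"
  using Q.power_sums_if_pover_prod[OF finite_conjs charpoly_over, of y 1] by simp

lemma norm_rat:
  assumes "y \<in> K" shows "(\<Prod>b\<in>conjs. emb b y) \<in> \<rat>"
proof -
  have "poly (\<Prod>b\<in>conjs. [:- emb b y, 1:]) 0 \<in> \<rat>"
    using charpoly_over[OF assms] by auto
  then have "(\<Prod>b\<in>conjs. - emb b y) \<in> \<rat>" by (simp add: poly_prod)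
  also have "(\<Prod>b\<in>conjs. - emb b y) = (- 1) ^ card conjs * (\<Prod>b\<in>conjs. emb b y)"
    by (simp add: prod_uminus)
  finally show ?thesis
    using Q.uminus_in[of "- (\<Prod>b\<in>conjs. emb b y)"] by (cases "even (card conjs)") auto
qed

lemma conjs_algebraic: "b \<in> conjs \<Longrightarrow> b \<in> Qbar"
  using f_over f by (auto simp: Qbar_def algebraic_altdef conjs_def pover_def is_minpoly_def)

lemma emb_Qbar: assumes "b \<in> conjs" "y \<in> K" shows "emb b y \<in> Qbar"
proof -
  from assms(2) obtain g where g: "pover \<rat> g" "y = poly g x" by (rule K_elimE)
  have "pover Qbar g" using g Rats_subset_Qbar by (auto simp: pover_def)
  then show ?thesis
    using csubfield.poly_in[OF csubfield_Qbar] conjs_algebraic[OF assms(1)] g emb_poly assms(1) by auto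
qed

lemma K_Qbar: "K \<subseteq> Qbar"
  by (rule number_field_subset_Qbar[OF numfield])

end

lemma number_field_numfield:
  assumes "number_field K" obtains x f where "numfield K x f"
  using assms by (elim number_field_primitive) (auto simp: numfield_def)

section \<open>Restriction of embeddings along an extension of number fields\<close>

locale numfield_ext = A: numfield K x f + B: numfield L y g
  for K x f L y g +
  assumes sub: "K \<subseteq> L"
begin

text \<open>The conjugate of \<open>x\<close> that names the restriction to \<open>K\<close> of the
  embedding \<open>B.emb b\<close> of \<open>L\<close>.\<close>

definition res :: "complex \<Rightarrow> complex" where "res b = B.emb b x"

lemma res_conj:
  assumes "b \<in> B.conjs" shows "res b \<in> A.conjs"
proof -
  from sub obtain h where h: "pover \<rat> h" "x = poly h y" using B.K_elimE A.x_in by (metis subsetD)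
  have "poly (pcompose f h) y = 0" using h A.f by (simp add: poly_pcompose is_minpoly_def)
  then have "B.emb b (poly (pcompose f h) y) = 0" using assms by simp
  then have "poly (pcompose f h) b = 0"
    using B.emb_poly[of "pcompose f h" b] assms h A.f_over by (auto simp: A.Q.pover_pcompose)
  then have "poly f (poly h b) = 0" by (simp add: poly_pcompose)
  moreover have "res b = poly h b"
    using B.emb_poly[OF h(1) assms] by (simp add: res_def flip: h(2))
  ultimately show ?thesis by (simp add: A.conjs_def)
qed

lemma emb_res:
  assumes "b \<in> B.conjs" "z \<in> K" shows "B.emb b z = A.emb (res b) z"
proof -
  from sub obtain h where h: "pover \<rat> h" "x = poly h y" using B.K_elimE A.x_in by (metis subsetD)
  from assms(2) obtain g' where g': "pover \<rat> g'" "z = poly g' x" by (rule A.K_elimE)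
  have "z = poly (pcompose g' h) y" using h g' by (simp add: poly_pcompose)
  then have "B.emb b z = poly g' (poly h b)"
    using B.emb_poly[of "pcompose g' h" b] assms(1) h(1) g'(1)
    by (auto simp: A.Q.pover_pcompose poly_pcompose)
  also have "poly h b = res b"
    using B.emb_poly[OF h(1) assms(1)] by (simp add: res_def flip: h(2))
  also have "poly g' (res b) = A.emb (res b) z" using g' A.emb_poly[OF g'(1) res_conj[OF assms(1)]] by simp
  finally show ?thesis .
qed

text \<open>The number of extensions of the embedding belonging to \<open>a\<close> is the order of
  \<open>a\<close> as a root of the characteristic polynomial of \<open>x\<close> in
  \<open>L\<close>. This order is the same for all \<open>a\<close>, and a comparison of degrees
  determines it.\<close>

lemma fiber_card:
  assumes "a \<in> A.conjs"
  shows "card {b \<in> B.conjs. res b = a} * degree f = degree g"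
proof -
  define P where "P = (\<Prod>b\<in>B.conjs. [:- res b, 1:])"
  have P: "pover \<rat> P" using B.charpoly_over[of x] sub A.x_in unfolding P_def res_def by blast
  have P0: "P \<noteq> 0" unfolding P_def using B.finite_conjs by auto
  have f0: "f \<noteq> 0" using A.degree_pos by auto
  text \<open>Write \<open>P = f\<^sup>m R\<close> with \<open>f\<close> not dividing \<open>R\<close>; then \<open>R\<close> has no roots at all.\<close>
  have "\<exists>m R. pover \<rat> R \<and> Q = f ^ m * R \<and> \<not> f dvd R" if "pover \<rat> Q" "Q \<noteq> 0" for Q
    using that
  proof (induction "degree Q" arbitrary: Q rule: less_induct)
    case less
    show ?case
    proof (cases "f dvd Q")
      case True
      then obtain S where S: "pover \<rat> S" "Q = f * S"
        using A.Q.pover_dvd_cofactor[OF less.prems(1) A.f_over] by blast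
      have "S \<noteq> 0" using S less.prems by auto
      moreover have "degree S < degree Q" using S \<open>S \<noteq> 0\<close> f0 A.degree_pos by (simp add: degree_mult_eq)
      ultimately obtain m R where "pover \<rat> R" "S = f ^ m * R" "\<not> f dvd R"
        using less.hyps S(1) by blast
      then show ?thesis using S by (intro exI[of _ "Suc m"] exI[of _ R]) (auto simp: mult_ac)
    next
      case False
      then show ?thesis using less.prems by (intro exI[of _ 0] exI[of _ Q]) auto
    qed
  qed
  from this[OF P P0] obtain m R where R: "pover \<rat> R" "P = f ^ m * R" "\<not> f dvd R" by blast
  have R0: "R \<noteq> 0" using R P0 by auto
  have noroot: "poly R c \<noteq> 0" for c
  proof
    assume c: "poly R c = 0"
    then have "poly P c = 0" using R by simp
    then obtain b where "b \<in> B.conjs" "c = res b" using B.finite_conjs by (auto simp: P_def poly_prod)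
    then have "poly f c = 0" using res_conj by (auto simp: A.conjs_def)
    then show False using A.Q.minpoly_dvd[OF A.f _ R(1) c] R(3) by blast
  qed
  have ord: "order a P = m" if a: "a \<in> A.conjs" for a
  proof -
    have "order a f = 1"
      using a A.Q.minpoly_simple_roots[OF A.f] f0
      by (intro rsquarefree_root_order) (auto simp: rsquarefree_roots A.conjs_def)
    then have "order a (f ^ m) = m" for m
    proof (induction m)
      case (Suc m)
      have "f * f ^ m \<noteq> 0" using f0 by simp
      from order_mult[OF this] Suc show ?case by simp
    qed simp
    moreover have "order a R = 0" using noroot by (simp add: order_0I)
    ultimately show ?thesis using R P0 order_mult by (metis add.right_neutral)
  qed
  have order_lin: "order a [:- c, 1:] = (if c = a then 1 else 0)" for a c :: complex
    using order_power_n_n[of a 1] by (auto intro!: order_0I)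
  have "order a (\<Prod>b\<in>S. [:- res b, 1:]) = card {b \<in> S. res b = a}" if "finite S" for S a
    using that
  proof (induction S)
    case (insert b S)
    have ne: "[:- res b, 1:] * (\<Prod>b\<in>S. [:- res b, 1:]) \<noteq> 0"
      unfolding mult_eq_0_iff prod_zero_iff[OF insert.hyps(1)] by auto
    have "{b' \<in> insert b S. res b' = a} = (if res b = a then insert b {b' \<in> S. res b' = a} else {b' \<in> S. res b' = a})"
      by auto
    then have "card {b' \<in> insert b S. res b' = a} = (if res b = a then 1 else 0) + card {b' \<in> S. res b' = a}"
      using insert.hyps by simp
    then show ?case
      unfolding prod.insert[OF insert.hyps] order_mult[OF ne] order_lin insert.IH by simp
  qed (auto simp: order_0I)
  then have card: "card {b \<in> B.conjs. res b = a} = m" if "a \<in> A.conjs" for a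
    using ord[OF that] B.finite_conjs unfolding P_def by metis
  have "degree g = card B.conjs" by (simp add: B.card_conjs)
  also have "\<dots> = card (\<Union>a\<in>A.conjs. {b \<in> B.conjs. res b = a})"
    using res_conj by (intro arg_cong[of _ _ card]) auto
  also have "\<dots> = (\<Sum>a\<in>A.conjs. card {b \<in> B.conjs. res b = a})"
    using A.finite_conjs B.finite_conjs by (intro card_UN_disjoint) auto
  also have "\<dots> = degree f * m" using card by (simp add: A.card_conjs)
  finally show ?thesis using card[OF assms] by simp
qed

end

text \<open>The norm of a polynomial over \<open>K\<close> takes rational values at integers, hence has rational
  coefficients.\<close>

lemma (in csubfield) pover_if_nat_values:
  assumes "\<And>n. n \<ge> N \<Longrightarrow> poly p (of_nat n) \<in> F"
  shows "pover F p"
  using assms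
proof (induction "degree p" arbitrary: p N rule: less_induct)
  case less
  show ?case
  proof (cases "degree p = 0")
    case True
    then obtain c where "p = [:c:]" by (rule degree_eq_zeroE)
    then show ?thesis using less.prems[of N] by simp
  next
    case False
    have "[:- of_nat N, 1:] dvd p - [:poly p (of_nat N):]"
      by (simp add: poly_eq_0_iff_dvd[symmetric])
    then obtain q where "p - [:poly p (of_nat N):] = [:- of_nat N, 1:] * q" by blast
    then have q: "p = [:- of_nat N, 1:] * q + [:poly p (of_nat N):]" by (simp add: algebra_simps)
    have "q \<noteq> 0" using False q by (metis add_0 degree_pCons_0 mult_zero_right)
    have "degree ([:- of_nat N, 1:] * q) = Suc (degree q)" using \<open>q \<noteq> 0\<close> by (subst degree_mult_eq) auto
    then have "degree p = Suc (degree q)" by (subst q) (simp add: degree_add_eq_left)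
    moreover have "poly q (of_nat n) \<in> F" if n: "n \<ge> Suc N" for n
    proof -
      have "poly p (of_nat n) = (of_nat n - of_nat N) * poly q (of_nat n) + poly p (of_nat N)"
        by (subst q) (simp add: algebra_simps)
      then have "poly q (of_nat n) = (poly p (of_nat n) - poly p (of_nat N)) / (of_nat n - of_nat N)"
        using n by (simp add: field_simps)
      also have "\<dots> \<in> F" using n by (intro divide_in diff_in of_nat_in less.prems) auto
      finally show ?thesis .
    qed
    ultimately have "pover F q" using less.hyps[of q "Suc N"] by auto
    then show ?thesis using less.prems[of N] by (subst q) (intro pover_add pover_mult, auto)
  qed
qed

text \<open>The coefficients of \<open>p\<close> lie in a number field. The product of the images of
  \<open>p\<close> under all its embeddings is a nonzero polynomial with rational coefficients, and
  one of the factors is \<open>p\<close> itself, so \<open>z\<close> is a root of it.\<close>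

lemma Qbar_root:
  assumes "pover Qbar p" "p \<noteq> 0" "poly p z = 0"
  shows "z \<in> Qbar"
proof -
  interpret Q: csubfield \<rat> by (rule csubfield_Rats)
  have "\<exists>x. algebraic_over \<rat> x \<and> set (coeffs p) \<subseteq> adj \<rat> x"
  proof -
    have "algebraic_over \<rat> a" if "a \<in> set (coeffs p)" for a
      using that assms(1)
      by (auto simp: pover_def Qbar_def algebraic_over_Rats coeffs_def simp del: upt_Suc split: if_splits)
    then show ?thesis using Q.primitive_element_finite[of "set (coeffs p)"] by blast
  qed
  then obtain x where x: "algebraic_over \<rat> x" "set (coeffs p) \<subseteq> adj \<rat> x" by blast
  obtain f where f: "is_minpoly \<rat> f x" using x(1) Q.minpoly_exists by blast
  interpret numfield "adj \<rat> x" x f by (simp add: numfield_def f)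
  have pK: "pover (adj \<rat> x) p"
    unfolding pover_def
  proof
    fix i show "coeff p i \<in> adj \<rat> x"
      using x(2) K.zero_in coeff_in_coeffs[OF assms(2), of i] coeff_eq_0[of p i]
      by (cases "i \<le> degree p") auto
  qed
  define q where "q = (\<Prod>b\<in>conjs. map_poly (emb b) p)"
  have vals: "poly q (of_nat n) \<in> \<rat>" for n
  proof -
    have "poly q (of_nat n) = (\<Prod>b\<in>conjs. emb b (poly p (of_nat n)))"
      unfolding q_def poly_prod using emb_poly_gen[OF pK] by (intro prod.cong) (auto simp: emb_rat)
    also have "\<dots> \<in> \<rat>" by (intro norm_rat K.poly_in pK) auto
    finally show ?thesis .
  qed
  have "pover \<rat> q" by (rule Q.pover_if_nat_values) (rule vals)
  moreover have "map_poly (emb b) p \<noteq> 0" if "b \<in> conjs" for b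
  proof -
    have "coeff (map_poly (emb b) p) (degree p) \<noteq> 0"
      using that emb_eq_0_iff[OF that pover_coeff[OF pK]] assms(2) by (simp add: coeff_map_poly)
    then show ?thesis by auto
  qed
  then have "q \<noteq> 0" unfolding q_def using finite_conjs by auto
  moreover have "map_poly (emb x) p = p"
    using emb_id pover_coeff[OF pK] x_conj by (intro poly_eqI) (auto simp: coeff_map_poly)
  then have "poly q z = 0" unfolding q_def poly_prod
    using x_conj finite_conjs assms(3) by (auto intro!: bexI[of _ x])
  ultimately show ?thesis by (auto simp: Qbar_def algebraic_altdef pover_def)
qed

section \<open>Absolute values\<close>

locale absval = csubfield K for K +
  fixes v :: "complex \<Rightarrow> real"
  assumes absval: "absolute_value_on K v"
begin

lemma nonneg [simp]: "x \<in> K \<Longrightarrow> 0 \<le> v x"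
  using absval by (auto simp: absolute_value_on_def)
lemma eq_0_iff [simp]: "x \<in> K \<Longrightarrow> v x = 0 \<longleftrightarrow> x = 0"
  using absval by (auto simp: absolute_value_on_def)
lemma mult: "x \<in> K \<Longrightarrow> y \<in> K \<Longrightarrow> v (x * y) = v x * v y"
  using absval by (auto simp: absolute_value_on_def)
lemma triangle: "x \<in> K \<Longrightarrow> y \<in> K \<Longrightarrow> v (x + y) \<le> v x + v y"
  using absval by (auto simp: absolute_value_on_def)

lemma v0 [simp]: "v 0 = 0"
  by simp

lemma pos: "x \<in> K \<Longrightarrow> x \<noteq> 0 \<Longrightarrow> v x > 0"
  using nonneg[of x] eq_0_iff[of x] by linarith

lemma v1 [simp]: "v 1 = 1"
  using mult[of 1 1] eq_0_iff[of 1] by simp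

lemma minus1 [simp]: "v (-1) = 1"
proof -
  have "v (-1) * v (-1) = 1" using mult[of "-1" "-1"] by (simp add: uminus_in)
  then have "v (-1) = 1 \<or> v (-1) = -1" by (simp add: square_eq_1_iff)
  then show ?thesis using nonneg[OF uminus_in[OF one_in]] by linarith
qed

lemma uminus [simp]: "x \<in> K \<Longrightarrow> v (- x) = v x"
  using mult[of "-1" x] by (simp add: uminus_in)

lemma diff_triangle: "x \<in> K \<Longrightarrow> y \<in> K \<Longrightarrow> v (x - y) \<le> v x + v y"
  using triangle[of x "- y"] by (simp add: uminus_in)

lemma diff_commute: "x \<in> K \<Longrightarrow> y \<in> K \<Longrightarrow> v (x - y) = v (y - x)"
  using uminus[of "x - y"] by (simp add: diff_in)

lemma inverse: "x \<in> K \<Longrightarrow> v (inverse x) = inverse (v x)"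
  using mult[of x "Fields.inverse x"] by (cases "x = 0") (auto simp: inverse_in inverse_unique)

lemma divide: "x \<in> K \<Longrightarrow> y \<in> K \<Longrightarrow> v (x / y) = v x / v y"
  by (simp add: divide_inverse mult inverse inverse_in)

lemma power: "x \<in> K \<Longrightarrow> v (x ^ n) = v x ^ n"
  by (induction n) (auto simp: mult power_in)

lemma sum_le: "(\<And>i. i \<in> A \<Longrightarrow> g i \<in> K) \<Longrightarrow> v (sum g A) \<le> (\<Sum>i\<in>A. v (g i))"
  by (induction A rule: infinite_finite_induct) (auto intro!: order_trans[OF triangle] sum_in)

lemma prod: "(\<And>i. i \<in> A \<Longrightarrow> g i \<in> K) \<Longrightarrow> v (prod g A) = (\<Prod>i\<in>A. v (g i))"
  by (induction A rule: infinite_finite_induct) (auto simp: mult prod_in)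

lemma reverse_triangle: "x \<in> K \<Longrightarrow> y \<in> K \<Longrightarrow> v x - v y \<le> v (x + y)"
  using triangle[of "x + y" "- y"] by (simp add: uminus_in add_in)

end

lemma absvalI: "csubfield K \<Longrightarrow> absolute_value_on K v \<Longrightarrow> absval K v"
  by (simp add: absval_def absval_axioms_def)

lemma (in numfield) absval_emb:
  assumes "absval Qbar w" "b \<in> conjs"
  shows "absval K (\<lambda>y. w (emb b y))"
proof -
  interpret w: absval Qbar w by fact
  show ?thesis
  proof (rule absvalI[OF K.csubfield_axioms], unfold absolute_value_on_def, intro conjI ballI)
    fix y assume y: "y \<in> K"
    show "0 \<le> w (emb b y)" "w (emb b y) = 0 \<longleftrightarrow> y = 0"
      using w.eq_0_iff[of "emb b y"] emb_Qbar[OF assms(2) y] emb_eq_0_iff[OF assms(2) y] by auto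
    fix z assume z: "z \<in> K"
    show "w (emb b (y * z)) = w (emb b y) * w (emb b z)" "w (emb b (y + z)) \<le> w (emb b y) + w (emb b z)"
      using y z assms(2) by (auto simp: emb_mult emb_add w.mult w.triangle emb_Qbar)
  qed
qed

section \<open>Weak approximation\<close>

text \<open>A p-adic absolute value takes only powers of \<open>p\<close> as nonzero values, and
  none of them need lie between \<open>s\<close> and \<open>t\<close>. Once
  \<open>(t / s) ^ k\<close> exceeds the square of \<open>p\<close>, one lies between
  \<open>s ^ k\<close> and \<open>t ^ k\<close>.\<close>

lemma standard_rat_abs_gap:
  assumes "u \<in> standard_rat_abs" "0 < s" "s < (t::real)"
  shows "\<exists>k q. k > 0 \<and> q \<noteq> 0 \<and> s ^ k < u q \<and> u q < t ^ k"
  using assms(1) unfolding standard_rat_abs_def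
proof
  assume u: "u = (\<lambda>r. \<bar>real_of_rat r\<bar>)"
  obtain q where q: "s < real_of_rat q" "real_of_rat q < t" using of_rat_dense[OF assms(3)] by blast
  moreover from q have "0 < real_of_rat q" using assms(2) by linarith
  then have "0 < q" by simp
  ultimately show ?thesis using q assms unfolding u by (intro exI[of _ "1::nat"] exI[of _ q]) auto
next
  assume "u \<in> {padic_abs p |p. Factorial_Ring.prime p}"
  then obtain p where p: "prime p" "u = padic_abs p" by auto
  have p1: "real p > 1" using prime_gt_1_nat[OF p(1)] by simp
  have up: "u ((of_nat p :: rat) powi m) = real p powi (- m)" for m
  proof -
    have mult: "multiplicity (int p) (int p ^ k) = k" for k
      using p(1) by (intro multiplicity_same_power) (auto simp: prime_gt_1_nat)
    show ?thesis
    proof (cases "m \<ge> 0")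
      case True
      then obtain k where k: "m = int k" by (metis nonneg_int_cases)
      have "(of_nat p :: rat) powi m = Rat.Fract (int p ^ k) 1"
        using k by (simp add: Fract_of_int_quotient)
      then show ?thesis using p k p1
        by (auto simp: padic_abs_def quotient_of_Fract mult)
    next
      case False
      then obtain k where k: "m = - int k" by (metis linear nonpos_int_cases)
      have "(of_nat p :: rat) powi m = Rat.Fract 1 (int p ^ k)"
        using k by (simp add: Fract_of_int_quotient power_int_minus field_simps)
      then show ?thesis using p k p1
        by (auto simp: padic_abs_def quotient_of_Fract mult normalize_def)
    qed
  qed
  have "t / s > 1" using assms by simp
  then obtain k where k: "(t / s) ^ k > real p ^ 2" using real_arch_pow by blast
  have k0: "k > 0"
  proof (rule ccontr)
    assume "\<not> k > 0"
    then have "real p ^ 2 < 1" using k by simp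
    moreover have "real p ^ 2 \<ge> 1" using p1 by (intro one_le_power) simp
    ultimately show False by simp
  qed
  have sk: "s ^ k > 0" using assms by simp
  \<comment> \<open>The first power of \<open>p\<close> above \<open>s ^ k\<close> has exponent
    \<open>m\<close>; it is at most \<open>p\<close> times \<open>s ^ k\<close>, hence below
    \<open>t ^ k\<close>.\<close>
  define m where "m = \<lfloor>log (real p) (s ^ k)\<rfloor> + 1"
  have "real p powr log (real p) (s ^ k) < real p powr real_of_int m"
    using p1 by (intro powr_less_mono) (auto simp: m_def)
  then have 1: "s ^ k < real p powi m" using p1 sk by (simp add: powr_real_of_int')
  have "real p powr real_of_int m \<le> real p powr (log (real p) (s ^ k) + 1)"
    using p1 by (intro powr_mono) (auto simp: m_def)
  also have "\<dots> = s ^ k * real p" using p1 sk by (simp add: powr_add)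
  also have "\<dots> \<le> s ^ k * real p ^ 2" using p1 sk by (simp add: power2_eq_square)
  also have "\<dots> < s ^ k * (t / s) ^ k" using k sk by (simp add: mult_strict_left_mono)
  also have "\<dots> = t ^ k" using assms by (simp add: power_divide)
  finally have 2: "real p powi m < t ^ k" using p1 by (simp add: powr_real_of_int')
  show ?thesis using k0 1 2 up[of "-m"] p1
    by (intro exI[of _ k] exI[of _ "(of_nat p :: rat) powi (-m)"]) auto
qed

text \<open>For some \<open>z\<close>, namely \<open>y\<close> or its inverse,
  \<open>w z < v z\<close>. Dividing a power of \<open>z\<close> by a rational number of
  intermediate absolute value pushes \<open>v\<close> above \<open>1\<close> and \<open>w\<close>
  below \<open>1\<close>; this works because \<open>v\<close> and \<open>w\<close> agree on the
  rationals.\<close>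

lemma absval_separate:
  assumes v: "absval K v" and w: "absval K w" and "u \<in> standard_rat_abs"
    and "\<And>r. v (of_rat r) = u r" "\<And>r. w (of_rat r) = u r"
    and "y \<in> K" "v y \<noteq> w y"
  shows "\<exists>a\<in>K. v a > 1 \<and> w a < 1"
proof -
  interpret v: absval K v by fact
  interpret w: absval K w by fact
  have y0: "y \<noteq> 0" using assms(7) by auto
  have "\<exists>z\<in>K. z \<noteq> 0 \<and> w z < v z"
  proof (cases "w y < v y")
    case False
    then have "w (inverse y) < v (inverse y)"
      using assms(6,7) y0 v.pos[of y] w.pos[of y] by (simp add: v.inverse w.inverse)
    then show ?thesis using assms(6) y0 v.inverse_in by (intro bexI[of _ "inverse y"]) auto
  qed (use assms(6) y0 in auto)
  then obtain z where z: "z \<in> K" "z \<noteq> 0" "w z < v z" by blast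
  obtain k q where kq: "k > 0" "q \<noteq> 0" "w z ^ k < u q" "u q < v z ^ k"
    using standard_rat_abs_gap[OF assms(3) w.pos[OF z(1,2)] z(3)] by blast
  have uq: "u q > 0" using v.pos[of "of_rat q"] kq(2) assms(4) by auto
  show ?thesis
    using z kq uq by (intro bexI[of _ "z ^ k / of_rat q"])
      (auto simp: v.divide w.divide v.power w.power assms(4,5) v.power_in v.divide_in)
qed

lemma tendsto_pow_ratio: "(1::real) < s \<Longrightarrow> (\<lambda>k. s ^ k / (1 + s ^ k)) \<longlonglongrightarrow> 1"
  by real_asymp

lemma tendsto_pow_ratio': "(1::real) < s \<Longrightarrow> (\<lambda>k. s ^ k / (s ^ k - 1)) \<longlonglongrightarrow> 1"
  by real_asymp

lemma tendsto_pow_ratio_inv: "(1::real) < s \<Longrightarrow> (\<lambda>k. 1 / (s ^ k - 1)) \<longlonglongrightarrow> 0"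
  by real_asymp

lemma tendsto_pow_ratio_small: assumes "0 \<le> s" "s < (1::real)" shows "(\<lambda>k. s ^ k / (1 - s ^ k)) \<longlonglongrightarrow> 0"
  using tendsto_divide[OF LIMSEQ_power_zero[of s] tendsto_diff[OF tendsto_const[of 1] LIMSEQ_power_zero[of s]]] assms by simp

context absval
begin

text \<open>The quotients tend to \<open>1\<close> at absolute values with \<open>v a > 1\<close>
  and to \<open>0\<close> at those with \<open>v a < 1\<close>. The explicit bounds allow one
  \<open>k\<close> to serve several absolute values.\<close>

lemma pow_ratio_bounds:
  assumes "a \<in> K" "v a \<noteq> 1" "k > 0"
  shows "a ^ k / (1 + a ^ k) \<in> K" "1 + a ^ k \<noteq> 0"
    "v a > 1 \<Longrightarrow> v (a ^ k / (1 + a ^ k)) \<ge> v a ^ k / (1 + v a ^ k)"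
    "v a > 1 \<Longrightarrow> v (a ^ k / (1 + a ^ k)) \<le> v a ^ k / (v a ^ k - 1)"
    "v a > 1 \<Longrightarrow> v (a ^ k / (1 + a ^ k) - 1) \<le> 1 / (v a ^ k - 1)"
    "v a < 1 \<Longrightarrow> v (a ^ k / (1 + a ^ k)) \<le> v a ^ k / (1 - v a ^ k)"
proof -
  have in1: "a ^ k \<in> K" "1 + a ^ k \<in> K" using assms by auto
  show in2: "a ^ k / (1 + a ^ k) \<in> K" using in1 by auto
  have up: "v (1 + a ^ k) \<le> 1 + v a ^ k" using triangle[of 1 "a ^ k"] in1 assms by (simp add: power)
  have lo: "v a ^ k - 1 \<le> v (1 + a ^ k)" "1 - v a ^ k \<le> v (1 + a ^ k)"
    using reverse_triangle[of "a ^ k" 1] reverse_triangle[of 1 "a ^ k"] in1 assms by (auto simp: power add.commute)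
  have gt: "v a > 1 \<Longrightarrow> v a ^ k > 1" "v a < 1 \<Longrightarrow> v a ^ k < 1"
    using assms by (auto simp: one_less_power power_less_one_iff)
  have "v (1 + a ^ k) \<noteq> 0" using lo gt assms(2) by (cases "v a > 1") auto
  then show ne: "1 + a ^ k \<noteq> 0" by auto
  then have pos: "v (1 + a ^ k) > 0" using in1 pos by blast
  show "v (a ^ k / (1 + a ^ k)) \<ge> v a ^ k / (1 + v a ^ k)" if "v a > 1"
    using up pos in1 assms(1) that by (simp add: divide power frac_le)
  show "v (a ^ k / (1 + a ^ k)) \<le> v a ^ k / (v a ^ k - 1)" if "v a > 1"
    using lo pos in1 assms(1) that gt by (simp add: divide power frac_le)
  show "v (a ^ k / (1 + a ^ k)) \<le> v a ^ k / (1 - v a ^ k)" if "v a < 1"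
    using lo pos in1 assms(1) that gt by (simp add: divide power frac_le)
  have "a ^ k / (1 + a ^ k) - 1 = - (1 / (1 + a ^ k))" using ne by (simp add: field_simps)
  then have "v (a ^ k / (1 + a ^ k) - 1) = 1 / v (1 + a ^ k)"
    using in1 by (simp add: divide divide_in)
  then show "v (a ^ k / (1 + a ^ k) - 1) \<le> 1 / (v a ^ k - 1)" if "v a > 1"
    using lo pos that gt by (simp add: frac_le)
qed

end

text \<open>Induction on \<open>W\<close>: \<open>a\<close> already works for \<open>W\<close>, and
  \<open>b\<close> separates \<open>v\<close> from the new \<open>w\<close>. If
  \<open>w a \<le> 1\<close>, then \<open>a ^ k * b\<close> works for large \<open>k\<close>.
  Otherwise \<open>a ^ k / (1 + a ^ k) * b\<close> does, since the quotient tends to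
  \<open>1\<close> at \<open>v\<close> and \<open>w\<close> and to \<open>0\<close> at the members
  of \<open>W\<close>.\<close>

lemma weak_approximation_aux:
  assumes v: "absval K v" and "finite W" and W: "\<And>w. w \<in> W \<Longrightarrow> absval K w"
    and "W \<noteq> {}" and sep: "\<And>w. w \<in> W \<Longrightarrow> \<exists>a\<in>K. v a > 1 \<and> w a < 1"
  shows "\<exists>a\<in>K. v a > 1 \<and> (\<forall>w\<in>W. w a < 1)"
  using assms(2) \<open>W \<noteq> {}\<close> W sep
proof (induction W rule: finite_ne_induct)
  case (singleton w)
  then show ?case by auto
next
  case (insert w W)
  interpret v: absval K v by fact
  interpret w: absval K w using insert by auto
  obtain a where a: "a \<in> K" "v a > 1" "\<And>w. w \<in> W \<Longrightarrow> w a < 1" using insert by force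
  obtain b where b: "b \<in> K" "v b > 1" "w b < 1" using insert by force
  show ?case
  proof (cases "w a \<le> 1")
    case True
    have "\<forall>\<^sub>F k in sequentially. \<forall>w'\<in>W. w' (a ^ k * b) < 1"
      using insert.hyps(1)
    proof (rule eventually_ball_finite, intro ballI)
      fix w' assume w': "w' \<in> W"
      interpret w': absval K w' using insert w' by auto
      have "(\<lambda>k. w' a ^ k * w' b) \<longlonglongrightarrow> 0 * w' b"
        by (intro tendsto_mult tendsto_const LIMSEQ_power_zero) (use a w' in auto)
      then have "\<forall>\<^sub>F k in sequentially. w' a ^ k * w' b < 1"
        by (rule order_tendstoD(2)) simp
      then show "\<forall>\<^sub>F k in sequentially. w' (a ^ k * b) < 1"
        using a b by (simp add: w'.mult w'.power v.power_in)
    qed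
    then obtain k where k: "\<forall>w'\<in>W. w' (a ^ k * b) < 1" by (auto simp: eventually_sequentially)
    have "v a ^ k \<ge> 1" using a(2) by simp
    then have "v (a ^ k * b) > 1"
      using a b less_le_trans[of 1 "v b" "v a ^ k * v b"] by (simp add: v.mult v.power v.power_in)
    moreover have "w (a ^ k * b) < 1"
    proof -
      have "w a ^ k \<le> 1" using True a by (simp add: power_le_one)
      then have "w a ^ k * w b \<le> 1 * w b" using b by (intro mult_right_mono) auto
      then show ?thesis using a b by (simp add: w.mult w.power v.power_in)
    qed
    ultimately show ?thesis using k a b by (intro bexI[of _ "a ^ k * b"]) auto
  next
    case False
    define c where "c = (\<lambda>k. a ^ k / (1 + a ^ k) * b)"
    have e0: "\<forall>\<^sub>F k in sequentially. k > 0" by (rule eventually_gt_at_top)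
    have ev: "\<forall>\<^sub>F k in sequentially. v (c k) > 1"
    proof -
      have "(\<lambda>k. v a ^ k / (1 + v a ^ k) * v b) \<longlonglongrightarrow> 1 * v b"
        by (intro tendsto_mult tendsto_const tendsto_pow_ratio) (use a in auto)
      then have "\<forall>\<^sub>F k in sequentially. v a ^ k / (1 + v a ^ k) * v b > 1"
        by (rule order_tendstoD(1)) (use b in simp)
      then show ?thesis using e0
      proof eventually_elim
        case (elim k)
        have "v a ^ k / (1 + v a ^ k) * v b \<le> v (a ^ k / (1 + a ^ k)) * v b"
          using v.pow_ratio_bounds(3)[OF a(1) _ elim(2)] a b by (intro mult_right_mono) auto
        moreover have "v (c k) = v (a ^ k / (1 + a ^ k)) * v b"
          unfolding c_def using a b v.pow_ratio_bounds(1)[OF a(1) _ elim(2)] by (intro v.mult) auto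
        ultimately show ?case using elim(1) by linarith
      qed
    qed
    have ew: "\<forall>\<^sub>F k in sequentially. w (c k) < 1"
    proof -
      have "(\<lambda>k. w a ^ k / (w a ^ k - 1) * w b) \<longlonglongrightarrow> 1 * w b"
        by (intro tendsto_mult tendsto_const tendsto_pow_ratio') (use False in auto)
      then have "\<forall>\<^sub>F k in sequentially. w a ^ k / (w a ^ k - 1) * w b < 1"
        by (rule order_tendstoD(2)) (use b in simp)
      then show ?thesis using e0
      proof eventually_elim
        case (elim k)
        have "w (a ^ k / (1 + a ^ k)) * w b \<le> w a ^ k / (w a ^ k - 1) * w b"
          using w.pow_ratio_bounds(4)[OF a(1) _ elim(2)] a b False by (intro mult_right_mono) auto
        moreover have "w (c k) = w (a ^ k / (1 + a ^ k)) * w b"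
          unfolding c_def using a b False w.pow_ratio_bounds(1)[OF a(1) _ elim(2)] by (intro w.mult) auto
        ultimately show ?case using elim(1) by linarith
      qed
    qed
    have eW: "\<forall>\<^sub>F k in sequentially. \<forall>w'\<in>W. w' (c k) < 1"
      using insert.hyps(1)
    proof (rule eventually_ball_finite, intro ballI)
      fix w' assume w': "w' \<in> W"
      interpret w': absval K w' using insert w' by auto
      have "(\<lambda>k. w' a ^ k / (1 - w' a ^ k) * w' b) \<longlonglongrightarrow> 0 * w' b"
        by (intro tendsto_mult tendsto_const tendsto_pow_ratio_small) (use a w' in auto)
      then have "\<forall>\<^sub>F k in sequentially. w' a ^ k / (1 - w' a ^ k) * w' b < 1"
        by (rule order_tendstoD(2)) simp
      then show "\<forall>\<^sub>F k in sequentially. w' (c k) < 1" using e0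
      proof eventually_elim
        case (elim k)
        have "w' (a ^ k / (1 + a ^ k)) * w' b \<le> w' a ^ k / (1 - w' a ^ k) * w' b"
          using w'.pow_ratio_bounds(6)[OF a(1) _ elim(2)] a(3)[OF w'] b by (intro mult_right_mono) auto
        moreover have "w' (c k) = w' (a ^ k / (1 + a ^ k)) * w' b"
          unfolding c_def using a(3)[OF w'] b w'.pow_ratio_bounds(1)[OF a(1) _ elim(2)] by (intro w'.mult) auto
        ultimately show ?case using elim(1) by linarith
      qed
    qed
    have "\<forall>\<^sub>F k in sequentially. v (c k) > 1 \<and> w (c k) < 1 \<and> (\<forall>w'\<in>W. w' (c k) < 1) \<and> k > 0"
      using ev ew eW e0 by eventually_elim auto
    then obtain k where "v (c k) > 1" "w (c k) < 1" "\<forall>w'\<in>W. w' (c k) < 1" "k > 0"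
      by (auto simp: eventually_sequentially)
    moreover have "c k \<in> K" using a(1) b(1) by (auto simp: c_def)
    ultimately show ?thesis by (intro bexI[of _ "c k"]) auto
  qed
qed

lemma weak_approximation:
  assumes v: "absval K v" and "finite W" and W: "\<And>w. w \<in> W \<Longrightarrow> absval K w"
    and sep: "\<And>w. w \<in> W \<Longrightarrow> \<exists>a\<in>K. v a > 1 \<and> w a < 1" and "\<delta> > 0"
  shows "\<exists>a\<in>K. v (a - 1) < \<delta> \<and> (\<forall>w\<in>W. w a < \<delta>)"
proof (cases "W = {}")
  case True
  interpret v: absval K v by fact
  show ?thesis using True assms by (intro bexI[of _ 1]) auto
next
  case False
  interpret v: absval K v by fact
  obtain a where a: "a \<in> K" "v a > 1" "\<And>w. w \<in> W \<Longrightarrow> w a < 1"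
    using weak_approximation_aux[OF v assms(2) W False sep] by blast
  have e0: "\<forall>\<^sub>F k in sequentially. k > 0" by (rule eventually_gt_at_top)
  have "\<forall>\<^sub>F k in sequentially. 1 / (v a ^ k - 1) < \<delta>"
    by (rule order_tendstoD(2)[OF tendsto_pow_ratio_inv]) (use a assms in auto)
  moreover have "\<forall>\<^sub>F k in sequentially. \<forall>w\<in>W. w a ^ k / (1 - w a ^ k) < \<delta>"
    using assms(2)
  proof (rule eventually_ball_finite, intro ballI)
    fix w assume w: "w \<in> W"
    interpret w: absval K w using W w by auto
    show "\<forall>\<^sub>F k in sequentially. w a ^ k / (1 - w a ^ k) < \<delta>"
      by (rule order_tendstoD(2)[OF tendsto_pow_ratio_small]) (use a w assms in auto)
  qed
  ultimately have "\<forall>\<^sub>F k in sequentially. 1 / (v a ^ k - 1) < \<delta> \<and> (\<forall>w\<in>W. w a ^ k / (1 - w a ^ k) < \<delta>) \<and> k > 0"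
    using e0 by eventually_elim auto
  then obtain k where k: "1 / (v a ^ k - 1) < \<delta>" "\<And>w. w \<in> W \<Longrightarrow> w a ^ k / (1 - w a ^ k) < \<delta>" "k > 0"
    by (auto simp: eventually_sequentially)
  show ?thesis
  proof (intro bexI[of _ "a ^ k / (1 + a ^ k)"] conjI ballI)
    show "v (a ^ k / (1 + a ^ k) - 1) < \<delta>"
      using v.pow_ratio_bounds(5)[OF a(1) _ k(3)] a(2) k(1) by auto
    show "w (a ^ k / (1 + a ^ k)) < \<delta>" if "w \<in> W" for w
      using absval.pow_ratio_bounds(6)[OF W[OF that] a(1) _ k(3)] a(3)[OF that] k(2)[OF that] by auto
    show "a ^ k / (1 + a ^ k) \<in> K" using a by auto
  qed
qed

section \<open>Extending the p-adic absolute value to the algebraic numbers\<close>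

definition csubring :: "complex set \<Rightarrow> bool" where
  "csubring A \<longleftrightarrow> 1 \<in> A \<and> (\<forall>x\<in>A. \<forall>y\<in>A. x - y \<in> A \<and> x * y \<in> A)"

lemma csubringD:
  assumes "csubring A"
  shows "0 \<in> A" "1 \<in> A" "x \<in> A \<Longrightarrow> y \<in> A \<Longrightarrow> x - y \<in> A" "x \<in> A \<Longrightarrow> y \<in> A \<Longrightarrow> x * y \<in> A"
    "x \<in> A \<Longrightarrow> - x \<in> A" "x \<in> A \<Longrightarrow> y \<in> A \<Longrightarrow> x + y \<in> A"
proof -
  have *: "x - y \<in> A" "x * y \<in> A" if "x \<in> A" "y \<in> A" for x y
    using assms that by (auto simp: csubring_def)
  then show "x \<in> A \<Longrightarrow> y \<in> A \<Longrightarrow> x - y \<in> A" "x \<in> A \<Longrightarrow> y \<in> A \<Longrightarrow> x * y \<in> A" by auto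
  show 1: "1 \<in> A" using assms by (simp add: csubring_def)
  show 0: "0 \<in> A" using *(1)[OF 1 1] by simp
  have m: "- x \<in> A" if "x \<in> A" for x using *(1)[OF 0 that] by simp
  then show "x \<in> A \<Longrightarrow> - x \<in> A" .
  show "x \<in> A \<Longrightarrow> y \<in> A \<Longrightarrow> x + y \<in> A" using *(1)[OF _ m, of x y] by simp
qed

lemma csubring_power: "csubring A \<Longrightarrow> x \<in> A \<Longrightarrow> x ^ n \<in> A"
  by (induction n) (auto simp: csubringD)

lemma csubring_sum: "csubring A \<Longrightarrow> (\<And>i. i \<in> I \<Longrightarrow> g i \<in> A) \<Longrightarrow> sum g I \<in> A"
  by (induction I rule: infinite_finite_induct) (auto simp: csubringD)

lemma csubring_of_nat: "csubring A \<Longrightarrow> of_nat n \<in> A"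
  by (induction n) (auto simp: csubringD)

lemma csubring_of_int: "csubring A \<Longrightarrow> of_int n \<in> A"
  by (cases n) (auto simp: csubringD csubring_of_nat simp del: of_nat_Suc)

definition ring_adj :: "complex set \<Rightarrow> complex \<Rightarrow> complex set" where
  "ring_adj A x = {\<Sum>i\<le>n. a i * x ^ i |a n. \<forall>i. a i \<in> A}"

lemma ring_adj_poly:
  assumes "csubring A"
  shows "ring_adj A x = {poly p x |p. \<forall>i. coeff p i \<in> A}"
proof (intro equalityI subsetI)
  fix y assume "y \<in> ring_adj A x"
  then obtain a n where a: "\<forall>i. a i \<in> A" "y = (\<Sum>i\<le>n. a i * x ^ i)" by (auto simp: ring_adj_def)
  define p where "p = (\<Sum>i\<le>n. monom (a i) i)"
  have "coeff p i = (if i \<le> n then a i else 0)" for i by (simp add: p_def coeff_sum)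
  then have "\<forall>i. coeff p i \<in> A" using a csubringD(1)[OF assms] by auto
  moreover have "y = poly p x" using a by (simp add: p_def poly_sum poly_monom)
  ultimately show "y \<in> {poly p x |p. \<forall>i. coeff p i \<in> A}" by blast
next
  fix y assume "y \<in> {poly p x |p. \<forall>i. coeff p i \<in> A}"
  then show "y \<in> ring_adj A x" unfolding ring_adj_def poly_altdef by blast
qed

lemma csubring_adj:
  assumes A: "csubring A"
  shows "csubring (ring_adj A x)" "A \<subseteq> ring_adj A x" "x \<in> ring_adj A x"
proof -
  show "A \<subseteq> ring_adj A x"
  proof
    fix a assume "a \<in> A"
    then show "a \<in> ring_adj A x" unfolding ring_adj_poly[OF A] using csubringD(1)[OF A]
      by (intro CollectI exI[of _ "[:a:]"]) (auto simp: coeff_pCons split: nat.split)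
  qed
  show "x \<in> ring_adj A x" unfolding ring_adj_poly[OF A] using csubringD(1,2)[OF A]
      by (intro CollectI exI[of _ "[:0, 1:]"]) (auto simp: coeff_pCons split: nat.split)
  show "csubring (ring_adj A x)"
    unfolding csubring_def
  proof (intro conjI ballI)
    show "1 \<in> ring_adj A x" unfolding ring_adj_poly[OF A] using csubringD(1,2)[OF A]
      by (intro CollectI exI[of _ "1"]) (auto simp: coeff_pCons split: nat.split)
    fix y z assume "y \<in> ring_adj A x" "z \<in> ring_adj A x"
    then obtain p q where pq: "\<forall>i. coeff p i \<in> A" "\<forall>i. coeff q i \<in> A" "y = poly p x" "z = poly q x"
      unfolding ring_adj_poly[OF A] by auto
    show "y - z \<in> ring_adj A x" unfolding ring_adj_poly[OF A] using pq
      by (intro CollectI exI[of _ "p - q"]) (auto simp: csubringD[OF A])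
    show "y * z \<in> ring_adj A x" unfolding ring_adj_poly[OF A] using pq
      by (intro CollectI exI[of _ "p * q"])
         (auto simp: csubringD[OF A] coeff_mult intro!: csubring_sum[OF A])
  qed
qed

text \<open>Zorn's lemma applies because the integers avoid \<open>c\<close> and unions of chains
  do. With \<open>c = 1/p\<close> such a ring turns out to be a valuation ring of the complex
  numbers in which \<open>p\<close> is not invertible.\<close>

lemma exists_maximal_subring:
  fixes c :: complex
  assumes "c \<notin> \<int>"
  shows "\<exists>A. csubring A \<and> c \<notin> A \<and> (\<forall>B. csubring B \<longrightarrow> c \<notin> B \<longrightarrow> A \<subseteq> B \<longrightarrow> B = A)"
proof -
  define SS where "SS = {A. csubring A \<and> c \<notin> A}"
  have "\<exists>M\<in>SS. \<forall>Y\<in>SS. M \<subseteq> Y \<longrightarrow> Y = M"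
  proof (rule subset_Zorn)
    fix C assume C: "subset.chain SS C"
    show "\<exists>U\<in>SS. \<forall>Y\<in>C. Y \<subseteq> U"
    proof (cases "C = {}")
      case True
      have "\<int> \<in> SS" using assms by (auto simp: SS_def csubring_def)
      then show ?thesis using True by blast
    next
      case False
      have sub: "C \<subseteq> SS" and lin: "\<And>Y1 Y2. Y1 \<in> C \<Longrightarrow> Y2 \<in> C \<Longrightarrow> Y1 \<subseteq> Y2 \<or> Y2 \<subseteq> Y1"
        using C by (auto simp: subset_chain_def)
      have "csubring (\<Union>C)" unfolding csubring_def
      proof (intro conjI ballI)
        show "1 \<in> \<Union>C" using False sub by (auto simp: SS_def csubring_def)
        fix x y assume "x \<in> \<Union>C" "y \<in> \<Union>C"
        then obtain Y1 Y2 where Y: "Y1 \<in> C" "Y2 \<in> C" "x \<in> Y1" "y \<in> Y2" by blast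
        obtain Z where Z: "Z \<in> C" "x \<in> Z" "y \<in> Z" using lin[OF Y(1,2)] Y by blast
        then have "csubring Z" using sub by (auto simp: SS_def)
        then show "x - y \<in> \<Union>C" "x * y \<in> \<Union>C" using Z csubringD by blast+
      qed
      moreover have "c \<notin> \<Union>C" using sub by (auto simp: SS_def)
      ultimately show ?thesis by (intro bexI[of _ "\<Union>C"]) (auto simp: SS_def)
    qed
  qed
  then show ?thesis by (auto simp: SS_def)
qed

section \<open>The valuation ring above a prime and its value group\<close>

locale padic_valring =
  fixes p :: nat and A :: "complex set"
  assumes prime_p: "Factorial_Ring.prime p" and ring: "csubring A" and no_inv: "1 / of_nat p \<notin> A"
    and maximal: "\<And>B. csubring B \<Longrightarrow> 1 / of_nat p \<notin> B \<Longrightarrow> A \<subseteq> B \<Longrightarrow> B = A"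
begin

lemmas ring_simps = csubringD[OF ring] csubring_of_nat[OF ring] csubring_of_int[OF ring] csubring_power[OF ring]

lemma p_nz [simp]: "p \<noteq> 0" "p > 0"
  using prime_p by (auto intro: prime_gt_0_nat)

lemma p_gt_1: "p > 1"
  using prime_gt_1_nat[OF prime_p] .

text \<open>The ideal generated by \<open>p\<close>, which may be smaller than the maximal ideal. It
  suffices because \<open>1 - x\<close> is a unit for each \<open>x\<close> in it.\<close>

definition m :: "complex set" where "m = {of_nat p * a |a. a \<in> A}"

lemma one_notin_m: "1 \<notin> m"
proof
  assume "1 \<in> m"
  then obtain a where a: "a \<in> A" "1 = of_nat p * a" by (auto simp: m_def)
  then have "a = 1 / of_nat p" by (simp add: field_simps)
  then show False using no_inv a by simp
qed

lemma m_add: "x \<in> m \<Longrightarrow> y \<in> m \<Longrightarrow> x + y \<in> m"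
  unfolding m_def by clarify (metis distrib_left ring_simps(6))

lemma m_mult: "x \<in> m \<Longrightarrow> y \<in> A \<Longrightarrow> x * y \<in> m"
  unfolding m_def by clarify (metis mult.assoc ring_simps(4))

lemma m_subset: "m \<subseteq> A"
  using ring_simps by (auto simp: m_def)

text \<open>By maximality, adjoining \<open>x\<close> produces \<open>1/p\<close> as a polynomial in
  \<open>x\<close>; multiplying by \<open>p\<close> moves the coefficients into
  \<open>m\<close>.\<close>

lemma adj_notin:
  assumes "x \<notin> A"
  shows "\<exists>a n. (\<forall>i. a i \<in> m) \<and> 1 = (\<Sum>i\<le>n. a i * x ^ i)"
proof -
  have "1 / of_nat p \<in> ring_adj A x"
    using maximal[of "ring_adj A x"] csubring_adj[OF ring, of x] assms by blast
  then obtain a n where a: "\<forall>i. a i \<in> A" "1 / of_nat p = (\<Sum>i\<le>n. a i * x ^ i)"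
    unfolding ring_adj_def by auto
  have "1 = of_nat p * (1 / of_nat p :: complex)" by simp
  also have "\<dots> = (\<Sum>i\<le>n. (of_nat p * a i) * x ^ i)"
    unfolding a(2) by (simp add: sum_distrib_left mult.assoc)
  finally show ?thesis using a(1) by (intro exI[of _ "\<lambda>i. of_nat p * a i"] exI[of _ n]) (auto simp: m_def)
qed

text \<open>Otherwise \<open>adj_notin\<close> gives a relation in the inverse of
  \<open>u = 1 - x\<close>. Multiplied by \<open>u ^ n\<close> it puts \<open>u ^ n\<close> into
  \<open>m\<close>, although \<open>u ^ n\<close> is congruent to \<open>1\<close> modulo
  \<open>m\<close>.\<close>

lemma one_minus_unit:
  assumes "x \<in> m" shows "inverse (1 - x) \<in> A"
proof (rule ccontr)
  assume "inverse (1 - x) \<notin> A"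
  from adj_notin[OF this] obtain a n where
    a: "\<forall>i. a i \<in> m" "1 = (\<Sum>i\<le>n. a i * inverse (1 - x) ^ i)" by blast
  let ?u = "1 - x"
  have u0: "?u \<noteq> 0" using one_notin_m assms by auto
  have uA: "?u \<in> A" using assms m_subset ring_simps by auto
  have "?u ^ n = ?u ^ n * (\<Sum>i\<le>n. a i * inverse ?u ^ i)" using a(2) by simp
  also have "\<dots> = (\<Sum>i\<le>n. a i * ?u ^ (n - i))"
    using u0 by (simp add: sum_distrib_left power_diff field_simps)
  finally have un: "?u ^ n = (\<Sum>i\<le>n. a i * ?u ^ (n - i))" .
  have "(\<Sum>i\<in>I. a i * ?u ^ (n - i)) \<in> m" if "finite I" for I
    using that a(1) uA
    by (induction I) (auto intro!: m_add m_mult simp: ring_simps, auto simp: m_def ring_simps)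
  then have 1: "?u ^ n \<in> m" unfolding un by auto
  have "1 - ?u ^ n \<in> m" for n
  proof (induction n)
    case 0 show ?case using ring_simps by (auto simp: m_def)
  next
    case (Suc n)
    have eq: "1 - ?u ^ Suc n = (1 - ?u ^ n) + x * ?u ^ n" by (simp add: algebra_simps)
    show ?case unfolding eq by (rule m_add[OF Suc m_mult[OF assms ring_simps(9)[OF uA]]])
  qed
  from m_add[OF this[of n] 1] show False using one_notin_m by simp
qed

text \<open>Among all relations witnessing that neither \<open>x\<close> nor \<open>1/x\<close> lies in \<open>A\<close> take the shortest ones;
  the longer of the two can be shortened with the other.\<close>

lemma valuation: "x \<in> A \<or> inverse x \<in> A"
proof (rule ccontr)
  assume *: "\<not> (x \<in> A \<or> inverse x \<in> A)"
  define R where "R = (\<lambda>x n. \<exists>a. (\<forall>i. a i \<in> m) \<and> 1 = (\<Sum>i\<le>n. a i * x ^ i))"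
  have red: False if x: "x \<noteq> 0" and "R x n" "R (inverse x) k" "k \<le> n" "\<And>j. R x j \<Longrightarrow> n \<le> j" for x :: complex and n k
  proof -
    from that(2) obtain a where a: "\<forall>i. a i \<in> m" "1 = (\<Sum>i\<le>n. a i * x ^ i)" by (auto simp: R_def)
    from that(3) obtain b where b: "\<forall>i. b i \<in> m" "1 = (\<Sum>i\<le>k. b i * inverse x ^ i)" by (auto simp: R_def)
    have n0: "n \<noteq> 0"
    proof
      assume "n = 0"
      then have "1 = a 0" using a(2) by simp
      then show False using a(1) one_notin_m by metis
    qed
    then obtain n' where n': "n = Suc n'" using not0_implies_Suc by blast
    have "(\<Sum>i\<le>k. b i * inverse x ^ i) = b 0 + (\<Sum>i\<in>{1..k}. b i * inverse x ^ i)"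
    proof -
      have "{..k} = insert 0 {1..k}" by auto
      then show ?thesis by simp
    qed
    then have b1: "1 - b 0 = (\<Sum>i\<in>{1..k}. b i * inverse x ^ i)" using b(2) by (metis add_diff_cancel_left')
    define e where "e = inverse (1 - b 0)"
    have e: "e \<in> A" using one_minus_unit b(1) by (auto simp: e_def)
    have ne: "1 - b 0 \<noteq> 0" using b(1) one_notin_m by (metis eq_iff_diff_eq_0)
    \<comment> \<open>Since \<open>1 - b 0\<close> is a unit and \<open>k \<le> n\<close>, the
      relation for \<open>inverse x\<close> expresses \<open>x ^ n\<close> by lower powers of
      \<open>x\<close>. Substituting this for the top term of the relation for \<open>x\<close>
      shortens it.\<close>
    have "1 = e * (1 - b 0)" using ne by (simp add: e_def)
    then have "x ^ n = e * (\<Sum>i\<in>{1..k}. b i * inverse x ^ i) * x ^ n" using b1 by simp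
    also have "\<dots> = (\<Sum>i\<in>{1..k}. (e * b i) * x ^ (n - i))"
      unfolding sum_distrib_left sum_distrib_right
      using x that(4) by (intro sum.cong) (auto simp: power_diff field_simps)
    finally have xn: "x ^ n = (\<Sum>i\<in>{1..k}. (e * b i) * x ^ (n - i))" .
    define c where "c = (\<lambda>j. a j + a n * (if n - k \<le> j \<and> j < n then e * b (n - j) else 0))"
    have "1 = (\<Sum>i\<le>n'. a i * x ^ i) + a n * x ^ n" using a(2) n' by simp
    also have "x ^ n = (\<Sum>j\<in>{n-k..n'}. (e * b (n - j)) * x ^ j)"
      unfolding xn using that(4) n'
      by (intro sum.reindex_bij_witness[of _ "\<lambda>j. n - j" "\<lambda>i. n - i"]) auto
    also have "\<dots> = (\<Sum>j\<le>n'. (if n - k \<le> j \<and> j < n then e * b (n - j) else 0) * x ^ j)"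
      using n' by (intro sum.mono_neutral_cong_left) auto
    also have "(\<Sum>i\<le>n'. a i * x ^ i) + a n * \<dots> = (\<Sum>i\<le>n'. c i * x ^ i)"
      by (simp add: sum_distrib_left sum.distrib[symmetric] c_def algebra_simps)
    finally have "1 = (\<Sum>i\<le>n'. c i * x ^ i)" .
    moreover have "c i \<in> m" for i
    proof -
      have "(if n - k \<le> i \<and> i < n then e * b (n - i) else 0) \<in> A"
        using e b(1) m_subset ring_simps(1,4) by auto
      then show ?thesis unfolding c_def using a(1) by (intro m_add m_mult) auto
    qed
    ultimately have "R x n'" unfolding R_def by blast
    then show False using that(5)[of n'] n' by simp
  qed
  have x0: "x \<noteq> 0" using * ring_simps(1) by auto
  have "\<exists>n. R x n" "\<exists>n. R (inverse x) n" using adj_notin * unfolding R_def by blast+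
  then obtain n k where nk: "R x n" "\<And>j. R x j \<Longrightarrow> n \<le> j" "R (inverse x) k" "\<And>j. R (inverse x) j \<Longrightarrow> k \<le> j"
    by (metis LeastI Least_le)
  show False
  proof (cases "k \<le> n")
    case True then show ?thesis using red[of x n k] nk x0 by blast
  next
    case False then show ?thesis using red[of "inverse x" k n] nk x0 by auto
  qed
qed

definition U :: "complex \<Rightarrow> bool" where "U x \<longleftrightarrow> x \<noteq> 0 \<and> x \<in> A \<and> inverse x \<in> A"

lemma U_1 [simp]: "U 1" using ring_simps by (simp add: U_def)
lemma U_mult: "U x \<Longrightarrow> U y \<Longrightarrow> U (x * y)" using ring_simps by (auto simp: U_def)
lemma U_inverse: "U x \<Longrightarrow> U (inverse x)" by (auto simp: U_def)
lemma U_power: "U x \<Longrightarrow> U (x ^ n)" by (induction n) (auto simp: U_mult)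
lemma U_uminus: "U x \<Longrightarrow> U (- x)" using ring_simps(5) by (auto simp: U_def)

text \<open>A Bezout relation \<open>a * q + b * p = 1\<close> makes \<open>a * q\<close> equal to
  \<open>1\<close> minus an element of \<open>m\<close>, hence invertible in
  \<open>A\<close>.\<close>

lemma U_coprime_nat:
  assumes "\<not> p dvd q" shows "U (of_nat q)"
proof -
  have "coprime (int q) (int p)"
    using prime_p assms by (metis coprime_commute coprime_int_iff prime_imp_coprime)
  then obtain a b where ab: "a * int q + b * int p = 1" by (metis bezout_int coprime_imp_gcd_eq_1)
  then have "of_int a * of_nat q = 1 - of_nat p * (of_int (b) :: complex)"
    by (metis (no_types, lifting) add_diff_cancel_right' mult.commute of_int_1 of_int_add of_int_mult of_int_of_nat_eq)
  moreover have "inverse (1 - of_nat p * (of_int b :: complex)) \<in> A"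
    by (rule one_minus_unit) (auto simp: m_def ring_simps)
  ultimately have "inverse (of_int a * of_nat q) \<in> A" by simp
  then have "of_int a * inverse (of_int a * of_nat q) \<in> A" by (rule ring_simps(4)[OF ring_simps(8)])
  moreover have "a \<noteq> 0" using ab prime_p by (auto simp: zmult_eq_1_iff)
  moreover have "q \<noteq> 0" using assms by (metis dvd_0_right)
  ultimately show ?thesis using ring_simps(7) by (simp add: U_def field_simps)
qed

lemma p_power_U: "U (of_nat p powi k) \<longleftrightarrow> k = 0"
proof
  assume *: "U (of_nat p powi k)"
  have gen: False if "k > 0" "U (of_nat p powi k)" for k
  proof -
    obtain n where n: "k = int (Suc n)" using \<open>k > 0\<close> by (metis gr0_implies_Suc zero_less_imp_eq_int)
    have eq: "of_nat p ^ n * inverse (of_nat p powi k) = (1 / of_nat p :: complex)"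
      unfolding n power_int_of_nat by (simp add: field_simps)
    have "of_nat p ^ n * inverse (of_nat p powi k) \<in> A"
      by (intro ring_simps) (use that in \<open>auto simp: U_def\<close>)
    then show False using no_inv unfolding eq by simp
  qed
  show "k = 0"
  proof (cases "k < 0")
    case True
    have "U (of_nat p powi (- k))" using U_inverse[OF *] by (simp add: power_int_minus)
    then show ?thesis using gen[of "- k"] True by auto
  next
    case False
    then show ?thesis using gen[of k] * by (cases "k = 0") auto
  qed
qed auto

lemma U_rat:
  fixes q :: rat assumes "q \<noteq> 0" "quotient_of q = (a, b)"
  shows "U (of_rat q * of_nat p powi (int (multiplicity (int p) b) - int (multiplicity (int p) a)))"
proof -
  have int_case: "U (of_int c * of_nat p powi (- int (multiplicity (int p) c)))" if "c \<noteq> 0" for c :: int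
  proof -
    obtain c' where c': "c = int p ^ multiplicity (int p) c * c'" "\<not> int p dvd c'"
    proof (rule multiplicity_decompose'[of c "int p"])
      show "c \<noteq> 0" "\<not> is_unit (int p)" using \<open>c \<noteq> 0\<close> p_gt_1 by auto
    qed
    have "\<not> p dvd nat \<bar>c'\<bar>" using c'(2) by (simp add: int_dvd_int_iff[symmetric])
    then have "U (of_nat (nat \<bar>c'\<bar>))" by (rule U_coprime_nat)
    then have "U (of_int c')" using U_uminus[of "of_nat (nat \<bar>c'\<bar>)"] by (cases "c' \<ge> 0") auto
    moreover have "of_int c * of_nat p powi (- int (multiplicity (int p) c)) = (of_int c' :: complex)"
      by (subst c'(1)) (simp add: power_int_minus)
    ultimately show ?thesis by simp
  qed
  have a0: "a \<noteq> 0" and b0: "b > 0" and q: "q = of_int a / of_int b"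
    using quotient_of_div[OF assms(2)] quotient_of_denom_pos[OF assms(2)] assms(1) by auto
  have eq: "(of_rat q :: complex) * of_nat p powi (int (multiplicity (int p) b) - int (multiplicity (int p) a)) =
     (of_int a * of_nat p powi (- int (multiplicity (int p) a))) *
     inverse (of_int b * of_nat p powi (- int (multiplicity (int p) b)))"
    by (simp add: q of_rat_divide power_int_diff power_int_minus field_simps)
  show ?thesis unfolding eq using b0 by (intro U_mult U_inverse int_case a0) auto
qed

lemma finite_dominating:
  assumes "finite I" "I \<noteq> {}" "\<And>i. i \<in> I \<Longrightarrow> t i \<noteq> 0"
  shows "\<exists>i\<in>I. \<forall>j\<in>I. t j / t i \<in> A"
  using assms
proof (induction I rule: finite_ne_induct)
  case (singleton i)
  then show ?case using ring_simps(2) by simp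
next
  case (insert i I)
  then obtain k where k: "k \<in> I" "\<forall>j\<in>I. t j / t k \<in> A" by auto
  show ?case
  proof (cases "t i / t k \<in> A")
    case True
    then show ?thesis using k by auto
  next
    case False
    then have ki: "t k / t i \<in> A" using valuation[of "t i / t k"] by simp
    have "t j / t i \<in> A" if "j \<in> I" for j
    proof -
      have "(t j / t k) * (t k / t i) \<in> A" using ki k that ring_simps(4) by blast
      then show ?thesis using insert.prems k(1) by simp
    qed
    moreover have "t i / t i \<in> A" using insert.prems ring_simps(2) by simp
    ultimately show ?thesis by blast
  qed
qed

text \<open>The ring is local. By \<open>valuation\<close> one summand divides the other, say
  \<open>x / y\<close> is in \<open>A\<close>; if \<open>x + y\<close> were a unit,
  \<open>(1 + x / y) / (x + y)\<close> would be an inverse of \<open>y\<close> in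
  \<open>A\<close>.\<close>

lemma nonunits_add:
  assumes "x \<in> A" "\<not> U x" "y \<in> A" "\<not> U y" shows "\<not> U (x + y)"
proof
  assume *: "U (x + y)"
  have main: False if "x \<in> A" "\<not> U x" "y \<in> A" "y \<noteq> 0" "x / y \<in> A" "U (x + y)" "\<not> U y" for x y
  proof -
    have "inverse (x + y) * (1 + x / y) \<in> A" using that ring_simps(2,4,6) by (auto simp: U_def)
    moreover have "inverse (x + y) * (1 + x / y) = inverse y"
      using that by (simp add: field_simps U_def)
    ultimately show False using that by (auto simp: U_def)
  qed
  have "x \<noteq> 0" "y \<noteq> 0" using * assms by auto
  then show False
    using main[of x y] main[of y x] valuation[of "x / y"] assms * by (auto simp: add.commute)
qed

text \<open>The value group of the algebraic numbers is generated up to torsion by the value of \<open>p\<close>: two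
  terms of an algebraic equation must have equal value.\<close>

lemma rational_value:
  assumes "x \<in> Qbar" "x \<noteq> 0"
  shows "\<exists>n k. n > (0::nat) \<and> U (x ^ n * of_nat p powi (- k))"
proof -
  from assms obtain f where f: "\<forall>i. coeff f i \<in> \<rat>" "f \<noteq> 0" "poly f x = 0"
    by (auto simp: Qbar_def algebraic_altdef)
  define I where "I = {i. coeff f i \<noteq> 0}"
  have "I \<subseteq> {..degree f}" by (auto simp: I_def le_degree)
  then have finI: "finite I" by (rule finite_subset) simp
  define t where "t = (\<lambda>i. coeff f i * x ^ i)"
  have t0: "t i \<noteq> 0" if "i \<in> I" for i using that assms by (auto simp: t_def I_def)
  have sum0: "(\<Sum>i\<in>I. t i) = 0"
  proof -
    have "(\<Sum>i\<in>I. t i) = (\<Sum>i\<le>degree f. t i)"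
      using \<open>I \<subseteq> _\<close> by (intro sum.mono_neutral_left) (auto simp: I_def t_def)
    then show ?thesis using f(3) by (simp add: poly_altdef t_def)
  qed
  have "I \<noteq> {}" using f(2) by (auto simp: I_def poly_eq_iff)
  then have "\<exists>i\<in>I. \<forall>j\<in>I. t j / t i \<in> A" by (intro finite_dominating finI t0)
  then obtain i where i: "i \<in> I" and "\<forall>j\<in>I. t j / t i \<in> A" by (elim bexE)
  then have ij: "t j / t i \<in> A" if "j \<in> I" for j using that by blast
  \<comment> \<open>If all other terms had larger value than the dominating one, the quotients would
    be nonunits with sum \<open>-1\<close>, which is a unit.\<close>
  have "\<exists>j\<in>I - {i}. U (t j / t i)"
  proof (rule ccontr)
    assume *: "\<not> (\<exists>j\<in>I - {i}. U (t j / t i))"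
    have "\<not> U (\<Sum>j\<in>J. t j / t i) \<and> (\<Sum>j\<in>J. t j / t i) \<in> A" if "finite J" "J \<subseteq> I - {i}" for J
      using that
    proof (induction J)
      case empty
      then show ?case using ring_simps(1) by (simp add: U_def)
    next
      case (insert j J)
      then show ?case using nonunits_add[of "t j / t i" "\<Sum>j\<in>J. t j / t i"] * ij ring_simps(6) by simp
    qed
    from this[of "I - {i}"] have "\<not> U (\<Sum>j\<in>I - {i}. t j / t i)" using finI by auto
    moreover have "(\<Sum>j\<in>I - {i}. t j / t i) = -1"
    proof -
      have "(\<Sum>j\<in>I. t j) = t i + (\<Sum>j\<in>I - {i}. t j)" using finI i by (rule sum.remove)
      then have "(\<Sum>j\<in>I - {i}. t j) = - t i" using sum0 by (simp add: add_eq_0_iff2)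
      then show ?thesis using t0[OF i] by (simp add: sum_divide_distrib[symmetric])
    qed
    ultimately show False using U_uminus[OF U_1] by simp
  qed
  then obtain j where j: "j \<in> I" "j \<noteq> i" "U (t j / t i)" by auto
  have main: "\<exists>n k. n > (0::nat) \<and> U (x ^ n * of_nat p powi (- k))"
    if ij: "i < j" "i \<in> I" "j \<in> I" "U (t j / t i)" for i j
  proof -
    obtain q where q: "coeff f j / coeff f i = of_rat q" using f(1) by (meson Rats_cases Rats_divide)
    have q0: "q \<noteq> 0" using q ij by (auto simp: I_def)
    obtain a b where ab: "quotient_of q = (a, b)" by fastforce
    define e where "e = int (multiplicity (int p) b) - int (multiplicity (int p) a)"
    have u: "U (of_rat q * of_nat p powi e)" using U_rat[OF q0 ab] by (simp add: e_def)
    have "t j / t i = of_rat q * x ^ (j - i)"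
      using ij assms(2) unfolding t_def q[symmetric] by (simp add: power_diff)
    then have "U (of_rat q * x ^ (j - i))" using ij(4) by simp
    then have "U ((of_rat q * x ^ (j - i)) * inverse (of_rat q * of_nat p powi e))"
      by (rule U_mult[OF _ U_inverse[OF u]])
    also have "(of_rat q * x ^ (j - i)) * inverse (of_rat q * of_nat p powi e) = x ^ (j - i) * of_nat p powi (- e)"
      using q0 by (simp add: power_int_minus)
    finally show ?thesis using ij by (intro exI[of _ "j - i"] exI[of _ e]) auto
  qed
  have "U (t i / t j)" using U_inverse[OF j(3)] by simp
  then show ?thesis using main[of i j] main[of j i] j i by (cases "i < j") auto
qed

text \<open>The additive valuation with value \<open>1\<close> at \<open>p\<close>, as a relation,
  because \<open>n\<close> and \<open>k\<close> are not determined by \<open>x\<close>. Uniqueness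
  of \<open>r\<close> rests on the fact that no nontrivial power of \<open>p\<close> is a
  unit.\<close>

definition val_is :: "complex \<Rightarrow> real \<Rightarrow> bool" where
  "val_is x r \<longleftrightarrow> (\<exists>n k. n > (0::nat) \<and> r = of_int k / of_nat n \<and> U (x ^ n * of_nat p powi (- k)))"

lemma power_term: "((x :: complex) ^ n * of_nat p powi (- k)) ^ n' = x ^ (n * n') * of_nat p powi (- (k * int n'))"
  by (simp only: power_mult_distrib power_mult[symmetric] minus_mult_left power_int_mult power_int_of_nat)

lemma val_is_unique:
  assumes "val_is x r" "val_is x s" shows "r = s"
proof -
  from assms obtain n k n' k' where
    *: "n > 0" "r = of_int k / of_nat n" "U (x ^ n * of_nat p powi (- k))"
    "n' > 0" "s = of_int k' / of_nat n'" "U (x ^ n' * of_nat p powi (- k'))"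
    unfolding val_is_def by blast
  have x0: "x \<noteq> 0" using *(1,3) by (auto simp: U_def)
  have "U ((x ^ n * of_nat p powi (- k)) ^ n' * inverse ((x ^ n' * of_nat p powi (- k')) ^ n))"
    by (rule U_mult[OF U_power[OF *(3)] U_inverse[OF U_power[OF *(6)]]])
  also have "(x ^ n * of_nat p powi (- k)) ^ n' * inverse ((x ^ n' * of_nat p powi (- k')) ^ n) =
     of_nat p powi (k' * int n - k * int n')"
    unfolding power_term using x0 by (simp add: power_int_minus power_int_diff field_simps)
  finally have "k' * int n = k * int n'" by (simp add: p_power_U)
  then have "real_of_int k' * real n = real_of_int k * real n'"
    by (metis of_int_mult of_int_of_nat_eq)
  then show ?thesis using *(1,4) unfolding *(2,5) by (simp add: frac_eq_eq)
qed

lemma val_is_exists: "x \<in> Qbar \<Longrightarrow> x \<noteq> 0 \<Longrightarrow> \<exists>r. val_is x r"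
  using rational_value unfolding val_is_def by blast

lemma val_is_mult:
  assumes "val_is x r" "val_is y s" shows "val_is (x * y) (r + s)"
proof -
  from assms obtain n k n' k' where
    *: "n > 0" "r = of_int k / of_nat n" "U (x ^ n * of_nat p powi (- k))"
    "n' > 0" "s = of_int k' / of_nat n'" "U (y ^ n' * of_nat p powi (- k'))"
    unfolding val_is_def by blast
  have "U ((x ^ n * of_nat p powi (- k)) ^ n' * (y ^ n' * of_nat p powi (- k')) ^ n)"
    by (rule U_mult[OF U_power[OF *(3)] U_power[OF *(6)]])
  also have "(x ^ n * of_nat p powi (- k)) ^ n' * (y ^ n' * of_nat p powi (- k')) ^ n =
     (x * y) ^ (n * n') * of_nat p powi (- (k * int n' + k' * int n))"
    unfolding power_term
    by (simp add: power_int_minus power_int_diff power_int_add power_mult_distrib mult_ac divide_inverse)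
  finally show ?thesis unfolding val_is_def using *
    by (intro exI[of _ "n * n'"] exI[of _ "k * int n' + k' * int n"]) (simp add: field_simps)
qed

lemma val_is_rat:
  assumes "q \<noteq> 0" "quotient_of q = (a, b)"
  shows "val_is (of_rat q) (real_of_int (int (multiplicity (int p) a) - int (multiplicity (int p) b)))"
  unfolding val_is_def using U_rat[OF assms]
  by (intro exI[of _ 1] exI[of _ "int (multiplicity (int p) a) - int (multiplicity (int p) b)"]) auto

lemma root_in: assumes "x ^ n \<in> A" "n > 0" shows "x \<in> A"
proof (rule ccontr)
  assume *: "x \<notin> A"
  then have "inverse x \<in> A" using valuation by blast
    then have "x ^ n * inverse x ^ (n - 1) \<in> A" by (rule ring_simps(4)[OF assms(1) ring_simps(9)])
  moreover have "x \<noteq> 0" using * ring_simps(1) by auto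
  then have "x ^ n * inverse x ^ (n - 1) = x" using assms(2)
    by (cases n) (auto simp: field_simps)
  ultimately show False using * by simp
qed

lemma val_nonneg_iff:
  assumes "val_is x r" shows "x \<in> A \<longleftrightarrow> r \<ge> 0"
proof -
  from assms obtain n k where *: "n > 0" "r = of_int k / of_nat n" "U (x ^ n * of_nat p powi (- k))"
    unfolding val_is_def by blast
  have r: "r \<ge> 0 \<longleftrightarrow> k \<ge> 0" using * by (simp add: zero_le_divide_iff)
  have pos: "x \<in> A" if "k \<ge> 0" "n > 0" "U (x ^ n * of_nat p powi (- k))" for x n k
  proof -
    obtain j where j: "k = int j" using \<open>k \<ge> 0\<close> by (metis nonneg_int_cases)
    have "x ^ n = (x ^ n * of_nat p powi (- k)) * of_nat p ^ j" by (simp add: j power_int_minus)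
    also have "\<dots> \<in> A" using that(3)
      by (intro ring_simps(4)[OF _ ring_simps(9)[OF ring_simps(7)]]) (simp add: U_def)
    finally show ?thesis using root_in that(2) by blast
  qed
  show ?thesis
  proof
    assume x: "x \<in> A"
    show "r \<ge> 0"
    proof (rule ccontr)
      assume "\<not> r \<ge> 0"
      then have k: "k < 0" using r by simp
      have "U (inverse x ^ n * of_nat p powi (- (- k)))"
        using U_inverse[OF *(3)] by (simp add: power_int_minus power_inverse)
      then have "inverse x \<in> A" using pos[of "- k" n "inverse x"] k *(1) by simp
      moreover have "x \<noteq> 0" using * by (auto simp: U_def)
      ultimately have "U x" using x by (simp add: U_def)
      then have "U (inverse (x ^ n) * (x ^ n * of_nat p powi (- k)))" using * U_mult U_inverse U_power by blast
      then have "U (of_nat p powi (- k))" using \<open>x \<noteq> 0\<close> by (simp add: mult.assoc[symmetric])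
      then show False using p_power_U[of "- k"] k by auto
    qed
  qed (use pos[of k n x] * r in auto)
qed

definition padic_ext :: "complex \<Rightarrow> real" where
  "padic_ext x = (if x = 0 then 0 else real p powr (- (SOME r. val_is x r)))"

lemma padic_ext_eq: assumes "val_is x r" shows "padic_ext x = real p powr (- r)"
proof -
  have "x \<noteq> 0" using assms by (auto simp: val_is_def U_def)
  moreover have "(SOME r. val_is x r) = r" using assms val_is_unique by blast
  ultimately show ?thesis by (simp add: padic_ext_def)
qed

lemma padic_ext_le_1_iff: assumes "x \<in> Qbar" shows "padic_ext x \<le> 1 \<longleftrightarrow> x \<in> A"
proof (cases "x = 0")
  case False
  then obtain r where r: "val_is x r" using val_is_exists assms by blast
  show ?thesis unfolding padic_ext_eq[OF r] val_nonneg_iff[OF r] using p_gt_1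
    using powr_le_cancel_iff[of "real p" "- r" 0] by simp
qed (use ring_simps(1) in \<open>simp add: padic_ext_def\<close>)

lemma padic_ext_mult:
  assumes "x \<in> Qbar" "y \<in> Qbar" shows "padic_ext (x * y) = padic_ext x * padic_ext y"
proof (cases "x = 0 \<or> y = 0")
  case False
  then obtain r s where rs: "val_is x r" "val_is y s" using val_is_exists assms by blast
  show ?thesis
    unfolding padic_ext_eq[OF rs(1)] padic_ext_eq[OF rs(2)] padic_ext_eq[OF val_is_mult[OF rs]]
    by (simp add: powr_add[symmetric])
qed (auto simp: padic_ext_def)

lemma padic_ext_nonneg: "padic_ext x \<ge> 0" by (simp add: padic_ext_def)
lemma padic_ext_0: "padic_ext x = 0 \<longleftrightarrow> x = 0" using p_gt_1 by (simp add: padic_ext_def)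

text \<open>After division by the larger of the two it reduces to \<open>1 + x / y \<in> A\<close>,
  since membership in \<open>A\<close> means absolute value at most \<open>1\<close>.\<close>

lemma padic_ext_ultra:
  assumes "x \<in> Qbar" "y \<in> Qbar" shows "padic_ext (x + y) \<le> max (padic_ext x) (padic_ext y)"
proof -
  interpret Q: csubfield Qbar by (rule csubfield_Qbar)
  have main: "padic_ext (x + y) \<le> padic_ext y"
    if "x \<in> Qbar" "y \<in> Qbar" "padic_ext x \<le> padic_ext y" "y \<noteq> 0" for x y
  proof -
    have y: "padic_ext y > 0" using padic_ext_nonneg[of y] padic_ext_0[of y] that by linarith
    have "padic_ext (x / y) * padic_ext y = padic_ext x"
      using padic_ext_mult[of "x / y" y] that Q.divide_in by auto
    then have "padic_ext (x / y) = padic_ext x / padic_ext y" using y by (simp add: field_simps)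
    then have "padic_ext (x / y) \<le> 1" using that(3) y by simp
    then have "1 + x / y \<in> A" using padic_ext_le_1_iff[of "x / y"] that Q.divide_in ring_simps(2,6) by auto
    then have 1: "padic_ext (1 + x / y) \<le> 1" using padic_ext_le_1_iff[of "1 + x / y"] that Q.divide_in by blast
    have "padic_ext (x + y) = padic_ext ((1 + x / y) * y)" using that by (simp add: field_simps)
    also have "\<dots> = padic_ext (1 + x / y) * padic_ext y" using that by (intro padic_ext_mult) auto
    also have "\<dots> \<le> padic_ext y" using 1 y by simp
    finally show ?thesis .
  qed
  consider "x = 0" | "y = 0" | "x \<noteq> 0" "y \<noteq> 0" "padic_ext x \<le> padic_ext y" | "x \<noteq> 0" "y \<noteq> 0" "padic_ext y \<le> padic_ext x"
    by linarith
  then show ?thesis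
    using main[of x y] main[of y x] assms by cases (auto simp: add.commute le_max_iff_disj)
qed

lemma absval_padic_ext: "absval Qbar padic_ext"
proof (rule absvalI[OF csubfield_Qbar], unfold absolute_value_on_def, intro conjI ballI)
  fix x y assume "x \<in> Qbar" "y \<in> Qbar"
  then show "padic_ext (x + y) \<le> padic_ext x + padic_ext y"
    using padic_ext_ultra[of x y] padic_ext_nonneg[of x] padic_ext_nonneg[of y] by linarith
qed (auto simp: padic_ext_mult padic_ext_nonneg padic_ext_0)

lemma padic_ext_rat: "padic_ext (of_rat q) = padic_abs p q"
proof (cases "q = 0")
  case False
  obtain a b where ab: "quotient_of q = (a, b)" by fastforce
  show ?thesis
    unfolding padic_ext_eq[OF val_is_rat[OF False ab]] using False p_gt_1
    by (simp add: padic_abs_def ab powr_real_of_int'[symmetric])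
qed (simp add: padic_ext_def padic_abs_def)

end

lemma padic_extension_exists:
  assumes "Factorial_Ring.prime p"
  shows "\<exists>w. absval Qbar w \<and> (\<forall>q. w (of_rat q) = padic_abs p q) \<and>
     (\<forall>x\<in>Qbar. \<forall>y\<in>Qbar. w (x + y) \<le> max (w x) (w y))"
proof -
  have p0: "of_nat p \<noteq> (0::complex)" using assms by auto
  have "1 / of_nat p \<notin> (\<int> :: complex set)"
  proof
    assume "1 / of_nat p \<in> (\<int> :: complex set)"
    then obtain n where "1 / of_nat p = (of_int n :: complex)" by (auto elim: Ints_cases)
    then have "of_int (n * int p) = (of_int 1 :: complex)" using p0 by (simp add: field_simps)
    then have "n * int p = 1" by (simp only: of_int_eq_iff)
    then show False using prime_gt_1_nat[OF assms] by (auto simp: zmult_eq_1_iff)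
  qed
  from exists_maximal_subring[OF this] obtain A where
    "csubring A" "1 / of_nat p \<notin> A" "\<And>B. csubring B \<Longrightarrow> 1 / of_nat p \<notin> B \<Longrightarrow> A \<subseteq> B \<Longrightarrow> B = A"
    by blast
  then interpret padic_valring p A by unfold_locales (use assms in auto)
  show ?thesis using absval_padic_ext padic_ext_rat padic_ext_ultra by blast
qed

section \<open>Places of a number field\<close>

abbreviation real_abs :: "rat \<Rightarrow> real" where "real_abs \<equiv> (\<lambda>r. \<bar>real_of_rat r\<bar>)"

text \<open>Any extension to the algebraic numbers serves, as the places of a number field above
  \<open>u\<close> are obtained from it by varying the embedding. The ultrametric inequality is part
  of the choice, so that all p-adic places inherit it.\<close>

definition ext_abs :: "(rat \<Rightarrow> real) \<Rightarrow> complex \<Rightarrow> real" where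
  "ext_abs u = (SOME w. absval Qbar w \<and> (\<forall>q. w (of_rat q) = u q) \<and>
     (u \<noteq> real_abs \<longrightarrow> (\<forall>x\<in>Qbar. \<forall>y\<in>Qbar. w (x + y) \<le> max (w x) (w y))))"

lemma ext_abs:
  assumes "u \<in> standard_rat_abs"
  shows "absval Qbar (ext_abs u)" "ext_abs u (of_rat q) = u q"
    "u \<noteq> real_abs \<Longrightarrow> x \<in> Qbar \<Longrightarrow> y \<in> Qbar \<Longrightarrow> ext_abs u (x + y) \<le> max (ext_abs u x) (ext_abs u y)"
proof -
  have "\<exists>w. absval Qbar w \<and> (\<forall>q. w (of_rat q) = u q) \<and>
     (u \<noteq> real_abs \<longrightarrow> (\<forall>x\<in>Qbar. \<forall>y\<in>Qbar. w (x + y) \<le> max (w x) (w y)))"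
  proof (cases "u = real_abs")
    case True
    have "cmod (of_rat q) = u q" for q
      unfolding True by (cases q) (simp add: of_rat_rat norm_divide)
    then show ?thesis using True
      by (intro exI[of _ cmod])
         (auto simp: absolute_value_on_def norm_mult norm_triangle_ineq intro!: absvalI csubfield_Qbar)
  next
    case False
    then obtain p where "Factorial_Ring.prime p" "u = padic_abs p"
      using assms by (auto simp: standard_rat_abs_def)
    then show ?thesis using padic_extension_exists by blast
  qed
  from someI_ex[OF this, folded ext_abs_def] show "absval Qbar (ext_abs u)" "ext_abs u (of_rat q) = u q"
    "u \<noteq> real_abs \<Longrightarrow> x \<in> Qbar \<Longrightarrow> y \<in> Qbar \<Longrightarrow> ext_abs u (x + y) \<le> max (ext_abs u x) (ext_abs u y)"
    by auto
qed

text \<open>A further linear factor multiplies the bound by \<open>max 1 (v (z j))\<close> and,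
  through the triangle inequality, by \<open>2\<close>. Under the ultrametric inequality the factor
  \<open>2\<close> disappears.\<close>

lemma (in absval) linear_prod_coeff_bound:
  assumes "finite I" "\<And>i. i \<in> I \<Longrightarrow> z i \<in> K"
  shows "v (coeff (\<Prod>i\<in>I. [:- z i, 1:]) k) \<le> 2 ^ card I * (\<Prod>i\<in>I. max 1 (v (z i)))"
    and "coeff (\<Prod>i\<in>I. [:- z i, 1:]) k \<in> K"
proof -
  have P: "pover K (\<Prod>i\<in>I. [:- z i, 1:])" if "I \<subseteq> J" "\<And>i. i \<in> J \<Longrightarrow> z i \<in> K" for I J
    using that by (intro pover_prod) auto
  show "coeff (\<Prod>i\<in>I. [:- z i, 1:]) k \<in> K" using P[of I I] assms by (auto simp: pover_def)
  show "v (coeff (\<Prod>i\<in>I. [:- z i, 1:]) k) \<le> 2 ^ card I * (\<Prod>i\<in>I. max 1 (v (z i)))"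
    using assms
  proof (induction I arbitrary: k)
    case empty
    then show ?case by (cases k) (auto simp: coeff_pCons)
  next
    case (insert j I)
    let ?P = "\<Prod>i\<in>I. [:- z i, 1:]" and ?B = "2 ^ card I * (\<Prod>i\<in>I. max 1 (v (z i)))"
    have c: "coeff ?P k \<in> K" for k using P[of I I] insert by (auto simp: pover_def)
    have B0: "?B \<ge> 0" by (intro mult_nonneg_nonneg prod_nonneg) auto
    have 1: "v (coeff ?P k) \<le> ?B" for k using insert by auto
    have eq: "coeff (\<Prod>i\<in>insert j I. [:- z i, 1:]) k = (if k = 0 then 0 else coeff ?P (k - 1)) - z j * coeff ?P k"
      using insert by (cases k) (auto simp: coeff_pCons)
    have "v (coeff (\<Prod>i\<in>insert j I. [:- z i, 1:]) k) \<le>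
        v (if k = 0 then 0 else coeff ?P (k - 1)) + v (z j * coeff ?P k)"
      unfolding eq using insert c by (intro diff_triangle) auto
    also have "\<dots> \<le> ?B + max 1 (v (z j)) * ?B"
      using insert c 1 B0 by (intro add_mono) (auto simp: mult intro!: mult_mono)
    also have "\<dots> \<le> max 1 (v (z j)) * ?B + max 1 (v (z j)) * ?B"
      using B0 by (intro add_mono) (auto intro: mult_right_mono[of 1 "max 1 (v (z j))" ?B, simplified])
    also have "\<dots> = 2 ^ card (insert j I) * (\<Prod>i\<in>insert j I. max 1 (v (z i)))"
      using insert by simp
    finally show ?case .
  qed
qed

lemma (in absval) linear_prod_coeff_bound_ultra:
  assumes "finite I" "\<And>i. i \<in> I \<Longrightarrow> z i \<in> K"
    and ultra: "\<And>x y. x \<in> K \<Longrightarrow> y \<in> K \<Longrightarrow> v (x + y) \<le> max (v x) (v y)"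
  shows "v (coeff (\<Prod>i\<in>I. [:- z i, 1:]) k) \<le> (\<Prod>i\<in>I. max 1 (v (z i)))"
  using assms(1,2)
proof (induction I arbitrary: k)
  case empty
  then show ?case by (cases k) (auto simp: coeff_pCons)
next
  case (insert j I)
  let ?P = "\<Prod>i\<in>I. [:- z i, 1:]" and ?B = "\<Prod>i\<in>I. max 1 (v (z i))"
  have c: "coeff ?P k \<in> K" for k using linear_prod_coeff_bound(2)[of I z] insert by auto
  have B0: "?B \<ge> 0" by (intro prod_nonneg) auto
  have 1: "v (coeff ?P k) \<le> ?B" for k using insert by auto
  have eq: "coeff (\<Prod>i\<in>insert j I. [:- z i, 1:]) k = (if k = 0 then 0 else coeff ?P (k - 1)) + - (z j * coeff ?P k)"
    using insert by (cases k) (auto simp: coeff_pCons)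
  have 2: "v (if k = 0 then 0 else coeff ?P (k - 1)) \<le> max 1 (v (z j)) * ?B"
    using 1[of "k - 1"] B0 by (auto intro: order_trans mult_right_mono[of 1 "max 1 (v (z j))" ?B, simplified])
  have 3: "v (- (z j * coeff ?P k)) \<le> max 1 (v (z j)) * ?B"
    using insert c 1 B0 by (auto simp: mult mult_in intro!: mult_mono)
  have "v (coeff (\<Prod>i\<in>insert j I. [:- z i, 1:]) k) \<le> max 1 (v (z j)) * ?B"
    unfolding eq using insert c 2 3 by (intro order_trans[OF ultra]) (auto intro!: uminus_in mult_in)
  also have "\<dots> = (\<Prod>i\<in>insert j I. max 1 (v (z i)))" using insert by simp
  finally show ?case .
qed

text \<open>Every coefficient below the leading one is a sum of products that contain at least one
  root.\<close>

lemma (in absval) linear_prod_coeff_small: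
  assumes "finite I" "\<And>i. i \<in> I \<Longrightarrow> z i \<in> K" "\<And>i. i \<in> I \<Longrightarrow> v (z i) \<le> \<delta>" "\<delta> \<le> 1" "0 \<le> \<delta>" "k < card I"
  shows "v (coeff (\<Prod>i\<in>I. [:- z i, 1:]) k) \<le> 2 ^ card I * \<delta>"
  using assms(1-3,6)
proof (induction I arbitrary: k)
  case (insert j I)
  let ?P = "\<Prod>i\<in>I. [:- z i, 1:]"
  have c: "coeff ?P k \<in> K" for k using linear_prod_coeff_bound(2)[of I z] insert by auto
  have "(\<Prod>i\<in>I. max 1 (v (z i))) = 1"
    using insert.prems assms(4) by (intro prod.neutral) (auto simp: max_def dest!: spec intro: order.antisym order_trans)
  then have 1: "v (coeff ?P k) \<le> 2 ^ card I" for k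
    using linear_prod_coeff_bound(1)[of I z k] insert by auto
  have eq: "coeff (\<Prod>i\<in>insert j I. [:- z i, 1:]) k = (if k = 0 then 0 else coeff ?P (k - 1)) - z j * coeff ?P k"
    using insert by (cases k) (auto simp: coeff_pCons)
  have "v (coeff (\<Prod>i\<in>insert j I. [:- z i, 1:]) k) \<le>
      v (if k = 0 then 0 else coeff ?P (k - 1)) + v (z j * coeff ?P k)"
    unfolding eq using insert c by (intro diff_triangle) auto
  also have "\<dots> \<le> 2 ^ card I * \<delta> + \<delta> * 2 ^ card I"
  proof (intro add_mono)
    show "v (if k = 0 then 0 else coeff ?P (k - 1)) \<le> 2 ^ card I * \<delta>"
      using insert assms(5) by auto
    show "v (z j * coeff ?P k) \<le> \<delta> * 2 ^ card I"
      using insert c 1 assms(5) by (auto simp: mult intro!: mult_mono)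
  qed
  also have "\<dots> = 2 ^ card (insert j I) * \<delta>" using insert by simp
  finally show ?case .
qed simp

lemma placesD:
  assumes "csubfield K" "v \<in> places K"
  shows "absval K v" "(\<lambda>r. v (of_rat r)) \<in> standard_rat_abs" "v \<in> extensional K"
  using assms by (auto simp: places_def absval_def absval_axioms_def)

context numfield
begin

definition place_of :: "(rat \<Rightarrow> real) \<Rightarrow> complex \<Rightarrow> complex \<Rightarrow> real" where
  "place_of u b = restrict (\<lambda>y. ext_abs u (emb b y)) K"

lemma place_of_apply: "y \<in> K \<Longrightarrow> place_of u b y = ext_abs u (emb b y)"
  by (simp add: place_of_def)

lemma place_of_rat: "u \<in> standard_rat_abs \<Longrightarrow> b \<in> conjs \<Longrightarrow> place_of u b (of_rat q) = u q"
  by (simp add: place_of_apply emb_rat ext_abs)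

lemma absval_place_of:
  assumes "u \<in> standard_rat_abs" "b \<in> conjs" shows "absval K (place_of u b)"
proof -
  interpret a: absval K "\<lambda>y. ext_abs u (emb b y)"
    by (rule absval_emb[OF ext_abs(1)[OF assms(1)] assms(2)])
  show ?thesis
    using a.absval by (intro absvalI K.csubfield_axioms)
      (auto simp: absolute_value_on_def place_of_apply K.add_in K.mult_in)
qed

lemma place_of_in: "u \<in> standard_rat_abs \<Longrightarrow> b \<in> conjs \<Longrightarrow> place_of u b \<in> places K"
  using absval.absval[OF absval_place_of, of u b] place_of_rat[of u b]
  by (auto simp: places_def place_of_def)

lemma place_separate:
  assumes "v \<in> places K" "w \<in> places K" "\<And>r. v (of_rat r) = w (of_rat r)" "v \<noteq> w"
  shows "\<exists>a\<in>K. v a > 1 \<and> w a < 1"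
proof -
  note v = placesD[OF K.csubfield_axioms assms(1)] and w = placesD[OF K.csubfield_axioms assms(2)]
  obtain y where y: "y \<in> K" "v y \<noteq> w y"
    using assms(4) extensionalityI[OF v(3) w(3)] by blast
  show ?thesis
    by (rule absval_separate[OF v(1) w(1) v(2) _ _ y]) (simp_all add: assms(3))
qed

text \<open>An element close to \<open>1\<close> at \<open>v\<close> and close to \<open>0\<close> at every \<open>w \<circ> emb b\<close> would be a root of a
  monic polynomial whose lower coefficients are small rationals.\<close>

theorem place_is_place_of:
  assumes v: "v \<in> places K"
  shows "\<exists>b\<in>conjs. v = place_of (\<lambda>r. v (of_rat r)) b"
proof (rule ccontr)
  assume neg: "\<not> ?thesis"
  define u where "u = (\<lambda>r. v (of_rat r))"
  note vD = placesD[OF K.csubfield_axioms v, folded u_def]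
  interpret v: absval K v by (rule vD)
  interpret w: absval Qbar "ext_abs u" by (rule ext_abs(1)[OF vD(2)])
  define n where "n = card conjs"
  \<comment> \<open>Three estimates cost a factor \<open>2 ^ n\<close> each: the lower coefficients
    are at most \<open>2 ^ n * \<delta>\<close>, the powers of \<open>a\<close> at most
    \<open>2 ^ n\<close>, and \<open>v a ^ n\<close> is at least \<open>(1 / 2) ^ n\<close>. There
    are \<open>n\<close> summands, whence \<open>n * 8 ^ n\<close>.\<close>
  define \<delta> :: real where "\<delta> = 1 / (2 * (real n * 8 ^ n + 1))"
  have den: "real n * 8 ^ n \<ge> 0" by simp
  have \<delta>: "\<delta> > 0" "\<delta> \<le> 1 / 2" "real n * 8 ^ n * \<delta> < 1"
  proof -
    have *: "1 / (2 * (t + 1)) > 0 \<and> 1 / (2 * (t + 1)) \<le> 1 / 2 \<and> t * (1 / (2 * (t + 1))) < 1"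
      if "t \<ge> 0" for t :: real using that by (simp add: field_simps)
    show "\<delta> > 0" "\<delta> \<le> 1 / 2" "real n * 8 ^ n * \<delta> < 1" using *[OF den] unfolding \<delta>_def by auto
  qed
  have "\<exists>a\<in>K. v (a - 1) < \<delta> \<and> (\<forall>w\<in>place_of u ` conjs. w a < \<delta>)"
  proof (rule weak_approximation[OF vD(1) finite_imageI[OF finite_conjs] _ _ \<delta>(1)])
    fix w assume w: "w \<in> place_of u ` conjs"
    then show "absval K w" using absval_place_of vD(2) by auto
    show "\<exists>a\<in>K. 1 < v a \<and> w a < 1"
      using w neg by (intro place_separate v) (auto simp: place_of_in vD(2) place_of_rat, auto simp: u_def)
  qed
  then obtain a where a: "a \<in> K" "v (a - 1) < \<delta>" "\<And>b. b \<in> conjs \<Longrightarrow> ext_abs u (emb b a) < \<delta>"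
    by (auto simp: place_of_apply)
  define P where "P = (\<Prod>b\<in>conjs. [:- emb b a, 1:])"
  have P: "pover \<rat> P" unfolding P_def by (rule charpoly_over[OF a(1)])
  have degP: "degree P = n" unfolding P_def n_def by (subst degree_prod_eq_sum_degree) auto
  have lcP: "lead_coeff P = 1" unfolding P_def by (simp add: lead_coeff_prod)
  have small: "v (coeff P k) \<le> 2 ^ n * \<delta>" if "k < n" for k
  proof -
    obtain q where q: "coeff P k = of_rat q" using P by (auto simp: pover_def elim: Rats_cases)
    have "ext_abs u (coeff P k) \<le> 2 ^ n * \<delta>"
      unfolding P_def n_def
    proof (intro w.linear_prod_coeff_small finite_conjs)
      show "ext_abs u (emb b a) \<le> \<delta>" if "b \<in> conjs" for b using a(3)[OF that] by simp
    qed (use a(1) \<delta> that emb_Qbar in \<open>auto simp: n_def\<close>)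
    then show ?thesis using ext_abs(2)[OF vD(2)] by (simp add: q u_def)
  qed
  have "poly P a = 0" unfolding P_def by (rule charpoly_root[OF a(1)])
  then have "a ^ n + (\<Sum>k<n. coeff P k * a ^ k) = 0"
    using degP lcP by (simp add: poly_altdef lessThan_Suc_atMost[symmetric] add.commute)
  then have an: "a ^ n = - (\<Sum>k<n. coeff P k * a ^ k)" by (simp add: add_eq_0_iff2)
  have PK: "coeff P k \<in> K" for k using P K.Rats_subset by (auto simp: pover_def)
  have va: "v a \<le> 2" "v a \<ge> 1 / 2"
    using v.triangle[of "a - 1" 1] v.reverse_triangle[of 1 "a - 1"] a \<delta> K.diff_in by auto
  have "v a ^ n = v (\<Sum>k<n. coeff P k * a ^ k)"
    using an a(1) PK by (metis (no_types, lifting) v.power v.uminus K.sum_in K.mult_in K.power_in)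
  also have "\<dots> \<le> (\<Sum>k<n. v (coeff P k * a ^ k))"
    using a(1) PK by (intro v.sum_le) auto
  also have "\<dots> \<le> (\<Sum>k<n. (2 ^ n * \<delta>) * 2 ^ n)"
  proof (intro sum_mono)
    fix k assume k: "k \<in> {..<n}"
    have "v a ^ k \<le> 2 ^ k" using va a by (intro power_mono) auto
    also have "\<dots> \<le> (2::real) ^ n" using k by (intro power_increasing) auto
    finally show "v (coeff P k * a ^ k) \<le> (2 ^ n * \<delta>) * 2 ^ n"
      using small[of k] k a PK \<delta> by (simp add: v.mult v.power K.power_in mult_mono)
  qed
  also have "\<dots> = real n * 4 ^ n * \<delta>" by (simp add: power_mult_distrib[symmetric] mult_ac)
  finally have "v a ^ n \<le> real n * 4 ^ n * \<delta>" .
  moreover have "(1 / 2) ^ n \<le> v a ^ n" using va by (intro power_mono) auto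
  ultimately have "(1 / 2) ^ n * 2 ^ n \<le> real n * 4 ^ n * \<delta> * 2 ^ n" by (intro mult_right_mono) auto
  then have "1 \<le> real n * 8 ^ n * \<delta>"
    by (simp add: power_mult_distrib[symmetric] mult_ac power_one_over field_simps)
  then show False using \<delta>(3) by simp
qed

end

text \<open>The algebraic elements of the completion of the rationals at \<open>u\<close>.\<close>

definition rat_closure :: "(rat \<Rightarrow> real) \<Rightarrow> complex set" where
  "rat_closure u = {z \<in> Qbar. \<forall>\<delta>>0. \<exists>q. ext_abs u (z - of_rat q) < \<delta>}"

lemma csubfield_rat_closure:
  assumes u: "u \<in> standard_rat_abs"
  shows "csubfield (rat_closure u)"
proof -
  interpret w: absval Qbar "ext_abs u" by (rule ext_abs(1)[OF u])
  show ?thesis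
  proof
    show "0 \<in> rat_closure u" unfolding rat_closure_def by (auto intro!: exI[of _ 0])
    show "1 \<in> rat_closure u" unfolding rat_closure_def by (auto intro!: exI[of _ 1])
  next
    fix y z assume yz: "y \<in> rat_closure u" "z \<in> rat_closure u"
    then have Q: "y \<in> Qbar" "z \<in> Qbar" by (auto simp: rat_closure_def)
    show "y + z \<in> rat_closure u" unfolding rat_closure_def
    proof (intro CollectI conjI allI impI)
      fix \<delta> :: real assume "\<delta> > 0"
      then obtain q r where qr: "ext_abs u (y - of_rat q) < \<delta> / 2" "ext_abs u (z - of_rat r) < \<delta> / 2"
        using yz unfolding rat_closure_def by (auto dest!: spec[of _ "\<delta> / 2"])
      have eq: "y + z - of_rat (q + r) = (y - of_rat q) + (z - of_rat r)" by (simp add: of_rat_add)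
      have "ext_abs u (y + z - of_rat (q + r)) \<le> ext_abs u (y - of_rat q) + ext_abs u (z - of_rat r)"
        unfolding eq using Q by (intro w.triangle) auto
      then show "\<exists>q. ext_abs u (y + z - of_rat q) < \<delta>" using qr by (intro exI[of _ "q + r"]) linarith
    qed (use Q in auto)
    show "y * z \<in> rat_closure u" unfolding rat_closure_def
    proof (intro CollectI conjI allI impI)
      fix \<delta> :: real assume "\<delta> > 0"
      define B where "B = ext_abs u y + ext_abs u z + 2"
      have B: "B \<ge> 2" using Q by (simp add: B_def)
      define \<eta> where "\<eta> = min 1 (\<delta> / (2 * B))"
      have \<eta>: "\<eta> > 0" "\<eta> \<le> 1" "\<eta> \<le> \<delta> / (2 * B)" using \<open>\<delta> > 0\<close> B by (auto simp: \<eta>_def)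
      then obtain q r where qr: "ext_abs u (y - of_rat q) < \<eta>" "ext_abs u (z - of_rat r) < \<eta>"
        using yz unfolding rat_closure_def by blast
      have "ext_abs u (of_rat r) \<le> ext_abs u z + ext_abs u (z - of_rat r)"
        using w.diff_triangle[of z "z - of_rat r"] Q w.diff_in by auto
      moreover have "ext_abs u y \<ge> 0" using Q by simp
      ultimately have r: "ext_abs u (of_rat r) \<le> B" using qr \<eta>(2) unfolding B_def by linarith
      have eq: "y * z - of_rat (q * r) = y * (z - of_rat r) + of_rat r * (y - of_rat q)"
        by (simp add: of_rat_mult algebra_simps)
      have "ext_abs u (y * z - of_rat (q * r)) \<le> ext_abs u (y * (z - of_rat r)) + ext_abs u (of_rat r * (y - of_rat q))"
        unfolding eq using Q by (intro w.triangle) auto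
      also have "\<dots> = ext_abs u y * ext_abs u (z - of_rat r) + ext_abs u (of_rat r) * ext_abs u (y - of_rat q)"
        using Q w.diff_in by (simp add: w.mult)
      also have "\<dots> \<le> ext_abs u y * \<eta> + B * \<eta>"
        using qr r Q w.diff_in B by (intro add_mono mult_mono) auto
      also have "\<dots> < 2 * B * \<eta>"
      proof -
        have "ext_abs u z \<ge> 0" using Q by simp
        then have "ext_abs u y < B" unfolding B_def by linarith
        then show ?thesis using \<eta>(1) by (simp add: algebra_simps)
      qed
      also have "\<dots> \<le> \<delta>" using \<eta>(3) B by (simp add: field_simps)
      finally show "\<exists>q. ext_abs u (y * z - of_rat q) < \<delta>" by blast
    qed (use Q in auto)
  next
    fix y assume y: "y \<in> rat_closure u"
    then have Q: "y \<in> Qbar" by (auto simp: rat_closure_def)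
    show "- y \<in> rat_closure u" unfolding rat_closure_def
    proof (intro CollectI conjI allI impI)
      fix \<delta> :: real assume "\<delta> > 0"
      then obtain q where "ext_abs u (y - of_rat q) < \<delta>" using y unfolding rat_closure_def by blast
      then have "ext_abs u (- y - of_rat (- q)) < \<delta>"
        using w.diff_commute[of y "of_rat q"] Q by (simp add: of_rat_minus)
      then show "\<exists>q. ext_abs u (- y - of_rat q) < \<delta>" by blast
    qed (use Q in auto)
    show "inverse y \<in> rat_closure u"
    proof (cases "y = 0")
      case True
      then show ?thesis using y by simp
    next
      case False
      then have yp: "ext_abs u y > 0" using w.pos Q by blast
      show ?thesis unfolding rat_closure_def
      proof (intro CollectI conjI allI impI)
        fix \<delta> :: real assume \<delta>: "\<delta> > 0"
        \<comment> \<open>The first bound keeps the approximant \<open>q\<close> away from zero,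
          with absolute value above half that of \<open>y\<close>; the second one then controls the
          difference of the inverses.\<close>
        define \<eta> where "\<eta> = min (ext_abs u y / 2) (\<delta> * ext_abs u y ^ 2 / 2)"
        have \<eta>: "\<eta> > 0" "\<eta> \<le> ext_abs u y / 2" "\<eta> \<le> \<delta> * ext_abs u y ^ 2 / 2"
          using \<delta> yp by (auto simp: \<eta>_def)
        then obtain q where q: "ext_abs u (y - of_rat q) < \<eta>"
          using y unfolding rat_closure_def by blast
        have "ext_abs u y \<le> ext_abs u (of_rat q) + ext_abs u (y - of_rat q)"
          using w.triangle[of "of_rat q" "y - of_rat q"] Q w.diff_in by auto
        then have qy: "ext_abs u (of_rat q) > ext_abs u y / 2" using q \<eta> by linarith
        then have q0: "q \<noteq> 0" using yp by auto
        have "inverse y - of_rat (inverse q) = (of_rat q - y) / (y * of_rat q)"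
          using False q0 by (simp add: of_rat_inverse of_rat_divide field_simps)
        then have "ext_abs u (inverse y - of_rat (inverse q)) =
            ext_abs u (y - of_rat q) / (ext_abs u y * ext_abs u (of_rat q))"
          using Q w.diff_in w.mult_in w.diff_commute[of y "of_rat q"] by (simp add: w.divide w.mult)
        also have "\<dots> \<le> ext_abs u (y - of_rat q) / (ext_abs u y * (ext_abs u y / 2))"
          using qy yp Q w.diff_in by (intro divide_left_mono mult_left_mono mult_pos_pos) auto
        also have "\<dots> < \<eta> / (ext_abs u y * (ext_abs u y / 2))"
          using q yp by (intro divide_strict_right_mono) auto
        also have "\<dots> \<le> \<delta>" using \<eta>(3) yp by (simp add: field_simps power2_eq_square)
        finally show "\<exists>q. ext_abs u (inverse y - of_rat q) < \<delta>" by blast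
      qed (use Q in auto)
    qed
  qed
qed

text \<open>Lagrange interpolation read off at one coefficient: the coefficients are linear in the
  values at the nodes, with factors depending on the nodes only. Bounds on values thus become bounds
  on coefficients.\<close>

lemma lagrange_coeff:
  fixes I :: "complex set"
  assumes "finite I" "degree p < card I"
  shows "coeff p j = (\<Sum>b\<in>I. poly p b * coeff (\<Prod>c\<in>I - {b}. smult (inverse (b - c)) [:- c, 1:]) j)"
proof -
  define L where "L = (\<lambda>b. \<Prod>c\<in>I - {b}. smult (inverse (b - c)) [:- c, 1:])"
  define q where "q = p - (\<Sum>b\<in>I. smult (poly p b) (L b))"
  have degL: "degree (L b) < card I" if "b \<in> I" for b
  proof -
    have "degree (L b) \<le> sum (degree \<circ> (\<lambda>c. smult (inverse (b - c)) [:- c, 1:])) (I - {b})"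
      unfolding L_def by (intro degree_prod_sum_le) (use assms(1) in simp)
    also have "\<dots> \<le> (\<Sum>c\<in>I - {b}. 1)"
    proof (rule sum_mono)
      show "(degree \<circ> (\<lambda>c. smult (inverse (b - c)) [:- c, 1:])) c \<le> 1" for c
        unfolding o_def using degree_smult_le[of "inverse (b - c)" "[:- c, 1:]"] by simp
    qed
    also have "\<dots> = card I - 1" using assms(1) that by simp
    also have "\<dots> < card I" using assms(2) by simp
    finally show ?thesis .
  qed
  have Lb: "poly (L b) c = (if b = c then 1 else 0)" if "b \<in> I" "c \<in> I" for b c
  proof (cases "b = c")
    case True
    have "inverse (b - x) * (b - x) = 1" if "x \<in> I - {b}" for x using that by (intro left_inverse) auto
    then have "poly (smult (inverse (b - x)) [:- x, 1:]) b = 1" if "x \<in> I - {b}" for x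
      using that by (simp add: algebra_simps)
    then show ?thesis unfolding L_def poly_prod using True by (auto intro!: prod.neutral)
  next
    case False
    then show ?thesis unfolding L_def poly_prod using that assms(1) by (auto intro!: bexI[of _ c])
  qed
  have c0: "0 < card I" using assms(2) by simp
  have "degree (\<Sum>b\<in>I. smult (poly p b) (L b)) < card I"
    using degL c0 by (intro degree_sum_less) (auto intro: le_less_trans[OF degree_smult_le])
  then have "degree q < card I" unfolding q_def using assms(2) by (intro degree_diff_less)
  moreover have "poly q c = 0" if "c \<in> I" for c
  proof -
    have "poly (\<Sum>b\<in>I. smult (poly p b) (L b)) c = (\<Sum>b\<in>I. if b = c then poly p b else 0)"
      unfolding poly_sum using Lb that by (intro sum.cong) auto
    also have "\<dots> = poly p c" using assms(1) that by simp
    finally show ?thesis by (simp add: q_def)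
  qed
  then have "I \<subseteq> {z. poly q z = 0}" by auto
  ultimately have "q = 0"
    using card_mono[OF poly_roots_finite, of q I] card_poly_roots_bound[of q] by force
  then have "p = (\<Sum>b\<in>I. smult (poly p b) (L b))" by (simp add: q_def)
  then have "coeff p j = coeff (\<Sum>b\<in>I. smult (poly p b) (L b)) j" by simp
  then show ?thesis by (simp add: coeff_sum L_def)
qed

section \<open>The embeddings that induce a given place\<close>

locale numfield_place = numfield K x f for K x f +
  fixes v :: "complex \<Rightarrow> real"
  assumes v: "v \<in> places K"
begin

definition u :: "rat \<Rightarrow> real" where "u = (\<lambda>r. v (of_rat r))"

definition w :: "complex \<Rightarrow> real" where "w = ext_abs u"

definition local_conjs :: "complex set" where
  "local_conjs = {b \<in> conjs. v = place_of u b}"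

lemma u_std: "u \<in> standard_rat_abs"
  using placesD(2)[OF K.csubfield_axioms v] by (simp add: u_def)

sublocale v: absval K v by (rule placesD(1)[OF K.csubfield_axioms v])

lemma absval_w: "absval Qbar w" unfolding w_def by (rule ext_abs(1)[OF u_std])

sublocale w: absval Qbar w by (rule absval_w)

lemma w_rat: "w (of_rat q) = u q"
  unfolding w_def by (rule ext_abs(2)[OF u_std])

lemma v_rat: "v (of_rat q) = u q" by (simp add: u_def)

lemma local_conjs_sub: "local_conjs \<subseteq> conjs" and finite_local_conjs: "finite local_conjs"
  using finite_conjs by (auto simp: local_conjs_def)

lemma local_conjs_nonempty: "local_conjs \<noteq> {}"
  using place_is_place_of[OF v] by (auto simp: local_conjs_def u_def)

lemma v_local: "b \<in> local_conjs \<Longrightarrow> y \<in> K \<Longrightarrow> v y = w (emb b y)"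
  by (auto simp: local_conjs_def place_of_apply w_def dest!: fun_cong[of _ _ y])

text \<open>With \<open>a\<close> close to \<open>1\<close> at \<open>v\<close> and close to
  \<open>0\<close> at the other places above \<open>u\<close>, the rational trace of
  \<open>y * a\<close> is close to the part of the trace of \<open>y\<close> that belongs to the
  embeddings inducing \<open>v\<close>.\<close>

lemma local_trace_approx:
  assumes y: "y \<in> K" and "\<delta> > 0"
  shows "\<exists>q. w ((\<Sum>b\<in>local_conjs. emb b y) - of_rat q) < \<delta>"
proof -
  define W where "W = place_of u ` (conjs - local_conjs)"
  \<comment> \<open>The added \<open>1\<close> makes \<open>B\<close> positive and the final bound
    \<open>(B - 1) * (\<delta> / B)\<close> strictly less than \<open>\<delta>\<close>.\<close>
  define B where "B = (\<Sum>b\<in>conjs. w (emb b y)) + 1"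
  have wn: "w (emb b z) \<ge> 0" if "b \<in> conjs" "z \<in> K" for b z using that emb_Qbar by simp
  have B: "B > 0" unfolding B_def using y wn by (intro add_nonneg_pos sum_nonneg) auto
  have "\<exists>a\<in>K. v (a - 1) < \<delta> / B \<and> (\<forall>w\<in>W. w a < \<delta> / B)"
  proof (rule weak_approximation)
    show "absval K v" by (rule v.absval_axioms)
    show "finite W" using finite_conjs by (simp add: W_def)
    show "\<delta> / B > 0" using B \<open>\<delta> > 0\<close> by simp
    fix w' assume w': "w' \<in> W"
    then show "absval K w'" using absval_place_of u_std by (auto simp: W_def)
    show "\<exists>a\<in>K. 1 < v a \<and> w' a < 1"
      using w' by (intro place_separate v) (auto simp: W_def place_of_in u_std place_of_rat v_rat local_conjs_def)
  qed
  then obtain a where a: "a \<in> K" "v (a - 1) < \<delta> / B" "\<And>w. w \<in> W \<Longrightarrow> w a < \<delta> / B" by blast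
  have ay: "y * a \<in> K" using a y by auto
  obtain q where q: "(\<Sum>b\<in>conjs. emb b (y * a)) = of_rat q"
    using trace_rat[OF ay] by (auto elim: Rats_cases)
  have fin: "finite local_conjs" "finite (conjs - local_conjs)" using finite_conjs finite_local_conjs by auto
  define e where "e = (\<lambda>b. if b \<in> local_conjs then emb b (y - y * a) else - emb b (y * a))"
  have "(\<Sum>b\<in>local_conjs. emb b y) - of_rat q = (\<Sum>b\<in>local_conjs. emb b y) -
      ((\<Sum>b\<in>local_conjs. emb b (y * a)) + (\<Sum>b\<in>conjs - local_conjs. emb b (y * a)))"
    unfolding q[symmetric] by (subst sum.subset_diff[OF local_conjs_sub finite_conjs]) (simp add: add.commute)
  also have "\<dots> = (\<Sum>b\<in>local_conjs. e b) + (\<Sum>b\<in>conjs - local_conjs. e b)"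
    using y ay local_conjs_sub by (simp add: e_def emb_diff subset_iff sum_subtractf sum_negf)
  also have "\<dots> = (\<Sum>b\<in>conjs. e b)"
    by (subst sum.subset_diff[OF local_conjs_sub finite_conjs]) (simp add: add.commute)
  finally have eq: "(\<Sum>b\<in>local_conjs. emb b y) - of_rat q = (\<Sum>b\<in>conjs. e b)" .
  have eQ: "e b \<in> Qbar" if "b \<in> conjs" for b
    using that y ay emb_Qbar K.diff_in w.uminus_in by (auto simp: e_def)
  have le: "w (e b) \<le> w (emb b y) * (\<delta> / B)" if b: "b \<in> conjs" for b
  proof (cases "b \<in> local_conjs")
    case True
    have "w (e b) = v (y * (a - 1))"
      using True v_local[OF True, of "y - y * a"] y ay v.diff_commute[of "y * a" y]
      by (simp add: e_def K.diff_in algebra_simps)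
    also have "\<dots> = v y * v (a - 1)" using y a by (simp add: v.mult K.diff_in)
    also have "\<dots> \<le> w (emb b y) * (\<delta> / B)"
      using a y v_local[OF True y] wn[OF b y] by (intro mult_mono) (auto simp: K.diff_in)
    finally show ?thesis .
  next
    case False
    have "w (e b) = w (emb b y) * w (emb b a)"
      using False b y a emb_Qbar ay by (simp add: e_def emb_mult w.mult w.mult_in)
    also have "w (emb b a) \<le> \<delta> / B"
      using a(3)[of "place_of u b"] False b a(1) by (auto simp: W_def place_of_apply w_def)
    finally show ?thesis using wn[OF b y] by (simp add: mult_left_mono)
  qed
  have "w ((\<Sum>b\<in>local_conjs. emb b y) - of_rat q) \<le> (\<Sum>b\<in>conjs. w (e b))"
    unfolding eq using eQ by (intro w.sum_le)
  also have "\<dots> \<le> (\<Sum>b\<in>conjs. w (emb b y) * (\<delta> / B))" by (intro sum_mono le)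
  also have "\<dots> = (B - 1) * (\<delta> / B)" unfolding sum_distrib_right[symmetric] by (simp add: B_def)
  also have "\<dots> < \<delta>" using B \<open>\<delta> > 0\<close> by (simp add: field_simps)
  finally show ?thesis by blast
qed

text \<open>The factor of \<open>f\<close> over the completion of the rationals that belongs to
  \<open>v\<close>. Its power sums are local traces of powers of \<open>x\<close>, so Newton's
  identities give coefficients in \<open>rat_closure u\<close>.\<close>

definition local_poly :: "complex poly" where "local_poly = (\<Prod>b\<in>local_conjs. [:- b, 1:])"

lemma local_poly_over: "pover (rat_closure u) local_poly"
  unfolding local_poly_def
proof (rule csubfield.pover_prod_if_power_sums[OF csubfield_rat_closure[OF u_std] finite_local_conjs])
  fix k :: nat
  have eq: "(\<Sum>b\<in>local_conjs. b ^ k) = (\<Sum>b\<in>local_conjs. emb b (x ^ k))"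
    using local_conjs_sub by (intro sum.cong) (auto simp: emb_power emb_x)
  show "(\<Sum>b\<in>local_conjs. b ^ k) \<in> rat_closure u"
    unfolding eq rat_closure_def w_def[symmetric]
    using local_trace_approx[of "x ^ k"] emb_Qbar local_conjs_sub K.power_in
    by (auto intro!: w.sum_in)
qed

text \<open>Division by \<open>local_poly\<close> leaves a remainder with
  \<open>card local_conjs\<close> coefficients in the closure of the rationals. Replacing them by
  rational numbers costs arbitrarily little.\<close>

lemma local_approx:
  assumes y: "y \<in> K" and "\<delta> > 0"
  shows "\<exists>q. v (y - (\<Sum>j<card local_conjs. of_rat (q j) * x ^ j)) < \<delta>"
proof -
  interpret R: csubfield "rat_closure u" by (rule csubfield_rat_closure[OF u_std])
  obtain g where g: "pover \<rat> g" "y = poly g x" using y by (rule K_elimE)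
  have g': "pover (rat_closure u) g" using g R.Rats_subset by (auto simp: pover_def)
  have ne: "local_poly \<noteq> 0" unfolding local_poly_def using finite_local_conjs by auto
  have deg: "degree local_poly = card local_conjs"
    unfolding local_poly_def by (subst degree_prod_eq_sum_degree) auto
  have r0: "card local_conjs > 0" using local_conjs_nonempty finite_local_conjs by (simp add: card_gt_0_iff)
  from R.pover_division[OF g' local_poly_over ne] obtain s r where
    sr: "pover (rat_closure u) r" "g = s * local_poly + r" "r = 0 \<or> degree r < card local_conjs"
    unfolding deg by blast
  obtain b where b: "b \<in> local_conjs" using local_conjs_nonempty by blast
  have bc: "b \<in> conjs" using b local_conjs_sub by auto
  have bQ: "b \<in> Qbar" using conjs_algebraic[OF bc] .
  have rQ: "coeff r j \<in> Qbar" for j using pover_coeff[OF sr(1)] by (auto simp: rat_closure_def)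
  have "emb b y = poly r b"
  proof -
    have "poly local_poly b = 0" unfolding local_poly_def poly_prod using b finite_local_conjs
      by (auto intro!: bexI[of _ b])
    then show ?thesis using g sr(2) emb_poly[OF g(1) bc] by simp
  qed
  also have "\<dots> = (\<Sum>j<card local_conjs. coeff r j * b ^ j)"
    unfolding poly_altdef using sr(3) r0
    by (intro sum.mono_neutral_left) (auto simp: coeff_eq_0 Suc_le_eq)
  finally have yb: "emb b y = (\<Sum>j<card local_conjs. coeff r j * b ^ j)" .
  define B where "B = (\<Sum>j<card local_conjs. w b ^ j) + 1"
  have B: "B > 0" unfolding B_def using bQ by (intro add_nonneg_pos sum_nonneg) auto
  have "\<forall>j. \<exists>q. w (coeff r j - of_rat q) < \<delta> / B"
    using pover_coeff[OF sr(1)] B \<open>\<delta> > 0\<close> by (auto simp: rat_closure_def w_def)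
  then obtain q where q: "\<And>j. w (coeff r j - of_rat (q j)) < \<delta> / B" by metis
  have "v (y - (\<Sum>j<card local_conjs. of_rat (q j) * x ^ j)) =
      w (emb b (y - (\<Sum>j<card local_conjs. of_rat (q j) * x ^ j)))"
    using b y by (intro v_local K.diff_in K.sum_in K.mult_in K.power_in) auto
  also have "emb b (y - (\<Sum>j<card local_conjs. of_rat (q j) * x ^ j)) =
      (\<Sum>j<card local_conjs. (coeff r j - of_rat (q j)) * b ^ j)"
    using bc y by (subst emb_diff)
      (auto simp: emb_sum emb_mult emb_rat emb_power emb_x K.mult_in K.power_in yb sum_subtractf algebra_simps
         intro!: K.sum_in)
  also have "w \<dots> \<le> (\<Sum>j<card local_conjs. w ((coeff r j - of_rat (q j)) * b ^ j))"
    using rQ bQ by (intro w.sum_le) auto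
  also have "\<dots> \<le> (\<Sum>j<card local_conjs. \<delta> / B * w b ^ j)"
  proof (rule sum_mono)
    fix j
    have "w ((coeff r j - of_rat (q j)) * b ^ j) = w (coeff r j - of_rat (q j)) * w b ^ j"
      using rQ bQ by (simp add: w.mult w.power w.diff_in w.power_in)
    also have "\<dots> \<le> \<delta> / B * w b ^ j"
      using q[of j] bQ by (intro mult_right_mono) auto
    finally show "w ((coeff r j - of_rat (q j)) * b ^ j) \<le> \<delta> / B * w b ^ j" .
  qed
  also have "\<dots> = \<delta> / B * (B - 1)" by (simp add: B_def sum_distrib_left)
  also have "\<dots> < \<delta>" using B \<open>\<delta> > 0\<close> by (simp add: field_simps)
  finally show ?thesis by blast
qed

text \<open>The values of the polynomial at the conjugates in \<open>local_conjs\<close> all have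
  the absolute value that \<open>v\<close> gives to its value at \<open>x\<close>. Interpolation at
  these conjugates bounds the coefficients.\<close>

lemma local_coeff_bound:
  "\<exists>M>0. \<forall>q. \<forall>j<card local_conjs. u (q j) \<le> M * v (\<Sum>i<card local_conjs. of_rat (q i) * x ^ i)"
proof -
  define c where "c = (\<lambda>b j. coeff (\<Prod>c\<in>local_conjs - {b}. smult (inverse (b - c)) [:- c, 1:]) j)"
  have bQ: "b \<in> Qbar" if "b \<in> local_conjs" for b using conjs_algebraic local_conjs_sub that by auto
  have cQ: "c b j \<in> Qbar" if "b \<in> local_conjs" for b j
  proof -
    have "pover Qbar (\<Prod>c\<in>local_conjs - {b}. smult (inverse (b - c)) [:- c, 1:])"
      using that bQ by (intro w.pover_prod w.pover_smult) auto
    then show ?thesis by (simp add: c_def pover_def)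
  qed
  define M where "M = (\<Sum>j<card local_conjs. \<Sum>b\<in>local_conjs. w (c b j)) + 1"
  have Mj: "(\<Sum>b\<in>local_conjs. w (c b j)) \<le> M" if "j < card local_conjs" for j
  proof -
    have "(\<Sum>b\<in>local_conjs. w (c b j)) \<le> (\<Sum>j<card local_conjs. \<Sum>b\<in>local_conjs. w (c b j))"
      using that cQ by (intro member_le_sum[of j "{..<card local_conjs}"] sum_nonneg) auto
    then show ?thesis by (simp add: M_def)
  qed
  have M0: "M > 0" unfolding M_def using cQ by (intro add_nonneg_pos sum_nonneg) auto
  have "u (q j) \<le> M * v (\<Sum>i<card local_conjs. of_rat (q i) * x ^ i)" if j: "j < card local_conjs" for q j
  proof -
    define p :: "complex poly" where "p = (\<Sum>i<card local_conjs. monom (of_rat (q i)) i)"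
    have cp: "coeff p i = (if i < card local_conjs then of_rat (q i) else 0)" for i
      by (auto simp: p_def coeff_sum)
    have pr: "pover \<rat> p" by (auto simp: pover_def cp)
    have px: "poly p x = (\<Sum>i<card local_conjs. of_rat (q i) * x ^ i)"
      by (simp add: p_def poly_sum poly_monom)
    have pK: "poly p x \<in> K" using pr K.Rats_subset by (intro K.poly_in) (auto simp: pover_def)
    have "degree p < card local_conjs"
    proof (cases "p = 0")
      case False
      then have "coeff p (degree p) \<noteq> 0" by simp
      then show ?thesis unfolding cp by (auto split: if_splits)
    qed (use j in auto)
    from lagrange_coeff[OF finite_local_conjs this, of j]
    have "of_rat (q j) = (\<Sum>b\<in>local_conjs. poly p b * c b j)" using cp[of j] j by (simp add: c_def)
    also have "\<dots> = (\<Sum>b\<in>local_conjs. emb b (poly p x) * c b j)"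
      using emb_poly[OF pr] local_conjs_sub by (intro sum.cong) auto
    finally have eq: "of_rat (q j) = (\<Sum>b\<in>local_conjs. emb b (poly p x) * c b j)" .
    have eb: "emb b (poly p x) \<in> Qbar" if "b \<in> local_conjs" for b
      using that local_conjs_sub emb_Qbar pK by auto
    have "u (q j) = w (of_rat (q j))" by (simp add: w_rat)
    also have "\<dots> \<le> (\<Sum>b\<in>local_conjs. w (emb b (poly p x) * c b j))"
      unfolding eq using eb cQ by (intro w.sum_le) auto
    also have "\<dots> = (\<Sum>b\<in>local_conjs. v (poly p x) * w (c b j))"
      using eb cQ v_local pK by (intro sum.cong) (auto simp: w.mult)
    also have "\<dots> = v (poly p x) * (\<Sum>b\<in>local_conjs. w (c b j))" by (simp add: sum_distrib_left)
    also have "\<dots> \<le> v (poly p x) * M" using Mj[OF j] pK by (intro mult_left_mono) auto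
    finally show ?thesis by (simp add: px mult.commute)
  qed
  then show ?thesis using M0 by blast
qed

end

section \<open>Local degrees\<close>

context absval
begin

lemma cauchy_carrier:
  "s \<in> carrier (cauchy_ring K v) \<longleftrightarrow> (\<forall>n. s n \<in> K) \<and>
    (\<forall>\<epsilon>>0. \<exists>n0. \<forall>m\<ge>n0. \<forall>n\<ge>n0. v (s m - s n) < \<epsilon>)"
  by (simp add: cauchy_ring_def)

lemma cauchy_simps:
  "s \<otimes>\<^bsub>cauchy_ring K v\<^esub> t = (\<lambda>n. s n * t n)" "s \<oplus>\<^bsub>cauchy_ring K v\<^esub> t = (\<lambda>n. s n + t n)"
  "\<zero>\<^bsub>cauchy_ring K v\<^esub> = (\<lambda>n. 0)" "\<one>\<^bsub>cauchy_ring K v\<^esub> = (\<lambda>n. 1)"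
  by (simp_all add: cauchy_ring_def)

lemma cauchy_in: "s \<in> carrier (cauchy_ring K v) \<Longrightarrow> s n \<in> K"
  by (simp add: cauchy_carrier)

lemma cauchyD:
  assumes "s \<in> carrier (cauchy_ring K v)" "\<epsilon> > 0"
  obtains n0 where "\<And>m n. m \<ge> n0 \<Longrightarrow> n \<ge> n0 \<Longrightarrow> v (s m - s n) < \<epsilon>"
  using assms unfolding cauchy_carrier by blast

lemma cauchy_bounded:
  assumes s: "s \<in> carrier (cauchy_ring K v)"
  obtains B where "B > 0" "\<And>n. v (s n) \<le> B"
proof -
  obtain n0 where n0: "\<And>m n. m \<ge> n0 \<Longrightarrow> n \<ge> n0 \<Longrightarrow> v (s m - s n) < 1"
    using cauchyD[OF s, of 1] by auto
  define B where "B = (\<Sum>n\<le>n0. v (s n)) + 1"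
  have nn: "v (s n) \<ge> 0" for n using cauchy_in[OF s] by simp
  have "B > 0" unfolding B_def by (intro add_nonneg_pos sum_nonneg nn) auto
  moreover have "v (s n) \<le> B" for n
  proof -
    have le: "v (s m) \<le> (\<Sum>n\<le>n0. v (s n))" if "m \<le> n0" for m
      using that nn by (intro member_le_sum) auto
    show ?thesis
    proof (cases "n \<le> n0")
      case True then show ?thesis using le[of n] by (simp add: B_def)
    next
      case False
      have "v (s n) \<le> v (s n - s n0) + v (s n0)"
        using triangle[of "s n - s n0" "s n0"] cauchy_in[OF s] diff_in by simp
      then show ?thesis using n0[of n n0] False le[of n0] by (simp add: B_def)
    qed
  qed
  ultimately show ?thesis using that by blast
qed

lemma cauchy_const: "c \<in> K \<Longrightarrow> (\<lambda>n. c) \<in> carrier (cauchy_ring K v)"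
  by (auto simp: cauchy_carrier)

lemma cauchy_add:
  assumes s: "s \<in> carrier (cauchy_ring K v)" and t: "t \<in> carrier (cauchy_ring K v)"
  shows "(\<lambda>n. s n + t n) \<in> carrier (cauchy_ring K v)"
  unfolding cauchy_carrier
proof (intro conjI allI impI)
  show "s n + t n \<in> K" for n using cauchy_in s t by blast
  fix \<epsilon> :: real assume e: "\<epsilon> > 0"
  obtain n1 where n1: "\<And>m n. m \<ge> n1 \<Longrightarrow> n \<ge> n1 \<Longrightarrow> v (s m - s n) < \<epsilon> / 2" using cauchyD[OF s, of "\<epsilon>/2"] e by auto
  obtain n2 where n2: "\<And>m n. m \<ge> n2 \<Longrightarrow> n \<ge> n2 \<Longrightarrow> v (t m - t n) < \<epsilon> / 2" using cauchyD[OF t, of "\<epsilon>/2"] e by auto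
  show "\<exists>n0. \<forall>m\<ge>n0. \<forall>n\<ge>n0. v (s m + t m - (s n + t n)) < \<epsilon>"
  proof (intro exI[of _ "max n1 n2"] allI impI)
    fix m n assume mn: "m \<ge> max n1 n2" "n \<ge> max n1 n2"
    have "s m + t m - (s n + t n) = (s m - s n) + (t m - t n)" by simp
    also have "v \<dots> \<le> v (s m - s n) + v (t m - t n)"
      using cauchy_in s t by (intro triangle diff_in) blast+
    also have "\<dots> < \<epsilon>" using n1[of m n] n2[of m n] mn by simp
    finally show "v (s m + t m - (s n + t n)) < \<epsilon>" .
  qed
qed

lemma cauchy_uminus: "s \<in> carrier (cauchy_ring K v) \<Longrightarrow> (\<lambda>n. - s n) \<in> carrier (cauchy_ring K v)"
  unfolding cauchy_carrier using diff_commute by (auto simp: uminus_in)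

lemma cauchy_mult:
  assumes s: "s \<in> carrier (cauchy_ring K v)" and t: "t \<in> carrier (cauchy_ring K v)"
  shows "(\<lambda>n. s n * t n) \<in> carrier (cauchy_ring K v)"
  unfolding cauchy_carrier
proof (intro conjI allI impI)
  have sK: "s n \<in> K" and tK: "t n \<in> K" for n using cauchy_in s t by auto
  show "s n * t n \<in> K" for n using sK tK by auto
  fix \<epsilon> :: real assume e: "\<epsilon> > 0"
  obtain B where B: "B > 0" "\<And>n. v (s n) \<le> B" using cauchy_bounded[OF s] by metis
  obtain C where C: "C > 0" "\<And>n. v (t n) \<le> C" using cauchy_bounded[OF t] by metis
  have "\<epsilon> / (2 * C) > 0" "\<epsilon> / (2 * B) > 0" using e B C by auto
  obtain n1 where n1: "\<And>m n. m \<ge> n1 \<Longrightarrow> n \<ge> n1 \<Longrightarrow> v (s m - s n) < \<epsilon> / (2 * C)"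
    using cauchyD[OF s \<open>\<epsilon> / (2 * C) > 0\<close>] by blast
  obtain n2 where n2: "\<And>m n. m \<ge> n2 \<Longrightarrow> n \<ge> n2 \<Longrightarrow> v (t m - t n) < \<epsilon> / (2 * B)"
    using cauchyD[OF t \<open>\<epsilon> / (2 * B) > 0\<close>] by blast
  show "\<exists>n0. \<forall>m\<ge>n0. \<forall>n\<ge>n0. v (s m * t m - s n * t n) < \<epsilon>"
  proof (intro exI[of _ "max n1 n2"] allI impI)
    fix m n assume mn: "m \<ge> max n1 n2" "n \<ge> max n1 n2"
    have "s m * t m - s n * t n = s m * (t m - t n) + (s m - s n) * t n" by (simp add: algebra_simps)
    also have "v \<dots> \<le> v (s m * (t m - t n)) + v ((s m - s n) * t n)"
      using sK tK by (intro triangle mult_in diff_in)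
    also have "\<dots> = v (s m) * v (t m - t n) + v (s m - s n) * v (t n)"
      using sK tK by (simp add: mult diff_in)
    also have "\<dots> \<le> B * v (t m - t n) + v (s m - s n) * C"
      using sK tK B C by (intro add_mono mult_mono) (auto simp: diff_in)
    also have "\<dots> < B * (\<epsilon> / (2 * B)) + \<epsilon> / (2 * C) * C"
      using n1[of m n] n2[of m n] mn B C by (intro add_strict_mono mult_strict_left_mono mult_strict_right_mono) auto
    also have "\<dots> = \<epsilon>" using B C by simp
    finally show "v (s m * t m - s n * t n) < \<epsilon>" .
  qed
qed

lemma cring_cauchy: "cring (cauchy_ring K v)"
proof (rule cringI)
  show "abelian_group (cauchy_ring K v)"
  proof (rule abelian_groupI)
    fix s assume s: "s \<in> carrier (cauchy_ring K v)"
    show "\<exists>y\<in>carrier (cauchy_ring K v). y \<oplus>\<^bsub>cauchy_ring K v\<^esub> s = \<zero>\<^bsub>cauchy_ring K v\<^esub>"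
      by (rule bexI[OF _ cauchy_uminus[OF s]]) (simp add: cauchy_simps)
  qed (auto simp: cauchy_simps cauchy_add cauchy_const algebra_simps)
  show "comm_monoid (cauchy_ring K v)"
    by (rule comm_monoidI) (auto simp: cauchy_simps cauchy_mult cauchy_const algebra_simps)
qed (auto simp: cauchy_simps algebra_simps)

lemma null_iff: "s \<in> null_sequences K v \<longleftrightarrow> (\<forall>n. s n \<in> K) \<and> (\<lambda>n. v (s n)) \<longlonglongrightarrow> 0"
proof
  assume *: "(\<forall>n. s n \<in> K) \<and> (\<lambda>n. v (s n)) \<longlonglongrightarrow> 0"
  have "\<exists>n0. \<forall>m\<ge>n0. \<forall>n\<ge>n0. v (s m - s n) < \<epsilon>" if e: "\<epsilon> > 0" for \<epsilon>
  proof -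
    have "\<forall>\<^sub>F n in sequentially. v (s n) < \<epsilon> / 2"
      using order_tendstoD(2)[OF conjunct2[OF *], of "\<epsilon> / 2"] e by simp
    then obtain n0 where n0: "\<And>n. n \<ge> n0 \<Longrightarrow> v (s n) < \<epsilon> / 2" by (auto simp: eventually_sequentially)
    show ?thesis
    proof (intro exI[of _ n0] allI impI)
      fix m n assume "m \<ge> n0" "n \<ge> n0"
      then show "v (s m - s n) < \<epsilon>" using diff_triangle[of "s m" "s n"] n0[of m] n0[of n] * by auto
    qed
  qed
  then show "s \<in> null_sequences K v" using * by (simp add: null_sequences_def cauchy_carrier)
qed (auto simp: null_sequences_def cauchy_carrier)

lemma ideal_null: "ideal (null_sequences K v) (cauchy_ring K v)"
proof -
  interpret C: cring "cauchy_ring K v" by (rule cring_cauchy)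
  have sub: "null_sequences K v \<subseteq> carrier (cauchy_ring K v)" by (auto simp: null_sequences_def)
  have minus: "\<ominus>\<^bsub>cauchy_ring K v\<^esub> s = (\<lambda>n. - s n)" if "s \<in> carrier (cauchy_ring K v)" for s
    using that by (intro C.minus_equality) (auto simp: cauchy_simps cauchy_uminus)
  have mult_null: "(\<lambda>n. t n * s n) \<in> null_sequences K v"
    if s: "s \<in> null_sequences K v" and t: "t \<in> carrier (cauchy_ring K v)" for s t
  proof -
    obtain B where B: "B > 0" "\<And>n. v (t n) \<le> B" using cauchy_bounded[OF t] by metis
    have sK: "s n \<in> K" and tK: "t n \<in> K" for n using cauchy_in[OF t] s null_iff by auto
    have "(\<lambda>n. B * v (s n)) \<longlonglongrightarrow> B * 0" using s null_iff by (intro tendsto_mult) auto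
    then have lim: "(\<lambda>n. B * v (s n)) \<longlonglongrightarrow> 0" by simp
    have le: "\<forall>\<^sub>F n in sequentially. v (t n * s n) \<le> B * v (s n)"
      using sK tK B by (intro always_eventually allI) (auto simp: mult intro: mult_right_mono)
    have ge: "\<forall>\<^sub>F n in sequentially. 0 \<le> v (t n * s n)"
      using sK tK by (intro always_eventually allI nonneg mult_in)
    have "(\<lambda>n. v (t n * s n)) \<longlonglongrightarrow> 0"
      by (rule tendsto_sandwich[OF ge le tendsto_const lim])
    then show ?thesis using sK tK by (auto simp: null_iff)
  qed
  show ?thesis
  proof (rule idealI[OF C.ring_axioms])
    show "subgroup (null_sequences K v) (add_monoid (cauchy_ring K v))"
    proof (rule C.add.subgroupI)
      show "null_sequences K v \<noteq> {}" using null_iff[of "\<lambda>n. 0"] by auto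
      fix s assume s: "s \<in> null_sequences K v"
      then have "(\<lambda>n. - s n) \<in> null_sequences K v" by (auto simp: null_iff)
      then show "\<ominus>\<^bsub>cauchy_ring K v\<^esub> s \<in> null_sequences K v"
        using s sub minus by auto
      fix t assume t: "t \<in> null_sequences K v"
      have "(\<lambda>n. v (s n + t n)) \<longlonglongrightarrow> 0"
      proof (rule tendsto_sandwich[OF _ _ tendsto_const])
        show "\<forall>\<^sub>F n in sequentially. v (s n + t n) \<le> v (s n) + v (t n)"
          using s t by (intro always_eventually allI triangle) (auto simp: null_iff)
        show "\<forall>\<^sub>F n in sequentially. 0 \<le> v (s n + t n)"
          using s t by (intro always_eventually allI nonneg add_in) (auto simp: null_iff)
        show "(\<lambda>n. v (s n) + v (t n)) \<longlonglongrightarrow> 0"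
          using tendsto_add[of "\<lambda>n. v (s n)" 0 _ "\<lambda>n. v (t n)" 0] s t by (auto simp: null_iff)
      qed
      then show "s \<oplus>\<^bsub>cauchy_ring K v\<^esub> t \<in> null_sequences K v"
        using s t by (auto simp: null_iff cauchy_simps)
    qed (use sub in auto)
    fix s t assume "s \<in> null_sequences K v" "t \<in> carrier (cauchy_ring K v)"
    then show "t \<otimes>\<^bsub>cauchy_ring K v\<^esub> s \<in> null_sequences K v" "s \<otimes>\<^bsub>cauchy_ring K v\<^esub> t \<in> null_sequences K v"
      using mult_null by (auto simp: cauchy_simps mult.commute)
  qed
qed

definition proj :: "(nat \<Rightarrow> complex) \<Rightarrow> (nat \<Rightarrow> complex) set" where
  "proj s = null_sequences K v +>\<^bsub>cauchy_ring K v\<^esub> s"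

lemma proj_hom: "ring_hom_cring (cauchy_ring K v) (completion K v) proj"
  using ideal.rcos_ring_hom_cring[OF ideal_null cring_cauchy]
  unfolding completion_def proj_def[abs_def] .

lemma cring_completion: "cring (completion K v)"
  using ideal.quotient_is_cring[OF ideal_null cring_cauchy] by (simp add: completion_def)

lemma carrier_completion: "carrier (completion K v) = proj ` carrier (cauchy_ring K v)"
  by (auto simp: completion_def FactRing_def A_RCOSETS_def' proj_def)

lemma proj_eq_iff:
  assumes "s \<in> carrier (cauchy_ring K v)" "t \<in> carrier (cauchy_ring K v)"
  shows "proj s = proj t \<longleftrightarrow> (\<lambda>n. v (s n - t n)) \<longlonglongrightarrow> 0"
proof -
  interpret C: cring "cauchy_ring K v" by (rule cring_cauchy)
  have "\<ominus>\<^bsub>cauchy_ring K v\<^esub> t = (\<lambda>n. - t n)"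
    using assms by (intro C.minus_equality) (auto simp: cauchy_simps cauchy_uminus)
  then have "s \<ominus>\<^bsub>cauchy_ring K v\<^esub> t = (\<lambda>n. s n - t n)"
    by (simp add: a_minus_def cauchy_simps)
  then show ?thesis
    using C.quotient_eq_iff_same_a_r_cos[OF ideal_null assms] assms
    by (auto simp: proj_def null_iff cauchy_in diff_in)
qed

lemma rat_completion_eq:
  "rat_completion K v = proj ` {s \<in> carrier (cauchy_ring K v). \<forall>n. s n \<in> \<rat>}"
  by (simp add: rat_completion_def proj_def[abs_def])

lemma proj_simps:
  assumes "s \<in> carrier (cauchy_ring K v)" "t \<in> carrier (cauchy_ring K v)"
  shows "proj s \<otimes>\<^bsub>completion K v\<^esub> proj t = proj (\<lambda>n. s n * t n)"
    "proj s \<oplus>\<^bsub>completion K v\<^esub> proj t = proj (\<lambda>n. s n + t n)"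
    "\<ominus>\<^bsub>completion K v\<^esub> proj s = proj (\<lambda>n. - s n)"
    "\<zero>\<^bsub>completion K v\<^esub> = proj (\<lambda>n. 0)" "\<one>\<^bsub>completion K v\<^esub> = proj (\<lambda>n. 1)"
proof -
  interpret H: ring_hom_cring "cauchy_ring K v" "completion K v" proj by (rule proj_hom)
  show "proj s \<otimes>\<^bsub>completion K v\<^esub> proj t = proj (\<lambda>n. s n * t n)"
    "proj s \<oplus>\<^bsub>completion K v\<^esub> proj t = proj (\<lambda>n. s n + t n)"
    using H.hom_mult[OF assms] H.hom_add[OF assms] by (simp_all add: cauchy_simps)
  have "\<ominus>\<^bsub>cauchy_ring K v\<^esub> s = (\<lambda>n. - s n)"
    using assms by (intro H.R.minus_equality) (auto simp: cauchy_simps cauchy_uminus)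
  then show "\<ominus>\<^bsub>completion K v\<^esub> proj s = proj (\<lambda>n. - s n)"
    using H.hom_a_inv[OF assms(1)] by simp
  show "\<zero>\<^bsub>completion K v\<^esub> = proj (\<lambda>n. 0)" "\<one>\<^bsub>completion K v\<^esub> = proj (\<lambda>n. 1)"
    using H.hom_zero H.hom_one by (simp_all add: cauchy_simps)
qed

text \<open>A Cauchy sequence that is not null stays away from zero from some index on. Earlier
  terms may vanish; since \<open>inverse 0 = 0\<close>, they still remain in
  \<open>K\<close>.\<close>

lemma cauchy_inverse:
  assumes s: "s \<in> carrier (cauchy_ring K v)" and "\<not> (\<lambda>n. v (s n)) \<longlonglongrightarrow> 0"
  shows "(\<lambda>n. inverse (s n)) \<in> carrier (cauchy_ring K v)"
    "(\<lambda>n. v (s n * inverse (s n) - 1)) \<longlonglongrightarrow> 0"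
proof -
  have sK: "s n \<in> K" for n using cauchy_in[OF s] .
  from assms(2) obtain \<epsilon> where e: "\<epsilon> > 0" "\<And>n0. \<exists>n\<ge>n0. v (s n) \<ge> \<epsilon>"
    using sK unfolding LIMSEQ_iff by (auto simp: not_less)
  obtain n0 where n0: "\<And>m n. m \<ge> n0 \<Longrightarrow> n \<ge> n0 \<Longrightarrow> v (s m - s n) < \<epsilon> / 2"
    using cauchyD[OF s, of "\<epsilon> / 2"] e(1) by auto
  obtain n1 where n1: "n1 \<ge> n0" "v (s n1) \<ge> \<epsilon>" using e(2) by blast
  have low: "v (s n) \<ge> \<epsilon> / 2" if "n \<ge> n0" for n
    using triangle[of "s n1 - s n" "s n"] n0[OF n1(1) that] n1(2) sK diff_in by auto
  have nz: "s n \<noteq> 0" if "n \<ge> n0" for n using low[OF that] e(1) by auto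
  show "(\<lambda>n. inverse (s n)) \<in> carrier (cauchy_ring K v)"
    unfolding cauchy_carrier
  proof (intro conjI allI impI)
    show "inverse (s n) \<in> K" for n using sK by auto
    fix \<delta> :: real assume d: "\<delta> > 0"
    then have "\<delta> * (\<epsilon> / 2 * (\<epsilon> / 2)) > 0" using e by simp
    then obtain n2 where n2: "\<And>m n. m \<ge> n2 \<Longrightarrow> n \<ge> n2 \<Longrightarrow> v (s m - s n) < \<delta> * (\<epsilon> / 2 * (\<epsilon> / 2))"
      using cauchyD[OF s] by blast
    show "\<exists>n0. \<forall>m\<ge>n0. \<forall>n\<ge>n0. v (inverse (s m) - inverse (s n)) < \<delta>"
    proof (intro exI[of _ "max n0 n2"] allI impI)
      fix m n assume mn: "m \<ge> max n0 n2" "n \<ge> max n0 n2"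
      have z: "s m \<noteq> 0" "s n \<noteq> 0" using nz mn by auto
      have "inverse (s m) - inverse (s n) = (s n - s m) / (s m * s n)" using z by (simp add: field_simps)
      then have "v (inverse (s m) - inverse (s n)) = v (s n - s m) / (v (s m) * v (s n))"
        using sK by (simp add: divide mult diff_in mult_in)
      also have "\<dots> \<le> v (s n - s m) / (\<epsilon> / 2 * (\<epsilon> / 2))"
        using low[of m] low[of n] mn e sK
        by (intro divide_left_mono mult_mono mult_pos_pos) (auto simp: diff_in pos z)
      also have "\<dots> < \<delta>" using n2[of n m] mn e by (simp add: pos_divide_less_eq)
      finally show "v (inverse (s m) - inverse (s n)) < \<delta>" .
    qed
  qed
  have "\<forall>\<^sub>F n in sequentially. v (s n * inverse (s n) - 1) = 0"
    using nz unfolding eventually_sequentially by (intro exI[of _ n0]) auto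
  then show "(\<lambda>n. v (s n * inverse (s n) - 1)) \<longlonglongrightarrow> 0" by (rule tendsto_eventually)
qed

lemma subfield_rat_completion: "subfield (rat_completion K v) (completion K v)"
proof -
  interpret A: cring "completion K v" by (rule cring_completion)
  let ?Q = "{s \<in> carrier (cauchy_ring K v). \<forall>n. s n \<in> \<rat>}"
  have carr: "proj s \<in> carrier (completion K v)" if "s \<in> carrier (cauchy_ring K v)" for s
    using that carrier_completion by auto
  have sr: "subring (rat_completion K v) (completion K v)"
  proof (rule A.subringI)
    show "rat_completion K v \<subseteq> carrier (completion K v)"
      unfolding rat_completion_eq carrier_completion by auto
    have "(\<lambda>n. 1) \<in> ?Q" using cauchy_const by auto
    then show "\<one>\<^bsub>completion K v\<^esub> \<in> rat_completion K v"
      unfolding rat_completion_eq using proj_simps(5)[OF cauchy_const[OF one_in] cauchy_const[OF one_in]] by blast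
    fix h assume "h \<in> rat_completion K v"
    then obtain s where s: "h = proj s" "s \<in> ?Q" unfolding rat_completion_eq by auto
    have "(\<lambda>n. - s n) \<in> ?Q" using s cauchy_uminus by auto
    then show "\<ominus>\<^bsub>completion K v\<^esub> h \<in> rat_completion K v"
      unfolding rat_completion_eq s(1) using proj_simps(3)[of s s] s by auto
  next
    fix h g assume "h \<in> rat_completion K v" "g \<in> rat_completion K v"
    then obtain s t where s: "h = proj s" "s \<in> ?Q" "g = proj t" "t \<in> ?Q" unfolding rat_completion_eq by auto
    have "(\<lambda>n. s n * t n) \<in> ?Q" "(\<lambda>n. s n + t n) \<in> ?Q" using s cauchy_mult cauchy_add by auto
    then show "h \<otimes>\<^bsub>completion K v\<^esub> g \<in> rat_completion K v" "h \<oplus>\<^bsub>completion K v\<^esub> g \<in> rat_completion K v"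
      unfolding rat_completion_eq s(1,3) using proj_simps(1,2)[of s t] s by auto
  qed
  show ?thesis
  proof (rule A.subfieldI[OF A.subcringI'[OF sr]])
    let ?A = "completion K v\<lparr>carrier := rat_completion K v\<rparr>"
    have ne: "\<one>\<^bsub>completion K v\<^esub> \<noteq> \<zero>\<^bsub>completion K v\<^esub>"
    proof
      assume "\<one>\<^bsub>completion K v\<^esub> = \<zero>\<^bsub>completion K v\<^esub>"
      then have "proj (\<lambda>n. 1) = proj (\<lambda>n. 0)"
        using proj_simps(4,5)[OF cauchy_const[OF one_in] cauchy_const[OF one_in]] by simp
      then have "(\<lambda>n. v (1 - 0)) \<longlonglongrightarrow> 0"
        using proj_eq_iff[OF cauchy_const[OF one_in] cauchy_const[OF zero_in]] by simp
      then show False by (simp add: LIMSEQ_const_iff)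
    qed
    show "Units ?A = rat_completion K v - {\<zero>\<^bsub>completion K v\<^esub>}"
    proof (intro equalityI subsetI)
      fix h assume "h \<in> Units ?A"
      then obtain g where g: "h \<in> rat_completion K v" "g \<in> rat_completion K v"
        "g \<otimes>\<^bsub>completion K v\<^esub> h = \<one>\<^bsub>completion K v\<^esub>" by (auto simp: Units_def)
      have "h \<noteq> \<zero>\<^bsub>completion K v\<^esub>" using g ne subringE(1)[OF sr] by auto
      then show "h \<in> rat_completion K v - {\<zero>\<^bsub>completion K v\<^esub>}" using g by simp
    next
      fix h assume h: "h \<in> rat_completion K v - {\<zero>\<^bsub>completion K v\<^esub>}"
      then obtain s where s: "h = proj s" "s \<in> ?Q" unfolding rat_completion_eq by auto
      have nn: "\<not> (\<lambda>n. v (s n)) \<longlonglongrightarrow> 0"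
      proof
        assume "(\<lambda>n. v (s n)) \<longlonglongrightarrow> 0"
        then have "proj s = proj (\<lambda>n. 0)" using proj_eq_iff[of s "\<lambda>n. 0"] s cauchy_const[OF zero_in] by simp
        then show False using h s(1) proj_simps(4)[OF cauchy_const[OF one_in] cauchy_const[OF one_in]] by simp
      qed
      have t: "(\<lambda>n. inverse (s n)) \<in> ?Q" using cauchy_inverse(1)[OF _ nn] s by auto
      have sc: "s \<in> carrier (cauchy_ring K v)" and tc: "(\<lambda>n. inverse (s n)) \<in> carrier (cauchy_ring K v)"
        using s t by auto
      have "proj (\<lambda>n. s n * inverse (s n)) = proj (\<lambda>n. 1)"
        using proj_eq_iff[OF cauchy_mult[OF sc tc] cauchy_const[OF one_in]] cauchy_inverse(2)[OF sc nn] by simp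
      then have "proj s \<otimes>\<^bsub>completion K v\<^esub> proj (\<lambda>n. inverse (s n)) = \<one>\<^bsub>completion K v\<^esub>"
        using proj_simps(1,5)[OF sc tc] by simp
      moreover have "proj (\<lambda>n. inverse (s n)) \<otimes>\<^bsub>completion K v\<^esub> proj s = \<one>\<^bsub>completion K v\<^esub>"
        using calculation A.m_comm carr s t by auto
      moreover have "proj (\<lambda>n. inverse (s n)) \<in> rat_completion K v" unfolding rat_completion_eq using t by blast
      ultimately show "h \<in> Units ?A" using h s by (auto simp: Units_def)
    qed
  qed
qed

lemma cauchy_sum:
  assumes "\<And>i. i < (n::nat) \<Longrightarrow> s i \<in> carrier (cauchy_ring K v)"
  shows "(\<lambda>k. \<Sum>i<n. s i k) \<in> carrier (cauchy_ring K v)"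
  using assms by (induction n) (auto simp: cauchy_const cauchy_add)

lemma completion_finsum:
  assumes "\<And>i. i < (n::nat) \<Longrightarrow> s i \<in> carrier (cauchy_ring K v)"
  shows "(\<Oplus>\<^bsub>completion K v\<^esub>i\<in>{..<n}. proj (s i)) = proj (\<lambda>k. \<Sum>i<n. s i k)"
proof -
  interpret A: cring "completion K v" by (rule cring_completion)
  show ?thesis using assms
  proof (induction n)
    case 0
    then show ?case using proj_simps(4)[OF cauchy_const[OF one_in] cauchy_const[OF one_in]] by simp
  next
    case (Suc n)
    have c: "proj (s i) \<in> carrier (completion K v)" if "i < Suc n" for i
      using Suc.prems[OF that] carrier_completion by auto
    have "(\<Oplus>\<^bsub>completion K v\<^esub>i\<in>{..<Suc n}. proj (s i)) =
        proj (s n) \<oplus>\<^bsub>completion K v\<^esub> (\<Oplus>\<^bsub>completion K v\<^esub>i\<in>{..<n}. proj (s i))"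
      unfolding lessThan_Suc using c by (intro A.finsum_insert) auto
    also have "\<dots> = proj (\<lambda>k. s n k + (\<Sum>i<n. s i k))"
      using Suc cauchy_sum[of n s] by (simp add: proj_simps)
    finally show ?case by (simp add: add.commute)
  qed
qed

end

context numfield_place
begin

text \<open>The powers of \<open>x\<close> with exponent below \<open>card local_conjs\<close> are a
  basis of the completion. By \<open>local_coeff_bound\<close> a combination tends to zero only if
  its coefficients do, and \<open>local_approx\<close> writes each element as a limit of rational
  combinations.\<close>

theorem local_degree_eq: "local_degree K v = card local_conjs"
proof -
  interpret A: cring "completion K v" by (rule v.cring_completion)
  let ?C = "carrier (cauchy_ring K v)" and ?r = "card local_conjs"
  let ?Q = "{s \<in> ?C. \<forall>n. s n \<in> \<rat>}"
  define b where "b = (\<lambda>i::nat. v.proj (\<lambda>n. x ^ i))"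
  have xc: "(\<lambda>n. x ^ i) \<in> ?C" for i by (rule v.cauchy_const) auto
  have bc: "b i \<in> carrier (completion K v)" for i unfolding b_def v.carrier_completion using xc by blast
  obtain M where M: "M > 0" "\<And>q j. j < ?r \<Longrightarrow> u (q j) \<le> M * v (\<Sum>i<?r. of_rat (q i) * x ^ i)"
    using local_coeff_bound by blast
  have sum_eq: "(\<Oplus>\<^bsub>completion K v\<^esub>i\<in>{..<?r}. v.proj (s i) \<otimes>\<^bsub>completion K v\<^esub> b i) =
      v.proj (\<lambda>k. \<Sum>i<?r. s i k * x ^ i)" if "\<And>i. i < ?r \<Longrightarrow> s i \<in> ?C" for s
  proof -
    have "(\<Oplus>\<^bsub>completion K v\<^esub>i\<in>{..<?r}. v.proj (s i) \<otimes>\<^bsub>completion K v\<^esub> b i) =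
       (\<Oplus>\<^bsub>completion K v\<^esub>i\<in>{..<?r}. v.proj (\<lambda>k. s i k * x ^ i))"
      using that xc v.carrier_completion v.cauchy_mult
      by (intro A.finsum_cong') (auto simp: b_def v.proj_simps)
    also have "\<dots> = v.proj (\<lambda>k. \<Sum>i<?r. s i k * x ^ i)"
      using that xc v.cauchy_mult by (intro v.completion_finsum) auto
    finally show ?thesis .
  qed
  have "A.dimension ?r (rat_completion K v) (carrier (completion K v))"
  proof (rule A.dimension_basisI[where b = b, OF v.subfield_rat_completion])
    show "b i \<in> carrier (completion K v)" for i by (rule bc)
  next
    fix a i assume a: "\<And>i. i < ?r \<Longrightarrow> a i \<in> rat_completion K v"
      "(\<Oplus>\<^bsub>completion K v\<^esub>i\<in>{..<?r}. a i \<otimes>\<^bsub>completion K v\<^esub> b i) = \<zero>\<^bsub>completion K v\<^esub>" "i < ?r"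
    define s where "s = (\<lambda>i. SOME t. t \<in> ?Q \<and> a i = v.proj t)"
    have s: "s i \<in> ?Q" "a i = v.proj (s i)" if i: "i < ?r" for i
    proof -
      have "\<exists>t. t \<in> ?Q \<and> a i = v.proj t" using a(1)[OF i] unfolding v.rat_completion_eq by blast
      from someI_ex[OF this] show "s i \<in> ?Q" "a i = v.proj (s i)" unfolding s_def by blast+
    qed
    have sum: "(\<lambda>k. \<Sum>i<?r. s i k * x ^ i) \<in> ?C"
      using s(1) xc v.cauchy_mult by (intro v.cauchy_sum) auto
    have "(\<Oplus>\<^bsub>completion K v\<^esub>i\<in>{..<?r}. v.proj (s i) \<otimes>\<^bsub>completion K v\<^esub> b i) =
        (\<Oplus>\<^bsub>completion K v\<^esub>i\<in>{..<?r}. a i \<otimes>\<^bsub>completion K v\<^esub> b i)"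
    proof (rule A.finsum_cong')
      show "(\<lambda>i. a i \<otimes>\<^bsub>completion K v\<^esub> b i) \<in> {..<?r} \<rightarrow> carrier (completion K v)"
      proof
        fix i assume "i \<in> {..<?r}"
        then show "a i \<otimes>\<^bsub>completion K v\<^esub> b i \<in> carrier (completion K v)"
          using a(1)[of i] subfieldE(3)[OF v.subfield_rat_completion] bc by (intro A.m_closed) auto
      qed
    qed (use s in auto)
    then have "v.proj (\<lambda>k. \<Sum>i<?r. s i k * x ^ i) = v.proj (\<lambda>n. 0)"
      using sum_eq[of s] s(1) a(2) v.proj_simps(4)[OF v.cauchy_const[OF K.one_in] v.cauchy_const[OF K.one_in]] by auto
    then have lim: "(\<lambda>k. v (\<Sum>i<?r. s i k * x ^ i)) \<longlonglongrightarrow> 0"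
      using v.proj_eq_iff[OF sum v.cauchy_const[of 0]] by simp
    have "(\<lambda>k. v (s i k)) \<longlonglongrightarrow> 0"
    proof (rule tendsto_sandwich[OF _ _ tendsto_const])
      show "\<forall>\<^sub>F k in sequentially. 0 \<le> v (s i k)"
        using s(1)[OF a(3)] v.cauchy_in by (intro always_eventually allI v.nonneg) auto
      show "\<forall>\<^sub>F k in sequentially. v (s i k) \<le> M * v (\<Sum>i<?r. s i k * x ^ i)"
      proof (intro always_eventually allI)
        fix k
        have "\<forall>i<?r. \<exists>q. s i k = of_rat q" using s(1) by (auto elim!: Rats_cases)
        then obtain q where q: "\<And>i. i < ?r \<Longrightarrow> s i k = of_rat (q i)" by metis
        have "(\<Sum>i<?r. s i k * x ^ i) = (\<Sum>i<?r. of_rat (q i) * x ^ i)" using q by simp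
        then show "v (s i k) \<le> M * v (\<Sum>i<?r. s i k * x ^ i)"
          using M(2)[OF a(3), of q] q[OF a(3)] by (simp add: v_rat)
      qed
      show "(\<lambda>k. M * v (\<Sum>i<?r. s i k * x ^ i)) \<longlonglongrightarrow> 0"
        using tendsto_mult[OF tendsto_const[of M] lim] by simp
    qed
    then show "a i = \<zero>\<^bsub>completion K v\<^esub>"
      using v.proj_eq_iff[of "s i" "\<lambda>n. 0"] v.proj_simps(4)[OF v.cauchy_const[OF K.one_in] v.cauchy_const[OF K.one_in]]
        v.cauchy_const s[OF a(3)] by auto
  next
    fix y
    show "y \<in> carrier (completion K v) \<longleftrightarrow> (\<exists>a. (\<forall>i<?r. a i \<in> rat_completion K v) \<and>
        y = (\<Oplus>\<^bsub>completion K v\<^esub>i\<in>{..<?r}. a i \<otimes>\<^bsub>completion K v\<^esub> b i))"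
    proof
      assume "y \<in> carrier (completion K v)"
      then obtain t where t: "t \<in> ?C" "y = v.proj t" using v.carrier_completion by auto
      have tK: "t k \<in> K" for k using v.cauchy_in[OF t(1)] .
      have "\<forall>k. \<exists>q. v (t k - (\<Sum>j<?r. of_rat (q j) * x ^ j)) < 1 / real (Suc k)"
        using local_approx[OF tK] by simp
      then obtain q where q: "\<And>k. v (t k - (\<Sum>j<?r. of_rat (q k j) * x ^ j)) < 1 / real (Suc k)" by metis
      let ?S = "\<lambda>k. \<Sum>j<?r. of_rat (q k j) * x ^ j"
      have SK: "?S k \<in> K" for k by (intro K.sum_in K.mult_in K.of_rat_in K.power_in x_in)
      have dlim: "(\<lambda>k. v (t k - ?S k)) \<longlonglongrightarrow> 0"
      proof (rule tendsto_sandwich[OF _ _ tendsto_const])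
        show "\<forall>\<^sub>F k in sequentially. 0 \<le> v (t k - ?S k)"
          using tK SK by (intro always_eventually allI v.nonneg) blast
        show "\<forall>\<^sub>F k in sequentially. v (t k - ?S k) \<le> inverse (real (Suc k))"
          using q by (intro always_eventually allI less_imp_le) (simp add: field_simps)
        show "(\<lambda>k. inverse (real (Suc k))) \<longlonglongrightarrow> 0" by (rule LIMSEQ_inverse_real_of_nat)
      qed
      have SC: "?S \<in> ?C"
      proof -
        have "(\<lambda>k. t k - ?S k) \<in> null_sequences K v" using dlim tK SK v.null_iff by blast
        then have "(\<lambda>k. t k - ?S k) \<in> ?C" by (simp add: null_sequences_def)
        from v.cauchy_add[OF t(1) v.cauchy_uminus[OF this]] show ?thesis by simp
      qed
      define s where "s = (\<lambda>i k. of_rat (q k i) :: complex)"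
      \<comment> \<open>The approximations \<open>?S\<close> form a Cauchy sequence, and
        \<open>M\<close> bounds each rational coefficient of a difference of two of them; hence the
        coefficients are Cauchy as well.\<close>
      have sC: "s i \<in> ?C" if i: "i < ?r" for i
        unfolding v.cauchy_carrier
      proof (intro conjI allI impI)
        show "s i k \<in> K" for k by (simp add: s_def)
        fix \<epsilon> :: real assume "\<epsilon> > 0"
        then have "\<epsilon> / M > 0" using M by simp
        then obtain n0 where n0: "\<And>m n. m \<ge> n0 \<Longrightarrow> n \<ge> n0 \<Longrightarrow> v (?S m - ?S n) < \<epsilon> / M"
          using v.cauchyD[OF SC] by blast
        show "\<exists>n0. \<forall>m\<ge>n0. \<forall>n\<ge>n0. v (s i m - s i n) < \<epsilon>"
        proof (intro exI[of _ n0] allI impI)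
          fix m n assume "m \<ge> n0" "n \<ge> n0"
          have eq: "(\<Sum>j<?r. of_rat (q m j - q n j) * x ^ j) = ?S m - ?S n"
            by (simp add: of_rat_diff sum_subtractf algebra_simps)
          have "v (s i m - s i n) = u (q m i - q n i)"
            by (simp add: s_def of_rat_diff[symmetric] v_rat)
          also have "\<dots> \<le> M * v (?S m - ?S n)"
            using M(2)[OF i, of "\<lambda>j. q m j - q n j"] unfolding eq by simp
          also have "\<dots> < M * (\<epsilon> / M)" using n0[OF \<open>m \<ge> n0\<close> \<open>n \<ge> n0\<close>] M(1) by (intro mult_strict_left_mono)
          finally show "v (s i m - s i n) < \<epsilon>" using M(1) by simp
        qed
      qed
      have "y = v.proj ?S" unfolding t(2) using v.proj_eq_iff[OF t(1) SC] dlim by simp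
      also have "\<dots> = (\<Oplus>\<^bsub>completion K v\<^esub>i\<in>{..<?r}. v.proj (s i) \<otimes>\<^bsub>completion K v\<^esub> b i)"
        using sum_eq[OF sC] by (simp add: s_def)
      finally show "\<exists>a. (\<forall>i<?r. a i \<in> rat_completion K v) \<and>
        y = (\<Oplus>\<^bsub>completion K v\<^esub>i\<in>{..<?r}. a i \<otimes>\<^bsub>completion K v\<^esub> b i)"
        using sC unfolding v.rat_completion_eq
        by (intro exI[of _ "\<lambda>i. v.proj (s i)"]) (auto simp: s_def)
    next
      assume "\<exists>a. (\<forall>i<?r. a i \<in> rat_completion K v) \<and>
        y = (\<Oplus>\<^bsub>completion K v\<^esub>i\<in>{..<?r}. a i \<otimes>\<^bsub>completion K v\<^esub> b i)"
      then obtain a where a: "\<forall>i<?r. a i \<in> rat_completion K v"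
        "y = (\<Oplus>\<^bsub>completion K v\<^esub>i\<in>{..<?r}. a i \<otimes>\<^bsub>completion K v\<^esub> b i)" by blast
      have "a i \<otimes>\<^bsub>completion K v\<^esub> b i \<in> carrier (completion K v)" if "i < ?r" for i
        using a(1) that subfieldE(3)[OF v.subfield_rat_completion] bc by (intro A.m_closed) auto
      then show "y \<in> carrier (completion K v)" unfolding a(2) by (intro A.finsum_closed) auto
    qed
  qed
  then show ?thesis unfolding local_degree_def by (rule A.dim_eqI[OF v.subfield_rat_completion])
qed

end

section \<open>Non-archimedean places and supports\<close>

definition rat_place :: "(complex \<Rightarrow> real) \<Rightarrow> rat \<Rightarrow> real" where
  "rat_place v = (\<lambda>r. v (of_rat r))"

lemma rat_place_apply: "v (of_rat r) = rat_place v r"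
  by (simp add: rat_place_def)

lemma archimedean_places_iff:
  "v \<in> archimedean_places K \<longleftrightarrow> v \<in> places K \<and> rat_place v = real_abs"
  by (auto simp: archimedean_places_def rat_place_def fun_eq_iff)

lemma padic_abs_of_int:
  "padic_abs p (of_int a) = (if a = 0 then 0 else inverse (real p ^ multiplicity (int p) a))"
proof -
  have "quotient_of (of_int a) = (a, 1)" by (simp add: quotient_of_int)
  then show ?thesis by (simp add: padic_abs_def power_int_minus)
qed

lemma padic_abs_int_le_1:
  assumes "Factorial_Ring.prime p" shows "padic_abs p (of_int a) \<le> 1"
proof -
  have "real p ^ k \<ge> 1" for k using prime_gt_1_nat[OF assms] by (intro one_le_power) simp
  then show ?thesis by (simp add: padic_abs_of_int inverse_le_1_iff)
qed

lemma padic_abs_unit: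
  assumes "\<not> int p dvd a" shows "padic_abs p (of_int a) = 1"
  using assms by (auto simp: padic_abs_of_int not_dvd_imp_multiplicity_0)

lemma padic_abs_self:
  assumes "Factorial_Ring.prime p" shows "padic_abs p (of_nat p) = 1 / real p"
proof -
  have "multiplicity (int p) (int p) = 1"
    using prime_gt_1_nat[OF assms] by (intro multiplicity_self) auto
  then show ?thesis using padic_abs_of_int[of p "int p"] prime_gt_0_nat[OF assms] by (simp add: field_simps)
qed

lemma padic_abs_neq_real_abs:
  assumes "Factorial_Ring.prime p" shows "padic_abs p \<noteq> real_abs"
proof
  assume "padic_abs p = real_abs"
  then have "1 / real p = real p" using padic_abs_self[OF assms] by simp
  then have "real p * real p = 1" using prime_gt_0_nat[OF assms] by (simp add: field_simps)
  moreover have "real p * real p > 1" using prime_gt_1_nat[OF assms] less_1_mult[of "real p" "real p"] by simp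
  ultimately show False by simp
qed

lemma padic_abs_inj:
  assumes "Factorial_Ring.prime p" "Factorial_Ring.prime q" "padic_abs p = padic_abs q" shows "p = q"
proof (rule ccontr)
  assume "p \<noteq> q"
  then have "\<not> int p dvd int q" using primes_dvd_imp_eq[OF assms(1,2)] by auto
  then have "padic_abs p (of_nat q) = 1" using padic_abs_unit[of p "int q"] by simp
  then have "1 / real q = 1" using padic_abs_self[OF assms(2)] assms(3) by simp
  then show False using prime_gt_1_nat[OF assms(2)] by (simp add: field_simps)
qed

lemma real_abs_std: "real_abs \<in> standard_rat_abs"
  by (simp add: standard_rat_abs_def)

lemma nonarch_std:
  assumes "u \<in> standard_rat_abs" "u \<noteq> real_abs"
  obtains p where "Factorial_Ring.prime p" "u = padic_abs p"
  using assms by (auto simp: standard_rat_abs_def)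

text \<open>The exceptional set consists of rational places, so that sums over the places above it
  become sums over embeddings. With \<open>real_abs\<close> included, every place outside is
  ultrametric.\<close>

definition good :: "complex set \<Rightarrow> complex set \<Rightarrow> (rat \<Rightarrow> real) set \<Rightarrow> bool" where
  "good K Y U \<longleftrightarrow> finite U \<and> U \<subseteq> standard_rat_abs \<and> real_abs \<in> U \<and>
     (\<forall>y\<in>Y. y \<noteq> 0 \<longrightarrow> (\<forall>v\<in>places K. rat_place v \<notin> U \<longrightarrow> v y = 1))"

lemma goodD:
  assumes "good K Y U"
  shows "finite U" "U \<subseteq> standard_rat_abs" "real_abs \<in> U"
    "y \<in> Y \<Longrightarrow> y \<noteq> 0 \<Longrightarrow> v \<in> places K \<Longrightarrow> rat_place v \<notin> U \<Longrightarrow> v y = 1"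
  using assms unfolding good_def by blast+

lemma good_mono: "good K Y U \<Longrightarrow> Y' \<subseteq> Y \<Longrightarrow> U \<subseteq> U' \<Longrightarrow> finite U' \<Longrightarrow> U' \<subseteq> standard_rat_abs \<Longrightarrow> good K Y' U'"
  unfolding good_def by blast

definition places_over :: "complex set \<Rightarrow> (rat \<Rightarrow> real) set \<Rightarrow> (complex \<Rightarrow> real) set" where
  "places_over K U = {v \<in> places K. rat_place v \<in> U}"

text \<open>The exponent in \<open>place_abs\<close>. Places are kept unnormalised, and the exponent
  appears as a factor of logarithms.\<close>

definition weight :: "complex set \<Rightarrow> (complex \<Rightarrow> real) \<Rightarrow> real" where
  "weight K v = real (local_degree K v) / real (field_degree K)"

context numfield
begin

lemma absval_place: "v \<in> places K \<Longrightarrow> absval K v"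
  by (rule placesD(1)[OF K.csubfield_axioms])

lemma rat_place_std: "v \<in> places K \<Longrightarrow> rat_place v \<in> standard_rat_abs"
  using placesD(2)[OF K.csubfield_axioms] by (simp add: rat_place_def)

lemma place_obtain:
  assumes "v \<in> places K" obtains b where "b \<in> conjs" "v = place_of (rat_place v) b"
  using place_is_place_of[OF assms] unfolding rat_place_def by blast

lemma rat_place_place_of: "u \<in> standard_rat_abs \<Longrightarrow> b \<in> conjs \<Longrightarrow> rat_place (place_of u b) = u"
  by (simp add: rat_place_def place_of_rat)

text \<open>The definition of \<open>places\<close> asks for the triangle inequality alone. The
  ultrametric one is inherited from \<open>ext_abs\<close> through an embedding.\<close>

lemma ultrametric:
  assumes v: "v \<in> places K" "rat_place v \<noteq> real_abs" and "y \<in> K" "z \<in> K"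
  shows "v (y + z) \<le> max (v y) (v z)"
proof -
  obtain b where b: "b \<in> conjs" "v = place_of (rat_place v) b" using place_obtain[OF v(1)] .
  have "place_of (rat_place v) b (y + z) \<le> max (place_of (rat_place v) b y) (place_of (rat_place v) b z)"
    using ext_abs(3)[OF rat_place_std[OF v(1)] v(2)] assms(3,4) b(1)
    by (simp add: place_of_apply K.add_in emb_add emb_Qbar)
  then show ?thesis using b(2) by simp
qed

lemma ultrametric_sum:
  assumes v: "v \<in> places K" "rat_place v \<noteq> real_abs" and "\<And>i. i \<in> I \<Longrightarrow> g i \<in> K"
    and "\<And>i. i \<in> I \<Longrightarrow> v (g i) \<le> B" "B \<ge> 0"
  shows "v (sum g I) \<le> B"
  using assms(3,4)
proof (induction I rule: infinite_finite_induct)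
  case (insert i I)
  interpret v: absval K v by (rule absval_place[OF v(1)])
  have "v (g i + sum g I) \<le> max (v (g i)) (v (sum g I))"
    using insert by (intro ultrametric[OF v]) auto
  also have "\<dots> \<le> B" using insert by auto
  finally show ?case using insert by simp
qed (use absval.v0[OF absval_place[OF v(1)]] assms(5) in auto)

lemma nonarch_int_le_1:
  assumes v: "v \<in> places K" "rat_place v \<noteq> real_abs" shows "v (of_int a) \<le> 1"
proof -
  obtain p where "Factorial_Ring.prime p" "rat_place v = padic_abs p"
    using nonarch_std[OF rat_place_std[OF v(1)] v(2)] .
  then show ?thesis using rat_place_apply[of v "of_int a"] padic_abs_int_le_1[of p a] by simp
qed

text \<open>In \<open>c\<^sub>n y\<^sup>n = - \<Sum> c\<^sub>i y\<^sup>i\<close> the left-hand side would dominate if \<open>v(y) > 1\<close>.\<close>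

lemma nonarch_root_le_1:
  assumes v: "v \<in> places K" "rat_place v \<noteq> real_abs" and "y \<in> K"
    and q: "\<And>i. coeff q i \<in> \<int>" "q \<noteq> 0" "poly q y = 0" "v (lead_coeff q) = 1"
  shows "v y \<le> 1"
proof (rule ccontr)
  interpret v: absval K v by (rule absval_place[OF v(1)])
  assume "\<not> v y \<le> 1"
  then have y1: "v y > 1" by simp
  have qK: "coeff q i \<in> K" for i using q(1)[of i] by (auto elim: Ints_cases)
  define n where "n = degree q"
  have n0: "n > 0"
  proof (rule ccontr)
    assume "\<not> n > 0"
    then obtain c where "q = [:c:]" by (auto simp: n_def elim: degree_eq_zeroE)
    then show False using q by auto
  qed
  have "poly q y = lead_coeff q * y ^ n + (\<Sum>i<n. coeff q i * y ^ i)"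
    by (simp add: poly_altdef n_def[symmetric] lessThan_Suc_atMost[symmetric])
  then have eq: "lead_coeff q * y ^ n = - (\<Sum>i<n. coeff q i * y ^ i)"
    using q(3) by (simp add: add_eq_0_iff2)
  have "v y ^ n = v (lead_coeff q * y ^ n)" using q(4) assms(3) qK by (simp add: v.mult v.power K.power_in)
  also have "\<dots> = v (\<Sum>i<n. coeff q i * y ^ i)"
    unfolding eq using qK assms(3) by (intro v.uminus K.sum_in K.mult_in K.power_in)
  also have "\<dots> \<le> v y ^ (n - 1)"
  proof (rule ultrametric_sum[OF v])
    fix i assume i: "i \<in> {..<n}"
    show "coeff q i * y ^ i \<in> K" using qK assms(3) by auto
    obtain a where "coeff q i = of_int a" using q(1) by (auto elim: Ints_cases)
    then have "v (coeff q i) \<le> 1" using nonarch_int_le_1[OF v] by simp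
    moreover have "v y ^ i \<le> v y ^ (n - 1)" using i y1 by (intro power_increasing) auto
    ultimately have "v (coeff q i) * v y ^ i \<le> 1 * v y ^ (n - 1)"
      using y1 assms(3) by (intro mult_mono) auto
    then show "v (coeff q i * y ^ i) \<le> v y ^ (n - 1)"
      using qK assms(3) by (simp add: v.mult v.power K.power_in)
  qed (use y1 in auto)
  also have "\<dots> < v y ^ n" using y1 n0 by (intro power_strict_increasing) auto
  finally show False by simp
qed

lemma nonarch_algebraic_int_le_1:
  assumes v: "v \<in> places K" "rat_place v \<noteq> real_abs" and "y \<in> K" "algebraic_int y"
  shows "v y \<le> 1"
proof -
  interpret v: absval K v by (rule absval_place[OF v(1)])
  from assms(4) obtain q where q: "lead_coeff q = 1" "\<forall>i. coeff q i \<in> \<int>" "poly q y = 0"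
    by (auto elim!: algebraic_int.cases)
  show ?thesis by (rule nonarch_root_le_1[OF v assms(3), of q]) (use q in auto)
qed

text \<open>Away from the primes that divide the leading coefficients of integral equations for
  \<open>y\<close> and \<open>inverse y\<close>, both have absolute value at most
  \<open>1\<close>.\<close>

lemma good_exists_single:
  assumes y: "y \<in> K" shows "\<exists>U. good K {y} U"
proof (cases "y = 0")
  case True
  then show ?thesis using real_abs_std by (intro exI[of _ "{real_abs}"]) (auto simp: good_def)
next
  case False
  have gen: "\<exists>a. a \<noteq> (0::int) \<and> (\<forall>v\<in>places K. rat_place v \<noteq> real_abs \<longrightarrow> v (of_int a) = 1 \<longrightarrow> v y \<le> 1)"
    if "y \<in> K" for y
  proof -
    have "algebraic y" using that K_Qbar by (auto simp: Qbar_def)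
    then obtain q where q: "\<forall>i. coeff q i \<in> \<int>" "q \<noteq> 0" "poly q y = 0" by (auto simp: algebraic_def)
    then obtain a where a: "lead_coeff q = of_int a" by (auto elim: Ints_cases)
    have "a \<noteq> 0" using a q(2) by auto
    then show ?thesis using nonarch_root_le_1[OF _ _ that, of _ q] q a by (intro exI[of _ a]) auto
  qed
  obtain a where a: "a \<noteq> 0" "\<And>v. v \<in> places K \<Longrightarrow> rat_place v \<noteq> real_abs \<Longrightarrow> v (of_int a) = 1 \<Longrightarrow> v y \<le> 1"
    using gen[OF y] by blast
  obtain b where b: "b \<noteq> 0" "\<And>v. v \<in> places K \<Longrightarrow> rat_place v \<noteq> real_abs \<Longrightarrow> v (of_int b) = 1 \<Longrightarrow> v (inverse y) \<le> 1"
    using gen[OF K.inverse_in[OF y]] by blast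
  \<comment> \<open>Taking all primes up to the absolute value of \<open>a * b\<close> covers the
    prime divisors of \<open>a\<close> and \<open>b\<close> and is visibly finite.\<close>
  define U where "U = insert real_abs (padic_abs ` {p. Factorial_Ring.prime p \<and> p \<le> nat \<bar>a * b\<bar>})"
  have "v y = 1" if v: "v \<in> places K" "rat_place v \<notin> U" for v
  proof -
    interpret v: absval K v by (rule absval_place[OF v(1)])
    have na: "rat_place v \<noteq> real_abs" using v by (auto simp: U_def)
    obtain p where p: "Factorial_Ring.prime p" "rat_place v = padic_abs p"
      using nonarch_std[OF rat_place_std[OF v(1)] na] .
    have "p > nat \<bar>a * b\<bar>" using v(2) p by (auto simp: U_def)
    then have "\<not> int p dvd a * b" using a(1) b(1) dvd_imp_le_int[of "a * b" "int p"] by auto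
    then have "\<not> int p dvd a" "\<not> int p dvd b" by auto
    then have "v (of_int a) = 1" "v (of_int b) = 1"
      using rat_place_apply[of v "of_int a"] rat_place_apply[of v "of_int b"] padic_abs_unit p(2) by auto
    then have "v y \<le> 1" "inverse (v y) \<le> 1" using a(2)[OF v(1) na] b(2)[OF v(1) na] v.inverse[OF y] by auto
    then show ?thesis using v.pos[OF y False] by (simp add: inverse_le_1_iff)
  qed
  moreover have "finite {p. Factorial_Ring.prime p \<and> p \<le> nat \<bar>a * b\<bar>}"
    by (rule finite_subset[of _ "{..nat \<bar>a * b\<bar>}"]) auto
  ultimately have "good K {y} U" unfolding good_def
    by (auto simp: U_def standard_rat_abs_def)
  then show ?thesis ..
qed

lemma good_exists:
  assumes "finite Y" "Y \<subseteq> K" shows "\<exists>U. good K Y U"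
  using assms
proof (induction Y)
  case empty
  then show ?case using real_abs_std by (intro exI[of _ "{real_abs}"]) (auto simp: good_def)
next
  case (insert y Y)
  then obtain U where U: "good K Y U" by auto
  obtain U' where U': "good K {y} U'" using good_exists_single insert by auto
  have "good K (insert y Y) (U \<union> U')" using U U' unfolding good_def by auto
  then show ?case ..
qed

lemma places_over_image:
  assumes "U \<subseteq> standard_rat_abs"
  shows "places_over K U = (\<lambda>(u, b). place_of u b) ` (U \<times> conjs)"
proof (intro equalityI subsetI)
  fix v assume v: "v \<in> places_over K U"
  then have "v \<in> places K" by (simp add: places_over_def)
  then obtain b where "b \<in> conjs" "v = place_of (rat_place v) b" by (rule place_obtain)
  then show "v \<in> (\<lambda>(u, b). place_of u b) ` (U \<times> conjs)"
    using v by (intro image_eqI[of _ _ "(rat_place v, b)"]) (auto simp: places_over_def)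
qed (use assms place_of_in rat_place_place_of in \<open>auto simp: places_over_def subset_iff\<close>)

lemma finite_places_over: "finite U \<Longrightarrow> U \<subseteq> standard_rat_abs \<Longrightarrow> finite (places_over K U)"
  using places_over_image finite_conjs by simp

lemma local_degree_card:
  assumes "v \<in> places K"
  shows "local_degree K v = card {b \<in> conjs. v = place_of (rat_place v) b}"
proof -
  interpret P: numfield_place K x f v by unfold_locales (rule assms)
  show ?thesis using P.local_degree_eq by (simp add: P.local_conjs_def P.u_def rat_place_def)
qed

lemma local_degree_pos: "v \<in> places K \<Longrightarrow> local_degree K v > 0"
  using place_obtain finite_conjs by (auto simp: local_degree_card card_gt_0_iff)

lemma weight_pos: "v \<in> places K \<Longrightarrow> weight K v > 0"
  using local_degree_pos degree_pos by (simp add: weight_def field_degree_eq)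

text \<open>Pairs of a rational place and an embedding are grouped by the place of \<open>K\<close>
  that they induce. By \<open>local_degree_card\<close> the size of each group is the local degree,
  which the weight contains as its numerator.\<close>

lemma sum_places_over:
  assumes U: "finite U" "U \<subseteq> standard_rat_abs"
  shows "(\<Sum>v\<in>places_over K U. weight K v * g v) = (\<Sum>u\<in>U. \<Sum>b\<in>conjs. g (place_of u b)) / real (degree f)"
proof -
  let ?S = "U \<times> conjs" and ?h = "\<lambda>(u, b). place_of u b"
  have fib: "card {p \<in> ?S. ?h p = v} = local_degree K v" if v: "v \<in> places_over K U" for v
  proof -
    have "{p \<in> ?S. ?h p = v} = Pair (rat_place v) ` {b \<in> conjs. v = place_of (rat_place v) b}"
      using v U(2) rat_place_place_of by (auto simp: places_over_def)
    then show ?thesis using local_degree_card[of v] v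
      by (simp add: card_image inj_on_def places_over_def)
  qed
  have "(\<Sum>u\<in>U. \<Sum>b\<in>conjs. g (place_of u b)) = (\<Sum>p\<in>?S. g (?h p))"
    by (simp add: sum.cartesian_product split_beta)
  also have "\<dots> = (\<Sum>v\<in>places_over K U. \<Sum>p\<in>{p \<in> ?S. ?h p = v}. g (?h p))"
    using U finite_conjs places_over_image[OF U(2)] finite_places_over[OF U]
    by (intro sum.group[symmetric]) auto
  also have "\<dots> = (\<Sum>v\<in>places_over K U. real (local_degree K v) * g v)"
  proof (rule sum.cong)
    fix v assume v: "v \<in> places_over K U"
    have "(\<Sum>p\<in>{p \<in> ?S. ?h p = v}. g (?h p)) = (\<Sum>p\<in>{p \<in> ?S. ?h p = v}. g v)" by (intro sum.cong) auto
    then show "(\<Sum>p\<in>{p \<in> ?S. ?h p = v}. g (?h p)) = real (local_degree K v) * g v" using fib[OF v] by simp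
  qed simp
  finally show ?thesis by (simp add: weight_def field_degree_eq sum_divide_distrib)
qed

end

section \<open>The product formula\<close>

lemma ln_nat_prime_sum:
  assumes "m > 0" "finite A" "prime_factors m \<subseteq> A" "\<And>p. p \<in> A \<Longrightarrow> Factorial_Ring.prime p"
  shows "ln (real m) = (\<Sum>p\<in>A. real (multiplicity p m) * ln (real p))"
proof -
  have "real m = (\<Prod>p\<in>prime_factors m. real p ^ multiplicity p m)"
    using arg_cong[OF prime_factorization_nat[OF assms(1)], of real] by (simp only: of_nat_power of_nat_prod)
  then have "ln (real m) = (\<Sum>p\<in>prime_factors m. ln (real p ^ multiplicity p m))"
    by (simp only:) (intro ln_prod, auto simp: in_prime_factors_iff prime_gt_0_nat)
  also have "\<dots> = (\<Sum>p\<in>prime_factors m. real (multiplicity p m) * ln (real p))"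
    by (intro sum.cong) (auto simp: ln_realpow prime_gt_0_nat in_prime_factors_iff)
  also have "\<dots> = (\<Sum>p\<in>A. real (multiplicity p m) * ln (real p))"
    using assms by (intro sum.mono_neutral_left)
      (auto simp: prime_factors_multiplicity)
  finally show ?thesis .
qed

lemma multiplicity_int_nat:
  assumes "Factorial_Ring.prime p" "a \<noteq> 0"
  shows "multiplicity (int p) a = multiplicity p (nat \<bar>a\<bar>)"
proof (rule multiplicity_eqI)
  have u: "\<not> is_unit p" using prime_gt_1_nat[OF assms(1)] by simp
  have dv: "int p ^ k dvd a \<longleftrightarrow> p ^ k dvd nat \<bar>a\<bar>" for k
    by (metis dvd_abs_iff int_dvd_int_iff int_nat_eq abs_ge_zero of_nat_power)
  show "int p ^ multiplicity p (nat \<bar>a\<bar>) dvd a"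
    unfolding dv by (rule multiplicity_dvd)
  show "\<not> int p ^ Suc (multiplicity p (nat \<bar>a\<bar>)) dvd a"
  proof -
    have "p ^ k dvd nat \<bar>a\<bar> \<longleftrightarrow> k \<le> multiplicity p (nat \<bar>a\<bar>)" for k
      using assms(2) u by (intro power_dvd_iff_le_multiplicity) auto
    then show ?thesis unfolding dv by (metis not_less_eq_eq order_refl)
  qed
qed

lemma rat_product_formula:
  assumes "r \<noteq> 0" "finite U" "U \<subseteq> standard_rat_abs" "real_abs \<in> U"
    and one: "\<And>u. u \<in> standard_rat_abs \<Longrightarrow> u \<notin> U \<Longrightarrow> u r = 1"
  shows "(\<Sum>u\<in>U. ln (u r)) = 0"
proof -
  obtain a b where ab: "quotient_of r = (a, b)" by fastforce
  have b0: "b > 0" and r: "r = of_int a / of_int b" and cop: "coprime a b"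
    using quotient_of_denom_pos[OF ab] quotient_of_div[OF ab] quotient_of_coprime[OF ab] by auto
  have a0: "a \<noteq> 0" using r assms(1) by auto
  define m where "m = nat \<bar>a\<bar>"
  define n where "n = nat b"
  have mn: "m > 0" "n > 0" "int m = \<bar>a\<bar>" "int n = b" using a0 b0 by (auto simp: m_def n_def)
  have pa: "padic_abs p r = real p powi (int (multiplicity p n) - int (multiplicity p m))"
    if "Factorial_Ring.prime p" for p
    using assms(1) multiplicity_int_nat[OF that a0] multiplicity_int_nat[OF that, of b] b0
    by (simp add: padic_abs_def ab m_def n_def)
  have lnpa: "ln (padic_abs p r) = (real (multiplicity p n) - real (multiplicity p m)) * ln (real p)"
    if "Factorial_Ring.prime p" for p
  proof -
    have "ln (real p powi k) = real_of_int k * ln (real p)" for k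
      using prime_gt_0_nat[OF that] by (simp add: powr_real_of_int'[symmetric] ln_powr)
    then show ?thesis unfolding pa[OF that] by simp
  qed
  define A where "A = prime_factors m \<union> prime_factors n"
  define B where "B = {p. Factorial_Ring.prime p \<and> padic_abs p \<in> U}"
  have injB: "inj_on padic_abs B" using padic_abs_inj by (auto simp: inj_on_def B_def)
  have Bim: "padic_abs ` B = U - {real_abs}"
    using assms(3) padic_abs_neq_real_abs by (auto simp: B_def standard_rat_abs_def)
  have finB: "finite B" using finite_imageD[OF _ injB] Bim assms(2) by simp
  \<comment> \<open>A prime dividing \<open>m\<close> or \<open>n\<close> divides only one of them,
    so its absolute value at \<open>r\<close> differs from \<open>1\<close> and its place must
    belong to \<open>U\<close>.\<close>
  have AB: "A \<subseteq> B"
  proof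
    fix p assume p: "p \<in> A"
    then have pr: "Factorial_Ring.prime p" by (auto simp: A_def in_prime_factors_iff)
    have "padic_abs p r \<noteq> 1"
    proof
      assume "padic_abs p r = 1"
      then have "ln (padic_abs p r) = 0" by simp
      then have eq: "multiplicity p n = multiplicity p m"
        unfolding lnpa[OF pr] using prime_gt_1_nat[OF pr] by simp
      have "multiplicity p m > 0 \<or> multiplicity p n > 0"
        using p by (auto simp: A_def prime_factors_multiplicity)
      then have "p dvd m" "p dvd n" using eq not_dvd_imp_multiplicity_0 by fastforce+
      then have "int p dvd a" "int p dvd b" using mn by (metis dvd_abs_iff int_dvd_int_iff)+
      then have "is_unit (int p)" using cop coprime_common_divisor by blast
      then show False using prime_gt_1_nat[OF pr] by simp
    qed
    then show "p \<in> B" using one[of "padic_abs p"] pr by (auto simp: B_def standard_rat_abs_def)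
  qed
  have "(\<Sum>u\<in>U. ln (u r)) = ln (real_abs r) + (\<Sum>u\<in>U - {real_abs}. ln (u r))"
    using assms(2,4) by (rule sum.remove)
  also have "(\<Sum>u\<in>U - {real_abs}. ln (u r)) = (\<Sum>p\<in>B. ln (padic_abs p r))"
    unfolding Bim[symmetric] by (simp add: sum.reindex[OF injB])
  also have "\<dots> = (\<Sum>p\<in>B. (real (multiplicity p n) - real (multiplicity p m)) * ln (real p))"
    by (intro sum.cong) (auto simp: B_def lnpa)
  also have "\<dots> = ln (real n) - ln (real m)"
  proof -
    have sub: "prime_factors n \<subseteq> B" "prime_factors m \<subseteq> B" using AB unfolding A_def by blast+
    have "ln (real n) = (\<Sum>p\<in>B. real (multiplicity p n) * ln (real p))"
      by (rule ln_nat_prime_sum[OF mn(2) finB sub(1)]) (simp add: B_def)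
    moreover have "ln (real m) = (\<Sum>p\<in>B. real (multiplicity p m) * ln (real p))"
      by (rule ln_nat_prime_sum[OF mn(1) finB sub(2)]) (simp add: B_def)
    ultimately show ?thesis by (simp only: left_diff_distrib sum_subtractf)
  qed
  also have "ln (real_abs r) = ln (real m) - ln (real n)"
  proof -
    have "real_abs r = real m / real n"
      using mn a0 b0 by (simp add: r of_rat_divide) (metis of_int_abs of_int_of_nat_eq abs_of_pos)
    then show ?thesis using mn by (simp add: ln_div)
  qed
  finally show ?thesis by simp
qed

context numfield
begin

text \<open>The places above \<open>u\<close> contribute \<open>ln (u r) / degree f\<close>, where
  \<open>r\<close> is the norm of \<open>y\<close>; the formula for the rational number
  \<open>r\<close> concludes.\<close>

theorem product_formula:
  assumes y: "y \<in> K" "y \<noteq> 0" and U: "good K {y} U"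
  shows "(\<Sum>v\<in>places_over K U. weight K v * ln (v y)) = 0"
proof -
  note g = goodD[OF U]
  obtain r where r: "(\<Prod>b\<in>conjs. emb b y) = of_rat r" using norm_rat[OF y(1)] by (auto elim: Rats_cases)
  have "r \<noteq> 0"
  proof
    assume "r = 0"
    then obtain b where "b \<in> conjs" "emb b y = 0" using r finite_conjs by auto
    then show False using emb_eq_0_iff y by simp
  qed
  have prod: "u r = (\<Prod>b\<in>conjs. place_of u b y)" if u: "u \<in> standard_rat_abs" for u
  proof -
    interpret w: absval Qbar "ext_abs u" by (rule ext_abs(1)[OF u])
    have "u r = ext_abs u (\<Prod>b\<in>conjs. emb b y)" unfolding r ext_abs(2)[OF u] ..
    also have "\<dots> = (\<Prod>b\<in>conjs. ext_abs u (emb b y))" using emb_Qbar y by (intro w.prod) auto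
    finally show ?thesis using y by (simp add: place_of_apply)
  qed
  have pos: "place_of u b y > 0" if "u \<in> standard_rat_abs" "b \<in> conjs" for u b
    using absval.pos[OF absval_place_of[OF that] y] .
  have ln: "ln (u r) = (\<Sum>b\<in>conjs. ln (place_of u b y))" if u: "u \<in> standard_rat_abs" for u
    unfolding prod[OF u]
  proof (intro ln_prod)
    fix b assume "b \<in> conjs"
    then show "place_of u b y \<noteq> 0" using pos[OF u, of b] by simp
  qed (rule finite_conjs)
  have "(\<Sum>v\<in>places_over K U. weight K v * ln (v y)) = (\<Sum>u\<in>U. ln (u r)) / real (degree f)"
    using sum_places_over[OF g(1,2), of "\<lambda>v. ln (v y)"] ln g(2) by (simp add: subset_iff)
  also have "(\<Sum>u\<in>U. ln (u r)) = 0"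
  proof (rule rat_product_formula[OF \<open>r \<noteq> 0\<close> g(1-3)])
    fix u assume u: "u \<in> standard_rat_abs" "u \<notin> U"
    have "place_of u b y = 1" if "b \<in> conjs" for b
      using g(4)[of y "place_of u b"] y u that place_of_in rat_place_place_of by auto
    then show "u r = 1" unfolding prod[OF u(1)] by simp
  qed
  finally show ?thesis by simp
qed

end

section \<open>Evaluation of polynomials\<close>

abbreviation "lookup \<equiv> Poly_Mapping.lookup"
abbreviation "keys \<equiv> Poly_Mapping.keys"
abbreviation "single \<equiv> Poly_Mapping.single"

definition mon_eval :: "(nat \<Rightarrow> complex) \<Rightarrow> (nat \<Rightarrow>\<^sub>0 nat) \<Rightarrow> complex" where
  "mon_eval x \<alpha> = (\<Prod>i\<in>keys \<alpha>. x i ^ lookup \<alpha> i)"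

lemma mon_eval_superset:
  assumes "finite S" "keys \<alpha> \<subseteq> S"
  shows "mon_eval x \<alpha> = (\<Prod>i\<in>S. x i ^ lookup \<alpha> i)"
  unfolding mon_eval_def using assms
  by (intro prod.mono_neutral_left) (auto simp: in_keys_iff)

lemma mon_eval_0 [simp]: "mon_eval x 0 = 1"
  by (simp add: mon_eval_def)

lemma mon_eval_add: "mon_eval x (\<alpha> + \<beta>) = mon_eval x \<alpha> * mon_eval x \<beta>"
proof -
  let ?S = "keys \<alpha> \<union> keys \<beta>"
  have "mon_eval x (\<alpha> + \<beta>) = (\<Prod>i\<in>?S. x i ^ lookup (\<alpha> + \<beta>) i)"
    by (intro mon_eval_superset) (auto simp: keys_add)
  also have "\<dots> = mon_eval x \<alpha> * mon_eval x \<beta>"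
    by (subst (1 2) mon_eval_superset[of ?S]) (auto simp: lookup_add power_add prod.distrib)
  finally show ?thesis .
qed

lemma poly_eval_mon: "poly_eval F x = (\<Sum>\<alpha>\<in>keys F. lookup F \<alpha> * mon_eval x \<alpha>)"
  by (simp add: poly_eval_def mon_eval_def)

lemma poly_eval_superset:
  assumes "finite S" "keys F \<subseteq> S"
  shows "poly_eval F x = (\<Sum>\<alpha>\<in>S. lookup F \<alpha> * mon_eval x \<alpha>)"
  unfolding poly_eval_mon using assms
  by (intro sum.mono_neutral_left) (auto simp: in_keys_iff)

lemma poly_eval_0 [simp]: "poly_eval 0 x = 0"
  by (simp add: poly_eval_def)

lemma poly_eval_single [simp]: "poly_eval (single \<alpha> c) x = c * mon_eval x \<alpha>"
  by (cases "c = 0") (simp_all add: poly_eval_mon)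

lemma poly_eval_1 [simp]: "poly_eval 1 x = 1"
  using poly_eval_single[of 0 1 x] by simp

lemma poly_eval_add [simp]: "poly_eval (F + G) x = poly_eval F x + poly_eval G x"
proof -
  let ?S = "keys F \<union> keys G"
  have "poly_eval (F + G) x = (\<Sum>\<alpha>\<in>?S. lookup (F + G) \<alpha> * mon_eval x \<alpha>)"
    by (intro poly_eval_superset) (auto simp: keys_add)
  also have "\<dots> = poly_eval F x + poly_eval G x"
    by (subst (1 2) poly_eval_superset[of ?S]) (auto simp: lookup_add algebra_simps sum.distrib)
  finally show ?thesis .
qed

lemma poly_eval_sum: "poly_eval (sum F A) x = (\<Sum>i\<in>A. poly_eval (F i) x)"
  by (induction A rule: infinite_finite_induct) auto

lemma cpoly_sum_monomials:
  fixes F :: cpoly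
  assumes "finite S" "keys F \<subseteq> S"
  shows "F = (\<Sum>\<alpha>\<in>S. single \<alpha> (lookup F \<alpha>))"
proof (rule poly_mapping_eqI)
  fix \<beta>
  have "lookup (\<Sum>\<alpha>\<in>S. single \<alpha> (lookup F \<alpha>)) \<beta> =
      (\<Sum>\<alpha>\<in>S. if \<alpha> = \<beta> then lookup F \<beta> else 0)"
    unfolding lookup_sum by (intro sum.cong) (auto simp: lookup_single when_def)
  also have "\<dots> = lookup F \<beta>"
    using assms by (auto simp: sum.delta' in_keys_iff subset_iff)
  finally show "lookup F \<beta> = lookup (\<Sum>\<alpha>\<in>S. single \<alpha> (lookup F \<alpha>)) \<beta>" ..
qed

lemma cpoly_mult_expand:
  fixes F G :: cpoly
  shows "F * G = (\<Sum>\<alpha>\<in>keys F. \<Sum>\<beta>\<in>keys G.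
     single (\<alpha> + \<beta>) (lookup F \<alpha> * lookup G \<beta>))"
proof -
  have "F * G = (\<Sum>\<alpha>\<in>keys F. single \<alpha> (lookup F \<alpha>)) *
      (\<Sum>\<beta>\<in>keys G. single \<beta> (lookup G \<beta>))"
    using cpoly_sum_monomials[OF finite_keys order_refl, of F] cpoly_sum_monomials[OF finite_keys order_refl, of G] by simp
  then show ?thesis by (simp add: sum_product mult_single)
qed

lemma poly_eval_mult [simp]: "poly_eval (F * G) x = poly_eval F x * poly_eval G x"
  unfolding cpoly_mult_expand poly_eval_sum poly_eval_single mon_eval_add
  unfolding poly_eval_mon[of F] poly_eval_mon[of G] sum_product by (simp add: mult_ac)

lemma poly_eval_power [simp]: "poly_eval (F ^ n) x = poly_eval F x ^ n"
  by (induction n) auto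

lemma poly_eval_prod: "poly_eval (prod F A) x = (\<Prod>i\<in>A. poly_eval (F i) x)"
  by (induction A rule: infinite_finite_induct) auto

definition var :: "nat \<Rightarrow> cpoly" where "var i = single (single i 1) 1"

lemma poly_eval_var [simp]: "poly_eval (var i) x = x i"
  by (simp add: var_def mon_eval_def)

lemma poly_eval_subst: "poly_eval (poly_subst F \<psi>) x = poly_eval F (\<lambda>i. poly_eval (\<psi> i) x)"
  unfolding poly_subst_def poly_eval_sum poly_eval_mult poly_eval_single poly_eval_prod poly_eval_power
  by (simp add: poly_eval_def[of F])

definition vars_below :: "nat \<Rightarrow> cpoly \<Rightarrow> bool" where
  "vars_below n F \<longleftrightarrow> (\<forall>\<alpha>\<in>keys F. keys \<alpha> \<subseteq> {..<n})"

lemma poly_eval_cong: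
  assumes "vars_below n F" "\<And>i. i < n \<Longrightarrow> x i = y i" shows "poly_eval F x = poly_eval F y"
  unfolding poly_eval_mon
proof (intro sum.cong refl)
  fix \<alpha> assume "\<alpha> \<in> keys F"
  then have "keys \<alpha> \<subseteq> {..<n}" using assms by (auto simp: vars_below_def)
  then have "mon_eval x \<alpha> = mon_eval y \<alpha>" unfolding mon_eval_def using assms(2)
    by (intro prod.cong refl) auto
  then show "lookup F \<alpha> * mon_eval x \<alpha> = lookup F \<alpha> * mon_eval y \<alpha>" by simp
qed

lemma homogeneous_vars_below: "homogeneous N e F \<Longrightarrow> vars_below (Suc N) F"
  unfolding homogeneous_def vars_below_def lessThan_Suc_atMost by blast

lemma mon_eval_scale: "mon_eval (\<lambda>i. c * x i) \<alpha> = c ^ monomial_degree \<alpha> * mon_eval x \<alpha>"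
  by (simp add: mon_eval_def monomial_degree_def power_mult_distrib prod.distrib power_sum)

lemma poly_eval_scale:
  assumes "homogeneous N e F" shows "poly_eval F (\<lambda>i. c * x i) = c ^ e * poly_eval F x"
  unfolding poly_eval_mon sum_distrib_left mon_eval_scale
  using assms by (intro sum.cong) (auto simp: homogeneous_def)

lemma divisor_degree_homogeneous:
  assumes "homogeneous N e F" "F \<noteq> 0" shows "divisor_degree F = e"
proof -
  have "monomial_degree ` keys F = {e}"
  proof -
    obtain \<alpha> where "\<alpha> \<in> keys F"
      using assms(2) poly_mapping_eqI[of F 0] by (auto simp: in_keys_iff)
    then show ?thesis using assms(1) by (auto simp: homogeneous_def image_iff)
  qed
  then show ?thesis by (simp add: divisor_degree_def)
qed

lemma effective_divisor_homogeneous: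
  assumes "effective_divisor N L F" shows "homogeneous N (divisor_degree F) F" "F \<noteq> 0" "coeffs_in L F"
  using assms divisor_degree_homogeneous by (auto simp: effective_divisor_def)

context csubfield
begin

lemma mon_eval_in: "(\<And>i. i \<in> keys \<alpha> \<Longrightarrow> x i \<in> F) \<Longrightarrow> mon_eval x \<alpha> \<in> F"
  unfolding mon_eval_def by (intro prod_in power_in)

lemma poly_eval_in:
  assumes "coeffs_in F P" "vars_below n P" "\<And>i. i < n \<Longrightarrow> x i \<in> F" shows "poly_eval P x \<in> F"
  unfolding poly_eval_mon using assms
  by (intro sum_in mult_in mon_eval_in) (auto simp: coeffs_in_def vars_below_def)

lemma coeffs_in_0 [simp]: "coeffs_in F 0" by (auto simp: coeffs_in_def)
lemma coeffs_in_single [simp]: "coeffs_in F (single \<alpha> c) \<longleftrightarrow> c \<in> F"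
  by (auto simp: coeffs_in_def lookup_single when_def)
lemma coeffs_in_1 [simp]: "coeffs_in F 1" using coeffs_in_single[of 0 1] by simp
lemma coeffs_in_add: "coeffs_in F P \<Longrightarrow> coeffs_in F Q \<Longrightarrow> coeffs_in F (P + Q)"
  by (auto simp: coeffs_in_def lookup_add)
lemma coeffs_in_diff: "coeffs_in F P \<Longrightarrow> coeffs_in F Q \<Longrightarrow> coeffs_in F (P - Q)"
  by (auto simp: coeffs_in_def lookup_minus)
lemma coeffs_in_sum: "(\<And>i. i \<in> A \<Longrightarrow> coeffs_in F (P i)) \<Longrightarrow> coeffs_in F (sum P A)"
  by (induction A rule: infinite_finite_induct) (auto simp: coeffs_in_add)
lemma coeffs_in_mult: "coeffs_in F P \<Longrightarrow> coeffs_in F Q \<Longrightarrow> coeffs_in F (P * Q)"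
  unfolding cpoly_mult_expand by (intro coeffs_in_sum) (auto simp: coeffs_in_def[of F P] coeffs_in_def[of F Q])

end

lemma vars_below_0 [simp]: "vars_below n 0" by (simp add: vars_below_def)
lemma vars_below_single: "keys \<alpha> \<subseteq> {..<n} \<Longrightarrow> vars_below n (single \<alpha> c)"
  by (auto simp: vars_below_def split: if_splits)
lemma vars_below_1 [simp]: "vars_below n 1" using vars_below_single[of 0 n 1] by simp
lemma vars_below_add: "vars_below n P \<Longrightarrow> vars_below n Q \<Longrightarrow> vars_below n (P + Q)"
  using keys_add[of P Q] unfolding vars_below_def by blast
lemma vars_below_diff: "vars_below n P \<Longrightarrow> vars_below n Q \<Longrightarrow> vars_below n (P - Q)"
  using vars_below_add[of n P "- Q"] by (simp add: vars_below_def)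
lemma vars_below_sum: "(\<And>i. i \<in> A \<Longrightarrow> vars_below n (P i)) \<Longrightarrow> vars_below n (sum P A)"
  by (induction A rule: infinite_finite_induct) (auto simp: vars_below_add)
lemma vars_below_mult: "vars_below n P \<Longrightarrow> vars_below n Q \<Longrightarrow> vars_below n (P * Q)"
  unfolding cpoly_mult_expand
proof (intro vars_below_sum vars_below_single)
  fix \<alpha> \<beta> assume "vars_below n P" "vars_below n Q" "\<alpha> \<in> keys P" "\<beta> \<in> keys Q"
  then show "keys (\<alpha> + \<beta>) \<subseteq> {..<n}"
    using keys_add[of \<alpha> \<beta>] unfolding vars_below_def by blast
qed

text \<open>The linear order on monomials is compatible with addition, so only the largest monomials
  of \<open>P\<close> and \<open>Q\<close> contribute to the monomial \<open>a + b\<close>.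
  Properties of a product can thus be passed on to a cofactor.\<close>

lemma lookup_mult_Max:
  fixes P Q :: cpoly
  assumes "P \<noteq> 0" "Q \<noteq> 0"
  defines "a \<equiv> Max (keys P)" and "b \<equiv> Max (keys Q)"
  shows "lookup (P * Q) (a + b) = lookup P a * lookup Q b"
    "a \<in> keys P" "b \<in> keys Q"
proof -
  have ne: "keys P \<noteq> {}" "keys Q \<noteq> {}" using assms by auto
  show aP: "a \<in> keys P" and bQ: "b \<in> keys Q"
    unfolding a_def b_def using ne by (auto intro: Max_in)
  have le: "\<alpha> \<le> a" "\<beta> \<le> b" if "\<alpha> \<in> keys P" "\<beta> \<in> keys Q" for \<alpha> \<beta>
    unfolding a_def b_def using that by (auto intro: Max_ge)
  have uniq: "\<alpha> + \<beta> = a + b \<longleftrightarrow> \<alpha> = a \<and> \<beta> = b"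
    if "\<alpha> \<in> keys P" "\<beta> \<in> keys Q" for \<alpha> \<beta>
  proof
    assume eq: "\<alpha> + \<beta> = a + b"
    have "\<alpha> = a"
    proof (rule ccontr)
      assume "\<alpha> \<noteq> a"
      then have "\<alpha> < a" using le[OF that] by simp
      then have "\<alpha> + \<beta> < a + b" using le[OF that] by (intro add_less_le_mono)
      then show False using eq by simp
    qed
    then show "\<alpha> = a \<and> \<beta> = b" using eq by simp
  qed simp
  have "lookup (P * Q) (a + b) = (\<Sum>\<alpha>\<in>keys P. \<Sum>\<beta>\<in>keys Q.
     if \<alpha> = a then (if \<beta> = b then lookup P \<alpha> * lookup Q \<beta> else 0) else 0)"
    unfolding cpoly_mult_expand lookup_sum
    by (intro sum.cong refl) (auto simp: lookup_single when_def uniq)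
  also have "\<dots> = (\<Sum>\<alpha>\<in>keys P. if \<alpha> = a then lookup P \<alpha> * lookup Q b else 0)"
    using bQ by (intro sum.cong refl) (simp add: sum.delta')
  also have "\<dots> = lookup P a * lookup Q b"
    using aP by simp
  finally show "lookup (P * Q) (a + b) = lookup P a * lookup Q b" .
qed

lemma cpoly_split:
  fixes Q :: cpoly
  obtains Q1 Q2 where "Q = Q1 + Q2"
    "\<And>\<beta>. lookup Q1 \<beta> = (if R \<beta> then lookup Q \<beta> else 0)"
    "\<And>\<beta>. lookup Q2 \<beta> = (if R \<beta> then 0 else lookup Q \<beta>)"
proof -
  define Q1 where "Q1 = (\<Sum>\<alpha> | \<alpha> \<in> keys Q \<and> R \<alpha>. single \<alpha> (lookup Q \<alpha>))"
  have look1: "lookup Q1 \<beta> = (if R \<beta> then lookup Q \<beta> else 0)" for \<beta>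
  proof -
    have "lookup Q1 \<beta> = (\<Sum>\<alpha> | \<alpha> \<in> keys Q \<and> R \<alpha>.
        if \<alpha> = \<beta> then lookup Q \<beta> else 0)"
      unfolding Q1_def lookup_sum by (intro sum.cong) (auto simp: lookup_single when_def)
    also have "\<dots> = (if R \<beta> then lookup Q \<beta> else 0)"
      by (subst sum.delta) (auto simp: in_keys_iff)
    finally show ?thesis .
  qed
  show ?thesis by (rule that[of Q1 "Q - Q1"]) (auto simp: look1 lookup_minus)
qed

text \<open>The terms of \<open>Q\<close> with coefficients outside \<open>F\<close> are collected
  in \<open>Q2\<close>. Since \<open>G * Q2\<close> is again over \<open>F\<close>, comparing
  leading coefficients would put the leading coefficient of a nonzero \<open>Q2\<close> into
  \<open>F\<close>.\<close>

lemma (in csubfield) coeffs_in_cofactor: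
  assumes E: "coeffs_in F (G * Q)" and G: "coeffs_in F G" "G \<noteq> 0"
  shows "coeffs_in F Q"
proof -
  obtain Q1 Q2 where Q: "Q = Q1 + Q2"
    and 1: "\<And>\<beta>. lookup Q1 \<beta> = (if lookup Q \<beta> \<in> F then lookup Q \<beta> else 0)"
    and 2: "\<And>\<beta>. lookup Q2 \<beta> = (if lookup Q \<beta> \<in> F then 0 else lookup Q \<beta>)"
    using cpoly_split[of Q "\<lambda>\<beta>. lookup Q \<beta> \<in> F"] by blast
  have Q1: "coeffs_in F Q1" by (auto simp: coeffs_in_def 1)
  have "Q2 = 0"
  proof (rule ccontr)
    assume "Q2 \<noteq> 0"
    note m = lookup_mult_Max[OF G(2) this]
    let ?a = "Max (keys G)" and ?b = "Max (keys Q2)"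
    have "G * Q2 = G * Q - G * Q1" by (simp add: Q algebra_simps)
    then have "coeffs_in F (G * Q2)" using E G Q1 by (simp add: coeffs_in_diff coeffs_in_mult)
    then have "lookup G ?a * lookup Q2 ?b \<in> F"
      unfolding m(1)[symmetric] by (simp add: coeffs_in_def)
    moreover have "lookup G ?a \<in> F" "lookup G ?a \<noteq> 0"
      using G m(2) by (auto simp: coeffs_in_def in_keys_iff)
    ultimately have "lookup Q2 ?b \<in> F"
      using divide_in[of "lookup G ?a * lookup Q2 ?b" "lookup G ?a"] by simp
    moreover have "lookup Q2 ?b \<noteq> 0" using m(3) by (simp add: in_keys_iff)
    ultimately show False using 2[of ?b] by (auto split: if_splits)
  qed
  then show ?thesis using Q1 by (simp add: Q)
qed

section \<open>Heights\<close>

definition hsum :: "complex set \<Rightarrow> ((complex \<Rightarrow> real) \<Rightarrow> real) \<Rightarrow> real" where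
  "hsum K g = (\<Sum>\<^sub>\<infinity>v\<in>places K. weight K v * g v)"

text \<open>The support is controlled by rational places: above each there are finitely many places
  of \<open>K\<close>, and the same \<open>U\<close> serves for the function pulled back to an
  extension field.\<close>

definition supp :: "complex set \<Rightarrow> (rat \<Rightarrow> real) set \<Rightarrow> ((complex \<Rightarrow> real) \<Rightarrow> real) \<Rightarrow> bool" where
  "supp K U g \<longleftrightarrow> finite U \<and> U \<subseteq> standard_rat_abs \<and> (\<forall>v\<in>places K. rat_place v \<notin> U \<longrightarrow> g v = 0)"

lemma supp_mono: "supp K U g \<Longrightarrow> U \<subseteq> U' \<Longrightarrow> finite U' \<Longrightarrow> U' \<subseteq> standard_rat_abs \<Longrightarrow> supp K U' g"
  unfolding supp_def by blast

lemma supp_Un: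
  assumes "supp K U g" "supp K U' h"
  shows "supp K (U \<union> U') g" "supp K (U \<union> U') h"
  using assms unfolding supp_def by auto

lemma infsum_finite_support:
  fixes g :: "'a \<Rightarrow> 'b :: {comm_monoid_add, t2_space}"
  assumes "finite F" "F \<subseteq> A" "\<And>x. x \<in> A - F \<Longrightarrow> g x = 0"
  shows "infsum g A = sum g F"
proof -
  have "infsum g A = infsum g F" using assms by (intro infsum_cong_neutral) auto
  then show ?thesis using assms(1) by (simp add: infsum_finite)
qed

definition mx :: "nat \<Rightarrow> (complex \<Rightarrow> real) \<Rightarrow> (nat \<Rightarrow> complex) \<Rightarrow> real" where
  "mx N v x = Max ((\<lambda>i. v (x i)) ` {..N})"

lemma mx_ge: "i \<le> N \<Longrightarrow> v (x i) \<le> mx N v x"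
  unfolding mx_def by (intro Max_ge) auto

lemma mx_attained: obtains i where "i \<le> N" "mx N v x = v (x i)"
proof -
  have "mx N v x \<in> (\<lambda>i. v (x i)) ` {..N}" unfolding mx_def by (intro Max_in) auto
  then show ?thesis using that by auto
qed

lemma mx_leI: "(\<And>i. i \<le> N \<Longrightarrow> v (x i) \<le> B) \<Longrightarrow> mx N v x \<le> B"
  by (metis mx_attained)

lemma coord_vectorsD:
  assumes "x \<in> coord_vectors N L"
  shows "i \<le> N \<Longrightarrow> x i \<in> L" "i > N \<Longrightarrow> x i = 0" "\<exists>i\<le>N. x i \<noteq> 0"
  using assms by (auto simp: coord_vectors_def) (meson leI)

lemma coord_vectors_mono: "K \<subseteq> L \<Longrightarrow> coord_vectors N K \<subseteq> coord_vectors N L"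
  by (auto simp: coord_vectors_def)

lemma proj_pointI: "c \<noteq> 0 \<Longrightarrow> (\<lambda>i. c * x i) \<in> proj_point x"
  by (auto simp: proj_point_def)

lemma proj_point_self: "x \<in> proj_point x"
  using proj_pointI[of 1 x] by simp

lemma proj_point_scale: "c \<noteq> 0 \<Longrightarrow> proj_point (\<lambda>i. c * x i) = proj_point x"
proof (intro equalityI subsetI)
  fix y assume c: "c \<noteq> 0" and "y \<in> proj_point x"
  then obtain d where "d \<noteq> 0" "y = (\<lambda>i. d * x i)" by (auto simp: proj_point_def)
  then show "y \<in> proj_point (\<lambda>i. c * x i)" unfolding proj_point_def using c
    by (intro CollectI exI[of _ "d / c"]) auto
next
  fix y assume c: "c \<noteq> 0" and "y \<in> proj_point (\<lambda>i. c * x i)"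
  then obtain d where "d \<noteq> 0" "y = (\<lambda>i. d * (c * x i))" by (auto simp: proj_point_def)
  then show "y \<in> proj_point x" unfolding proj_point_def using c
    by (intro CollectI exI[of _ "d * c"]) (auto simp: mult.assoc)
qed

lemma representative_props:
  assumes "x \<in> coord_vectors N K"
  shows "representative N K (proj_point x) \<in> proj_point x"
    "representative N K (proj_point x) \<in> coord_vectors N K"
  using someI[of "\<lambda>y. y \<in> proj_point x \<and> y \<in> coord_vectors N K" x] assms proj_point_self
  by (auto simp: representative_def)

lemma (in csubfield) coord_vectors_ratio:
  assumes "x \<in> coord_vectors N F" "y \<in> coord_vectors N F" "y \<in> proj_point x"
  obtains c where "c \<noteq> 0" "c \<in> F" "y = (\<lambda>i. c * x i)"
proof -
  obtain c where c: "c \<noteq> 0" "y = (\<lambda>i. c * x i)" using assms(3) by (auto simp: proj_point_def)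
  obtain i where i: "i \<le> N" "x i \<noteq> 0" using coord_vectorsD(3)[OF assms(1)] by blast
  have "c = y i / x i" using c i by simp
  then have "c \<in> F" using coord_vectorsD(1)[OF assms(1) i(1)] coord_vectorsD(1)[OF assms(2) i(1)] by auto
  then show ?thesis using that c by blast
qed

lemma Max_powr:
  assumes "finite A" "A \<noteq> {}" "\<And>t. t \<in> A \<Longrightarrow> t \<ge> 0" "w \<ge> (0::real)"
  shows "Max ((\<lambda>t. t powr w) ` A) = Max A powr w"
proof (rule Max_eqI)
  show "finite ((\<lambda>t. t powr w) ` A)" using assms by simp
  show "y \<le> Max A powr w" if "y \<in> (\<lambda>t. t powr w) ` A" for y
    using that assms by (auto intro!: powr_mono2)
  show "Max A powr w \<in> (\<lambda>t. t powr w) ` A" using assms(1,2) by (intro imageI Max_in)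
qed

section \<open>Weighted sums over places and heights of coordinate vectors\<close>

context numfield
begin

lemma hsum_finite:
  assumes "supp K U g"
  shows "hsum K g = (\<Sum>v\<in>places_over K U. weight K v * g v)"
  unfolding hsum_def using assms finite_places_over
  by (intro infsum_finite_support) (auto simp: supp_def places_over_def)

lemma hsum_conjs:
  assumes "supp K U g"
  shows "hsum K g = (\<Sum>u\<in>U. \<Sum>b\<in>conjs. g (place_of u b)) / real (degree f)"
  using hsum_finite[OF assms] sum_places_over[of U g] assms by (simp add: supp_def)

lemma hsum_add:
  assumes "supp K U g" "supp K U h"
  shows "hsum K (\<lambda>v. g v + h v) = hsum K g + hsum K h"
proof -
  have "supp K U (\<lambda>v. g v + h v)" using assms by (auto simp: supp_def)
  then show ?thesis using assms by (simp add: hsum_finite distrib_left sum.distrib)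
qed

lemma hsum_cmult:
  assumes "supp K U g"
  shows "hsum K (\<lambda>v. c * g v) = c * hsum K g"
proof -
  have "supp K U (\<lambda>v. c * g v)" using assms by (auto simp: supp_def)
  then show ?thesis using assms by (simp add: hsum_finite sum_distrib_left mult_ac)
qed

lemma hsum_mono:
  assumes "supp K U g" "supp K U h" "\<And>v. v \<in> places K \<Longrightarrow> g v \<le> h v"
  shows "hsum K g \<le> hsum K h"
  unfolding hsum_finite[OF assms(1)] hsum_finite[OF assms(2)]
  using assms(3) by (intro sum_mono mult_left_mono less_imp_le[OF weight_pos]) (auto simp: places_over_def)

lemma hsum_cong: "(\<And>v. v \<in> places K \<Longrightarrow> g v = h v) \<Longrightarrow> hsum K g = hsum K h"
  unfolding hsum_def by (intro infsum_cong) auto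

lemma supp_ln:
  assumes "good K Y U" "y \<in> Y" "y \<noteq> 0"
  shows "supp K U (\<lambda>v. ln (v y))"
  unfolding supp_def
proof (intro conjI ballI impI goodD(1,2)[OF assms(1)])
  fix v assume "v \<in> places K" "rat_place v \<notin> U"
  then have "v y = 1" by (rule goodD(4)[OF assms])
  then show "ln (v y) = 0" by simp
qed

lemma hsum_product_formula:
  assumes "y \<in> K" "y \<noteq> 0"
  shows "hsum K (\<lambda>v. ln (v y)) = 0"
proof -
  obtain U where U: "good K {y} U" using good_exists_single assms(1) by blast
  show ?thesis
    using hsum_finite[OF supp_ln[OF U _ assms(2)]] product_formula[OF assms U] by simp
qed

lemma mx_pos:
  assumes "v \<in> places K" "z \<in> coord_vectors N K"
  shows "mx N v z > 0"
proof -
  interpret v: absval K v by (rule absval_place[OF assms(1)])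
  obtain i where i: "i \<le> N" "z i \<noteq> 0" using coord_vectorsD(3)[OF assms(2)] by blast
  have "0 < v (z i)" using v.pos i coord_vectorsD(1)[OF assms(2)] by blast
  also have "\<dots> \<le> mx N v z" by (rule mx_ge[OF i(1)])
  finally show ?thesis .
qed

lemma mx_scale:
  assumes "v \<in> places K" "z \<in> coord_vectors N K" "c \<in> K"
  shows "mx N v (\<lambda>i. c * z i) = v c * mx N v z"
proof -
  interpret v: absval K v by (rule absval_place[OF assms(1)])
  have m: "v (c * z i) = v c * v (z i)" if "i \<le> N" for i
    using assms(3) coord_vectorsD(1)[OF assms(2) that] by (rule v.mult)
  show ?thesis
  proof (rule antisym)
    show "mx N v (\<lambda>i. c * z i) \<le> v c * mx N v z"
      using assms(3) by (intro mx_leI) (auto simp: m intro!: mult_left_mono mx_ge)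
    obtain i where i: "i \<le> N" "mx N v z = v (z i)" by (rule mx_attained)
    show "v c * mx N v z \<le> mx N v (\<lambda>i. c * z i)"
      unfolding i(2) m[OF i(1), symmetric] using mx_ge[OF i(1), of v "\<lambda>i. c * z i"] .
  qed
qed

lemma mx_one:
  assumes "good K (z ` {..N}) U" "v \<in> places K" "rat_place v \<notin> U" "z \<in> coord_vectors N K"
  shows "mx N v z = 1"
proof -
  interpret v: absval K v by (rule absval_place[OF assms(2)])
  have 1: "v (z i) = 1" if "i \<le> N" "z i \<noteq> 0" for i
    using goodD(4)[OF assms(1) _ _ assms(2,3)] that by auto
  obtain j where j: "j \<le> N" "z j \<noteq> 0" using coord_vectorsD(3)[OF assms(4)] by blast
  have le: "v (z i) \<le> 1" if "i \<le> N" for i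
    using 1[OF that] by (cases "z i = 0") auto
  show ?thesis using mx_ge[OF j(1), of v z] 1[OF j] mx_leI[of N v z 1] le by fastforce
qed

lemma good_coords: "z \<in> coord_vectors N K \<Longrightarrow> \<exists>U. good K (z ` {..N}) U"
  by (intro good_exists) (auto dest: coord_vectorsD)

lemma supp_mx:
  assumes "z \<in> coord_vectors N K" "good K (z ` {..N}) U"
  shows "supp K U (\<lambda>v. ln (mx N v z))"
  using assms mx_one[OF assms(2)] by (auto simp: supp_def good_def)

definition height :: "nat \<Rightarrow> (nat \<Rightarrow> complex) \<Rightarrow> real" where
  "height N z = hsum K (\<lambda>v. ln (mx N v z))"

lemma height_scale:
  assumes "z \<in> coord_vectors N K" "c \<in> K" "c \<noteq> 0"
  shows "height N (\<lambda>i. c * z i) = height N z"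
proof -
  obtain U where U: "good K (insert c (z ` {..N})) U"
    using good_exists[of "insert c (z ` {..N})"] assms coord_vectorsD(1)[OF assms(1)] by auto
  have g: "good K (z ` {..N}) U" using good_mono[OF U _ order_refl] U by (auto simp: good_def)
  have "height N (\<lambda>i. c * z i) = hsum K (\<lambda>v. ln (v c) + ln (mx N v z))"
    unfolding height_def
  proof (rule hsum_cong)
    fix v assume v: "v \<in> places K"
    interpret v: absval K v by (rule absval_place[OF v])
    show "ln (mx N v (\<lambda>i. c * z i)) = ln (v c) + ln (mx N v z)"
      unfolding mx_scale[OF v assms(1,2)] using v.pos[OF assms(2,3)] mx_pos[OF v assms(1)] by (simp add: ln_mult)
  qed
  also have "\<dots> = hsum K (\<lambda>v. ln (v c)) + height N z"
    unfolding height_def using supp_ln[OF U _ assms(3)] supp_mx[OF assms(1) g] by (intro hsum_add) auto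
  finally show ?thesis using hsum_product_formula[OF assms(2,3)] by simp
qed

lemma weil_height_eq:
  assumes "z \<in> coord_vectors N K"
  shows "weil_height N K (proj_point z) = height N z"
proof -
  define r where "r = representative N K (proj_point z)"
  have r: "r \<in> proj_point z" "r \<in> coord_vectors N K" using representative_props[OF assms] by (auto simp: r_def)
  obtain c where c: "c \<noteq> 0" "c \<in> K" "r = (\<lambda>i. c * z i)" using K.coord_vectors_ratio[OF assms r(2,1)] .
  have "weil_height N K (proj_point z) = height N r"
    unfolding weil_height_def height_def hsum_def r_def[symmetric]
  proof (rule infsum_cong)
    fix v assume v: "v \<in> places K"
    interpret v: absval K v by (rule absval_place[OF v])
    have "Max ((\<lambda>i. place_abs K v (r i)) ` {..N}) = Max ((\<lambda>t. t powr weight K v) ` ((\<lambda>i. v (r i)) ` {..N}))"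
      by (simp add: image_image place_abs_def weight_def)
    also have "\<dots> = mx N v r powr weight K v"
      unfolding mx_def using coord_vectorsD(1)[OF r(2)] weight_pos[OF v] by (intro Max_powr) auto
    finally show "ln (Max ((\<lambda>i. place_abs K v (r i)) ` {..N})) = weight K v * ln (mx N v r)"
      using mx_pos[OF v r(2)] by (simp add: ln_powr)
  qed
  then show ?thesis using height_scale[OF assms c(2,1)] c(3) by simp
qed

text \<open>The local height of a coordinate vector, without the weight. It is real-valued and hence
  meaningful only where \<open>F\<close> does not vanish.\<close>

definition lheight :: "nat \<Rightarrow> (complex \<Rightarrow> real) \<Rightarrow> cpoly \<Rightarrow> (nat \<Rightarrow> complex) \<Rightarrow> real" where
  "lheight N v F z = real (divisor_degree F) * ln (mx N v z) - ln (v (poly_eval F z))"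

lemma poly_eval_K:
  assumes "homogeneous N e F" "coeffs_in K F" "z \<in> coord_vectors N K"
  shows "poly_eval F z \<in> K"
  using K.poly_eval_in[OF assms(2) homogeneous_vars_below[OF assms(1)]] coord_vectorsD(1)[OF assms(3)]
  by (simp add: less_Suc_eq_le)

lemma place_val_eq:
  assumes "v \<in> places K" "y \<in> K" "y \<noteq> 0"
  shows "place_val K v y = ereal (- (weight K v * ln (v y)))"
  using absval.pos[OF absval_place[OF assms(1)] assms(2,3)] assms(3)
  by (simp add: place_val_def place_abs_def weight_def ln_powr)

lemma Min_place_val:
  assumes "v \<in> places K" "z \<in> coord_vectors N K"
  shows "Min ((\<lambda>i. place_val K v (z i)) ` {..N}) = ereal (- (weight K v * ln (mx N v z)))"
proof (rule Min_eqI)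
  interpret v: absval K v by (rule absval_place[OF assms(1)])
  show "finite ((\<lambda>i. place_val K v (z i)) ` {..N})" by simp
  fix y assume "y \<in> (\<lambda>i. place_val K v (z i)) ` {..N}"
  then obtain i where i: "i \<le> N" "y = place_val K v (z i)" by auto
  show "ereal (- (weight K v * ln (mx N v z))) \<le> y"
  proof (cases "z i = 0")
    case False
    have xi: "z i \<in> K" using coord_vectorsD(1)[OF assms(2) i(1)] .
    have "ln (v (z i)) \<le> ln (mx N v z)" using mx_ge[OF i(1), of v z] v.pos[OF xi False] by simp
    then have "weight K v * ln (v (z i)) \<le> weight K v * ln (mx N v z)"
      using weight_pos[OF assms(1)] by (intro mult_left_mono) auto
    then show ?thesis using i(2) place_val_eq[OF assms(1) xi False] by simp
  qed (use i in \<open>simp add: place_val_def\<close>)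
next
  interpret v: absval K v by (rule absval_place[OF assms(1)])
  obtain i where i: "i \<le> N" "mx N v z = v (z i)" by (rule mx_attained)
  have "z i \<noteq> 0" using mx_pos[OF assms] i(2) by auto
  then have "place_val K v (z i) = ereal (- (weight K v * ln (mx N v z)))"
    using place_val_eq[OF assms(1) coord_vectorsD(1)[OF assms(2) i(1)]] i(2) by simp
  then show "ereal (- (weight K v * ln (mx N v z))) \<in> (\<lambda>i. place_val K v (z i)) ` {..N}"
    using i(1) by (intro image_eqI[of _ _ i]) auto
qed

lemma local_height_eq:
  assumes v: "v \<in> places K" and z: "z \<in> coord_vectors N K"
    and F: "homogeneous N (divisor_degree F) F" "coeffs_in K F"
  shows "local_height N K v F (proj_point z) =
     (if poly_eval F z = 0 then \<infinity> else ereal (weight K v * lheight N v F z))"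
proof -
  interpret v: absval K v by (rule absval_place[OF v])
  define r where "r = representative N K (proj_point z)"
  have r: "r \<in> proj_point z" "r \<in> coord_vectors N K" using representative_props[OF z] by (auto simp: r_def)
  obtain c where c: "c \<noteq> 0" "c \<in> K" "r = (\<lambda>i. c * z i)" using K.coord_vectors_ratio[OF z r(2,1)] .
  have ev: "poly_eval F r = c ^ divisor_degree F * poly_eval F z"
    unfolding c(3) by (rule poly_eval_scale[OF F(1)])
  have FK: "poly_eval F z \<in> K" by (rule poly_eval_K[OF F z])
  show ?thesis
  proof (cases "poly_eval F z = 0")
    case True
    then show ?thesis unfolding local_height_def r_def[symmetric] Min_place_val[OF v r(2)]
      by (simp add: ev place_val_def)
  next
    case False
    have "ln (v (poly_eval F r)) = real (divisor_degree F) * ln (v c) + ln (v (poly_eval F z))"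
    proof -
      have "v (poly_eval F r) = v c ^ divisor_degree F * v (poly_eval F z)"
        unfolding ev using c FK by (simp add: v.mult v.power K.power_in)
      then show ?thesis using v.pos[OF c(2,1)] v.pos[OF FK False] by (simp add: ln_mult ln_realpow)
    qed
    moreover have "ln (mx N v r) = ln (v c) + ln (mx N v z)"
      unfolding c(3) mx_scale[OF v z c(2)] using v.pos[OF c(2,1)] mx_pos[OF v z] by (simp add: ln_mult)
    moreover have "poly_eval F r \<in> K" "poly_eval F r \<noteq> 0"
    proof -
      show "poly_eval F r \<in> K" by (rule poly_eval_K[OF F r(2)])
      show "poly_eval F r \<noteq> 0" unfolding ev using False c(1) by simp
    qed
    ultimately show ?thesis
      unfolding local_height_def r_def[symmetric] Min_place_val[OF v r(2)]
      using False by (simp add: place_val_eq[OF v] lheight_def algebra_simps)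
  qed
qed

lemma supp_lheight:
  assumes z: "z \<in> coord_vectors N K" and "good K (insert (poly_eval F z) (z ` {..N})) U" "poly_eval F z \<noteq> 0"
  shows "supp K U (\<lambda>v. lheight N v F z)"
proof -
  have g: "good K (z ` {..N}) U" using good_mono[OF assms(2) _ order_refl] assms(2) by (auto simp: good_def)
  show ?thesis using supp_mx[OF z g] supp_ln[OF assms(2) _ assms(3)]
    by (auto simp: supp_def lheight_def)
qed

text \<open>By the product formula the terms \<open>ln (v (poly_eval F z))\<close> sum to
  zero.\<close>

lemma hsum_lheight:
  assumes z: "z \<in> coord_vectors N K" and F: "homogeneous N e F" "coeffs_in K F" and nz: "poly_eval F z \<noteq> 0"
  shows "hsum K (\<lambda>v. lheight N v F z) = real (divisor_degree F) * height N z"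
proof -
  have FK: "poly_eval F z \<in> K" by (rule poly_eval_K[OF F z])
  obtain U where U: "good K (insert (poly_eval F z) (z ` {..N})) U"
    using good_exists[of "insert (poly_eval F z) (z ` {..N})"] FK coord_vectorsD(1)[OF z] by auto
  have g: "good K (z ` {..N}) U" using good_mono[OF U _ order_refl] U by (auto simp: good_def)
  note s1 = supp_mx[OF z g] and s2 = supp_ln[OF U _ nz, OF insertI1]
  have s1': "supp K U (\<lambda>v. real (divisor_degree F) * ln (mx N v z))" using s1 by (auto simp: supp_def)
  have s2': "supp K U (\<lambda>v. (- 1) * ln (v (poly_eval F z)))" using s2 by (auto simp: supp_def)
  have "hsum K (\<lambda>v. lheight N v F z) =
      hsum K (\<lambda>v. real (divisor_degree F) * ln (mx N v z) + (- 1) * ln (v (poly_eval F z)))"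
    by (rule hsum_cong) (simp add: lheight_def)
  also have "\<dots> = real (divisor_degree F) * height N z"
    unfolding hsum_add[OF s1' s2'] hsum_cmult[OF s1] hsum_cmult[OF s2] height_def
    using hsum_product_formula[OF FK nz] by simp
  finally show ?thesis .
qed

end

section \<open>Independence of the field\<close>

context numfield_ext
begin

lemma restrict_place_of:
  assumes "b \<in> B.conjs" shows "restrict (B.place_of u b) K = A.place_of u (res b)"
  using sub emb_res[OF assms] by (auto simp: B.place_of_def A.place_of_def restrict_def fun_eq_iff)

lemma rat_place_restrict: "rat_place (restrict w K) = rat_place w"
  by (auto simp: rat_place_def fun_eq_iff)

lemma restrict_in_places:
  assumes "w \<in> places L" shows "restrict w K \<in> places K"
proof -
  obtain b where b: "b \<in> B.conjs" "w = B.place_of (rat_place w) b" using B.place_obtain[OF assms] .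
  have "restrict (B.place_of (rat_place w) b) K \<in> places K"
    unfolding restrict_place_of[OF b(1)]
    using A.place_of_in[OF B.rat_place_std[OF assms] res_conj[OF b(1)]] .
  then show ?thesis using b(2) by simp
qed

lemma supp_restrict: "supp K U h \<Longrightarrow> supp L U (\<lambda>w. h (restrict w K))"
  using restrict_in_places by (auto simp: supp_def rat_place_restrict)

text \<open>Both sides are averages over embeddings, and every embedding of \<open>K\<close> extends
  to \<open>L\<close> in the same number of ways, namely \<open>degree g / degree f\<close>.\<close>

lemma hsum_restrict:
  assumes "supp K U h"
  shows "hsum L (\<lambda>w. h (restrict w K)) = hsum K h"
proof -
  have inner: "(\<Sum>b\<in>B.conjs. h (restrict (B.place_of u b) K)) / real (degree g) =
      (\<Sum>a\<in>A.conjs. h (A.place_of u a)) / real (degree f)" for u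
  proof -
    have "(\<Sum>b\<in>B.conjs. h (restrict (B.place_of u b) K)) = (\<Sum>b\<in>B.conjs. h (A.place_of u (res b)))"
      by (intro sum.cong) (auto simp: restrict_place_of)
    also have "\<dots> = (\<Sum>a\<in>A.conjs. \<Sum>b | b \<in> B.conjs \<and> res b = a. h (A.place_of u (res b)))"
      using res_conj A.finite_conjs B.finite_conjs by (intro sum.group[symmetric]) auto
    also have "\<dots> = (\<Sum>a\<in>A.conjs. real (card {b \<in> B.conjs. res b = a}) * h (A.place_of u a))"
      by (intro sum.cong) auto
    also have "\<dots> = (\<Sum>a\<in>A.conjs. real (degree g) / real (degree f) * h (A.place_of u a))"
    proof (intro sum.cong refl)
      fix a assume "a \<in> A.conjs"
      then have "card {b \<in> B.conjs. res b = a} * degree f = degree g" by (rule fiber_card)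
      then have "real (card {b \<in> B.conjs. res b = a}) * real (degree f) = real (degree g)"
        by (metis of_nat_mult)
      then show "real (card {b \<in> B.conjs. res b = a}) * h (A.place_of u a) =
          real (degree g) / real (degree f) * h (A.place_of u a)"
        using A.degree_pos by (simp add: field_simps)
    qed
    also have "\<dots> = real (degree g) / real (degree f) * (\<Sum>a\<in>A.conjs. h (A.place_of u a))"
      by (rule sum_distrib_left[symmetric])
    finally show ?thesis using B.degree_pos A.degree_pos by simp
  qed
  show ?thesis
    unfolding B.hsum_conjs[OF supp_restrict[OF assms]] A.hsum_conjs[OF assms]
    using inner by (simp add: sum_divide_distrib)
qed

lemma mx_restrict: "z \<in> coord_vectors N K \<Longrightarrow> mx N (restrict w K) z = mx N w z"
  unfolding mx_def by (intro arg_cong[of _ _ Max] image_cong) (auto dest: coord_vectorsD)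

lemma height_ext:
  assumes "z \<in> coord_vectors N K" shows "B.height N z = A.height N z"
proof -
  obtain U where "good K (z ` {..N}) U" using A.good_coords[OF assms] by blast
  then have "supp K U (\<lambda>v. ln (mx N v z))" by (rule A.supp_mx[OF assms])
  from hsum_restrict[OF this] show ?thesis
    by (simp add: A.height_def B.height_def mx_restrict[OF assms])
qed

end

lemma number_field_extension:
  assumes "number_field K" "finite Y" "Y \<subseteq> Qbar"
  obtains L where "number_field L" "K \<subseteq> L" "Y \<subseteq> L"
proof -
  interpret Q: csubfield \<rat> by (rule csubfield_Rats)
  obtain x f where "numfield K x f" using number_field_numfield[OF assms(1)] .
  then interpret numfield K x f .
  have "\<exists>z. algebraic_over \<rat> z \<and> insert x Y \<subseteq> adj \<rat> z"
    using Q.primitive_element_finite[of "insert x Y"] assms alg_x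
    by (auto simp: algebraic_over_Rats Qbar_def)
  then obtain z where z: "algebraic_over \<rat> z" "insert x Y \<subseteq> adj \<rat> z" by blast
  have "K \<subseteq> adj \<rat> z" unfolding K_eq
    using z Q.csubfield_adj[OF z(1)] csubfield.Rats_subset[OF Q.csubfield_adj[OF z(1)]]
    by (intro Q.adj_subset) auto
  then show ?thesis using that[of "adj \<rat> z"] number_field_adj z by (auto simp: algebraic_over_Rats)
qed

section \<open>Northcott's theorem\<close>

text \<open>The archimedean term bounds the absolute value of \<open>q\<close>, and the terms at the
  primes dividing the denominator add up to the logarithm of the denominator.\<close>

lemma finite_rat_bounded_height:
  "finite {q. \<forall>U. finite U \<longrightarrow> U \<subseteq> standard_rat_abs \<longrightarrow> (\<Sum>u\<in>U. ln (max 1 (u q))) \<le> B}" (is "finite ?R")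
proof -
  \<comment> \<open>The denominator is at most \<open>exp B\<close>; the numerator is the
    denominator times the absolute value of \<open>q\<close>, which is again at most
    \<open>exp B\<close>.\<close>
  define M where "M = \<lceil>exp B * exp B\<rceil>"
  have "?R \<subseteq> (\<lambda>(a, b). of_int a / of_int b) ` ({-M..M} \<times> {-M..M})"
  proof
    fix q assume q: "q \<in> ?R"
    obtain a b where ab: "quotient_of q = (a, b)" by fastforce
    have b0: "b > 0" and qab: "q = of_int a / of_int b" and cop: "coprime a b"
      using quotient_of_denom_pos[OF ab] quotient_of_div[OF ab] quotient_of_coprime[OF ab] by auto
    have "ln (max 1 (real_abs q)) \<le> B" using q real_abs_std by (auto dest!: spec[of _ "{real_abs}"])
    then have "exp (ln (max 1 (real_abs q))) \<le> exp B" by (simp only: exp_le_cancel_iff)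
    moreover have "max 1 (real_abs q) > 0" by simp
    ultimately have "max 1 (real_abs q) \<le> exp B" by (simp only: exp_ln)
    then have absq: "real_abs q \<le> exp B" and B1: "1 \<le> exp B" by auto
    define A where "A = prime_factors (nat b)"
    have inj: "inj_on padic_abs A" using padic_abs_inj by (auto simp: inj_on_def A_def in_prime_factors_iff)
    have "padic_abs ` A \<subseteq> standard_rat_abs" by (auto simp: standard_rat_abs_def A_def in_prime_factors_iff)
    then have "(\<Sum>u\<in>padic_abs ` A. ln (max 1 (u q))) \<le> B" using q by (auto simp: A_def)
    then have 1: "(\<Sum>p\<in>A. ln (max 1 (padic_abs p q))) \<le> B" by (simp add: sum.reindex[OF inj])
    have "ln (real (nat b)) = (\<Sum>p\<in>A. real (multiplicity p (nat b)) * ln (real p))"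
      using b0 by (intro ln_nat_prime_sum) (auto simp: A_def in_prime_factors_iff)
    also have "\<dots> \<le> (\<Sum>p\<in>A. ln (max 1 (padic_abs p q)))"
    proof (rule sum_mono)
      fix p assume p: "p \<in> A"
      then have pr: "Factorial_Ring.prime p" and dv: "p dvd nat b" by (auto simp: A_def in_prime_factors_iff)
      have "\<not> int p dvd a"
      proof
        assume "int p dvd a"
        moreover have "int p dvd b" using dv b0 by (metis int_dvd_int_iff int_nat_eq less_imp_le)
        ultimately have "is_unit (int p)" using cop coprime_common_divisor by blast
        then show False using prime_gt_1_nat[OF pr] by simp
      qed
      then have "q \<noteq> 0" "multiplicity (int p) a = 0" using qab b0 by (auto simp: not_dvd_imp_multiplicity_0)
      then have "padic_abs p q = real p ^ multiplicity p (nat b)"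
        using multiplicity_int_nat[OF pr, of b] b0 by (simp add: padic_abs_def ab)
      then have "real (multiplicity p (nat b)) * ln (real p) = ln (padic_abs p q)" "padic_abs p q > 0"
        using prime_gt_0_nat[OF pr] by (auto simp: ln_realpow)
      then show "real (multiplicity p (nat b)) * ln (real p) \<le> ln (max 1 (padic_abs p q))" by simp
    qed
    finally have "ln (real (nat b)) \<le> B" using 1 by simp
    then have "exp (ln (real (nat b))) \<le> exp B" by (simp only: exp_le_cancel_iff)
    then have bB: "real_of_int b \<le> exp B" using b0 by simp
    have "real_of_int \<bar>a\<bar> = real_abs q * real_of_int b"
      using b0 by (simp add: qab of_rat_divide abs_mult)
    also have "\<dots> \<le> exp B * exp B" using absq bB b0 by (intro mult_mono) auto
    finally have "real_of_int \<bar>a\<bar> \<le> exp B * exp B" .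
    then have "\<bar>a\<bar> \<le> M" unfolding M_def by linarith
    moreover have "real_of_int b \<le> exp B * exp B" using bB B1 mult_right_mono[of 1 "exp B" "exp B"] by linarith
    then have "b \<le> M" unfolding M_def by linarith
    ultimately show "q \<in> (\<lambda>(a, b). of_int a / of_int b) ` ({-M..M} \<times> {-M..M})"
      using b0 by (intro image_eqI[of _ _ "(a, b)"]) (auto simp: qab)
  qed
  then show ?thesis by (rule finite_subset) auto
qed

lemma finite_polys_bounded:
  assumes "finite (S :: complex set)"
  shows "finite {p. degree p \<le> n \<and> (\<forall>i. coeff p i \<in> S)}"
proof -
  have "{p. degree p \<le> n \<and> (\<forall>i. coeff p i \<in> S)} \<subseteq> Poly ` {l. set l \<subseteq> S \<and> length l = Suc n}"
  proof
    fix p assume p: "p \<in> {p. degree p \<le> n \<and> (\<forall>i. coeff p i \<in> S)}"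
    have "p = Poly (map (coeff p) [0..<Suc n])"
      using p by (intro poly_eqI) (auto simp: coeff_Poly_eq nth_default_def coeff_eq_0 simp del: upt_Suc)
    then show "p \<in> Poly ` {l. set l \<subseteq> S \<and> length l = Suc n}"
      using p by (intro image_eqI[of _ _ "map (coeff p) [0..<Suc n]"]) (auto simp del: upt_Suc)
  qed
  then show ?thesis by (rule finite_subset) (intro finite_imageI finite_lists_length_eq assms)
qed

section \<open>Points of bounded height over a fixed number field\<close>

context numfield
begin

lemma supp_max1:
  assumes "good K {y} U" "y \<in> K" shows "supp K U (\<lambda>v. ln (max 1 (v y)))"
  unfolding supp_def
proof (intro conjI ballI impI goodD(1,2)[OF assms(1)])
  fix v assume v: "v \<in> places K" "rat_place v \<notin> U"
  interpret v: absval K v by (rule absval_place[OF v(1)])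
  show "ln (max 1 (v y)) = 0"
  proof (cases "y = 0")
    case False
    then have "v y = 1" using goodD(4)[OF assms(1) _ _ v] by simp
    then show ?thesis by simp
  qed simp
qed

text \<open>At each rational place the coefficient is bounded by the product of the
  \<open>max 1\<close> of the conjugates. Only the archimedean place adds a factor
  \<open>2 ^ degree f\<close>, the origin of \<open>ln 2\<close>.\<close>

lemma charpoly_coeff_height:
  assumes y: "y \<in> K" and q: "coeff (\<Prod>b\<in>conjs. [:- emb b y, 1:]) k = of_rat q"
    and U: "finite U" "U \<subseteq> standard_rat_abs"
  shows "(\<Sum>u\<in>U. ln (max 1 (u q))) \<le>
     real (degree f) * (ln 2 + hsum K (\<lambda>v. ln (max 1 (v y))))"
proof -
  obtain U1 where U1: "good K {y} U1" using good_exists_single[OF y] by blast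
  define U' where "U' = U \<union> U1"
  have U': "finite U'" "U' \<subseteq> standard_rat_abs" "real_abs \<in> U'"
    using U goodD(1-3)[OF U1] by (auto simp: U'_def)
  have pb: "place_of u b y \<ge> 0" if "u \<in> standard_rat_abs" "b \<in> conjs" for u b
    using absval.nonneg[OF absval_place_of[OF that] y] .
  have key: "ln (max 1 (u q)) \<le> (if u = real_abs then real (degree f) * ln 2 else 0) +
      (\<Sum>b\<in>conjs. ln (max 1 (place_of u b y)))" if u: "u \<in> standard_rat_abs" for u
  proof -
    interpret w: absval Qbar "ext_abs u" by (rule ext_abs(1)[OF u])
    define c :: real where "c = (if u = real_abs then 2 ^ degree f else 1)"
    define R where "R = (\<Prod>b\<in>conjs. max 1 (place_of u b y))"
    have c1: "c \<ge> 1" by (simp add: c_def)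
    have R1: "R \<ge> 1" unfolding R_def by (intro prod_ge_1) auto
    have "ext_abs u (of_rat q) \<le> c * R"
    proof (cases "u = real_abs")
      case True
      show ?thesis unfolding q[symmetric] c_def R_def
        using w.linear_prod_coeff_bound(1)[OF finite_conjs, of "\<lambda>b. emb b y" k] emb_Qbar[OF _ y] True
        by (simp add: card_conjs place_of_apply[OF y])
    next
      case False
      show ?thesis unfolding q[symmetric] c_def R_def
        using w.linear_prod_coeff_bound_ultra[OF finite_conjs, of "\<lambda>b. emb b y" k] emb_Qbar[OF _ y] False
          ext_abs(3)[OF u False]
        by (simp add: place_of_apply[OF y])
    qed
    then have "max 1 (u q) \<le> c * R" using ext_abs(2)[OF u] mult_mono[OF c1 R1] c1 by simp
    then have "ln (max 1 (u q)) \<le> ln (c * R)" by (subst ln_le_cancel_iff) (use c1 R1 in auto)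
    also have "\<dots> = ln c + ln R" using c1 R1 by (simp add: ln_mult)
    also have "ln R = (\<Sum>b\<in>conjs. ln (max 1 (place_of u b y)))"
      unfolding R_def by (intro ln_prod) (auto simp: finite_conjs max_def)
    also have "ln c = (if u = real_abs then real (degree f) * ln 2 else 0)"
      by (simp add: c_def ln_realpow)
    finally show ?thesis .
  qed
  have "(\<Sum>u\<in>U. ln (max 1 (u q))) \<le> (\<Sum>u\<in>U'. ln (max 1 (u q)))"
    using U'(1) by (intro sum_mono2) (auto simp: U'_def)
  also have "\<dots> \<le> (\<Sum>u\<in>U'. (if u = real_abs then real (degree f) * ln 2 else 0) +
      (\<Sum>b\<in>conjs. ln (max 1 (place_of u b y))))"
  proof (rule sum_mono)
    fix u assume "u \<in> U'"
    then have "u \<in> standard_rat_abs" using U'(2) by blast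
    then show "ln (max 1 (u q)) \<le> (if u = real_abs then real (degree f) * ln 2 else 0) +
      (\<Sum>b\<in>conjs. ln (max 1 (place_of u b y)))" by (rule key)
  qed
  also have "\<dots> = real (degree f) * ln 2 + (\<Sum>u\<in>U'. \<Sum>b\<in>conjs. ln (max 1 (place_of u b y)))"
    unfolding sum.distrib using U'(1,3) by (simp add: sum.delta')
  also have "(\<Sum>u\<in>U'. \<Sum>b\<in>conjs. ln (max 1 (place_of u b y))) =
      real (degree f) * hsum K (\<lambda>v. ln (max 1 (v y)))"
    using hsum_conjs[OF supp_mono[OF supp_max1[OF U1 y] _ U'(1,2)]] degree_pos by (simp add: U'_def)
  finally show ?thesis by (simp add: distrib_left)
qed

text \<open>The characteristic polynomial of such an element has degree \<open>degree f\<close> and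
  its coefficients lie in a finite set of rationals; the element is one of its roots.\<close>

lemma finite_bounded_elements: "finite {y \<in> K. hsum K (\<lambda>v. ln (max 1 (v y))) \<le> B}"
proof -
  define C where "C = real (degree f) * (ln 2 + B)"
  define R where "R = {q. \<forall>U. finite U \<longrightarrow> U \<subseteq> standard_rat_abs \<longrightarrow> (\<Sum>u\<in>U. ln (max 1 (u q))) \<le> C}"
  have finR: "finite R" unfolding R_def by (rule finite_rat_bounded_height)
  define PP where "PP = {p. degree p \<le> degree f \<and> (\<forall>i. coeff p i \<in> (of_rat ` R :: complex set))}"
  have "finite PP" unfolding PP_def using finR by (intro finite_polys_bounded) auto
  moreover have "{y \<in> K. hsum K (\<lambda>v. ln (max 1 (v y))) \<le> B} \<subseteq> (\<Union>p\<in>PP - {0}. {z. poly p z = 0})"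
  proof
    fix y assume "y \<in> {y \<in> K. hsum K (\<lambda>v. ln (max 1 (v y))) \<le> B}"
    then have y: "y \<in> K" "hsum K (\<lambda>v. ln (max 1 (v y))) \<le> B" by auto
    define p where "p = (\<Prod>b\<in>conjs. [:- emb b y, 1:])"
    have "degree p = degree f" unfolding p_def by (subst degree_prod_eq_sum_degree) (auto simp: card_conjs)
    moreover have "coeff p i \<in> of_rat ` R" for i
    proof -
      obtain q where q: "coeff p i = of_rat q"
        using charpoly_over[OF y(1)] unfolding p_def pover_def by (auto elim: Rats_cases)
      have "(\<Sum>u\<in>U. ln (max 1 (u q))) \<le> C" if "finite U" "U \<subseteq> standard_rat_abs" for U
      proof -
        have "(\<Sum>u\<in>U. ln (max 1 (u q))) \<le> real (degree f) * (ln 2 + hsum K (\<lambda>v. ln (max 1 (v y))))"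
          using charpoly_coeff_height[OF y(1) q[unfolded p_def] that] .
        also have "\<dots> \<le> C" unfolding C_def using y(2) by (intro mult_left_mono add_left_mono) auto
        finally show ?thesis .
      qed
      then show ?thesis using q by (auto simp: R_def)
    qed
    moreover have "p \<noteq> 0" unfolding p_def using finite_conjs by auto
    moreover have "poly p y = 0" unfolding p_def by (rule charpoly_root[OF y(1)])
    ultimately show "y \<in> (\<Union>p\<in>PP - {0}. {z. poly p z = 0})" by (auto simp: PP_def)
  qed
  moreover have "finite (\<Union>p\<in>PP - {0}. {z. poly p z = 0})"
    using \<open>finite PP\<close> by (auto intro!: poly_roots_finite)
  ultimately show ?thesis using finite_subset by blast
qed

text \<open>Once a coordinate is scaled to \<open>1\<close>, the maximum at every place is at least
  \<open>max 1 (v (t i))\<close>, so the height of the point bounds that of each coordinate.\<close>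

theorem northcott: "finite {P \<in> proj_space N K. weil_height N K P \<le> B}"
proof -
  define Y where "Y = {y \<in> K. hsum K (\<lambda>v. ln (max 1 (v y))) \<le> B}"
  have finY: "finite Y" unfolding Y_def by (rule finite_bounded_elements)
  have "{P \<in> proj_space N K. weil_height N K P \<le> B} \<subseteq>
      proj_point ` {z. \<forall>i. (i \<in> {..N} \<longrightarrow> z i \<in> Y) \<and> (i \<notin> {..N} \<longrightarrow> z i = 0)}"
  proof
    fix P assume P: "P \<in> {P \<in> proj_space N K. weil_height N K P \<le> B}"
    then obtain z where z: "z \<in> coord_vectors N K" "P = proj_point z" by (auto simp: proj_space_def)
    then have hz: "height N z \<le> B" using P weil_height_eq by simp
    obtain j where j: "j \<le> N" "z j \<noteq> 0" using coord_vectorsD(3)[OF z(1)] by blast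
    define c where "c = inverse (z j)"
    have c: "c \<in> K" "c \<noteq> 0" using coord_vectorsD(1)[OF z(1) j(1)] j(2) by (auto simp: c_def)
    define t where "t = (\<lambda>i. c * z i)"
    have t: "t \<in> coord_vectors N K" using z(1) c K.mult_in unfolding coord_vectors_def t_def by auto
    have tj: "t j = 1" using j by (simp add: t_def c_def)
    have ht: "height N t \<le> B" unfolding t_def height_scale[OF z(1) c] by (rule hz)
    have "t i \<in> Y" if i: "i \<le> N" for i
    proof -
      have ti: "t i \<in> K" using coord_vectorsD(1)[OF t i] .
      obtain U where U: "good K (t ` {..N}) U" using good_coords[OF t] by blast
      have U1: "good K {t i} U" using good_mono[OF U _ order_refl] goodD[OF U] i by auto
      have "hsum K (\<lambda>v. ln (max 1 (v (t i)))) \<le> height N t"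
        unfolding height_def
      proof (rule hsum_mono[OF supp_max1[OF U1 ti] supp_mx[OF t U]])
        fix v assume v: "v \<in> places K"
        interpret v: absval K v by (rule absval_place[OF v])
        have "max 1 (v (t i)) \<le> mx N v t"
          using mx_ge[OF i, of v t] mx_ge[OF j(1), of v t] tj by simp
        then show "ln (max 1 (v (t i))) \<le> ln (mx N v t)" using mx_pos[OF v t] by simp
      qed
      then show ?thesis using ti ht by (simp add: Y_def)
    qed
    then have "t \<in> {z. \<forall>i. (i \<in> {..N} \<longrightarrow> z i \<in> Y) \<and> (i \<notin> {..N} \<longrightarrow> z i = 0)}"
      using coord_vectorsD(2)[OF t] by auto
    moreover have "P = proj_point t" unfolding t_def z(2) using proj_point_scale[OF c(2)] by simp
    ultimately show "P \<in> proj_point ` {z. \<forall>i. (i \<in> {..N} \<longrightarrow> z i \<in> Y) \<and> (i \<notin> {..N} \<longrightarrow> z i = 0)}" by blast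
  qed
  moreover have "finite {z :: nat \<Rightarrow> complex. \<forall>i. (i \<in> {..N} \<longrightarrow> z i \<in> Y) \<and> (i \<notin> {..N} \<longrightarrow> z i = 0)}"
    using finY by (intro finite_set_of_finite_funs) auto
  ultimately show ?thesis using finite_subset by blast
qed

end

section \<open>Local bounds for polynomial values\<close>

context numfield
begin

text \<open>The error families of height theory, trivial at almost all places. The bound from below
  by \<open>1\<close> makes logarithms nonnegative and lets several families be merged into a
  product that dominates each of them.\<close>

definition local_const :: "((complex \<Rightarrow> real) \<Rightarrow> real) \<Rightarrow> bool" where
  "local_const C \<longleftrightarrow> (\<forall>v\<in>places K. C v \<ge> 1) \<and> (\<exists>U. supp K U (\<lambda>v. ln (C v)))"

lemma local_const_prod:
  assumes "finite A" "\<And>i. i \<in> A \<Longrightarrow> local_const (C i)"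
  shows "local_const (\<lambda>v. \<Prod>i\<in>A. C i v)"
  using assms
proof (induction A)
  case empty
  show ?case unfolding local_const_def
    by (auto intro!: exI[of _ "{}"] simp: supp_def)
next
  case (insert i A)
  then have IH: "local_const (\<lambda>v. \<Prod>i\<in>A. C i v)" and i: "local_const (C i)" by auto
  from IH i obtain U U' where U: "supp K U (\<lambda>v. ln (\<Prod>i\<in>A. C i v))" "supp K U' (\<lambda>v. ln (C i v))"
    unfolding local_const_def by blast
  have ge: "(\<Prod>i\<in>A. C i v) \<ge> 1" "C i v \<ge> 1" if "v \<in> places K" for v
    using IH i that by (auto simp: local_const_def)
  have "supp K (U \<union> U') (\<lambda>v. ln (C i v * (\<Prod>i\<in>A. C i v)))"
    unfolding supp_def
  proof (intro conjI ballI impI)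
    fix v assume v: "v \<in> places K" "rat_place v \<notin> U \<union> U'"
    then have "ln (C i v) = 0" "ln (\<Prod>i\<in>A. C i v) = 0" using U by (auto simp: supp_def)
    then show "ln (C i v * (\<Prod>i\<in>A. C i v)) = 0"
      using ge[OF v(1)] by (subst ln_mult) auto
  qed (use U in \<open>auto simp: supp_def\<close>)
  moreover have "C i v * (\<Prod>i\<in>A. C i v) \<ge> 1" if "v \<in> places K" for v
    using ge[OF that] mult_mono[of 1 "C i v" 1 "\<Prod>i\<in>A. C i v"] by simp
  ultimately show ?case unfolding local_const_def using insert.hyps by (auto intro!: exI[of _ "U \<union> U'"])
qed

lemma local_const_le_prod:
  assumes "finite A" "\<And>i. i \<in> A \<Longrightarrow> local_const (C i)" "i \<in> A" "v \<in> places K"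
  shows "C i v \<le> (\<Prod>i\<in>A. C i v)"
proof -
  have "(\<Prod>i\<in>A. C i v) = C i v * (\<Prod>i\<in>A - {i}. C i v)" using assms(1,3) by (rule prod.remove)
  moreover have "(\<Prod>i\<in>A - {i}. C i v) \<ge> 1" "C i v \<ge> 1"
    using assms by (auto simp: local_const_def intro!: prod_ge_1)
  ultimately show ?thesis using mult_left_mono[of 1 "\<Prod>i\<in>A - {i}. C i v" "C i v"] by simp
qed

text \<open>The constant comes from the sum of the absolute values of the coefficients at
  archimedean places and from their maximum elsewhere; including \<open>1\<close> keeps it at least
  \<open>1\<close>. The free bound \<open>T\<close> on the monomials covers homogeneous polynomials
  as well as arbitrary ones on vectors with entries at most \<open>1\<close>.\<close>

lemma poly_eval_local_bound:
  assumes F: "coeffs_in K F" "vars_below n F"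
  shows "\<exists>C. local_const C \<and> (\<forall>v\<in>places K. \<forall>z T. (\<forall>i<n. z i \<in> K) \<longrightarrow> T \<ge> 0 \<longrightarrow>
     (\<forall>\<alpha>\<in>keys F. v (mon_eval z \<alpha>) \<le> T) \<longrightarrow> v (poly_eval F z) \<le> C v * T)"
proof -
  let ?Y = "lookup F ` keys F"
  have YK: "?Y \<subseteq> K" using F by (auto simp: coeffs_in_def)
  obtain U where U: "good K ?Y U" using good_exists[of ?Y] YK by auto
  define C where "C = (\<lambda>v. if rat_place v = real_abs then 1 + (\<Sum>\<alpha>\<in>keys F. v (lookup F \<alpha>))
     else Max (insert 1 (v ` ?Y)))"
  have "local_const C" unfolding local_const_def
  proof (intro conjI ballI exI[of _ U])
    fix v assume v: "v \<in> places K"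
    interpret v: absval K v by (rule absval_place[OF v])
    have "(\<Sum>\<alpha>\<in>keys F. v (lookup F \<alpha>)) \<ge> 0" using YK by (intro sum_nonneg) auto
    then show "1 \<le> C v" by (auto simp: C_def)
  next
    show "supp K U (\<lambda>v. ln (C v))" unfolding supp_def
    proof (intro conjI ballI impI goodD(1,2)[OF U])
      fix v assume v: "v \<in> places K" "rat_place v \<notin> U"
      have "v y = 1" if "y \<in> ?Y" for y
        using goodD(4)[OF U that _ v] that by (auto simp: in_keys_iff)
      then have eq: "insert 1 (v ` ?Y) = {1}" by blast
      have "rat_place v \<noteq> real_abs" using v(2) goodD(3)[OF U] by auto
      then have "C v = Max (insert 1 (v ` ?Y))" by (simp add: C_def)
      also have "\<dots> = Max {1}" by (simp only: eq)
      finally show "ln (C v) = 0" by simp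
    qed
  qed
  moreover have "v (poly_eval F z) \<le> C v * T"
    if v: "v \<in> places K" and z: "\<forall>i<n. z i \<in> K" and T: "T \<ge> 0" "\<forall>\<alpha>\<in>keys F. v (mon_eval z \<alpha>) \<le> T" for v z T
  proof -
    interpret v: absval K v by (rule absval_place[OF v])
    have cK: "lookup F \<alpha> \<in> K" for \<alpha> using F(1) by (simp add: coeffs_in_def)
    have mK: "mon_eval z \<alpha> \<in> K" if "\<alpha> \<in> keys F" for \<alpha>
      using that F(2) z by (intro K.mon_eval_in) (auto simp: vars_below_def)
    show ?thesis
    proof (cases "rat_place v = real_abs")
      case True
      have "v (poly_eval F z) \<le> (\<Sum>\<alpha>\<in>keys F. v (lookup F \<alpha> * mon_eval z \<alpha>))"
        unfolding poly_eval_mon using cK mK by (intro v.sum_le K.mult_in)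
      also have "\<dots> \<le> (\<Sum>\<alpha>\<in>keys F. v (lookup F \<alpha>) * T)"
        using cK mK T by (intro sum_mono) (auto simp: v.mult intro!: mult_left_mono)
      also have "\<dots> \<le> C v * T" using True T(1) by (simp add: C_def sum_distrib_right distrib_right)
      finally show ?thesis .
    next
      case False
      have C1: "C v \<ge> 1" and Cc: "v (lookup F \<alpha>) \<le> C v" if "\<alpha> \<in> keys F" for \<alpha>
        using False that by (auto simp: C_def)
      have "C v \<ge> 1" using False by (auto simp: C_def)
      show ?thesis unfolding poly_eval_mon
      proof (rule ultrametric_sum[OF v False])
        fix \<alpha> assume a: "\<alpha> \<in> keys F"
        show "lookup F \<alpha> * mon_eval z \<alpha> \<in> K" using cK mK[OF a] by auto
        show "v (lookup F \<alpha> * mon_eval z \<alpha>) \<le> C v * T"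
          using cK mK[OF a] Cc[OF a] T a \<open>C v \<ge> 1\<close> by (simp add: v.mult mult_mono)
      qed (use T(1) \<open>C v \<ge> 1\<close> in simp)
    qed
  qed
  ultimately show ?thesis by blast
qed

lemma mon_eval_bound:
  assumes v: "v \<in> places K" and "keys \<alpha> \<subseteq> {..N}" "\<And>i. i \<le> N \<Longrightarrow> z i \<in> K" "\<And>i. i \<le> N \<Longrightarrow> v (z i) \<le> M"
  shows "v (mon_eval z \<alpha>) \<le> M ^ monomial_degree \<alpha>"
proof -
  interpret v: absval K v by (rule absval_place[OF v])
  have "v (mon_eval z \<alpha>) = (\<Prod>i\<in>keys \<alpha>. v (z i) ^ lookup \<alpha> i)"
    unfolding mon_eval_def using assms(2,3) by (subst v.prod) (auto simp: v.power intro!: prod.cong)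
  also have "\<dots> \<le> (\<Prod>i\<in>keys \<alpha>. M ^ lookup \<alpha> i)"
    using assms by (intro prod_mono conjI power_mono zero_le_power) auto
  also have "\<dots> = M ^ monomial_degree \<alpha>" by (simp add: monomial_degree_def power_sum)
  finally show ?thesis .
qed

lemma homogeneous_local_bound:
  assumes F: "coeffs_in K F" "homogeneous N e F"
  shows "\<exists>C. local_const C \<and> (\<forall>v\<in>places K. \<forall>z\<in>coord_vectors N K. v (poly_eval F z) \<le> C v * mx N v z ^ e)"
proof -
  obtain C where C: "local_const C" "\<And>v z T. v \<in> places K \<Longrightarrow> \<forall>i<Suc N. z i \<in> K \<Longrightarrow> T \<ge> 0 \<Longrightarrow>
     \<forall>\<alpha>\<in>keys F. v (mon_eval z \<alpha>) \<le> T \<Longrightarrow> v (poly_eval F z) \<le> C v * T"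
    using poly_eval_local_bound[OF F(1) homogeneous_vars_below[OF F(2)]] by blast
  have "v (poly_eval F z) \<le> C v * mx N v z ^ e" if v: "v \<in> places K" and z: "z \<in> coord_vectors N K" for v z
  proof (rule C(2)[OF v])
    show "\<forall>i<Suc N. z i \<in> K" using coord_vectorsD(1)[OF z] by auto
    show "0 \<le> mx N v z ^ e" using mx_pos[OF v z] by simp
    show "\<forall>\<alpha>\<in>keys F. v (mon_eval z \<alpha>) \<le> mx N v z ^ e"
    proof
      fix \<alpha> assume "\<alpha> \<in> keys F"
      then have a: "keys \<alpha> \<subseteq> {..N}" "monomial_degree \<alpha> = e" using F(2) by (auto simp: homogeneous_def)
      show "v (mon_eval z \<alpha>) \<le> mx N v z ^ e"
        using mon_eval_bound[OF v a(1), of z "mx N v z"] coord_vectorsD(1)[OF z] mx_ge[of _ N v z] a(2) by auto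
    qed
  qed
  then show ?thesis using C(1) by blast
qed

lemma integral_local_bound:
  assumes F: "coeffs_in K F" "vars_below (Suc N) F"
  shows "\<exists>C. local_const C \<and> (\<forall>v\<in>places K. \<forall>z\<in>coord_vectors N K. mx N v z \<le> 1 \<longrightarrow> v (poly_eval F z) \<le> C v)"
proof -
  obtain C where C: "local_const C" "\<And>v z T. v \<in> places K \<Longrightarrow> \<forall>i<Suc N. z i \<in> K \<Longrightarrow> T \<ge> 0 \<Longrightarrow>
     \<forall>\<alpha>\<in>keys F. v (mon_eval z \<alpha>) \<le> T \<Longrightarrow> v (poly_eval F z) \<le> C v * T"
    using poly_eval_local_bound[OF F] by blast
  have "v (poly_eval F z) \<le> C v * 1" if v: "v \<in> places K" and z: "z \<in> coord_vectors N K" "mx N v z \<le> 1" for v z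
  proof (rule C(2)[OF v])
    show "\<forall>i<Suc N. z i \<in> K" using coord_vectorsD(1)[OF z(1)] by auto
    show "\<forall>\<alpha>\<in>keys F. v (mon_eval z \<alpha>) \<le> 1"
    proof
      fix \<alpha> assume "\<alpha> \<in> keys F"
      then have a: "keys \<alpha> \<subseteq> {..N}" using F(2) unfolding vars_below_def lessThan_Suc_atMost by blast
      show "v (mon_eval z \<alpha>) \<le> 1"
        using mon_eval_bound[OF v a(1), of z 1] coord_vectorsD(1)[OF z(1)] order_trans[OF mx_ge z(2)] by auto
    qed
  qed simp
  then show ?thesis using C(1) by auto
qed

end

section \<open>The Nullstellensatz\<close>

definition pring :: "complex set \<Rightarrow> nat \<Rightarrow> cpoly set" where
  "pring K n = {F. coeffs_in K F \<and> vars_below n F}"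

lemma vars_below_mono: "vars_below m F \<Longrightarrow> m \<le> n \<Longrightarrow> vars_below n F"
  unfolding vars_below_def by (meson dual_order.trans lessThan_subset_iff)

lemma pring_mono: "m \<le> n \<Longrightarrow> pring K m \<subseteq> pring K n"
  by (auto simp: pring_def vars_below_mono)

context csubfield
begin

lemma pring_0 [simp, intro]: "0 \<in> pring F n" by (simp add: pring_def)
lemma pring_1 [simp, intro]: "1 \<in> pring F n" by (simp add: pring_def)
lemma pring_add [intro]: "P \<in> pring F n \<Longrightarrow> Q \<in> pring F n \<Longrightarrow> P + Q \<in> pring F n"
  by (simp add: pring_def coeffs_in_add vars_below_add)
lemma pring_diff [intro]: "P \<in> pring F n \<Longrightarrow> Q \<in> pring F n \<Longrightarrow> P - Q \<in> pring F n"
  by (simp add: pring_def coeffs_in_diff vars_below_diff)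
lemma pring_mult [intro]: "P \<in> pring F n \<Longrightarrow> Q \<in> pring F n \<Longrightarrow> P * Q \<in> pring F n"
  by (simp add: pring_def coeffs_in_mult vars_below_mult)
lemma pring_power [intro]: "P \<in> pring F n \<Longrightarrow> P ^ k \<in> pring F n"
  by (induction k) auto
lemma pring_sum [intro]: "(\<And>i. i \<in> A \<Longrightarrow> P i \<in> pring F n) \<Longrightarrow> sum P A \<in> pring F n"
  by (induction A rule: infinite_finite_induct) auto
lemma pring_var: "i < n \<Longrightarrow> var i \<in> pring F n"
  unfolding pring_def var_def by (auto intro!: vars_below_single)
lemma pring_const: "c \<in> F \<Longrightarrow> single 0 c \<in> pring F n"
  by (simp add: pring_def vars_below_single)

lemma pring_mon: "keys \<alpha> \<subseteq> {..<n} \<Longrightarrow> c \<in> F \<Longrightarrow> single \<alpha> c \<in> pring F n"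
  by (simp add: pring_def vars_below_single)

end

lemma var_power: "var m ^ k = single (single m k) 1"
  by (induction k) (simp_all add: var_def mult_single single_add[symmetric])

text \<open>The polynomials in the variables up to \<open>m\<close>, read as polynomials in
  \<open>var m\<close> over those in the earlier variables; evaluation at \<open>var m\<close>
  passes between the two readings.\<close>

definition rpoly :: "complex set \<Rightarrow> nat \<Rightarrow> cpoly poly \<Rightarrow> bool" where
  "rpoly K m p \<longleftrightarrow> (\<forall>i. coeff p i \<in> pring K m)"

context csubfield
begin

lemma rpoly_0 [simp, intro]: "rpoly F m 0" by (simp add: rpoly_def)
lemma rpoly_add [intro]: "rpoly F m p \<Longrightarrow> rpoly F m q \<Longrightarrow> rpoly F m (p + q)" by (auto simp: rpoly_def)
lemma rpoly_diff [intro]: "rpoly F m p \<Longrightarrow> rpoly F m q \<Longrightarrow> rpoly F m (p - q)" by (auto simp: rpoly_def)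
lemma rpoly_mult [intro]: "rpoly F m p \<Longrightarrow> rpoly F m q \<Longrightarrow> rpoly F m (p * q)"
  by (auto simp: rpoly_def coeff_mult)
lemma rpoly_smult [intro]: "c \<in> pring F m \<Longrightarrow> rpoly F m p \<Longrightarrow> rpoly F m (smult c p)" by (auto simp: rpoly_def)
lemma rpoly_monom [intro]: "c \<in> pring F m \<Longrightarrow> rpoly F m (monom c k)" by (auto simp: rpoly_def)
lemma rpoly_sum [intro]: "(\<And>i. i \<in> A \<Longrightarrow> rpoly F m (p i)) \<Longrightarrow> rpoly F m (sum p A)"
  by (induction A rule: infinite_finite_induct) auto

lemma rpoly_eval_in: assumes "rpoly F m p" shows "poly p (var m) \<in> pring F (Suc m)"
  unfolding poly_altdef using assms pring_mono[of m "Suc m"]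
  by (intro pring_sum pring_mult pring_power pring_var) (auto simp: rpoly_def)

lemma rpoly_of_pring:
  assumes "P \<in> pring F (Suc m)" shows "\<exists>p. rpoly F m p \<and> P = poly p (var m)"
proof -
  define p where "p = (\<Sum>\<alpha>\<in>keys P.
     monom (single (Poly_Mapping.update m 0 \<alpha>) (lookup P \<alpha>)) (lookup \<alpha> m))"
  have split: "\<alpha> = Poly_Mapping.update m 0 \<alpha> + single m (lookup \<alpha> m)" for \<alpha> :: "nat \<Rightarrow>\<^sub>0 nat"
    by (rule poly_mapping_eqI) (auto simp: lookup_add lookup_update lookup_single when_def)
  have "rpoly F m p" unfolding p_def
  proof (intro rpoly_sum rpoly_monom pring_mon)
    fix \<alpha> assume a: "\<alpha> \<in> keys P"
    have "keys \<alpha> \<subseteq> {..<Suc m}" using a assms unfolding pring_def vars_below_def by blast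
    then show "keys (Poly_Mapping.update m 0 \<alpha>) \<subseteq> {..<m}"
      by (auto simp: in_keys_iff lookup_update less_Suc_eq subset_iff split: if_splits)
    show "lookup P \<alpha> \<in> F" using assms by (simp add: pring_def coeffs_in_def)
  qed
  moreover have "poly p (var m) = (\<Sum>\<alpha>\<in>keys P. single \<alpha> (lookup P \<alpha>))"
    unfolding p_def poly_sum poly_monom var_power
    by (intro sum.cong refl) (simp add: mult_single split[symmetric])
  ultimately show ?thesis using cpoly_sum_monomials[OF finite_keys order_refl, of P] by metis
qed

lemma pseudo_division:
  assumes "rpoly F m p" "rpoly F m q" "q \<noteq> 0"
  shows "\<exists>k s r. rpoly F m s \<and> rpoly F m r \<and> smult (lead_coeff q ^ k) p = s * q + r \<and> (r = 0 \<or> degree r < degree q)"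
  using assms(1)
proof (induction "if p = 0 then 0 else Suc (degree p)" arbitrary: p rule: less_induct)
  case (less p)
  have lq: "lead_coeff q \<in> pring F m" using assms(2) by (simp add: rpoly_def)
  show ?case
  proof (cases "p = 0 \<or> degree p < degree q")
    case True
    then show ?thesis using less.prems by (intro exI[of _ 0] exI[of _ p]) auto
  next
    case False
    define c where "c = monom (lead_coeff p) (degree p - degree q)"
    have c: "rpoly F m c" using less.prems unfolding c_def by (intro rpoly_monom) (simp add: rpoly_def)
    define p' where "p' = smult (lead_coeff q) p - c * q"
    have p': "rpoly F m p'" using less.prems c assms(2) lq by (auto simp: p'_def)
    have lp: "lead_coeff p \<noteq> 0" using False by simp
    have degc: "degree (c * q) = degree p"
      using False assms(3) by (auto simp: c_def degree_mult_eq degree_monom_eq monom_eq_0_iff)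
    have lcc: "coeff (c * q) (degree p) = lead_coeff q * lead_coeff p"
      unfolding c_def coeff_monom_mult using False by (simp add: mult.commute)
    have "p' = 0 \<or> degree p' < degree p"
    proof -
      have "degree p' \<le> degree p" unfolding p'_def using degc
        by (intro degree_diff_le) (auto intro: order_trans[OF degree_smult_le])
      moreover have "coeff p' (degree p) = 0" using lcc by (simp add: p'_def)
      ultimately show ?thesis by (rule eq_zero_or_degree_less)
    qed
    then have "(if p' = 0 then 0 else Suc (degree p')) < (if p = 0 then 0 else Suc (degree p))"
      using False by auto
    from less.hyps[OF this p'] obtain k s r where
      sr: "rpoly F m s" "rpoly F m r" "smult (lead_coeff q ^ k) p' = s * q + r" "r = 0 \<or> degree r < degree q" by blast
    have "smult (lead_coeff q ^ Suc k) p = smult (lead_coeff q ^ k) (p' + c * q)"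
      by (simp add: p'_def mult.commute)
    also have "\<dots> = (s + smult (lead_coeff q ^ k) c) * q + r"
      using sr(3) by (simp add: smult_add_right algebra_simps)
    finally show ?thesis using sr c pring_power[OF lq, of k]
      by (intro exI[of _ "Suc k"] exI[of _ "s + smult (lead_coeff q ^ k) c"] exI[of _ r]) auto
  qed
qed

end

section \<open>Zeros of prime ideals, by induction on the number of variables\<close>

locale prime_pideal = csubfield K for K +
  fixes n :: nat and M :: "cpoly set"
  assumes KQ: "K \<subseteq> Qbar" and M_0: "0 \<in> M" and M_1: "1 \<notin> M"
    and M_add: "\<And>P Q. P \<in> M \<Longrightarrow> Q \<in> M \<Longrightarrow> P + Q \<in> M"
    and M_mult: "\<And>P Q. P \<in> pring K n \<Longrightarrow> Q \<in> M \<Longrightarrow> P * Q \<in> M"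
    and M_prime: "\<And>P Q. P \<in> pring K n \<Longrightarrow> Q \<in> pring K n \<Longrightarrow> P * Q \<in> M \<Longrightarrow> P \<in> M \<or> Q \<in> M"
begin

lemma M_uminus: "P \<in> M \<Longrightarrow> - P \<in> M"
  using M_mult[of "-1" P] pring_diff[OF pring_0 pring_1, of n] by simp

lemma M_diff: "P \<in> M \<Longrightarrow> Q \<in> M \<Longrightarrow> P - Q \<in> M"
  using M_add[OF _ M_uminus, of P Q] by simp

lemma M_power: "P \<in> pring K n \<Longrightarrow> P \<notin> M \<Longrightarrow> P ^ k \<notin> M"
  by (induction k) (use M_1 M_prime in auto)

lemma M_sum: "(\<And>i. i \<in> A \<Longrightarrow> P i \<in> M) \<Longrightarrow> sum P A \<in> M"
  by (induction A rule: infinite_finite_induct) (auto simp: M_0 M_add)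

text \<open>The zero must also avoid the zeros of an arbitrary \<open>b\<close> outside
  \<open>M\<close>. This strengthening carries the induction: it keeps leading coefficients from
  vanishing when the earlier variables are specialised.\<close>

definition has_zeros :: "nat \<Rightarrow> bool" where
  "has_zeros m \<longleftrightarrow> (\<forall>b \<in> pring K m - M. \<exists>a. (\<forall>i. a i \<in> Qbar) \<and>
     (\<forall>P \<in> M \<inter> pring K m. poly_eval P a = 0) \<and> poly_eval b a \<noteq> 0)"

lemma has_zeros_0: "has_zeros 0"
  unfolding has_zeros_def
proof
  have const: "\<exists>c\<in>K. P = single 0 c" if "P \<in> pring K 0" for P
  proof -
    have "keys P \<subseteq> {0}"
      using that poly_mapping_eqI[of _ "0 :: nat \<Rightarrow>\<^sub>0 nat"]
      by (auto simp: pring_def vars_below_def in_keys_iff)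
    from cpoly_sum_monomials[OF _ this] have "P = single 0 (lookup P 0)" by simp
    moreover have "lookup P 0 \<in> K" using that by (simp add: pring_def coeffs_in_def)
    ultimately show ?thesis by blast
  qed
  fix b assume b: "b \<in> pring K 0 - M"
  then obtain c where c: "b = single 0 c" using const by blast
  have "P = 0" if "P \<in> M \<inter> pring K 0" for P
  proof (rule ccontr)
    assume "P \<noteq> 0"
    from that obtain d where d: "d \<in> K" "P = single 0 d" using const by blast
    have "d \<noteq> 0" using \<open>P \<noteq> 0\<close> d by auto
    have "single 0 (inverse d) * P \<in> M"
      using that d by (intro M_mult pring_const) auto
    then show False using M_1 d(2) \<open>d \<noteq> 0\<close> by (simp add: mult_single)
  qed
  then have "\<forall>P \<in> M \<inter> pring K 0. poly_eval P (\<lambda>_. 0) = 0" by (metis poly_eval_0)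
  moreover have "c \<noteq> 0" using b c M_0 by auto
  ultimately show "\<exists>a. (\<forall>i. a i \<in> Qbar) \<and> (\<forall>P \<in> M \<inter> pring K 0. poly_eval P a = 0) \<and> poly_eval b a \<noteq> 0"
    by (intro exI[of _ "\<lambda>_. 0"] conjI) (simp_all add: c csubfield.zero_in[OF csubfield_Qbar])
qed

context
  fixes m :: nat
  assumes mn: "Suc m \<le> n"
begin

lemma sub_n: "P \<in> pring K m \<Longrightarrow> P \<in> pring K n" "P \<in> pring K (Suc m) \<Longrightarrow> P \<in> pring K n"
  using mn pring_mono[of m n K] pring_mono[of "Suc m" n K] by auto

lemma rp_n: "rpoly K m p \<Longrightarrow> poly p (var m) \<in> pring K n"
  using rpoly_eval_in sub_n by blast

lemma coeff_n: "rpoly K m p \<Longrightarrow> coeff p i \<in> pring K n"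
  using sub_n by (simp add: rpoly_def)

lemma coeffs_M_eval:
  assumes "\<And>i. coeff p i \<in> M" shows "poly p (var m) \<in> M"
proof -
  have "var m \<in> pring K n" using mn by (intro pring_var) auto
  then have "(var m) ^ i * coeff p i \<in> M" for i using assms by (intro M_mult pring_power)
  then show ?thesis unfolding poly_altdef by (intro M_sum) (simp add: mult.commute)
qed

text \<open>The top terms with coefficients in \<open>M\<close> are dropped, which changes the value
  at \<open>var m\<close> by an element of \<open>M\<close> only.\<close>

lemma reduce:
  assumes p: "rpoly K m p" and "\<not> (\<forall>i. coeff p i \<in> M)"
  shows "\<exists>p'. rpoly K m p' \<and> lead_coeff p' \<notin> M \<and> degree p' \<le> degree p \<and> poly p (var m) - poly p' (var m) \<in> M"
proof -
  define J where "J = {i. coeff p i \<notin> M}"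
  have Jsub: "J \<subseteq> {..degree p}" using M_0 coeff_eq_0[of p] by (auto simp: J_def) (metis not_le)
  then have finJ: "finite J" by (rule finite_subset) simp
  have neJ: "J \<noteq> {}" using assms(2) by (auto simp: J_def)
  define j where "j = Max J"
  have j: "j \<in> J" unfolding j_def using finJ neJ by (rule Max_in)
  define p' where "p' = (\<Sum>i\<le>j. monom (coeff p i) i)"
  have cp': "coeff p' i = (if i \<le> j then coeff p i else 0)" for i by (auto simp: p'_def coeff_sum)
  have "rpoly K m p'" using p unfolding rpoly_def cp' by auto
  moreover have "coeff p j \<noteq> 0" using j M_0 by (auto simp: J_def)
  then have deg: "degree p' = j"
    by (intro antisym degree_le le_degree) (auto simp: cp')
  then have "lead_coeff p' \<notin> M" using j by (simp add: cp' J_def)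
  moreover have "degree p' \<le> degree p" using deg j Jsub by auto
  moreover have "poly (p - p') (var m) \<in> M"
  proof (rule coeffs_M_eval)
    fix i show "coeff (p - p') i \<in> M"
    proof (cases "i \<le> j")
      case False
      then have "i \<notin> J" using Max_ge[OF finJ, of i] unfolding j_def by blast
      then show ?thesis using False by (simp add: cp' J_def)
    qed (simp add: cp' M_0)
  qed
  ultimately show ?thesis by (intro exI[of _ p']) simp
qed

lemma poly_eval_rpoly:
  assumes "rpoly K m p"
  shows "poly_eval (poly p (var m)) (a(m := t)) = poly (map_poly (\<lambda>c. poly_eval c a) p) t"
proof -
  have eq: "poly_eval (coeff p i) (a(m := t)) = poly_eval (coeff p i) a" for i
    using assms by (intro poly_eval_cong[of m]) (auto simp: rpoly_def pring_def)
  have "poly (map_poly (\<lambda>c. poly_eval c a) p) t = (\<Sum>i\<le>degree p. poly_eval (coeff p i) a * t ^ i)"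
    unfolding poly_altdef using map_poly_degree_leq[of "\<lambda>c. poly_eval c a" p]
    by (intro sum.mono_neutral_cong_left) (auto simp: coeff_map_poly, metis coeff_eq_0 coeff_map_poly poly_eval_0 not_le)
  then show ?thesis by (simp add: poly_altdef[of p] poly_eval_sum eq)
qed

text \<open>The elements of \<open>M\<close> in question have all their coefficients in
  \<open>M\<close>, so a zero in the first \<open>m\<close> coordinates may be continued by any
  number. A natural number off the roots of the specialised \<open>b\<close> keeps \<open>b\<close>
  from vanishing.\<close>

lemma zeros_step_transcendental:
  assumes IH: "has_zeros m" and b: "b \<in> pring K (Suc m) - M"
    and tr: "\<And>p. rpoly K m p \<Longrightarrow> poly p (var m) \<in> M \<Longrightarrow> \<forall>i. coeff p i \<in> M"
  shows "\<exists>a. (\<forall>i. a i \<in> Qbar) \<and> (\<forall>P \<in> M \<inter> pring K (Suc m). poly_eval P a = 0) \<and> poly_eval b a \<noteq> 0"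
proof -
  obtain pb where pb: "rpoly K m pb" "b = poly pb (var m)" using rpoly_of_pring b by blast
  then obtain i where i: "coeff pb i \<notin> M" using b coeffs_M_eval by blast
  then obtain a where a: "\<And>i. a i \<in> Qbar" "\<And>P. P \<in> M \<inter> pring K m \<Longrightarrow> poly_eval P a = 0"
    "poly_eval (coeff pb i) a \<noteq> 0"
    using IH pb(1) unfolding has_zeros_def rpoly_def by blast
  define q where "q = map_poly (\<lambda>c. poly_eval c a) pb"
  have "coeff q i \<noteq> 0" using a(3) by (simp add: q_def coeff_map_poly)
  then have "q \<noteq> 0" by auto
  then have "finite {z. poly q z = 0}" by (rule poly_roots_finite)
  moreover have "infinite (range (of_nat :: nat \<Rightarrow> complex))" by (intro range_inj_infinite inj_of_nat)
  ultimately obtain k :: nat where k: "poly q (of_nat k) \<noteq> 0"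
    by (metis (mono_tags, lifting) finite_subset image_subsetI mem_Collect_eq)
  show ?thesis
  proof (intro exI[of _ "a(m := of_nat k)"] conjI allI ballI)
    show "(a(m := of_nat k)) i \<in> Qbar" for i using a(1) csubfield.of_nat_in[OF csubfield_Qbar] by simp
    show "poly_eval b (a(m := of_nat k)) \<noteq> 0" using k poly_eval_rpoly[OF pb(1)] by (simp add: pb(2) q_def)
    fix P assume P: "P \<in> M \<inter> pring K (Suc m)"
    then obtain p where p: "rpoly K m p" "P = poly p (var m)" using rpoly_of_pring by blast
    have "coeff p j \<in> M \<inter> pring K m" for j using tr[OF p(1)] P p by (auto simp: rpoly_def)
    then have "map_poly (\<lambda>c. poly_eval c a) p = 0"
      using a(2) by (intro poly_eqI) (simp add: coeff_map_poly)
    then show "poly_eval P (a(m := of_nat k)) = 0" using poly_eval_rpoly[OF p(1)] p(2) by simp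
  qed
qed

text \<open>In the algebraic case \<open>p \<in> M\<close> has minimal degree among the relations with leading
  coefficient outside \<open>M\<close>, and \<open>g\<close> minimal degree in the ideal generated by \<open>M\<close> and \<open>b\<close>. Pseudo-dividing
  \<open>p\<close> by \<open>g\<close> shows that \<open>g\<close> is constant, so that \<open>b\<close> is a unit up to \<open>M\<close> and a constant outside \<open>M\<close>.\<close>

lemma zeros_step_algebraic:
  assumes IH: "has_zeros m" and b: "b \<in> pring K (Suc m) - M"
    and alg: "\<exists>p. rpoly K m p \<and> poly p (var m) \<in> M \<and> \<not> (\<forall>i. coeff p i \<in> M)"
  shows "\<exists>a. (\<forall>i. a i \<in> Qbar) \<and> (\<forall>P \<in> M \<inter> pring K (Suc m). poly_eval P a = 0) \<and> poly_eval b a \<noteq> 0"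
proof -
  define S where "S = {p. rpoly K m p \<and> poly p (var m) \<in> M \<and> lead_coeff p \<notin> M}"
  have inM: "poly p' (var m) \<in> M" if "poly p (var m) \<in> M" "poly p (var m) - poly p' (var m) \<in> M" for p p'
    using M_diff[OF that] by simp
  have "\<exists>p. p \<in> S" using alg reduce inM unfolding S_def by blast
  then obtain p where pS: "p \<in> S" and pmin: "\<And>q. q \<in> S \<Longrightarrow> degree p \<le> degree q"
    using ex_has_least_nat[of "\<lambda>p. p \<in> S" _ degree] by blast
  have p: "rpoly K m p" "poly p (var m) \<in> M" "lead_coeff p \<notin> M" using pS by (auto simp: S_def)
  have p0: "p \<noteq> 0" using p(3) M_0 by auto
  have e0: "degree p > 0"
  proof (rule ccontr)
    assume "\<not> degree p > 0"
    then obtain c where "p = [:c:]" by (auto elim: degree_eq_zeroE)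
    then show False using p(2,3) by simp
  qed
  have small: "\<forall>i. coeff r i \<in> M" if "rpoly K m r" "poly r (var m) \<in> M" "r = 0 \<or> degree r < degree p" for r
  proof (rule ccontr)
    assume *: "\<not> (\<forall>i. coeff r i \<in> M)"
    then have "r \<noteq> 0" using M_0 by auto
    from reduce[OF that(1) *] obtain r' where "rpoly K m r'" "lead_coeff r' \<notin> M" "degree r' \<le> degree r"
      "poly r (var m) - poly r' (var m) \<in> M" by blast
    then have "r' \<in> S" "degree r' < degree p" using inM[OF that(2)] that(3) \<open>r \<noteq> 0\<close> by (auto simp: S_def)
    then show False using pmin[of r'] by simp
  qed
  define J where "J = {u * b + y |u y. u \<in> pring K (Suc m) \<and> y \<in> M \<inter> pring K (Suc m)}"
  have J_M: "y \<in> J" if "y \<in> M \<inter> pring K (Suc m)" for y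
    unfolding J_def using that by (intro CollectI exI[of _ 0] exI[of _ y]) auto
  have J_diff: "P - Q \<in> J" if "P \<in> J" "Q \<in> J" for P Q
  proof -
    from that obtain u y u' y' where *: "P = u * b + y" "Q = u' * b + y'" "u \<in> pring K (Suc m)" "u' \<in> pring K (Suc m)"
      "y \<in> M \<inter> pring K (Suc m)" "y' \<in> M \<inter> pring K (Suc m)" unfolding J_def by blast
    have "P - Q = (u - u') * b + (y - y')" using * by (simp add: algebra_simps)
    then show ?thesis unfolding J_def using * M_diff by blast
  qed
  have J_mult: "Q * P \<in> J" if "P \<in> J" "Q \<in> pring K (Suc m)" for P Q
  proof -
    from that(1) obtain u y where *: "P = u * b + y" "u \<in> pring K (Suc m)" "y \<in> M \<inter> pring K (Suc m)"
      unfolding J_def by blast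
    have "Q * P = (Q * u) * b + Q * y" using * by (simp add: algebra_simps)
    moreover have "Q * y \<in> M \<inter> pring K (Suc m)" using * that(2) M_mult sub_n by auto
    ultimately show ?thesis unfolding J_def using * that(2) by blast
  qed
  have bJ: "b \<in> J" unfolding J_def using b M_0 by (intro CollectI exI[of _ 1] exI[of _ 0]) auto
  define T where "T = {g. rpoly K m g \<and> poly g (var m) \<in> J \<and> lead_coeff g \<notin> M}"
  have T_reduce: "\<exists>g\<in>T. degree g \<le> degree r" if "rpoly K m r" "poly r (var m) \<in> J" "\<not> (\<forall>i. coeff r i \<in> M)" for r
  proof -
    from reduce[OF that(1,3)] obtain r' where r': "rpoly K m r'" "lead_coeff r' \<notin> M" "degree r' \<le> degree r"
      "poly r (var m) - poly r' (var m) \<in> M" by blast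
    have "poly r (var m) - poly r' (var m) \<in> M \<inter> pring K (Suc m)"
      using r'(4) rpoly_eval_in[OF that(1)] rpoly_eval_in[OF r'(1)] by auto
    from J_diff[OF that(2) J_M[OF this]] have "poly r' (var m) \<in> J" by simp
    then show ?thesis using r' by (auto simp: T_def)
  qed
  obtain pb where pb: "rpoly K m pb" "b = poly pb (var m)" using rpoly_of_pring b by blast
  have "\<exists>g\<in>T. degree g < degree p"
  proof -
    from pseudo_division[OF pb(1) p(1) p0] obtain k s r where
      sr: "rpoly K m s" "rpoly K m r" "smult (lead_coeff p ^ k) pb = s * p + r" "r = 0 \<or> degree r < degree p" by blast
    have "poly (smult (lead_coeff p ^ k) pb) (var m) = poly (s * p + r) (var m)" by (simp only: sr(3))
    then have eq: "poly r (var m) = lead_coeff p ^ k * b - poly s (var m) * poly p (var m)"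
      by (simp add: pb(2) algebra_simps)
    have lpk: "lead_coeff p ^ k \<in> pring K (Suc m)"
      using p(1) pring_mono[of m "Suc m" K] by (intro pring_power) (auto simp: rpoly_def)
    have sp: "poly s (var m) * poly p (var m) \<in> M \<inter> pring K (Suc m)"
      using p sr(1) by (auto intro!: M_mult rp_n rpoly_eval_in)
    have rJ: "poly r (var m) \<in> J" unfolding eq using J_diff[OF J_mult[OF bJ lpk] J_M[OF sp]] .
    have rM: "poly r (var m) \<notin> M"
    proof
      assume "poly r (var m) \<in> M"
      then have "poly r (var m) + poly s (var m) * poly p (var m) \<in> M" using M_add sp by blast
      then have pb_M: "lead_coeff p ^ k * b \<in> M" by (simp add: eq)
      have "b \<in> pring K n" "b \<notin> M" using b sub_n(2) by auto
      then show False
        using M_prime[OF pring_power[OF coeff_n[OF p(1)]] _ pb_M] M_power[OF coeff_n[OF p(1)] p(3), of k] by simp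
    qed
    then have nall: "\<not> (\<forall>i. coeff r i \<in> M)" using coeffs_M_eval by blast
    then have "r \<noteq> 0" using M_0 by auto
    with sr(4) have "degree r < degree p" by simp
    moreover obtain g where "g \<in> T" "degree g \<le> degree r" using T_reduce[OF sr(2) rJ nall] by blast
    ultimately show ?thesis by (intro bexI[of _ g]) simp_all
  qed
  then obtain g0 where "g0 \<in> T" "degree g0 < degree p" by blast
  then obtain g where gT: "g \<in> T" and gmin: "\<And>q. q \<in> T \<Longrightarrow> degree g \<le> degree q"
    using ex_has_least_nat[of "\<lambda>p. p \<in> T" _ degree] by blast
  have ge: "degree g < degree p" using gmin[OF \<open>g0 \<in> T\<close>] \<open>degree g0 < degree p\<close> by simp
  have g: "rpoly K m g" "poly g (var m) \<in> J" "lead_coeff g \<notin> M" using gT by (auto simp: T_def)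
  have g0: "g \<noteq> 0" using g(3) M_0 by auto
  have "degree g = 0"
  proof (rule ccontr)
    assume s0: "degree g \<noteq> 0"
    from pseudo_division[OF p(1) g(1) g0] obtain k q r where
      qr: "rpoly K m q" "rpoly K m r" "smult (lead_coeff g ^ k) p = q * g + r" "r = 0 \<or> degree r < degree g" by blast
    have "poly (smult (lead_coeff g ^ k) p) (var m) = poly (q * g + r) (var m)" by (simp only: qr(3))
    then have eq: "poly r (var m) = lead_coeff g ^ k * poly p (var m) - poly q (var m) * poly g (var m)"
      by (simp add: algebra_simps)
    have lgk: "lead_coeff g ^ k \<in> pring K (Suc m)" "lead_coeff g ^ k \<in> pring K n"
      using g(1) pring_mono[of m "Suc m" K] coeff_n[OF g(1)] by (auto intro!: pring_power simp: rpoly_def)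
    have lgM: "lead_coeff g ^ k \<notin> M" using M_power[OF coeff_n[OF g(1)] g(3)] .
    have lp: "lead_coeff g ^ k * poly p (var m) \<in> M \<inter> pring K (Suc m)"
      using p lgk by (auto intro!: M_mult rpoly_eval_in)
    have "poly r (var m) \<in> J"
      unfolding eq using J_diff[OF J_M[OF lp] J_mult[OF g(2) rpoly_eval_in[OF qr(1)]]] .
    note rJ = this
    have rall: "\<forall>i. coeff r i \<in> M"
    proof (rule ccontr)
      assume nall: "\<not> (\<forall>i. coeff r i \<in> M)"
      then obtain g' where "g' \<in> T" "degree g' \<le> degree r" using T_reduce[OF qr(2) rJ] by blast
      moreover have "r \<noteq> 0" using nall M_0 by auto
      ultimately show False using gmin[of g'] qr(4) by simp
    qed
    then have "poly r (var m) \<in> M" using coeffs_M_eval by blast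
    then have "lead_coeff g ^ k * poly p (var m) - poly r (var m) \<in> M" using M_diff lp by blast
    then have "poly q (var m) * poly g (var m) \<in> M" by (simp add: eq)
    then have "poly q (var m) \<in> M \<or> poly g (var m) \<in> M" using M_prime rp_n[OF qr(1)] rp_n[OF g(1)] by blast
    then show False
    proof
      assume "poly g (var m) \<in> M"
      then have "g \<in> S" using g by (simp add: S_def)
      then show False using pmin[of g] ge by simp
    next
      \<comment> \<open>Here \<open>q\<close> contradicts the minimality of \<open>p\<close>: the
        coefficient of \<open>q * g\<close> at the degree of \<open>p\<close> lies outside
        \<open>M\<close>, hence so does the leading coefficient of \<open>q\<close>, and
        \<open>q\<close> has smaller degree than \<open>p\<close> because that of \<open>g\<close>
        is positive.\<close>
      assume qM: "poly q (var m) \<in> M"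
      have cr: "coeff r (degree p) = 0" using qr(4) ge coeff_eq_0[of r "degree p"] by auto
      have "lead_coeff g ^ k * lead_coeff p \<notin> M"
        using M_prime[OF lgk(2) coeff_n[OF p(1)]] lgM p(3) by blast
      moreover have top: "coeff (q * g) (degree p) = lead_coeff g ^ k * lead_coeff p"
        using arg_cong[OF qr(3), of "\<lambda>z. coeff z (degree p)"] cr by simp
      ultimately have topM: "coeff (q * g) (degree p) \<notin> M" by simp
      have degqg: "degree (q * g) = degree p"
      proof (rule antisym)
        have "q * g = smult (lead_coeff g ^ k) p - r" using qr(3) by simp
        also have "degree \<dots> \<le> degree p"
          using qr(4) ge by (intro degree_diff_le order_trans[OF degree_smult_le]) auto
        finally show "degree (q * g) \<le> degree p" .
        show "degree p \<le> degree (q * g)" using topM M_0 by (intro le_degree) auto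
      qed
      have q0: "q \<noteq> 0" using topM M_0 by auto
      have "lead_coeff (q * g) = lead_coeff q * lead_coeff g" by (rule lead_coeff_mult)
      then have "lead_coeff q * lead_coeff g \<notin> M" using topM degqg by simp
      then have "lead_coeff q \<notin> M"
        using M_mult[OF coeff_n[OF g(1), of "degree g"], of "lead_coeff q"] by (metis mult.commute)
      then have "q \<in> S" using qr(1) qM by (simp add: S_def)
      moreover have "degree q < degree p" using degqg q0 g0 s0 by (simp add: degree_mult_eq)
      ultimately show False using pmin[of q] by simp
    qed
  qed
  then obtain c where c: "g = [:c:]" by (rule degree_eq_zeroE)
  have cM: "c \<notin> M" "c \<in> pring K m" using g(1,3) by (auto simp: c rpoly_def split: if_splits dest: spec[of _ 0])
  obtain u y where uy: "c = u * b + y" "u \<in> pring K (Suc m)" "y \<in> M \<inter> pring K (Suc m)"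
    using g(2) unfolding J_def c by auto
  have lp: "lead_coeff p \<in> pring K m" using p(1) by (simp add: rpoly_def)
  \<comment> \<open>Where \<open>lead_coeff p\<close> does not vanish, the specialised
    \<open>p\<close> keeps its positive degree and has a root \<open>t\<close>. Where
    \<open>c\<close> does not vanish, neither does \<open>b\<close> at a zero of \<open>M\<close>,
    by \<open>c = u * b + y\<close>.\<close>
  have "lead_coeff p * c \<in> pring K m - M"
    using lp cM p(3) M_prime[of "lead_coeff p" c] sub_n by auto
  then obtain a where a: "\<And>i. a i \<in> Qbar" "\<And>P. P \<in> M \<inter> pring K m \<Longrightarrow> poly_eval P a = 0"
    "poly_eval (lead_coeff p * c) a \<noteq> 0"
    using IH unfolding has_zeros_def by blast
  define pa where "pa = map_poly (\<lambda>c. poly_eval c a) p"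
  have cpa: "coeff pa i = poly_eval (coeff p i) a" for i by (simp add: pa_def coeff_map_poly)
  have lpa: "coeff pa (degree p) \<noteq> 0" using a(3) by (simp add: cpa)
  then have "degree pa > 0" using le_degree[OF lpa] e0 by simp
  then obtain t where t: "poly pa t = 0"
    using fundamental_theorem_of_algebra[of pa] by (auto simp: constant_degree)
  have "pover Qbar pa" unfolding pover_def cpa
  proof
    fix i
    have "coeffs_in Qbar (coeff p i)" "vars_below m (coeff p i)"
      using p(1) KQ by (auto simp: rpoly_def pring_def coeffs_in_def)
    then show "poly_eval (coeff p i) a \<in> Qbar"
      using csubfield.poly_eval_in[OF csubfield_Qbar] a(1) by blast
  qed
  then have tQ: "t \<in> Qbar" using Qbar_root t \<open>degree pa > 0\<close> by (metis degree_0 less_irrefl)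
  let ?a = "a(m := t)"
  have pz: "poly_eval (poly p (var m)) ?a = 0" using poly_eval_rpoly[OF p(1)] t by (simp add: pa_def)
  have lpz: "poly_eval (lead_coeff p) ?a \<noteq> 0" "poly_eval c ?a \<noteq> 0"
  proof -
    have "poly_eval P ?a = poly_eval P a" if "P \<in> pring K m" for P
      using that by (intro poly_eval_cong[of m]) (auto simp: pring_def)
    then show "poly_eval (lead_coeff p) ?a \<noteq> 0" "poly_eval c ?a \<noteq> 0" using a(3) lp cM(2) by auto
  qed
  have zero: "poly_eval P ?a = 0" if P: "P \<in> M \<inter> pring K (Suc m)" for P
  proof -
    obtain q where q: "rpoly K m q" "P = poly q (var m)" using rpoly_of_pring P by blast
    from pseudo_division[OF q(1) p(1) p0] obtain k s r where
      sr: "rpoly K m s" "rpoly K m r" "smult (lead_coeff p ^ k) q = s * p + r" "r = 0 \<or> degree r < degree p" by blast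
    have "poly (smult (lead_coeff p ^ k) q) (var m) = poly (s * p + r) (var m)" by (simp only: sr(3))
    then have eq: "lead_coeff p ^ k * P = poly s (var m) * poly p (var m) + poly r (var m)" by (simp add: q(2))
    have "poly r (var m) = lead_coeff p ^ k * P - poly s (var m) * poly p (var m)" by (simp add: eq)
    also have "\<dots> \<in> M" using P p sr(1) coeff_n[OF p(1)] by (intro M_diff M_mult pring_power rp_n) auto
    finally have "\<forall>i. coeff r i \<in> M" using small[OF sr(2) _ sr(4)] by blast
    then have "coeff r i \<in> M \<inter> pring K m" for i using sr(2) by (simp add: rpoly_def)
    then have "map_poly (\<lambda>c. poly_eval c a) r = 0" using a(2) by (intro poly_eqI) (simp add: coeff_map_poly)
    then have "poly_eval (poly r (var m)) ?a = 0" using poly_eval_rpoly[OF sr(2)] by simp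
    then have "poly_eval (lead_coeff p ^ k * P) ?a = 0" unfolding eq using pz by simp
    then show ?thesis using lpz by simp
  qed
  show ?thesis
  proof (intro exI[of _ ?a] conjI allI ballI)
    show "?a i \<in> Qbar" for i using a(1) tQ by simp
    show "poly_eval P ?a = 0" if "P \<in> M \<inter> pring K (Suc m)" for P using zero[OF that] .
    show "poly_eval b ?a \<noteq> 0" using lpz(2) zero[OF uy(3)] uy(1) by auto
  qed
qed

end

lemma has_zeros_all: "m \<le> n \<Longrightarrow> has_zeros m"
proof (induction m)
  case (Suc m)
  then have IH: "has_zeros m" by simp
  show ?case unfolding has_zeros_def
  proof
    fix b assume b: "b \<in> pring K (Suc m) - M"
    show "\<exists>a. (\<forall>i. a i \<in> Qbar) \<and> (\<forall>P \<in> M \<inter> pring K (Suc m). poly_eval P a = 0) \<and> poly_eval b a \<noteq> 0"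
    proof (cases "\<exists>p. rpoly K m p \<and> poly p (var m) \<in> M \<and> \<not> (\<forall>i. coeff p i \<in> M)")
      case True
      then show ?thesis by (rule zeros_step_algebraic[OF Suc.prems IH b])
    next
      case False
      then show ?thesis by (intro zeros_step_transcendental[OF Suc.prems IH b]) blast
    qed
  qed
qed (rule has_zeros_0)

end

text \<open>The zero ideal is prime and does not contain \<open>F\<close>, so
  \<open>has_zeros\<close> applies with \<open>b = F\<close>.\<close>

lemma nonzero_poly_has_nonzero:
  assumes "F \<noteq> 0" "coeffs_in Qbar F" "vars_below n F"
  obtains a where "\<And>i. a i \<in> Qbar" "poly_eval F a \<noteq> 0"
proof -
  interpret Q: csubfield Qbar by (rule csubfield_Qbar)
  interpret P: prime_pideal Qbar n "{0}" by unfold_locales auto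
  have "F \<in> pring Qbar n - {0}" using assms by (simp add: pring_def)
  then show ?thesis using P.has_zeros_all[of n] that unfolding P.has_zeros_def by blast
qed

context csubfield
begin

definition pideal :: "nat \<Rightarrow> cpoly set \<Rightarrow> bool" where
  "pideal n M \<longleftrightarrow> M \<subseteq> pring F n \<and> 0 \<in> M \<and> (\<forall>P\<in>M. \<forall>Q\<in>M. P + Q \<in> M) \<and> (\<forall>P\<in>pring F n. \<forall>Q\<in>M. P * Q \<in> M)"

lemma pideal_extend:
  assumes M: "pideal n M" and P: "P \<in> pring F n"
  shows "pideal n {u * P + y |u y. u \<in> pring F n \<and> y \<in> M}"
    "M \<subseteq> {u * P + y |u y. u \<in> pring F n \<and> y \<in> M}" "P \<in> {u * P + y |u y. u \<in> pring F n \<and> y \<in> M}"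
proof -
  let ?I = "{u * P + y |u y. u \<in> pring F n \<and> y \<in> M}"
  show sub: "M \<subseteq> ?I"
  proof
    fix y assume "y \<in> M"
    then show "y \<in> ?I" by (intro CollectI exI[of _ 0] exI[of _ y]) auto
  qed
  show "P \<in> ?I" using M by (intro CollectI exI[of _ 1] exI[of _ 0]) (auto simp: pideal_def)
  show "pideal n ?I" unfolding pideal_def
  proof (intro conjI ballI)
    show "?I \<subseteq> pring F n" using M P by (auto simp: pideal_def)
    have "0 \<in> M" using M by (simp add: pideal_def)
    then show "0 \<in> ?I" using sub by (rule rev_subsetD)
    fix Q assume "Q \<in> ?I"
    then obtain u y where *: "Q = u * P + y" "u \<in> pring F n" "y \<in> M" by blast
    {
      fix Q' assume "Q' \<in> ?I"
      then obtain u' y' where **: "Q' = u' * P + y'" "u' \<in> pring F n" "y' \<in> M" by blast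
      have "Q + Q' = (u + u') * P + (y + y')" using * ** by (simp add: algebra_simps)
      moreover have "y + y' \<in> M" using M * ** by (auto simp: pideal_def)
      ultimately show "Q + Q' \<in> ?I" using * ** by blast
    next
      fix R assume R: "R \<in> pring F n"
      have "R * Q = (R * u) * P + R * y" using * by (simp add: algebra_simps)
      moreover have "R * y \<in> M" using M * R by (auto simp: pideal_def)
      ultimately show "R * Q \<in> ?I" using * R by blast
    }
  qed
qed

text \<open>An ideal maximal among those above \<open>I\<close> without a power of \<open>H\<close>
  is prime. If \<open>P\<close> and \<open>Q\<close> lie outside, adjoining either one yields a
  power of \<open>H\<close>; the product of the two relations shows that \<open>P * Q\<close> lies
  outside too.\<close>

lemma exists_prime_pideal:
  assumes "F \<subseteq> Qbar" "pideal n I" "H \<in> pring F n" "\<And>e. H ^ e \<notin> I"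
  obtains M where "I \<subseteq> M" "prime_pideal F n M" "H \<notin> M"
proof -
  define SS where "SS = {M. pideal n M \<and> I \<subseteq> M \<and> (\<forall>e. H ^ e \<notin> M)}"
  have "\<exists>M\<in>SS. \<forall>Y\<in>SS. M \<subseteq> Y \<longrightarrow> Y = M"
  proof (rule subset_Zorn)
    fix C assume C: "subset.chain SS C"
    show "\<exists>U\<in>SS. \<forall>Y\<in>C. Y \<subseteq> U"
    proof (cases "C = {}")
      case True
      then show ?thesis using assms by (intro bexI[of _ I]) (auto simp: SS_def)
    next
      case False
      have sub: "C \<subseteq> SS" and lin: "\<And>Y1 Y2. Y1 \<in> C \<Longrightarrow> Y2 \<in> C \<Longrightarrow> Y1 \<subseteq> Y2 \<or> Y2 \<subseteq> Y1"
        using C by (auto simp: subset_chain_def)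
      have "pideal n (\<Union>C)" unfolding pideal_def
      proof (intro conjI ballI)
        show "\<Union>C \<subseteq> pring F n" using sub by (auto simp: SS_def pideal_def)
        show "0 \<in> \<Union>C" using False sub by (auto simp: SS_def pideal_def)
        fix P Q assume "P \<in> \<Union>C" "Q \<in> \<Union>C"
        then obtain Y1 Y2 where Y: "Y1 \<in> C" "Y2 \<in> C" "P \<in> Y1" "Q \<in> Y2" by blast
        obtain Z where Z: "Z \<in> C" "P \<in> Z" "Q \<in> Z" using lin[OF Y(1,2)] Y by blast
        then have "pideal n Z" using sub by (auto simp: SS_def)
        then have "P + Q \<in> Z" using Z by (simp add: pideal_def)
        then show "P + Q \<in> \<Union>C" using Z(1) by (rule UnionI[rotated])
      next
        fix P Q assume P: "P \<in> pring F n" and "Q \<in> \<Union>C"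
        then obtain Z where Z: "Z \<in> C" "Q \<in> Z" by blast
        then have "pideal n Z" using sub by (auto simp: SS_def)
        then have "P * Q \<in> Z" using P Z by (simp add: pideal_def)
        then show "P * Q \<in> \<Union>C" using Z(1) by (rule UnionI[rotated])
      qed
      then have "\<Union>C \<in> SS" using sub False by (auto simp: SS_def)
      then show ?thesis by (intro bexI[of _ "\<Union>C"]) auto
    qed
  qed
  then obtain M where M: "pideal n M" "I \<subseteq> M" "\<And>e. H ^ e \<notin> M"
    and max: "\<And>Y. pideal n Y \<Longrightarrow> I \<subseteq> Y \<Longrightarrow> (\<And>e. H ^ e \<notin> Y) \<Longrightarrow> M \<subseteq> Y \<Longrightarrow> Y = M"
    by (auto simp: SS_def)
  have hit: "\<exists>e u y. u \<in> pring F n \<and> y \<in> M \<and> H ^ e = u * P + y" if P: "P \<in> pring F n" "P \<notin> M" for P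
  proof (rule ccontr)
    assume neg: "\<not> ?thesis"
    let ?I = "{u * P + y |u y. u \<in> pring F n \<and> y \<in> M}"
    note ext = pideal_extend[OF M(1) P(1)]
    have "?I = M" using ext M(2) neg by (intro max) auto
    then show False using ext(3) P(2) by simp
  qed
  have "prime_pideal F n M"
  proof
    show "1 \<notin> M" using M(3)[of 0] by simp
    fix P Q assume PQ: "P \<in> pring F n" "Q \<in> pring F n" "P * Q \<in> M"
    show "P \<in> M \<or> Q \<in> M"
    proof (rule ccontr)
      assume "\<not> (P \<in> M \<or> Q \<in> M)"
      then obtain e u y e' u' y' where *: "u \<in> pring F n" "y \<in> M" "H ^ e = u * P + y"
        "u' \<in> pring F n" "y' \<in> M" "H ^ e' = u' * Q + y'"
        using hit[OF PQ(1)] hit[OF PQ(2)] by blast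
      have "H ^ (e + e') = (u * u') * (P * Q) + ((u' * Q) * y + (u * P + y) * y')"
        unfolding power_add *(3,6) by (simp add: algebra_simps)
      moreover have "(u * u') * (P * Q) \<in> M" "(u' * Q) * y \<in> M" "(u * P + y) * y' \<in> M"
        using * PQ M(1) unfolding pideal_def by (auto intro!: pring_mult pring_add)
      ultimately have "H ^ (e + e') \<in> M" using M(1) unfolding pideal_def by auto
      then show False using M(3) by blast
    qed
  qed (use M(1) assms(1) in \<open>auto simp: pideal_def\<close>)
  moreover have "H \<notin> M" using M(3)[of 1] by simp
  ultimately show ?thesis using that M(2) by blast
qed

text \<open>If no power of \<open>H\<close> were in the ideal generated by the
  \<open>\<phi> j\<close>, some prime ideal above it would miss \<open>H\<close>, and
  \<open>has_zeros\<close> with \<open>b = H\<close> would give a common zero at which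
  \<open>H\<close> does not vanish.\<close>

theorem nullstellensatz:
  assumes "F \<subseteq> Qbar" and \<phi>: "\<And>j. j \<in> A \<Longrightarrow> \<phi> j \<in> pring F n" and A: "finite A" and H: "H \<in> pring F n"
    and van: "\<And>a. (\<And>i. a i \<in> Qbar) \<Longrightarrow> (\<And>j. j \<in> A \<Longrightarrow> poly_eval (\<phi> j) a = 0) \<Longrightarrow> poly_eval H a = 0"
  shows "\<exists>e G. (\<forall>j\<in>A. G j \<in> pring F n) \<and> H ^ e = (\<Sum>j\<in>A. G j * \<phi> j)"
proof (rule ccontr)
  assume neg: "\<not> ?thesis"
  define I where "I = {\<Sum>j\<in>A. G j * \<phi> j |G. \<forall>j\<in>A. G j \<in> pring F n}"
  have "pideal n I" unfolding pideal_def
  proof (intro conjI ballI)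
    show "I \<subseteq> pring F n" using \<phi> by (auto simp: I_def)
    show "0 \<in> I" unfolding I_def by (intro CollectI exI[of _ "\<lambda>_. 0"]) auto
    fix P assume "P \<in> I"
    then obtain G where G: "P = (\<Sum>j\<in>A. G j * \<phi> j)" "\<forall>j\<in>A. G j \<in> pring F n" unfolding I_def by blast
    {
      fix Q assume "Q \<in> I"
      then obtain G' where G': "Q = (\<Sum>j\<in>A. G' j * \<phi> j)" "\<forall>j\<in>A. G' j \<in> pring F n" unfolding I_def by blast
      show "P + Q \<in> I" unfolding I_def using G G'
        by (intro CollectI exI[of _ "\<lambda>j. G j + G' j"]) (auto simp: distrib_right sum.distrib)
    next
      fix Q assume "Q \<in> pring F n"
      then show "Q * P \<in> I" unfolding I_def using G
        by (intro CollectI exI[of _ "\<lambda>j. Q * G j"]) (auto simp: sum_distrib_left mult.assoc)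
    }
  qed
  moreover have "H ^ e \<notin> I" for e using neg unfolding I_def by blast
  ultimately obtain M where M: "I \<subseteq> M" "prime_pideal F n M" "H \<notin> M"
    using exists_prime_pideal[OF assms(1) _ H] by blast
  interpret P: prime_pideal F n M by fact
  obtain a where a: "\<And>i. a i \<in> Qbar" "\<And>P. P \<in> M \<inter> pring F n \<Longrightarrow> poly_eval P a = 0" "poly_eval H a \<noteq> 0"
    using P.has_zeros_all[of n] H M(3) unfolding P.has_zeros_def by blast
  have \<phi>M: "\<phi> j \<in> M \<inter> pring F n" if "j \<in> A" for j
  proof -
    have "\<phi> j = (\<Sum>i\<in>A. (if i = j then 1 else 0) * \<phi> i)"
      using A that by (simp add: if_distrib[of "\<lambda>z. z * _"] cong: if_cong)
    moreover have "\<forall>i\<in>A. (if i = j then 1 else 0) \<in> pring F n" by auto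
    ultimately have "\<phi> j \<in> I" unfolding I_def by (intro CollectI exI[of _ "\<lambda>i. if i = j then 1 else 0"]) auto
    then show ?thesis using M(1) \<phi>[OF that] by auto
  qed
  have "poly_eval H a = 0" using a(1) a(2)[OF \<phi>M] by (rule van)
  then show False using a(3) by simp
qed

end

section \<open>Homogeneous polynomials\<close>

lemma monomial_degree_add: "monomial_degree (\<alpha> + \<beta>) = monomial_degree \<alpha> + monomial_degree \<beta>"
proof -
  have "monomial_degree \<gamma> = (\<Sum>i\<in>keys \<alpha> \<union> keys \<beta>. lookup \<gamma> i)"
    if "keys \<gamma> \<subseteq> keys \<alpha> \<union> keys \<beta>" for \<gamma>
    unfolding monomial_degree_def using that by (intro sum.mono_neutral_left) (auto simp: in_keys_iff)
  then show ?thesis using keys_add[of \<alpha> \<beta>] by (simp add: lookup_add sum.distrib)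
qed

lemma homogeneous_single: "homogeneous N (monomial_degree \<alpha>) (single \<alpha> c)" if "keys \<alpha> \<subseteq> {..N}"
  using that by (simp add: homogeneous_def)

lemma homogeneous_0 [simp]: "homogeneous N e 0" by (simp add: homogeneous_def)

lemma homogeneous_add: "homogeneous N e P \<Longrightarrow> homogeneous N e Q \<Longrightarrow> homogeneous N e (P + Q)"
  using keys_add[of P Q] unfolding homogeneous_def by blast

lemma homogeneous_sum: "(\<And>i. i \<in> A \<Longrightarrow> homogeneous N e (P i)) \<Longrightarrow> homogeneous N e (sum P A)"
  by (induction A rule: infinite_finite_induct) (auto intro: homogeneous_add)

lemma homogeneous_mult:
  assumes "homogeneous N a P" "homogeneous N b Q" shows "homogeneous N (a + b) (P * Q)"
  unfolding cpoly_mult_expand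
proof (intro homogeneous_sum)
  fix \<alpha> \<beta> assume "\<alpha> \<in> keys P" "\<beta> \<in> keys Q"
  then have "keys (\<alpha> + \<beta>) \<subseteq> {..N}" "monomial_degree (\<alpha> + \<beta>) = a + b"
    using assms keys_add[of \<alpha> \<beta>] unfolding homogeneous_def monomial_degree_add by (blast, simp)
  then show "homogeneous N (a + b) (single (\<alpha> + \<beta>) (lookup P \<alpha> * lookup Q \<beta>))"
    using homogeneous_single by metis
qed

lemma homogeneous_1: "homogeneous N 0 1"
  by (simp add: homogeneous_def monomial_degree_def)

lemma homogeneous_power: "homogeneous N a P \<Longrightarrow> homogeneous N (k * a) (P ^ k)"
  by (induction k) (auto intro: homogeneous_mult homogeneous_1)

lemma homogeneous_prod: "(\<And>i. i \<in> A \<Longrightarrow> homogeneous N (a i) (P i)) \<Longrightarrow> homogeneous N (sum a A) (prod P A)"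
  by (induction A rule: infinite_finite_induct) (auto intro: homogeneous_mult homogeneous_1)

lemma homogeneous_const: "homogeneous N 0 (single 0 c)"
  by (simp add: homogeneous_def monomial_degree_def)

lemma homogeneous_subst:
  assumes "homogeneous N m F" "\<And>i. i \<le> N \<Longrightarrow> homogeneous N e (\<psi> i)"
  shows "homogeneous N (m * e) (poly_subst F \<psi>)"
  unfolding poly_subst_def
proof (rule homogeneous_sum)
  fix \<alpha> assume "\<alpha> \<in> keys F"
  then have \<alpha>: "keys \<alpha> \<subseteq> {..N}" "monomial_degree \<alpha> = m" using assms(1) by (auto simp: homogeneous_def)
  have "homogeneous N (\<Sum>i\<in>keys \<alpha>. lookup \<alpha> i * e)
      (\<Prod>i\<in>keys \<alpha>. \<psi> i ^ lookup \<alpha> i)"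
    using \<alpha>(1) assms(2) by (intro homogeneous_prod homogeneous_power) auto
  from homogeneous_mult[OF homogeneous_const this]
  show "homogeneous N (m * e) (single 0 (lookup F \<alpha>) *
      (\<Prod>i\<in>keys \<alpha>. \<psi> i ^ lookup \<alpha> i))"
    using \<alpha>(2) by (simp add: monomial_degree_def sum_distrib_right[symmetric])
qed

lemma (in csubfield) coeffs_in_power: "coeffs_in F P \<Longrightarrow> coeffs_in F (P ^ k)"
  by (induction k) (auto intro: coeffs_in_mult)

lemma (in csubfield) coeffs_in_prod: "(\<And>i. i \<in> A \<Longrightarrow> coeffs_in F (P i)) \<Longrightarrow> coeffs_in F (prod P A)"
  by (induction A rule: infinite_finite_induct) (auto intro: coeffs_in_mult)

lemma (in csubfield) coeffs_in_subst:
  assumes "coeffs_in F P" "\<And>i. i \<le> N \<Longrightarrow> coeffs_in F (\<psi> i)" "homogeneous N m P"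
  shows "coeffs_in F (poly_subst P \<psi>)"
  unfolding poly_subst_def
proof (intro coeffs_in_sum coeffs_in_mult coeffs_in_prod coeffs_in_power)
  show "coeffs_in F (single 0 (lookup P \<alpha>))" for \<alpha>
    using assms(1) by (simp add: coeffs_in_def[of F P])
  fix \<alpha> i assume "\<alpha> \<in> keys P" "i \<in> keys \<alpha>"
  then have "i \<le> N" using assms(3) unfolding homogeneous_def by blast
  then show "coeffs_in F (\<psi> i)" by (rule assms(2))
qed

text \<open>The terms of \<open>Q\<close> of the wrong degree or with variables beyond
  \<open>N\<close> are collected in \<open>Q2\<close>. As \<open>G * Q2\<close> is still homogeneous
  of degree \<open>M\<close>, the leading monomial of a nonzero \<open>Q2\<close> would have the
  right shape after all.\<close>

lemma homogeneous_cofactor: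
  assumes E: "homogeneous N M (G * Q)" and G: "homogeneous N g G" "G \<noteq> 0" and "Q \<noteq> 0"
  shows "g \<le> M" "homogeneous N (M - g) Q"
proof -
  have key: "keys b \<subseteq> {..N} \<and> g + monomial_degree b = M"
    if "homogeneous N M (G * Q')" "Q' \<noteq> 0" "b = Max (keys Q')" for Q' b
  proof -
    note m = lookup_mult_Max[OF G(2) that(2)]
    let ?a = "Max (keys G)"
    have "?a + b \<in> keys (G * Q')" using m that(3) by (simp add: in_keys_iff)
    then have "keys (?a + b) \<subseteq> {..N}" "monomial_degree ?a + monomial_degree b = M"
      using that(1) by (auto simp: homogeneous_def monomial_degree_add)
    moreover have "keys b \<subseteq> keys (?a + b)"
      by (auto simp: in_keys_iff lookup_add)
    moreover have "monomial_degree ?a = g" using G(1) m(2) by (auto simp: homogeneous_def)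
    ultimately show ?thesis by auto
  qed
  show gM: "g \<le> M" using key[OF E \<open>Q \<noteq> 0\<close> refl] by simp
  define R where "R \<beta> \<longleftrightarrow> keys \<beta> \<subseteq> {..N} \<and> monomial_degree \<beta> = M - g" for \<beta>
  obtain Q1 Q2 where Q: "Q = Q1 + Q2"
    and 1: "\<And>\<beta>. lookup Q1 \<beta> = (if R \<beta> then lookup Q \<beta> else 0)"
    and 2: "\<And>\<beta>. lookup Q2 \<beta> = (if R \<beta> then 0 else lookup Q \<beta>)"
    using cpoly_split[of Q R] by blast
  have "R \<beta>" if "\<beta> \<in> keys Q1" for \<beta> using that by (auto simp: in_keys_iff 1 split: if_splits)
  then have Q1: "homogeneous N (M - g) Q1" unfolding homogeneous_def R_def by blast
  have "homogeneous N M (G * (- 1 * Q1))"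
    using homogeneous_mult[OF G(1) homogeneous_mult[OF homogeneous_const[of N "-1"] Q1]] gM
    by (simp add: single_uminus)
  from homogeneous_add[OF E this] have "homogeneous N M (G * Q2)" by (simp add: Q algebra_simps)
  have "Q2 = 0"
  proof (rule ccontr)
    assume "Q2 \<noteq> 0"
    define b where "b = Max (keys Q2)"
    have "b \<in> keys Q2" using lookup_mult_Max(3)[OF G(2) \<open>Q2 \<noteq> 0\<close>] by (simp add: b_def)
    moreover have "keys b \<subseteq> {..N}" "monomial_degree b = M - g"
      using key[OF \<open>homogeneous N M (G * Q2)\<close> \<open>Q2 \<noteq> 0\<close> b_def] by auto
    ultimately show False by (simp add: in_keys_iff 2 R_def)
  qed
  then show "homogeneous N (M - g) Q" using Q Q1 by simp
qed

lemma homogeneous_iterate: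
  assumes "\<And>i. i \<le> N \<Longrightarrow> homogeneous N d (\<phi> i)" "i \<le> N"
  shows "homogeneous N (d ^ n) (poly_iterate \<phi> n i)"
  using assms(2)
proof (induction n arbitrary: i)
  case 0
  then show ?case by (simp add: homogeneous_def monomial_degree_def)
next
  case (Suc n)
  then show ?case using homogeneous_subst[OF assms(1)[OF Suc.prems] Suc.IH] by simp
qed

lemma (in csubfield) coeffs_in_iterate:
  assumes "\<And>i. i \<le> N \<Longrightarrow> homogeneous N d (\<phi> i)" "\<And>i. i \<le> N \<Longrightarrow> coeffs_in F (\<phi> i)" "i \<le> N"
  shows "coeffs_in F (poly_iterate \<phi> n i)"
  using assms(3)
proof (induction n arbitrary: i)
  case (Suc n)
  then show ?case using coeffs_in_subst[OF assms(2)[OF Suc.prems] Suc.IH assms(1)[OF Suc.prems]] by simp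
qed simp

section \<open>Algebraic integers\<close>

text \<open>Integrality is claimed for all multiples of \<open>a\<close>, so that one common
  multiple can serve finitely many numbers.\<close>

lemma algebraic_int_multiples:
  assumes "algebraic (y :: complex)"
  shows "\<exists>a :: int. a \<noteq> 0 \<and> (\<forall>k. a dvd k \<longrightarrow> algebraic_int (of_int k * y))"
proof -
  from assms obtain p where p: "\<And>i. coeff p i \<in> \<int>" "p \<noteq> 0" "poly p y = 0" by (auto simp: algebraic_def)
  define n where "n = degree p"
  obtain a :: int where a: "lead_coeff p = of_int a" using p(1)[of "degree p"] by (auto elim: Ints_cases)
  have a0: "a \<noteq> 0" using p(2) a by auto
  have n0: "n > 0"
  proof (rule ccontr)
    assume "\<not> n > 0"
    then obtain c where "p = [:c:]" using degree_eq_zeroE[of p] by (auto simp: n_def)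
    then show False using p(2,3) by simp
  qed
  have "algebraic_int (of_int k * y)" if "a dvd k" for k
  proof -
    from that obtain m where k: "k = a * m" by (elim dvdE)
    \<comment> \<open>With \<open>k = a * m\<close> and \<open>a\<close> the leading coefficient of
      \<open>p\<close>, this monic polynomial satisfies
      \<open>q(k y) = m k^(n-1) p(y)\<close>.\<close>
    define q where "q = monom 1 n + (\<Sum>i<n. monom (coeff p i * of_int (m * k ^ (n - 1 - i))) i)"
    have cq: "coeff q i = (if i = n then 1 else if i < n then coeff p i * of_int (m * k ^ (n - 1 - i)) else 0)" for i
      by (auto simp: q_def coeff_sum)
    have dq: "degree q = n" by (intro antisym degree_le le_degree) (auto simp: cq)
    have "poly q (of_int k * y) = of_int k ^ n * y ^ n +
        (\<Sum>i<n. coeff p i * of_int (m * k ^ (n - 1 - i)) * (of_int k * y) ^ i)"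
      by (simp add: q_def poly_sum poly_monom power_mult_distrib)
    also have "(\<Sum>i<n. coeff p i * of_int (m * k ^ (n - 1 - i)) * (of_int k * y) ^ i) =
        (\<Sum>i<n. of_int (m * k ^ (n - 1)) * (coeff p i * y ^ i))"
    proof (intro sum.cong refl)
      fix i assume "i \<in> {..<n}"
      then have "k ^ (n - 1 - i) * k ^ i = k ^ (n - 1)" by (simp add: power_add[symmetric])
      then have *: "of_int (k ^ (n - 1 - i)) * of_int k ^ i = (of_int (k ^ (n - 1)) :: complex)"
        by (metis of_int_mult of_int_power)
      have "coeff p i * of_int (m * k ^ (n - 1 - i)) * (of_int k * y) ^ i =
          of_int m * (of_int (k ^ (n - 1 - i)) * of_int k ^ i) * (coeff p i * y ^ i)"
        by (simp add: power_mult_distrib mult_ac)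
      also have "\<dots> = of_int (m * k ^ (n - 1)) * (coeff p i * y ^ i)" unfolding * by simp
      finally show "coeff p i * of_int (m * k ^ (n - 1 - i)) * (of_int k * y) ^ i =
          of_int (m * k ^ (n - 1)) * (coeff p i * y ^ i)" .
    qed
    also have "of_int k ^ n * y ^ n = of_int (m * k ^ (n - 1)) * (coeff p n * y ^ n)"
    proof -
      have "k ^ n = k ^ (n - 1) * (a * m)" using n0 k by (metis power_minus_mult)
      then have "(of_int (k ^ n) :: complex) = of_int (k ^ (n - 1) * (a * m))" by simp
      then show ?thesis using a by (simp add: n_def mult_ac)
    qed
    also have "of_int (m * k ^ (n - 1)) * (coeff p n * y ^ n) + (\<Sum>i<n. of_int (m * k ^ (n - 1)) * (coeff p i * y ^ i)) =
        of_int (m * k ^ (n - 1)) * (\<Sum>i<Suc n. coeff p i * y ^ i)"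
      by (simp add: sum_distrib_left distrib_left)
    also have "(\<Sum>i<Suc n. coeff p i * y ^ i) = poly p y"
      by (simp only: poly_altdef n_def lessThan_Suc_atMost)
    finally have "poly q (of_int k * y) = 0" using p(3) by simp
    moreover have "coeff q i \<in> \<int>" for i
      unfolding cq using p(1) by (auto intro!: Ints_mult)
    ultimately show ?thesis using dq by (intro algebraic_int.intros[of q]) (auto simp: cq)
  qed
  with a0 show ?thesis by (intro exI[of _ a]) auto
qed

lemma clear_denominators:
  assumes "finite Y" "Y \<subseteq> Qbar"
  obtains k :: int where "k \<noteq> 0" "\<And>y. y \<in> Y \<Longrightarrow> algebraic_int (of_int k * y)"
proof -
  have "\<forall>y\<in>Y. \<exists>a :: int. a \<noteq> 0 \<and> (\<forall>k. a dvd k \<longrightarrow> algebraic_int (of_int k * y))"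
    using assms(2) by (auto simp: Qbar_def intro!: algebraic_int_multiples)
  from bchoice[OF this] obtain a :: "complex \<Rightarrow> int" where a: "\<And>y. y \<in> Y \<Longrightarrow> a y \<noteq> 0"
    "\<And>y k. y \<in> Y \<Longrightarrow> a y dvd k \<Longrightarrow> algebraic_int (of_int k * y)" by auto
  show ?thesis
  proof (rule that[of "\<Prod>y\<in>Y. a y"])
    show "(\<Prod>y\<in>Y. a y) \<noteq> 0" using a(1) assms(1) by (simp add: prod_zero_iff)
    show "algebraic_int (of_int (\<Prod>y\<in>Y. a y) * y)" if "y \<in> Y" for y
      using that assms(1) by (intro a(2)) (auto intro: dvd_prodI)
  qed
qed

section \<open>Scaling of normal crossings divisors\<close>

lemma analytic_near_cmult:
  assumes "analytic_near I u p" shows "analytic_near I (\<lambda>z. c * u z) p"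
proof -
  obtain r a where r: "r > 0" and a: "\<And>z. z \<in> polydisc I p r \<Longrightarrow>
      ((\<lambda>\<alpha>. a \<alpha> * (\<Prod>i\<in>I. (z i - p i) ^ lookup \<alpha> i)) has_sum u z) {\<alpha>. keys \<alpha> \<subseteq> I}"
    using assms unfolding analytic_near_def by blast
  show ?thesis unfolding analytic_near_def
  proof (intro exI[of _ r] conjI exI[of _ "\<lambda>\<alpha>. c * a \<alpha>"] ballI)
    show "((\<lambda>\<alpha>. c * a \<alpha> * (\<Prod>i\<in>I. (z i - p i) ^ lookup \<alpha> i)) has_sum c * u z) {\<alpha>. keys \<alpha> \<subseteq> I}"
      if "z \<in> polydisc I p r" for z
      using has_sum_cmult_right[OF a[OF that], of c] by (simp add: mult.assoc)
  qed (rule r)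
qed

text \<open>The constant is absorbed by the unit \<open>u\<close> of the local equation. This
  permits clearing denominators in a normal-crossings divisor.\<close>

lemma normal_crossings_scale:
  assumes "normal_crossings N E" "c \<noteq> 0"
  shows "normal_crossings N (single 0 c * E)"
  unfolding normal_crossings_def
proof (intro ballI allI impI)
  fix p j assume "p \<in> coord_vectors N UNIV" "j \<le> N" "p j = 1"
  then obtain x A u r where *: "local_coordinates ({..N} - {j}) p x" "A \<subseteq> {..N} - {j}"
    "analytic_near ({..N} - {j}) u p" "u p \<noteq> 0"
    "r > 0" "\<And>z. z \<in> polydisc ({..N} - {j}) p r \<Longrightarrow> poly_eval E z = u z * (\<Prod>i\<in>A. x z i)"
    using assms(1) unfolding normal_crossings_def by blast
  show "\<exists>x A u. local_coordinates ({..N} - {j}) p x \<and> A \<subseteq> {..N} - {j} \<and>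
          analytic_near ({..N} - {j}) u p \<and> u p \<noteq> 0 \<and>
          (\<exists>r>0. \<forall>z\<in>polydisc ({..N} - {j}) p r. poly_eval (single 0 c * E) z = u z * (\<Prod>i\<in>A. x z i))"
    using *(4,6) assms(2)
    by (intro exI[of _ x] exI[of _ A] exI[of _ "\<lambda>z. c * u z"] conjI exI[of _ r] ballI
        *(1,2,5) analytic_near_cmult[OF *(3)]) simp_all
qed

section \<open>Heights under iteration\<close>

text \<open>The lift of \<open>proj_map\<close> to coordinate vectors. The value \<open>0\<close>
  beyond \<open>N\<close> keeps iterates inside \<open>coord_vectors\<close>.\<close>

definition hmap :: "nat \<Rightarrow> (nat \<Rightarrow> cpoly) \<Rightarrow> (nat \<Rightarrow> complex) \<Rightarrow> nat \<Rightarrow> complex" where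
  "hmap N \<phi> z = (\<lambda>i. if i \<le> N then poly_eval (\<phi> i) z else 0)"

lemma poly_eval_iterate:
  assumes "\<And>i. i \<le> N \<Longrightarrow> homogeneous N d (\<phi> i)" "i \<le> N"
  shows "poly_eval (poly_iterate \<phi> n i) z = (hmap N \<phi> ^^ n) z i"
  using assms(2)
proof (induction n arbitrary: i)
  case 0
  then show ?case using poly_eval_var[of i z] by (simp add: var_def)
next
  case (Suc n)
  have "poly_eval (\<phi> i) (\<lambda>j. poly_eval (poly_iterate \<phi> n j) z) = poly_eval (\<phi> i) ((hmap N \<phi> ^^ n) z)"
    using homogeneous_vars_below[OF assms(1)[OF Suc.prems]] Suc.IH by (intro poly_eval_cong) auto
  then show ?case using Suc.prems by (simp add: poly_eval_subst hmap_def[of N \<phi> "(hmap N \<phi> ^^ n) z"])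
qed

lemma poly_eval_pullback_iterate:
  assumes "\<And>i. i \<le> N \<Longrightarrow> homogeneous N d (\<phi> i)" "homogeneous N e F"
  shows "poly_eval (pullback (poly_iterate \<phi> n) F) z = poly_eval F ((hmap N \<phi> ^^ n) z)"
  unfolding pullback_def poly_eval_subst
  using homogeneous_vars_below[OF assms(2)] poly_eval_iterate[OF assms(1)] by (intro poly_eval_cong) auto

lemma vanishes_at_proj_point:
  assumes "homogeneous N e F" shows "vanishes_at F (proj_point z) \<longleftrightarrow> poly_eval F z = 0"
proof
  show "vanishes_at F (proj_point z)" if "poly_eval F z = 0"
    unfolding vanishes_at_def proj_point_def using poly_eval_scale[OF assms] that by auto
qed (auto simp: vanishes_at_def intro: proj_point_self)

lemma hmap_scale:
  assumes "\<And>i. i \<le> N \<Longrightarrow> homogeneous N d (\<phi> i)"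
  shows "hmap N \<phi> (\<lambda>i. c * z i) = (\<lambda>i. c ^ d * hmap N \<phi> z i)"
  using poly_eval_scale[OF assms] by (auto simp: hmap_def fun_eq_iff)

locale morphism_over = numfield K x f for K x f +
  fixes N d :: nat and \<phi> :: "nat \<Rightarrow> cpoly"
  assumes morphism: "proj_morphism N K d \<phi>"
begin

lemma hom: "i \<le> N \<Longrightarrow> homogeneous N d (\<phi> i)" and coeffs: "i \<le> N \<Longrightarrow> coeffs_in K (\<phi> i)"
  using morphism by (auto simp: proj_morphism_def)

abbreviation "H \<equiv> hmap N \<phi>"

lemma eval_pullback: "homogeneous N e F \<Longrightarrow> poly_eval (pullback (poly_iterate \<phi> n) F) z = poly_eval F ((H ^^ n) z)"
  using poly_eval_pullback_iterate[where \<phi> = \<phi>, OF hom] .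

lemma hmap_in: "z \<in> coord_vectors N K \<Longrightarrow> H z \<in> coord_vectors N K"
proof -
  assume z: "z \<in> coord_vectors N K"
  then have "z \<in> coord_vectors N Qbar" using coord_vectors_mono[OF K_Qbar] by blast
  then obtain i where i: "i \<le> N" "poly_eval (\<phi> i) z \<noteq> 0" using morphism by (auto simp: proj_morphism_def)
  then have "\<exists>i. H z i \<noteq> 0" by (intro exI[of _ i]) (simp add: hmap_def)
  then show ?thesis using poly_eval_K[OF hom coeffs z] by (auto simp: coord_vectors_def hmap_def)
qed

lemma hmap_iterate_in: "z \<in> coord_vectors N K \<Longrightarrow> (H ^^ n) z \<in> coord_vectors N K"
  by (induction n) (auto intro: hmap_in)

lemma proj_map_point: "proj_map N \<phi> (proj_point z) = proj_point (H z)"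
proof -
  have "proj_point (H y) = proj_point (H z)" if "y \<in> proj_point z" for y
  proof -
    from that obtain c where c: "y = (\<lambda>i. c * z i)" "c \<noteq> 0"
      unfolding proj_point_def mem_Collect_eq by (elim exE conjE)
    have "H y = (\<lambda>i. c ^ d * H z i)" unfolding c(1) by (rule hmap_scale[OF hom])
    then show ?thesis using c(2) proj_point_scale[of "c ^ d" "H z"] by simp
  qed
  then have "(\<Union>y\<in>proj_point z. proj_point (H y)) = (\<Union>y\<in>proj_point z. proj_point (H z))"
    by (intro SUP_cong) auto
  also have "\<dots> = proj_point (H z)" using proj_point_self by auto
  finally show ?thesis by (simp add: proj_map_def hmap_def)
qed

lemma proj_map_iterate: "(proj_map N \<phi> ^^ n) (proj_point z) = proj_point ((H ^^ n) z)"
  by (induction n) (simp_all add: proj_map_point)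

lemma hmap_upper:
  "\<exists>C. local_const C \<and> (\<forall>v\<in>places K. \<forall>z\<in>coord_vectors N K. mx N v (H z) \<le> C v * mx N v z ^ d)"
proof -
  have "\<forall>i\<in>{..N}. \<exists>C. local_const C \<and> (\<forall>v\<in>places K. \<forall>z\<in>coord_vectors N K. v (poly_eval (\<phi> i) z) \<le> C v * mx N v z ^ d)"
    using homogeneous_local_bound[OF coeffs hom] by auto
  from bchoice[OF this] obtain C where
    C: "\<And>i. i \<in> {..N} \<Longrightarrow> local_const (C i)"
      "\<And>i v z. i \<in> {..N} \<Longrightarrow> v \<in> places K \<Longrightarrow> z \<in> coord_vectors N K \<Longrightarrow> v (poly_eval (\<phi> i) z) \<le> C i v * mx N v z ^ d"
    by auto
  note Cprod = local_const_le_prod[where C = C and A = "{..N}", OF finite_atMost C(1)]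
  have "mx N v (H z) \<le> (\<Prod>i\<le>N. C i v) * mx N v z ^ d" if v: "v \<in> places K" and z: "z \<in> coord_vectors N K" for v z
  proof (rule mx_leI)
    fix i assume i: "i \<le> N"
    have "v (H z i) \<le> C i v * mx N v z ^ d" using C(2) i v z by (simp add: hmap_def)
    also have "\<dots> \<le> (\<Prod>i\<le>N. C i v) * mx N v z ^ d"
      using Cprod[OF _ _ v, of i] i mx_pos[OF v z] by (intro mult_right_mono) auto
    finally show "v (H z i) \<le> (\<Prod>i\<le>N. C i v) * mx N v z ^ d" .
  qed
  then show ?thesis using local_const_prod[of "{..N}" C] C(1) by (intro exI[of _ "\<lambda>v. \<Prod>i\<le>N. C i v"]) simp
qed

lemma local_const_supp:
  assumes "local_const C" "finite Y" "Y \<subseteq> K"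
  obtains U where "supp K U (\<lambda>v. ln (C v))" "good K Y U"
proof -
  obtain U where U: "supp K U (\<lambda>v. ln (C v))" using assms(1) by (auto simp: local_const_def)
  obtain U' where U': "good K Y U'" using good_exists assms(2,3) by blast
  have fin: "finite (U \<union> U')" "U \<union> U' \<subseteq> standard_rat_abs"
    using U goodD[OF U'] by (auto simp: supp_def)
  show ?thesis
    using supp_mono[OF U _ fin] good_mono[OF U' order_refl _ fin] by (intro that[of "U \<union> U'"]) auto
qed

lemma height_hmap_le: "\<exists>B\<ge>0. \<forall>z\<in>coord_vectors N K. height N (H z) \<le> real d * height N z + B"
proof -
  obtain C where C: "local_const C"
    "\<And>v z. v \<in> places K \<Longrightarrow> z \<in> coord_vectors N K \<Longrightarrow> mx N v (H z) \<le> C v * mx N v z ^ d"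
    using hmap_upper by blast
  define B where "B = hsum K (\<lambda>v. ln (C v))"
  have "height N (H z) \<le> real d * height N z + B" if z: "z \<in> coord_vectors N K" for z
  proof -
    have Hz: "H z \<in> coord_vectors N K" by (rule hmap_in[OF z])
    obtain U where U: "supp K U (\<lambda>v. ln (C v))" "good K (z ` {..N} \<union> H z ` {..N}) U"
      using local_const_supp[OF C(1), of "z ` {..N} \<union> H z ` {..N}"] coord_vectorsD(1)[OF z] coord_vectorsD(1)[OF Hz]
      by auto
    have g: "good K (z ` {..N}) U" "good K (H z ` {..N}) U"
      using good_mono[OF U(2) _ order_refl] goodD(1,2)[OF U(2)] by auto
    note s = supp_mx[OF z g(1)] supp_mx[OF Hz g(2)]
    have s': "supp K U (\<lambda>v. real d * ln (mx N v z))" using s(1) by (auto simp: supp_def)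
    have "height N (H z) \<le> hsum K (\<lambda>v. real d * ln (mx N v z) + ln (C v))"
      unfolding height_def
    proof (rule hsum_mono[OF s(2)])
      show "supp K U (\<lambda>v. real d * ln (mx N v z) + ln (C v))" using s' U(1) by (auto simp: supp_def)
      fix v assume v: "v \<in> places K"
      have C1: "C v \<ge> 1" using C(1) v by (simp add: local_const_def)
      have "ln (mx N v (H z)) \<le> ln (C v * mx N v z ^ d)"
        using C(2)[OF v z] mx_pos[OF v Hz] mx_pos[OF v z] C1 by (subst ln_le_cancel_iff) auto
      also have "\<dots> = real d * ln (mx N v z) + ln (C v)"
        using mx_pos[OF v z] C1 by (simp add: ln_mult ln_realpow)
      finally show "ln (mx N v (H z)) \<le> real d * ln (mx N v z) + ln (C v)" .
    qed
    then show ?thesis unfolding hsum_add[OF s' U(1)] hsum_cmult[OF s(1)] by (simp add: height_def B_def)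
  qed
  then show ?thesis by (intro exI[of _ "\<bar>B\<bar>"]) force
qed

lemma height_iterate_le: "\<exists>B. \<forall>z\<in>coord_vectors N K. height N ((H ^^ n) z) \<le> real d ^ n * height N z + B"
proof (induction n)
  case 0
  show ?case by (intro exI[of _ 0]) simp
next
  case (Suc n)
  then obtain B where B: "\<And>z. z \<in> coord_vectors N K \<Longrightarrow> height N ((H ^^ n) z) \<le> real d ^ n * height N z + B" by blast
  obtain B' where B': "\<And>z. z \<in> coord_vectors N K \<Longrightarrow> height N (H z) \<le> real d * height N z + B'"
    using height_hmap_le by blast
  have "height N ((H ^^ Suc n) z) \<le> real d ^ Suc n * height N z + (real d * B + B')" if z: "z \<in> coord_vectors N K" for z
  proof -
    have "height N ((H ^^ Suc n) z) \<le> real d * height N ((H ^^ n) z) + B'" using B'[OF hmap_iterate_in[OF z]] by simp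
    also have "\<dots> \<le> real d * (real d ^ n * height N z + B) + B'"
      using B[OF z] by (intro add_right_mono mult_left_mono) auto
    finally show ?thesis by (simp add: algebra_simps)
  qed
  then show ?case by (intro exI[of _ "real d * B + B'"]) simp
qed

text \<open>By the Nullstellensatz a power of each coordinate lies in the ideal generated by the \<open>\<phi> i\<close>. Since the
  relation need not be homogeneous, it is applied after scaling the largest coordinate of \<open>z\<close> to one.\<close>

lemma hmap_lower:
  "\<exists>C. local_const C \<and> (\<forall>v\<in>places K. rat_place v \<noteq> real_abs \<longrightarrow>
     (\<forall>z\<in>coord_vectors N K. mx N v z ^ d \<le> C v * mx N v (H z)))"
proof -
  have "\<exists>C. local_const C \<and> (\<forall>v\<in>places K. rat_place v \<noteq> real_abs \<longrightarrow>
     (\<forall>z\<in>coord_vectors N K. mx N v z \<le> 1 \<longrightarrow> z i = 1 \<longrightarrow> 1 \<le> C v * mx N v (H z)))" if i: "i \<le> N" for i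
  proof -
    have "\<exists>e G. (\<forall>j\<in>{..N}. G j \<in> pring K (Suc N)) \<and> var i ^ e = (\<Sum>j\<in>{..N}. G j * \<phi> j)"
    proof (rule K.nullstellensatz[OF K_Qbar])
      show "\<phi> j \<in> pring K (Suc N)" if "j \<in> {..N}" for j
        using that hom[of j] coeffs[of j] homogeneous_vars_below[of N d "\<phi> j"] by (simp add: pring_def)
      show "var i \<in> pring K (Suc N)" using i by (intro K.pring_var) simp
      fix a :: "nat \<Rightarrow> complex"
      assume a: "\<And>i. a i \<in> Qbar" "\<And>j. j \<in> {..N} \<Longrightarrow> poly_eval (\<phi> j) a = 0"
      show "poly_eval (var i) a = 0"
      proof (rule ccontr)
        assume nz: "poly_eval (var i) a \<noteq> 0"
        \<comment> \<open>The zero \<open>a\<close> may have nonzero entries beyond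
          \<open>N\<close>. Cutting them off gives a vector in \<open>coord_vectors\<close> and
          leaves the values of the \<open>\<phi> j\<close> unchanged.\<close>
        define a' where "a' = (\<lambda>j. if j \<le> N then a j else 0)"
        have "a' i \<noteq> 0" using nz i by (simp add: a'_def)
        moreover have "\<forall>i\<le>N. a' i \<in> Qbar" "\<forall>i>N. a' i = 0" using a(1) by (simp_all add: a'_def)
        ultimately have "a' \<in> coord_vectors N Qbar" unfolding coord_vectors_def by blast
        then obtain j where j: "j \<le> N" "poly_eval (\<phi> j) a' \<noteq> 0" using morphism by (auto simp: proj_morphism_def)
        have "poly_eval (\<phi> j) a' = poly_eval (\<phi> j) a"
          using homogeneous_vars_below[OF hom[OF j(1)]] by (intro poly_eval_cong) (auto simp: a'_def)
        then show False using j a(2)[of j] by simp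
      qed
    qed simp
    then obtain e G where G: "\<And>j. j \<le> N \<Longrightarrow> G j \<in> pring K (Suc N)" "var i ^ e = (\<Sum>j\<in>{..N}. G j * \<phi> j)" by auto
    have "\<forall>j\<in>{..N}. \<exists>C. local_const C \<and> (\<forall>v\<in>places K. \<forall>z\<in>coord_vectors N K. mx N v z \<le> 1 \<longrightarrow> v (poly_eval (G j) z) \<le> C v)"
      using integral_local_bound G(1) by (auto simp: pring_def)
    from bchoice[OF this] obtain C where
      C: "\<And>j. j \<in> {..N} \<Longrightarrow> local_const (C j)"
        "\<And>j v z. j \<in> {..N} \<Longrightarrow> v \<in> places K \<Longrightarrow> z \<in> coord_vectors N K \<Longrightarrow> mx N v z \<le> 1 \<Longrightarrow> v (poly_eval (G j) z) \<le> C j v"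
      by auto
    note Cprod = local_const_le_prod[where C = C and A = "{..N}", OF finite_atMost C(1)]
    have "1 \<le> (\<Prod>j\<le>N. C j v) * mx N v (H z)"
      if v: "v \<in> places K" "rat_place v \<noteq> real_abs" and z: "z \<in> coord_vectors N K" "mx N v z \<le> 1" "z i = 1" for v z
    proof -
      interpret v: absval K v by (rule absval_place[OF v(1)])
      have Hz: "H z \<in> coord_vectors N K" by (rule hmap_in[OF z(1)])
      have G_in: "poly_eval (G j) z \<in> K" if "j \<le> N" for j
        using G(1)[OF that] coord_vectorsD(1)[OF z(1)] by (intro K.poly_eval_in[of _ "Suc N"]) (auto simp: pring_def)
      have "1 = poly_eval (var i ^ e) z" using z(3) by simp
      also have "\<dots> = (\<Sum>j\<in>{..N}. poly_eval (G j) z * H z j)"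
        unfolding G(2) poly_eval_sum by (intro sum.cong) (auto simp: hmap_def)
      finally have "v 1 = v (\<Sum>j\<in>{..N}. poly_eval (G j) z * H z j)" by simp
      also have "\<dots> \<le> (\<Prod>j\<le>N. C j v) * mx N v (H z)"
      proof (rule ultrametric_sum[OF v])
        fix j assume j: "j \<in> {..N}"
        then have jK: "poly_eval (G j) z \<in> K" "H z j \<in> K" using G_in coord_vectorsD(1)[OF Hz] by auto
        then show "poly_eval (G j) z * H z j \<in> K" by auto
        have "v (poly_eval (G j) z) \<le> (\<Prod>j\<le>N. C j v)"
          using C(2)[OF j v(1) z(1,2)] Cprod[OF _ j v(1)] by simp
        moreover have "v (H z j) \<le> mx N v (H z)" using j by (intro mx_ge) simp
        moreover have "v (H z j) \<ge> 0" "v (poly_eval (G j) z) \<ge> 0" using jK by (auto intro: v.nonneg)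
        ultimately show "v (poly_eval (G j) z * H z j) \<le> (\<Prod>j\<le>N. C j v) * mx N v (H z)"
          unfolding v.mult[OF jK] by (intro mult_mono) auto
      next
        have "C j v \<ge> 0" if "j \<in> {..N}" for j using C(1)[OF that] v(1) by (force simp: local_const_def)
        then have "(\<Prod>j\<le>N. C j v) \<ge> 0" by (intro prod_nonneg) auto
        then show "0 \<le> (\<Prod>j\<le>N. C j v) * mx N v (H z)" using mx_pos[OF v(1) Hz] by simp
      qed
      finally show ?thesis by simp
    qed
    then show ?thesis using local_const_prod[where C = C and A = "{..N}", OF finite_atMost C(1)] by (intro exI[of _ "\<lambda>v. \<Prod>j\<le>N. C j v"]) simp
  qed
  then have "\<forall>i\<in>{..N}. \<exists>C. local_const C \<and> (\<forall>v\<in>places K. rat_place v \<noteq> real_abs \<longrightarrow>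
     (\<forall>z\<in>coord_vectors N K. mx N v z \<le> 1 \<longrightarrow> z i = 1 \<longrightarrow> 1 \<le> C v * mx N v (H z)))" by auto
  from bchoice[OF this] obtain C where
    C: "\<And>i. i \<in> {..N} \<Longrightarrow> local_const (C i)"
      "\<And>i v z. i \<in> {..N} \<Longrightarrow> v \<in> places K \<Longrightarrow> rat_place v \<noteq> real_abs \<Longrightarrow> z \<in> coord_vectors N K \<Longrightarrow>
         mx N v z \<le> 1 \<Longrightarrow> z i = 1 \<Longrightarrow> 1 \<le> C i v * mx N v (H z)"
    by auto
  note Cprod = local_const_le_prod[where C = C and A = "{..N}", OF finite_atMost C(1)]
  have "mx N v z ^ d \<le> (\<Prod>i\<le>N. C i v) * mx N v (H z)"
    if v: "v \<in> places K" "rat_place v \<noteq> real_abs" and z: "z \<in> coord_vectors N K" for v z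
  proof -
    interpret v: absval K v by (rule absval_place[OF v(1)])
    have Hz: "H z \<in> coord_vectors N K" by (rule hmap_in[OF z])
    obtain i where i: "i \<le> N" "mx N v z = v (z i)" by (rule mx_attained)
    have zi: "z i \<in> K" "z i \<noteq> 0" using coord_vectorsD(1)[OF z i(1)] mx_pos[OF v(1) z] i(2) by auto
    define c where "c = inverse (z i)"
    have c: "c \<in> K" "c \<noteq> 0" using zi by (auto simp: c_def)
    have vc: "v c * mx N v z = 1" using v.pos[OF zi] zi by (simp add: c_def i(2) v.inverse)
    define y where "y = (\<lambda>i. c * z i)"
    have "y i \<noteq> 0" "\<forall>i\<le>N. y i \<in> K" "\<forall>i>N. y i = 0"
      using c zi coord_vectorsD(1,2)[OF z] by (auto simp: y_def)
    then have y: "y \<in> coord_vectors N K" unfolding coord_vectors_def by blast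
    have "mx N v y = 1" unfolding y_def mx_scale[OF v(1) z c(1)] by (rule vc)
    moreover have "y i = 1" using zi by (simp add: y_def c_def)
    ultimately have "1 \<le> C i v * mx N v (H y)" using C(2)[OF _ v y] i(1) by simp
    also have "H y = (\<lambda>i. c ^ d * H z i)" unfolding y_def by (rule hmap_scale[OF hom])
    also have "mx N v (\<lambda>i. c ^ d * H z i) = v c ^ d * mx N v (H z)"
      using mx_scale[OF v(1) Hz, of "c ^ d"] c by (simp add: v.power K.power_in)
    finally have "1 * mx N v z ^ d \<le> C i v * (v c ^ d * mx N v (H z)) * mx N v z ^ d"
      using mx_pos[OF v(1) z] by (intro mult_right_mono) auto
    also have "\<dots> = (v c * mx N v z) ^ d * (C i v * mx N v (H z))" by (simp add: power_mult_distrib mult_ac)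
    also have "\<dots> \<le> (\<Prod>i\<le>N. C i v) * mx N v (H z)" unfolding vc
      using Cprod[OF _ _ v(1), of i] i(1) mx_pos[OF v(1) Hz] by simp
    finally show ?thesis by simp
  qed
  then show ?thesis using local_const_prod[where C = C and A = "{..N}", OF finite_atMost C(1)] by (intro exI[of _ "\<lambda>v. \<Prod>j\<le>N. C j v"]) simp
qed

lemma local_const_mult:
  assumes "local_const C" "local_const C'" shows "local_const (\<lambda>v. C v * C' v)"
  using local_const_prod[of "UNIV :: bool set" "\<lambda>b. if b then C else C'"] assms by (simp add: UNIV_bool mult.commute)

lemma local_const_power: "local_const C \<Longrightarrow> local_const (\<lambda>v. C v ^ k)"
  using local_const_prod[of "{..<k}" "\<lambda>_. C"] by simp

lemma hmap_iterate_lower: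
  "\<exists>C. local_const C \<and> (\<forall>v\<in>places K. rat_place v \<noteq> real_abs \<longrightarrow>
     (\<forall>z\<in>coord_vectors N K. mx N v z ^ (d ^ n) \<le> C v * mx N v ((H ^^ n) z)))"
proof (induction n)
  case 0
  have "local_const (\<lambda>_. 1)" using local_const_prod[of "{}"] by simp
  then show ?case by (intro exI[of _ "\<lambda>_. 1"]) simp
next
  case (Suc n)
  then obtain C where C: "local_const C" "\<And>v z. v \<in> places K \<Longrightarrow> rat_place v \<noteq> real_abs \<Longrightarrow> z \<in> coord_vectors N K \<Longrightarrow>
      mx N v z ^ (d ^ n) \<le> C v * mx N v ((H ^^ n) z)" by blast
  obtain C' where C': "local_const C'" "\<And>v z. v \<in> places K \<Longrightarrow> rat_place v \<noteq> real_abs \<Longrightarrow> z \<in> coord_vectors N K \<Longrightarrow>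
      mx N v z ^ d \<le> C' v * mx N v (H z)" using hmap_lower by blast
  have "mx N v z ^ (d ^ Suc n) \<le> (C v ^ d * C' v) * mx N v ((H ^^ Suc n) z)"
    if v: "v \<in> places K" "rat_place v \<noteq> real_abs" and z: "z \<in> coord_vectors N K" for v z
  proof -
    have C1: "C v \<ge> 1" using C(1) v(1) by (simp add: local_const_def)
    have "mx N v z ^ (d ^ Suc n) = (mx N v z ^ (d ^ n)) ^ d" by (simp add: power_mult[symmetric] mult.commute)
    also have "\<dots> \<le> (C v * mx N v ((H ^^ n) z)) ^ d"
      using C(2)[OF v z] mx_pos[OF v(1) z] by (intro power_mono) auto
    also have "\<dots> = C v ^ d * mx N v ((H ^^ n) z) ^ d" by (rule power_mult_distrib)
    also have "\<dots> \<le> C v ^ d * (C' v * mx N v (H ((H ^^ n) z)))"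
      using C'(2)[OF v hmap_iterate_in[OF z]] C1 by (intro mult_left_mono) auto
    finally show ?thesis by (simp add: mult.assoc)
  qed
  then show ?case using local_const_mult[OF local_const_power[OF C(1)] C'(1)]
    by (intro exI[of _ "\<lambda>v. C v ^ d * C' v"]) simp
qed

end

section \<open>Comparison of local heights\<close>

definition fsupp :: "complex set \<Rightarrow> ((complex \<Rightarrow> real) \<Rightarrow> real) \<Rightarrow> bool" where
  "fsupp K h \<longleftrightarrow> (\<exists>U. supp K U h)"

lemma fsupp_add: "fsupp K g \<Longrightarrow> fsupp K h \<Longrightarrow> fsupp K (\<lambda>v. g v + h v)"
proof -
  assume "fsupp K g" "fsupp K h"
  then obtain U U' where "supp K U g" "supp K U' h" by (auto simp: fsupp_def)
  from supp_Un[OF this] have "supp K (U \<union> U') (\<lambda>v. g v + h v)" by (auto simp: supp_def)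
  then show ?thesis by (auto simp: fsupp_def)
qed

lemma fsupp_mono: "fsupp K h \<Longrightarrow> (\<And>v. v \<in> places K \<Longrightarrow> h v = 0 \<Longrightarrow> g v = 0) \<Longrightarrow> fsupp K g"
  unfolding fsupp_def supp_def by meson

lemma fsupp_out: "fsupp K h \<Longrightarrow> fsupp K (\<lambda>v. if v \<in> S then 0 else h v)"
  by (erule fsupp_mono) simp

lemma fsupp_0: "fsupp K (\<lambda>_. 0)"
  unfolding fsupp_def by (intro exI[of _ "{}"]) (simp add: supp_def)

context numfield
begin

lemma hsum_fsupp_add: "fsupp K g \<Longrightarrow> fsupp K h \<Longrightarrow> hsum K (\<lambda>v. g v + h v) = hsum K g + hsum K h"
  using hsum_add[OF supp_Un] unfolding fsupp_def by blast

lemma hsum_fsupp_mono: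
  "fsupp K g \<Longrightarrow> fsupp K h \<Longrightarrow> (\<And>v. v \<in> places K \<Longrightarrow> g v \<le> h v) \<Longrightarrow> hsum K g \<le> hsum K h"
  using hsum_mono[OF supp_Un] unfolding fsupp_def by blast

lemma hsum_0: "hsum K (\<lambda>_. 0) = 0" by (simp add: hsum_def)

lemma fsupp_lheight:
  assumes z: "z \<in> coord_vectors N K" and F: "homogeneous N e F" "coeffs_in K F" and nz: "poly_eval F z \<noteq> 0"
  shows "fsupp K (\<lambda>v. lheight N v F z)"
proof -
  have "insert (poly_eval F z) (z ` {..N}) \<subseteq> K" using poly_eval_K[OF F z] coord_vectorsD(1)[OF z] by auto
  then obtain U where "good K (insert (poly_eval F z) (z ` {..N})) U"
    using good_exists[of "insert (poly_eval F z) (z ` {..N})"] by auto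
  from supp_lheight[OF z this nz] show ?thesis unfolding fsupp_def by (rule exI)
qed

lemma lheight_ge:
  assumes F: "homogeneous N (divisor_degree F) F" "coeffs_in K F"
  shows "\<exists>C. local_const C \<and> (\<forall>v\<in>places K. \<forall>z\<in>coord_vectors N K.
     poly_eval F z \<noteq> 0 \<longrightarrow> 0 \<le> lheight N v F z + ln (C v))"
proof -
  obtain C where C: "local_const C" "\<And>v z. v \<in> places K \<Longrightarrow> z \<in> coord_vectors N K \<Longrightarrow>
      v (poly_eval F z) \<le> C v * mx N v z ^ divisor_degree F"
    using homogeneous_local_bound[OF F(2,1)] by blast
  have "0 \<le> lheight N v F z + ln (C v)" if v: "v \<in> places K" and z: "z \<in> coord_vectors N K" and nz: "poly_eval F z \<noteq> 0" for v z
  proof -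
    interpret v: absval K v by (rule absval_place[OF v])
    have pos: "v (poly_eval F z) > 0" "C v \<ge> 1" "mx N v z > 0"
      using v.pos[OF poly_eval_K[OF F z] nz] C(1) v mx_pos[OF v z] by (auto simp: local_const_def)
    have "ln (v (poly_eval F z)) \<le> ln (C v * mx N v z ^ divisor_degree F)"
      using C(2)[OF v z] pos by (subst ln_le_cancel_iff) auto
    also have "\<dots> = ln (C v) + real (divisor_degree F) * ln (mx N v z)" using pos by (simp add: ln_mult ln_realpow)
    finally show ?thesis by (simp add: lheight_def)
  qed
  then show ?thesis using C(1) by blast
qed

text \<open>Integral coefficients have absolute value at most \<open>1\<close> at ultrametric
  places, so the constant of \<open>lheight_ge\<close> disappears there.\<close>

lemma lheight_integral:
  assumes F: "homogeneous N (divisor_degree F) F" "coeffs_in (ring_of_integers K) F"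
    and v: "v \<in> places K" "rat_place v \<noteq> real_abs" and z: "z \<in> coord_vectors N K" and nz: "poly_eval F z \<noteq> 0"
  shows "0 \<le> lheight N v F z"
proof -
  interpret v: absval K v by (rule absval_place[OF v(1)])
  have FK: "coeffs_in K F" using F(2) by (auto simp: coeffs_in_def ring_of_integers_def)
  have "v (poly_eval F z) \<le> mx N v z ^ divisor_degree F"
    unfolding poly_eval_mon
  proof (rule ultrametric_sum[OF v])
    fix \<alpha> assume "\<alpha> \<in> keys F"
    then have \<alpha>: "keys \<alpha> \<subseteq> {..N}" "monomial_degree \<alpha> = divisor_degree F"
      using F(1) by (auto simp: homogeneous_def)
    have cK: "lookup F \<alpha> \<in> K" "algebraic_int (lookup F \<alpha>)"
      using F(2) by (auto simp: coeffs_in_def ring_of_integers_def)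
    have mK: "mon_eval z \<alpha> \<in> K" using \<alpha>(1) coord_vectorsD(1)[OF z] by (intro K.mon_eval_in) auto
    show "lookup F \<alpha> * mon_eval z \<alpha> \<in> K" using cK mK by auto
    have "v (mon_eval z \<alpha>) \<le> mx N v z ^ divisor_degree F"
      using mon_eval_bound[OF v(1) \<alpha>(1), of z "mx N v z"] coord_vectorsD(1)[OF z] mx_ge[of _ N v z] \<alpha>(2) by simp
    moreover have "v (lookup F \<alpha>) \<le> 1" by (rule nonarch_algebraic_int_le_1[OF v cK])
    ultimately show "v (lookup F \<alpha> * mon_eval z \<alpha>) \<le> mx N v z ^ divisor_degree F"
      unfolding v.mult[OF cK(1) mK] using v.nonneg[OF mK] v.nonneg[OF cK(1)]
        mult_mono[of "v (lookup F \<alpha>)" 1 "v (mon_eval z \<alpha>)" "mx N v z ^ divisor_degree F"] by simp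
  qed (use mx_pos[OF v(1) z] in simp)
  then have "ln (v (poly_eval F z)) \<le> ln (mx N v z ^ divisor_degree F)"
    using v.pos[OF poly_eval_K[OF F(1) FK z] nz] mx_pos[OF v(1) z] by (subst ln_le_cancel_iff) auto
  then show ?thesis using mx_pos[OF v(1) z] by (simp add: lheight_def ln_realpow)
qed

definition out_height :: "nat \<Rightarrow> (complex \<Rightarrow> real) set \<Rightarrow> cpoly \<Rightarrow> (nat \<Rightarrow> complex) \<Rightarrow> real" where
  "out_height N S F z = hsum K (\<lambda>v. if v \<in> S then 0 else lheight N v F z)"

lemma infsum_local_height:
  assumes z: "z \<in> coord_vectors N K" and F: "homogeneous N (divisor_degree F) F" "coeffs_in K F" and nz: "poly_eval F z \<noteq> 0"
  shows "(\<Sum>\<^sub>\<infinity>v\<in>places K - S. local_height N K v F (proj_point z)) = ereal (out_height N S F z)"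
proof -
  obtain U where U: "supp K U (\<lambda>v. lheight N v F z)" using fsupp_lheight[OF z F nz] by (auto simp: fsupp_def)
  define T where "T = places_over K U"
  have T: "finite T" "T \<subseteq> places K" using U finite_places_over by (auto simp: T_def supp_def places_over_def)
  have 0: "lheight N v F z = 0" if "v \<in> places K - T" for v
    using that U by (auto simp: supp_def T_def places_over_def)
  have lh: "local_height N K v F (proj_point z) = ereal (weight K v * lheight N v F z)" if "v \<in> places K" for v
    using local_height_eq[OF that z F] nz by simp
  have "(\<Sum>\<^sub>\<infinity>v\<in>places K - S. local_height N K v F (proj_point z)) = (\<Sum>v\<in>T - S. local_height N K v F (proj_point z))"
    using T lh 0 by (intro infsum_finite_support) (auto simp: zero_ereal_def)
  also have "\<dots> = ereal (\<Sum>v\<in>T - S. weight K v * lheight N v F z)"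
    using T lh by (subst sum_ereal[symmetric], intro sum.cong) auto
  also have "(\<Sum>v\<in>T - S. weight K v * lheight N v F z) = (\<Sum>v\<in>T. weight K v * (if v \<in> S then 0 else lheight N v F z))"
    using T by (intro sum.mono_neutral_cong_left) auto
  also have "\<dots> = out_height N S F z"
    unfolding out_height_def hsum_def using T 0 by (intro infsum_finite_support[symmetric]) auto
  finally show ?thesis .
qed

lemma out_height_le:
  assumes F: "homogeneous N (divisor_degree F) F" "coeffs_in K F"
  shows "\<exists>B. \<forall>z\<in>coord_vectors N K. poly_eval F z \<noteq> 0 \<longrightarrow>
     out_height N S F z \<le> real (divisor_degree F) * height N z + B"
proof -
  obtain C where C: "local_const C" "\<And>v z. v \<in> places K \<Longrightarrow> z \<in> coord_vectors N K \<Longrightarrow> poly_eval F z \<noteq> 0 \<Longrightarrow>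
      0 \<le> lheight N v F z + ln (C v)"
    using lheight_ge[OF F] by blast
  have fC: "fsupp K (\<lambda>v. ln (C v))" and C1: "\<And>v. v \<in> places K \<Longrightarrow> C v \<ge> 1"
    using C(1) by (auto simp: local_const_def fsupp_def)
  have "out_height N S F z \<le> real (divisor_degree F) * height N z + hsum K (\<lambda>v. ln (C v))"
    if z: "z \<in> coord_vectors N K" and nz: "poly_eval F z \<noteq> 0" for z
  proof -
    note f = fsupp_lheight[OF z F nz]
    have "out_height N S F z \<le> hsum K (\<lambda>v. lheight N v F z + ln (C v))"
      unfolding out_height_def
    proof (rule hsum_fsupp_mono[OF fsupp_out[OF f] fsupp_add[OF f fC]])
      fix v assume v: "v \<in> places K"
      show "(if v \<in> S then 0 else lheight N v F z) \<le> lheight N v F z + ln (C v)"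
        using C(2)[OF v z nz] C1[OF v] by auto
    qed
    then show ?thesis unfolding hsum_fsupp_add[OF f fC] hsum_lheight[OF z F nz] .
  qed
  then show ?thesis by blast
qed

lemma out_height_nonneg:
  assumes F: "homogeneous N (divisor_degree F) F" "coeffs_in (ring_of_integers K) F"
    and S: "archimedean_places K \<subseteq> S" and z: "z \<in> coord_vectors N K" and nz: "poly_eval F z \<noteq> 0"
  shows "0 \<le> out_height N S F z"
proof -
  have FK: "coeffs_in K F" using F(2) by (auto simp: coeffs_in_def ring_of_integers_def)
  have "hsum K (\<lambda>_. 0) \<le> out_height N S F z"
    unfolding out_height_def
  proof (rule hsum_fsupp_mono[OF fsupp_0 fsupp_out[OF fsupp_lheight[OF z F(1) FK nz]]])
    fix v assume v: "v \<in> places K"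
    show "0 \<le> (if v \<in> S then 0 else lheight N v F z)"
      using lheight_integral[OF F v _ z nz] S v archimedean_places_iff by auto
  qed
  then show ?thesis by (simp add: hsum_0)
qed

lemma out_height_integral_le:
  assumes F: "homogeneous N (divisor_degree F) F" "coeffs_in K F" and fin: "finite {v \<in> places K. c v \<noteq> 0}"
  shows "\<exists>B. \<forall>z\<in>coord_vectors N K. poly_eval F z \<noteq> 0 \<longrightarrow>
     (\<forall>v\<in>places K - S. local_height N K v F (proj_point z) \<le> ereal (c v)) \<longrightarrow> out_height N S F z \<le> B"
proof -
  \<comment> \<open>The constants bound local heights that include the weight, hence the division.
    The absolute value makes \<open>h\<close> nonnegative, as the summand is \<open>0\<close> at the
    places in \<open>S\<close>.\<close>
  define h where "h = (\<lambda>v. \<bar>c v\<bar> / weight K v)"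
  have "supp K (rat_place ` {v \<in> places K. c v \<noteq> 0}) h"
    unfolding supp_def h_def using fin rat_place_std by auto
  then have fh: "fsupp K h" by (auto simp: fsupp_def)
  have "out_height N S F z \<le> hsum K h"
    if z: "z \<in> coord_vectors N K" and nz: "poly_eval F z \<noteq> 0"
      and le: "\<forall>v\<in>places K - S. local_height N K v F (proj_point z) \<le> ereal (c v)" for z
    unfolding out_height_def
  proof (rule hsum_fsupp_mono[OF fsupp_out[OF fsupp_lheight[OF z F nz]] fh])
    fix v assume v: "v \<in> places K"
    have w: "weight K v > 0" by (rule weight_pos[OF v])
    have "lheight N v F z \<le> h v" if "v \<notin> S"
    proof -
      have "local_height N K v F (proj_point z) \<le> ereal (c v)" using le v that by blast
      then have "weight K v * lheight N v F z \<le> c v" using local_height_eq[OF v z F] nz by simp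
      also have "\<dots> \<le> \<bar>c v\<bar>" by simp
      finally show ?thesis using w by (simp add: h_def field_simps)
    qed
    moreover have "h v \<ge> 0" using w by (simp add: h_def)
    ultimately show "(if v \<in> S then 0 else lheight N v F z) \<le> h v" by auto
  qed
  then show ?thesis by blast
qed

end

lemma (in morphism_over) lheight_pullback:
  assumes D: "homogeneous N (divisor_degree D) D" "coeffs_in K D"
    and E: "pullback (poly_iterate \<phi> n) D = G * Q"
    and G: "homogeneous N (divisor_degree G) G" "coeffs_in K G" "G \<noteq> 0" and Q: "coeffs_in K Q" "Q \<noteq> 0"
  shows "\<exists>C. local_const C \<and> (\<forall>v\<in>places K. rat_place v \<noteq> real_abs \<longrightarrow> (\<forall>z\<in>coord_vectors N K.
     poly_eval D ((H ^^ n) z) \<noteq> 0 \<longrightarrow> lheight N v G z \<le> lheight N v D ((H ^^ n) z) + ln (C v)))"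
proof -
  let ?\<delta> = "divisor_degree D" and ?g = "divisor_degree G"
  let ?M = "?\<delta> * d ^ n"
  have "homogeneous N ?M (G * Q)"
    unfolding E[symmetric] pullback_def using hom by (intro homogeneous_subst[OF D(1)] homogeneous_iterate)
  \<comment> \<open>The degree \<open>?M - ?g\<close> of \<open>Q\<close> is exactly what makes the
    powers of \<open>mx N v z\<close> cancel when combined with the lower bound for the
    image.\<close>
  from homogeneous_cofactor[OF this G(1,3) Q(2)] have gM: "?g \<le> ?M" and homQ: "homogeneous N (?M - ?g) Q" .
  obtain C1 where C1: "local_const C1" "\<And>v z. v \<in> places K \<Longrightarrow> z \<in> coord_vectors N K \<Longrightarrow>
      v (poly_eval Q z) \<le> C1 v * mx N v z ^ (?M - ?g)"
    using homogeneous_local_bound[OF Q(1) homQ] by blast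
  obtain C2 where C2: "local_const C2" "\<And>v z. v \<in> places K \<Longrightarrow> rat_place v \<noteq> real_abs \<Longrightarrow> z \<in> coord_vectors N K \<Longrightarrow>
      mx N v z ^ (d ^ n) \<le> C2 v * mx N v ((H ^^ n) z)"
    using hmap_iterate_lower[of n] by blast
  have "lheight N v G z \<le> lheight N v D ((H ^^ n) z) + ln (C1 v * C2 v ^ ?\<delta>)"
    if v: "v \<in> places K" "rat_place v \<noteq> real_abs" and z: "z \<in> coord_vectors N K" and nz: "poly_eval D ((H ^^ n) z) \<noteq> 0" for v z
  proof -
    interpret v: absval K v by (rule absval_place[OF v(1)])
    have c: "C1 v \<ge> 1" "C2 v \<ge> 1" using C1(1) C2(1) v(1) by (auto simp: local_const_def)
    have mp: "mx N v z > 0" "mx N v ((H ^^ n) z) > 0"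
      using mx_pos[OF v(1)] z hmap_iterate_in[OF z] by auto
    have split: "poly_eval D ((H ^^ n) z) = poly_eval G z * poly_eval Q z"
      using eval_pullback[OF D(1), of n z] by (simp add: E)
    have in_K: "poly_eval G z \<in> K" "poly_eval Q z \<in> K" using poly_eval_K[OF _ _ z] G Q homQ by auto
    have pos: "v (poly_eval G z) > 0" "v (poly_eval Q z) > 0" using v.pos in_K nz split by auto
    have ln_D: "ln (v (poly_eval D ((H ^^ n) z))) = ln (v (poly_eval G z)) + ln (v (poly_eval Q z))"
      unfolding split v.mult[OF in_K] using pos by (simp add: ln_mult)
    have "ln (v (poly_eval Q z)) \<le> ln (C1 v * mx N v z ^ (?M - ?g))"
      using C1(2)[OF v(1) z] pos c mp by (subst ln_le_cancel_iff) auto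
    also have "\<dots> = ln (C1 v) + real (?M - ?g) * ln (mx N v z)" using c mp by (simp add: ln_mult ln_realpow)
    also have "real (?M - ?g) = real ?\<delta> * real d ^ n - real ?g" using gM by (simp add: of_nat_diff)
    finally have 1: "ln (v (poly_eval Q z)) \<le> ln (C1 v) + (real ?\<delta> * real d ^ n - real ?g) * ln (mx N v z)" .
    have "ln (mx N v z ^ (d ^ n)) \<le> ln (C2 v * mx N v ((H ^^ n) z))"
      using C2(2)[OF v z] c mp by (subst ln_le_cancel_iff) auto
    then have "real d ^ n * ln (mx N v z) \<le> ln (C2 v) + ln (mx N v ((H ^^ n) z))"
      using c mp by (simp add: ln_mult ln_realpow)
    from mult_left_mono[OF this, of "real ?\<delta>"]
    have 2: "real ?\<delta> * (real d ^ n * ln (mx N v z)) \<le> real ?\<delta> * ln (C2 v) + real ?\<delta> * ln (mx N v ((H ^^ n) z))"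
      by (simp add: distrib_left)
    have "ln (C1 v * C2 v ^ ?\<delta>) = ln (C1 v) + real ?\<delta> * ln (C2 v)" using c by (simp add: ln_mult ln_realpow)
    then show ?thesis using 1 2 unfolding lheight_def ln_D by (simp add: algebra_simps)
  qed
  then show ?thesis using local_const_mult[OF C1(1) local_const_power[OF C2(1)]]
    by (intro exI[of _ "\<lambda>v. C1 v * C2 v ^ ?\<delta>"]) blast
qed

section \<open>Vojta's inequality along orbits\<close>

text \<open>\<open>G\<close> and \<open>Q\<close> live over \<open>L\<close>, while the conclusion
  concerns \<open>K\<close>. Since \<open>D\<close> and the point are defined over \<open>K\<close>,
  the local height of \<open>D\<close> depends on a place of \<open>L\<close> only through its
  restriction, and \<open>hsum_restrict\<close> brings the sum back.\<close>

lemma (in numfield_ext) vojta_step: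
  assumes mor: "morphism_over K x f N d \<phi>"
    and D: "homogeneous N (divisor_degree D) D" "coeffs_in K D"
    and E: "pullback (poly_iterate \<phi> n) D = G * Q"
    and G: "effective_divisor N (ring_of_integers L) G" "normal_crossings N G" and Q: "coeffs_in L Q" "Q \<noteq> 0"
    and S: "finite S" "archimedean_places K \<subseteq> S" "S \<subseteq> places K"
    and vojta: "vojta_conjecture N" and \<epsilon>: "\<epsilon> > 0"
  shows "\<exists>Z C. finite Z \<and> (\<forall>F\<in>Z. effective_divisor N Qbar F) \<and>
     (\<forall>z\<in>coord_vectors N K. (\<forall>F\<in>Z. poly_eval F z \<noteq> 0) \<longrightarrow> poly_eval D ((hmap N \<phi> ^^ n) z) \<noteq> 0 \<longrightarrow>
        (real (divisor_degree G) - (real N + 1 + \<epsilon>)) * A.height N z - C \<le> A.out_height N S D ((hmap N \<phi> ^^ n) z))"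
proof -
  interpret MA: morphism_over K x f N d \<phi> by (rule mor)
  have "coeffs_in L (\<phi> i)" if "i \<le> N" for i using MA.coeffs[OF that] sub by (auto simp: coeffs_in_def)
  then have "proj_morphism N L d \<phi>" using MA.morphism by (auto simp: proj_morphism_def)
  then interpret MB: morphism_over L y g N d \<phi> by unfold_locales
  \<comment> \<open>All places of \<open>L\<close> above \<open>S\<close>: they include the
    archimedean ones, and leaving them out over \<open>L\<close> matches leaving out
    \<open>S\<close> over \<open>K\<close>.\<close>
  define S' where "S' = {w \<in> places L. restrict w K \<in> S}"
  have S': "finite S'" "S' \<subseteq> places L"
  proof -
    have "S' \<subseteq> places_over L (rat_place ` S)"
      unfolding S'_def places_over_def using rat_place_restrict by (metis (mono_tags, lifting) Collect_mono image_eqI)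
    moreover have "finite (places_over L (rat_place ` S))"
      using S A.rat_place_std by (intro B.finite_places_over) auto
    ultimately show "finite S'" by (rule finite_subset)
  qed (auto simp: S'_def)
  have nonarch: "rat_place w \<noteq> real_abs" if "w \<in> places L - S'" for w
  proof
    assume "rat_place w = real_abs"
    then have "restrict w K \<in> archimedean_places K"
      using that restrict_in_places by (simp add: archimedean_places_iff rat_place_restrict)
    then show False using that S(2) by (auto simp: S'_def)
  qed
  have DL: "coeffs_in L D" using D(2) sub by (auto simp: coeffs_in_def)
  note G' = effective_divisor_homogeneous[OF G(1)]
  have GL: "coeffs_in L G" using G'(3) by (auto simp: coeffs_in_def ring_of_integers_def)
  have "number_field L \<and> effective_divisor N (ring_of_integers L) G \<and> normal_crossings N G \<and>
      finite S' \<and> S' \<subseteq> places L \<and> \<epsilon> > 0"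
    using B.numfield G S' \<epsilon> by simp
  from vojta[unfolded vojta_conjecture_def, THEN spec, THEN spec, THEN spec, THEN spec, THEN mp, OF this]
  obtain Z C where ZC: "finite Z \<and> (\<forall>F\<in>Z. effective_divisor N Qbar F \<and> divisor_degree F > 0) \<and>
      (\<forall>P\<in>proj_space N L. (\<forall>F\<in>Z. \<not> vanishes_at F P) \<longrightarrow>
      (\<Sum>w\<in>S'. local_height N L w G P) < ereal ((real N + 1 + \<epsilon>) * weil_height N L P + C))"
    by (elim exE)
  then have Z: "finite Z" "\<And>F. F \<in> Z \<Longrightarrow> effective_divisor N Qbar F"
    and V: "\<And>P. P \<in> proj_space N L \<Longrightarrow> (\<And>F. F \<in> Z \<Longrightarrow> \<not> vanishes_at F P) \<Longrightarrow>
      (\<Sum>w\<in>S'. local_height N L w G P) < ereal ((real N + 1 + \<epsilon>) * weil_height N L P + C)"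
    by simp_all
  obtain C' where C': "B.local_const C'" "\<And>w z. w \<in> places L \<Longrightarrow> rat_place w \<noteq> real_abs \<Longrightarrow> z \<in> coord_vectors N L \<Longrightarrow>
     poly_eval D ((hmap N \<phi> ^^ n) z) \<noteq> 0 \<Longrightarrow> B.lheight N w G z \<le> B.lheight N w D ((hmap N \<phi> ^^ n) z) + ln (C' w)"
    using MB.lheight_pullback[OF D(1) DL E G'(1) GL G'(2) Q] by (elim exE conjE) (rule that; blast)
  have fC: "fsupp L (\<lambda>w. ln (C' w))" and C1: "\<And>w. w \<in> places L \<Longrightarrow> C' w \<ge> 1"
    using C'(1) by (auto simp: B.local_const_def fsupp_def)
  have "(real (divisor_degree G) - (real N + 1 + \<epsilon>)) * A.height N z - (C + hsum L (\<lambda>w. ln (C' w)))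
      \<le> A.out_height N S D ((hmap N \<phi> ^^ n) z)"
    if z: "z \<in> coord_vectors N K" and avoid: "\<forall>F\<in>Z. poly_eval F z \<noteq> 0" and nz: "poly_eval D ((hmap N \<phi> ^^ n) z) \<noteq> 0" for z
  proof -
    define u where "u = (hmap N \<phi> ^^ n) z"
    have u: "u \<in> coord_vectors N K" "poly_eval D u \<noteq> 0" using MA.hmap_iterate_in[OF z] nz by (auto simp: u_def)
    have zL: "z \<in> coord_vectors N L" and uL: "u \<in> coord_vectors N L" using z u coord_vectors_mono[OF sub] by auto
    have Gz: "poly_eval G z \<noteq> 0"
      using MA.eval_pullback[OF D(1), of n z] nz by (auto simp: E)
    note fG = B.fsupp_lheight[OF zL G'(1) GL Gz] and fD = B.fsupp_lheight[OF uL D(1) DL u(2)]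
    have "proj_point z \<in> proj_space N L" using zL by (auto simp: proj_space_def)
    then have "(\<Sum>w\<in>S'. local_height N L w G (proj_point z)) < ereal ((real N + 1 + \<epsilon>) * weil_height N L (proj_point z) + C)"
    proof (rule V)
      fix F assume F: "F \<in> Z"
      show "\<not> vanishes_at F (proj_point z)"
        using vanishes_at_proj_point[OF effective_divisor_homogeneous(1)[OF Z(2)[OF F]]] avoid F by blast
    qed
    also have "(\<Sum>w\<in>S'. local_height N L w G (proj_point z)) = ereal (\<Sum>w\<in>S'. weight L w * B.lheight N w G z)"
      using B.local_height_eq[OF _ zL G'(1) GL] S' Gz by (subst sum_ereal[symmetric], intro sum.cong) auto
    finally have 1: "(\<Sum>w\<in>S'. weight L w * B.lheight N w G z) < (real N + 1 + \<epsilon>) * A.height N z + C"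
      by (simp add: B.weil_height_eq[OF zL] height_ext[OF z])
    define i where "i = (\<lambda>w. if w \<in> S' then B.lheight N w G z else 0)"
    have "(\<Sum>w\<in>S'. weight L w * B.lheight N w G z) = hsum L i"
      unfolding hsum_def i_def using S' by (subst infsum_finite_support[of S']) auto
    moreover have "real (divisor_degree G) * A.height N z = hsum L i + B.out_height N S' G z"
    proof -
      have "real (divisor_degree G) * A.height N z = hsum L (\<lambda>w. B.lheight N w G z)"
        using B.hsum_lheight[OF zL G'(1) GL Gz] by (simp add: height_ext[OF z])
      also have "\<dots> = hsum L (\<lambda>w. i w + (if w \<in> S' then 0 else B.lheight N w G z))"
        by (intro B.hsum_cong) (simp add: i_def)
      also have "\<dots> = hsum L i + B.out_height N S' G z"
        unfolding B.out_height_def using fG by (intro B.hsum_fsupp_add fsupp_out) (auto simp: i_def elim: fsupp_mono)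
      finally show ?thesis .
    qed
    moreover have "B.out_height N S' G z \<le> B.out_height N S' D u + hsum L (\<lambda>w. ln (C' w))"
      unfolding B.out_height_def B.hsum_fsupp_add[OF fsupp_out[OF fD] fC, symmetric]
    proof (rule B.hsum_fsupp_mono[OF fsupp_out[OF fG] fsupp_add[OF fsupp_out[OF fD] fC]])
      fix w assume w: "w \<in> places L"
      show "(if w \<in> S' then 0 else B.lheight N w G z) \<le> (if w \<in> S' then 0 else B.lheight N w D u) + ln (C' w)"
        using C1[OF w] C'(2)[OF w nonarch zL nz] w by (auto simp: u_def)
    qed
    moreover have "B.out_height N S' D u = A.out_height N S D u"
    proof -
      have lw: "A.lheight N (restrict w K) D u = B.lheight N w D u" for w
        using mx_restrict[OF u(1)] A.poly_eval_K[OF D u(1)] by (simp add: A.lheight_def B.lheight_def)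
      obtain U where U: "supp K U (\<lambda>v. if v \<in> S then 0 else A.lheight N v D u)"
        using fsupp_out[OF A.fsupp_lheight[OF u(1) D u(2)]] by (auto simp: fsupp_def)
      have "B.out_height N S' D u = hsum L (\<lambda>w. if restrict w K \<in> S then 0 else A.lheight N (restrict w K) D u)"
        unfolding B.out_height_def by (intro B.hsum_cong) (auto simp: S'_def lw)
      also have "\<dots> = A.out_height N S D u" unfolding A.out_height_def by (rule hsum_restrict[OF U])
      finally show ?thesis .
    qed
    ultimately show ?thesis using 1 by (simp add: algebra_simps u_def)
  qed
  then show ?thesis using Z by (intro exI[of _ Z] exI[of _ "C + hsum L (\<lambda>w. ln (C' w))"]) blast
qed

lemma lookup_const_mult:
  fixes F :: cpoly
  shows "lookup (single 0 c * F) \<alpha> = c * lookup F \<alpha>"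
proof -
  have "single 0 c * F = (\<Sum>\<beta>\<in>keys F. single \<beta> (c * lookup F \<beta>))"
    by (subst cpoly_sum_monomials[OF finite_keys order_refl, of F]) (simp add: sum_distrib_left mult_single)
  then have "lookup (single 0 c * F) \<alpha> =
      (\<Sum>\<beta>\<in>keys F. if \<beta> = \<alpha> then c * lookup F \<alpha> else 0)"
    by (auto simp: lookup_sum lookup_single when_def intro!: sum.cong)
  also have "\<dots> = c * lookup F \<alpha>" by (simp add: in_keys_iff)
  finally show ?thesis .
qed

text \<open>The equation \<open>G0\<close> is multiplied by an integer that clears its denominators,
  and the cofactor is divided by it. The cofactor has algebraic coefficients by
  \<open>coeffs_in_cofactor\<close>, so one number field above \<open>K\<close> contains
  everything.\<close>

lemma (in numfield) nc_part_over_integers: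
  assumes nc: "nc_part N E G0" and E: "coeffs_in K E" "E \<noteq> 0"
  shows "\<exists>L y g G Q. numfield_ext K x f L y g \<and> effective_divisor N (ring_of_integers L) G \<and> normal_crossings N G \<and>
     divisor_degree G = divisor_degree G0 \<and> E = G * Q \<and> coeffs_in L Q \<and> Q \<noteq> 0"
proof -
  interpret QB: csubfield Qbar by (rule csubfield_Qbar)
  have G0: "effective_divisor N Qbar G0" "normal_crossings N G0" "G0 dvd E" using nc by (auto simp: nc_part_def)
  note G0' = effective_divisor_homogeneous[OF G0(1)]
  obtain Q0 where Q0: "E = G0 * Q0" using G0(3) by (elim dvdE)
  have "coeffs_in Qbar (G0 * Q0)" using E(1) K_Qbar by (auto simp: coeffs_in_def Q0)
  from QB.coeffs_in_cofactor[OF this G0'(3,2)] have Q0_Qbar: "coeffs_in Qbar Q0" .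
  have "lookup G0 ` keys G0 \<subseteq> Qbar" using G0'(3) by (auto simp: coeffs_in_def)
  then obtain k :: int where k: "k \<noteq> 0"
    "\<And>y. y \<in> lookup G0 ` keys G0 \<Longrightarrow> algebraic_int (of_int k * y)"
    using clear_denominators[of "lookup G0 ` keys G0"] by auto
  define c :: complex where "c = of_int k"
  have c: "c \<noteq> 0" "c \<in> Qbar" using k(1) QB.of_int_in by (auto simp: c_def)
  define G where "G = single 0 c * G0"
  define Q where "Q = single 0 (inverse c) * Q0"
  have lookG: "lookup G \<alpha> = c * lookup G0 \<alpha>" for \<alpha>
    by (simp add: G_def lookup_const_mult)
  have "G * Q = (single 0 c * single 0 (inverse c)) * (G0 * Q0)"
    by (simp add: G_def Q_def mult_ac)
  also have "\<dots> = E" using c(1) by (simp add: mult_single Q0)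
  finally have E_eq: "E = G * Q" by simp
  have keysG: "keys G = keys G0" using c(1) by (auto simp: in_keys_iff lookG)
  have homG: "homogeneous N (divisor_degree G0) G" using G0'(1) by (simp add: homogeneous_def keysG)
  have G_nz: "G \<noteq> 0" and Q_nz: "Q \<noteq> 0" using E(2) E_eq by auto
  have G_alg: "coeffs_in Qbar G" "coeffs_in Qbar Q"
    using c G0'(3) Q0_Qbar by (auto simp: G_def Q_def intro!: QB.coeffs_in_mult)
  let ?Y = "lookup G ` keys G \<union> lookup Q ` keys Q"
  have "?Y \<subseteq> Qbar" using G_alg by (auto simp: coeffs_in_def)
  then obtain L where L: "number_field L" "K \<subseteq> L" "?Y \<subseteq> L"
    using number_field_extension[OF numfield, of ?Y] by auto
  obtain y g where "numfield L y g" using number_field_numfield[OF L(1)] .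
  then have ext: "numfield_ext K x f L y g"
    using L(2) numfield_axioms by (simp add: numfield_ext_def numfield_ext_axioms_def)
  interpret L: csubfield L by (rule number_field_csubfield[OF L(1)])
  have in_L: "coeffs_in L F" if "lookup F ` keys F \<subseteq> L" for F
    unfolding coeffs_in_def
  proof
    fix \<alpha> show "lookup F \<alpha> \<in> L"
      using that L.zero_in by (cases "\<alpha> \<in> keys F") (auto simp: in_keys_iff)
  qed
  have "coeffs_in (ring_of_integers L) G"
    unfolding coeffs_in_def ring_of_integers_def
  proof (intro allI CollectI conjI)
    fix \<alpha>
    show "lookup G \<alpha> \<in> L" using in_L[of G] L(3) by (simp add: coeffs_in_def)
    show "algebraic_int (lookup G \<alpha>)"
      using k(2) by (cases "\<alpha> \<in> keys G0") (auto simp: lookG c_def in_keys_iff)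
  qed
  then have "effective_divisor N (ring_of_integers L) G"
    using G_nz homG by (auto simp: effective_divisor_def)
  moreover have "normal_crossings N G" unfolding G_def by (rule normal_crossings_scale[OF G0(2) c(1)])
  moreover have "divisor_degree G = divisor_degree G0" by (rule divisor_degree_homogeneous[OF homG G_nz])
  moreover have "coeffs_in L Q" using in_L[of Q] L(3) by simp
  ultimately show ?thesis using ext E_eq Q_nz by blast
qed

section \<open>Generic orbits\<close>

text \<open>If the iterates \<open>a < b\<close> coincide, all later ones repeat earlier ones, and
  the first \<open>b\<close> exhaust the orbit.\<close>

lemma funpow_inj_if_infinite_orbit:
  fixes h :: "'a \<Rightarrow> 'a"
  assumes "infinite (range (\<lambda>m. (h ^^ m) p))"
  shows "inj (\<lambda>m. (h ^^ m) p)"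
proof (rule linorder_injI, rule notI)
  fix a b :: nat assume ab: "a < b" "(h ^^ a) p = (h ^^ b) p"
  have "(h ^^ m) p \<in> (\<lambda>m. (h ^^ m) p) ` {..<b}" for m
  proof (induction m rule: less_induct)
    case (less m)
    show ?case
    proof (cases "m < b")
      case False
      have "(h ^^ m) p = (h ^^ (m - b)) ((h ^^ b) p)"
        using False funpow_add[of "m - b" b h] by simp
      also have "\<dots> = (h ^^ (m - b + a)) p" by (simp add: ab(2)[symmetric] funpow_add)
      finally show ?thesis using less[of "m - b + a"] False ab(1) by simp
    qed simp
  qed
  then have "range (\<lambda>m. (h ^^ m) p) \<subseteq> (\<lambda>m. (h ^^ m) p) ` {..<b}" by blast
  then show False using assms finite_subset by blast
qed

lemma eventually_not_if_finite: "finite {m. R m} \<Longrightarrow> eventually (\<lambda>m :: nat. \<not> R m) sequentially"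
  by (simp add: cofinite_eq_sequentially[symmetric] eventually_cofinite)

locale generic_orbit = morphism_over K x f N d \<phi> for K x f N d \<phi> +
  fixes z0 :: "nat \<Rightarrow> complex"
  assumes z0: "z0 \<in> coord_vectors N K" and generic: "generic N (orbit N \<phi> (proj_point z0))"
    and d2: "d \<ge> 2"
begin

definition pt :: "nat \<Rightarrow> nat \<Rightarrow> complex" where "pt m = (H ^^ m) z0"

lemma pt_in: "pt m \<in> coord_vectors N K" unfolding pt_def by (rule hmap_iterate_in[OF z0])

lemma pt_add: "(H ^^ n) (pt m) = pt (m + n)" by (simp add: pt_def funpow_add add.commute[of m n])

lemma proj_map_pt: "(proj_map N \<phi> ^^ m) (proj_point z0) = proj_point (pt m)"
  by (simp add: proj_map_iterate pt_def)

lemma orbit_eq: "orbit N \<phi> (proj_point z0) = range (\<lambda>m. proj_point (pt m))"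
  by (auto simp: orbit_def proj_map_pt)

lemma inj_pt: "inj (\<lambda>m. proj_point (pt m))"
proof -
  have "infinite (range (\<lambda>m. (proj_map N \<phi> ^^ m) (proj_point z0)))"
    using generic by (simp add: generic_def orbit_eq proj_map_pt)
  from funpow_inj_if_infinite_orbit[OF this] show ?thesis by (simp add: proj_map_pt)
qed

text \<open>Infinitely many orbit points on the hypersurface would be dense, so the hypersurface
  would be the whole space; but a nonzero polynomial has a nonzero value at some point.\<close>

lemma eventually_avoids:
  assumes F: "homogeneous N e F" "coeffs_in Qbar F" "F \<noteq> 0"
  shows "eventually (\<lambda>m. poly_eval F (pt m) \<noteq> 0) sequentially"
proof (rule eventually_not_if_finite, rule ccontr)
  assume inf: "infinite {m. poly_eval F (pt m) = 0}"
  let ?B = "(\<lambda>m. proj_point (pt m)) ` {m. poly_eval F (pt m) = 0}"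
  define Z where "Z = {P \<in> proj_space N Qbar. \<forall>F'\<in>{F}. vanishes_at F' P}"
  have "infinite ?B" using inf inj_pt by (simp add: finite_image_iff inj_on_def)
  moreover have B: "?B \<subseteq> orbit N \<phi> (proj_point z0)" by (auto simp: orbit_eq)
  ultimately have "zariski_dense N ?B" using generic by (simp add: generic_def)
  moreover have "zariski_closed N Z" unfolding zariski_closed_def Z_def using F by (intro exI[of _ "{F}"]) auto
  moreover have "?B \<subseteq> Z" unfolding Z_def
  proof
    fix P assume "P \<in> ?B"
    then obtain m where m: "P = proj_point (pt m)" "poly_eval F (pt m) = 0" by blast
    have "P \<in> proj_space N Qbar"
      using pt_in[of m] coord_vectors_mono[OF K_Qbar] m(1) by (auto simp: proj_space_def)
    then show "P \<in> {P \<in> proj_space N Qbar. \<forall>F'\<in>{F}. vanishes_at F' P}"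
      using vanishes_at_proj_point[OF F(1)] m by simp
  qed
  ultimately have Z: "Z = proj_space N Qbar" by (simp add: zariski_dense_def)
  interpret QB: csubfield Qbar by (rule csubfield_Qbar)
  \<comment> \<open>The extra factor \<open>var 0\<close> forces the first coordinate of
    \<open>a\<close> to be nonzero, so that the truncated vector is a point of projective
    space.\<close>
  have v0: "var 0 \<noteq> 0" using poly_eval_var[of 0 "\<lambda>_. 1"] by (auto simp del: poly_eval_var)
  have "F * var 0 \<noteq> 0" using F(3) v0 by simp
  moreover have "F * var 0 \<in> pring Qbar (Suc N)"
    using F homogeneous_vars_below[OF F(1)] by (intro QB.pring_mult QB.pring_var) (auto simp: pring_def)
  ultimately obtain a where a: "\<And>i. a i \<in> Qbar" "poly_eval (F * var 0) a \<noteq> 0"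
    using nonzero_poly_has_nonzero[of "F * var 0" "Suc N"] by (auto simp: pring_def)
  define b where "b = (\<lambda>i. if i \<le> N then a i else 0)"
  have "b 0 \<noteq> 0" "\<forall>i\<le>N. b i \<in> Qbar" "\<forall>i>N. b i = 0" using a by (auto simp: b_def)
  then have "b \<in> coord_vectors N Qbar" unfolding coord_vectors_def by blast
  then have "proj_point b \<in> Z" unfolding Z by (auto simp: proj_space_def)
  then have "poly_eval F b = 0" using vanishes_at_proj_point[OF F(1)] by (simp add: Z_def)
  moreover have "poly_eval F b = poly_eval F a"
    using homogeneous_vars_below[OF F(1)] by (intro poly_eval_cong) (auto simp: b_def)
  ultimately show False using a(2) by simp
qed

text \<open>Northcott's theorem leaves finitely many points of bounded height, and by
  \<open>inj_pt\<close> each is visited at most once.\<close>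

lemma height_at_top: "filterlim (\<lambda>m. height N (pt m)) at_top sequentially"
  unfolding filterlim_at_top_dense
proof
  fix B
  have "finite ((\<lambda>m. proj_point (pt m)) -` {P \<in> proj_space N K. weil_height N K P \<le> B})"
    by (rule finite_vimageI[OF northcott inj_pt])
  moreover have "(\<lambda>m. proj_point (pt m)) -` {P \<in> proj_space N K. weil_height N K P \<le> B} = {m. height N (pt m) \<le> B}"
    using pt_in weil_height_eq[OF pt_in] by (auto simp: proj_space_def)
  ultimately have "finite {m. height N (pt m) \<le> B}" by simp
  from eventually_not_if_finite[OF this] show "eventually (\<lambda>m. B < height N (pt m)) sequentially"
    by (simp add: not_le)
qed

section \<open>Proximity of a generic orbit to the divisor outside \<open>S\<close>\<close>

context
  fixes D :: cpoly
  assumes D: "effective_divisor N (ring_of_integers K) D" and D_pos: "divisor_degree D > 0"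
begin

lemma D_hom: "homogeneous N (divisor_degree D) D" and D_int: "coeffs_in (ring_of_integers K) D"
  and D_K: "coeffs_in K D" and D_nz: "D \<noteq> 0"
  using effective_divisor_homogeneous[OF D] by (auto simp: coeffs_in_def ring_of_integers_def)

lemma eventually_D: "eventually (\<lambda>m. poly_eval D (pt m) \<noteq> 0) sequentially"
  using eventually_avoids[OF D_hom _ D_nz] D_K K_Qbar by (auto simp: coeffs_in_def)

lemma pullback_props:
  defines "E \<equiv> \<lambda>n. pullback (poly_iterate \<phi> n) D"
  shows "homogeneous N (divisor_degree D * d ^ n) (E n)" "coeffs_in K (E n)" "E n \<noteq> 0"
proof -
  show "homogeneous N (divisor_degree D * d ^ n) (E n)"
    unfolding E_def pullback_def using hom by (intro homogeneous_subst[OF D_hom] homogeneous_iterate)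
  show "coeffs_in K (E n)"
    unfolding E_def pullback_def using hom coeffs by (intro K.coeffs_in_subst[OF D_K _ D_hom] K.coeffs_in_iterate)
  obtain m where "\<And>k. k \<ge> m \<Longrightarrow> poly_eval D (pt k) \<noteq> 0" using eventually_D unfolding eventually_sequentially by blast
  then have "poly_eval D ((H ^^ n) (pt m)) \<noteq> 0" unfolding pt_add by simp
  then have "poly_eval (E n) (pt m) \<noteq> 0" unfolding E_def eval_pullback[OF D_hom] .
  then show "E n \<noteq> 0" by auto
qed

text \<open>This bounds the terms under the supremum \<open>c\<close> by \<open>1\<close>, so that
  it is the supremum of a bounded family of reals.\<close>

lemma nc_degree_le:
  assumes "nc_part N (pullback (poly_iterate \<phi> n) D) G"
  shows "divisor_degree G \<le> divisor_degree D * d ^ n"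
proof -
  have G: "effective_divisor N Qbar G" "G dvd pullback (poly_iterate \<phi> n) D" using assms by (auto simp: nc_part_def)
  obtain Q where Q: "pullback (poly_iterate \<phi> n) D = G * Q" using G(2) by (elim dvdE)
  have "Q \<noteq> 0" using pullback_props(3)[of n] by (auto simp: Q)
  then show ?thesis
    using homogeneous_cofactor(1) pullback_props(1)[of n] effective_divisor_homogeneous[OF G(1)] unfolding Q by blast
qed

text \<open>For \<open>A \<ge> 0\<close> the inequality at \<open>pt m\<close> is transferred to
  \<open>pt (m + n)\<close>. The height of \<open>pt m\<close> is bounded from below through that of
  its image, so the factor \<open>a\<close> in front of it has to be positive. For
  \<open>A < 0\<close> the claim follows from \<open>out_height_nonneg\<close>.\<close>

lemma eventually_out_height_gt:
  assumes nc: "nc_part N (pullback (poly_iterate \<phi> n) D) G0"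
    and S: "finite S" "archimedean_places K \<subseteq> S" "S \<subseteq> places K" and vojta: "vojta_conjecture N"
    and A: "A < (real (divisor_degree G0) - (real N + 1)) / (real d ^ n * real (divisor_degree D))"
  shows "eventually (\<lambda>m. A * (real (divisor_degree D) * height N (pt m)) < out_height N S D (pt m)) sequentially"
proof (cases "A < 0")
  case True
  have "eventually (\<lambda>m. height N (pt m) > 0) sequentially" using height_at_top by (simp add: filterlim_at_top_dense)
  with eventually_D show ?thesis
  proof eventually_elim
    case (elim m)
    have "A * (real (divisor_degree D) * height N (pt m)) < 0"
      using True D_pos elim(2) by (intro mult_neg_pos) auto
    then show ?case using out_height_nonneg[OF D_hom D_int S(2) pt_in elim(1)] by simp
  qed
next
  case False
  let ?\<delta> = "real (divisor_degree D)" and ?g = "real (divisor_degree G0)"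
  have dn: "real d ^ n > 0" and \<delta>: "?\<delta> > 0" using d2 D_pos by auto
  \<comment> \<open>Half of the surplus is spent on Vojta's \<open>\<epsilon>\<close>. The other
    half remains in \<open>a\<close> and, multiplied by the growing height, absorbs all
    constants.\<close>
  define \<epsilon> where "\<epsilon> = (?g - (real N + 1) - A * (real d ^ n * ?\<delta>)) / 2"
  define a where "a = ?g - (real N + 1 + \<epsilon>)"
  have \<epsilon>: "\<epsilon> > 0" using A dn \<delta> by (simp add: \<epsilon>_def field_simps)
  have a_eq: "a = A * (real d ^ n * ?\<delta>) + \<epsilon>" by (simp add: a_def \<epsilon>_def field_simps)
  then have a_pos: "a > 0" using False dn \<delta> \<epsilon> by (simp add: add_nonneg_pos)
  obtain L y g G Q where ext: "numfield_ext K x f L y g" and G: "effective_divisor N (ring_of_integers L) G"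
    "normal_crossings N G" "divisor_degree G = divisor_degree G0" "pullback (poly_iterate \<phi> n) D = G * Q"
    "coeffs_in L Q" "Q \<noteq> 0"
    using nc_part_over_integers[OF nc pullback_props(2,3)] by (elim exE conjE)
  interpret LK: numfield_ext K x f L y g by (rule ext)
  obtain Z C where Z: "finite Z" "\<forall>F\<in>Z. effective_divisor N Qbar F"
    and V: "\<forall>z\<in>coord_vectors N K. (\<forall>F\<in>Z. poly_eval F z \<noteq> 0) \<longrightarrow> poly_eval D ((H ^^ n) z) \<noteq> 0 \<longrightarrow>
        a * height N z - C \<le> out_height N S D ((H ^^ n) z)"
    using LK.vojta_step[OF morphism_over_axioms D_hom D_K G(4,1,2,5,6) S vojta \<epsilon>] unfolding a_def G(3) by (elim exE conjE)
  obtain B where B: "\<forall>z\<in>coord_vectors N K. height N ((H ^^ n) z) \<le> real d ^ n * height N z + B"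
    using height_iterate_le[of n] by (elim exE)
  have "eventually (\<lambda>m. poly_eval F (pt m) \<noteq> 0) sequentially" if "F \<in> Z" for F
  proof -
    have "effective_divisor N Qbar F" using Z(2) that by simp
    note F = effective_divisor_homogeneous[OF this]
    show ?thesis by (rule eventually_avoids[OF F(1,3,2)])
  qed
  then have ev_Z: "eventually (\<lambda>m. \<forall>F\<in>Z. poly_eval F (pt m) \<noteq> 0) sequentially"
    using Z(1) by (simp add: eventually_ball_finite)
  have ev_D: "eventually (\<lambda>m. poly_eval D (pt (m + n)) \<noteq> 0) sequentially"
    using eventually_D by (subst eventually_sequentially_seg)
  have "eventually (\<lambda>m. (a * B / real d ^ n + C) * real d ^ n / \<epsilon> < height N (pt m)) sequentially"
    using height_at_top by (simp add: filterlim_at_top_dense)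
  then have "eventually (\<lambda>m. (a * B / real d ^ n + C) * real d ^ n / \<epsilon> < height N (pt (m + n))) sequentially"
    by (subst eventually_sequentially_seg)
  with ev_Z ev_D have "eventually (\<lambda>m. A * (?\<delta> * height N (pt (m + n))) < out_height N S D (pt (m + n))) sequentially"
  proof eventually_elim
    case (elim m)
    let ?h = "height N (pt (m + n))"
    have 1: "a * height N (pt m) - C \<le> out_height N S D (pt (m + n))"
      using V[rule_format, OF pt_in, of m] elim(1,2) unfolding pt_add by blast
    have "?h \<le> real d ^ n * height N (pt m) + B" using B[rule_format, OF pt_in, of m] unfolding pt_add .
    then have "a * ((?h - B) / real d ^ n) \<le> a * height N (pt m)"
      using a_pos dn by (intro mult_left_mono) (auto simp: field_simps)
    moreover have "a * ((?h - B) / real d ^ n) = A * (?\<delta> * ?h) + \<epsilon> * ?h / real d ^ n - a * B / real d ^ n"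
      using dn by (simp add: a_eq field_simps)
    moreover have "a * B / real d ^ n + C < \<epsilon> * ?h / real d ^ n"
    proof -
      have "(a * B / real d ^ n + C) * real d ^ n < \<epsilon> * ?h"
        using elim(3) unfolding pos_divide_less_eq[OF \<epsilon>] by (simp only: mult.commute)
      then show ?thesis unfolding pos_less_divide_eq[OF dn] .
    qed
    ultimately show ?case using 1 by linarith
  qed
  then show ?thesis by (subst (asm) eventually_sequentially_seg)
qed

end

end

theorem corollary2:
  fixes N d :: nat
    and \<phi> :: "nat \<Rightarrow> cpoly"
    and D :: cpoly
    and Dnc :: "nat \<Rightarrow> cpoly"
    and K :: "complex set"
    and P :: "(nat \<Rightarrow> complex) set"
    and S :: "(complex \<Rightarrow> real) set"
    and c :: real
    and ratio :: "nat \<Rightarrow> ereal"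
  assumes "N \<ge> 1" and "d \<ge> 2"
    and "number_field K"
    and "proj_morphism N K d \<phi>"
    and "effective_divisor N (ring_of_integers K) D" and "divisor_degree D > 0"
    and "\<And>n. nc_part N (pullback (poly_iterate \<phi> n) D) (Dnc n)"
    and "P \<in> proj_space N K"
    and "finite S" and "archimedean_places K \<subseteq> S" and "S \<subseteq> places K"
    and "c = (SUP n. (real (divisor_degree (Dnc n)) - (real N + 1))
                      / (real d ^ n * real (divisor_degree D)))"
    and "\<And>m. ratio m =
           (\<Sum>\<^sub>\<infinity>v\<in>places K - S. local_height N K v D ((proj_map N \<phi> ^^ m) P))
           / ereal (real (divisor_degree D) * weil_height N K ((proj_map N \<phi> ^^ m) P))"
    and "generic N (orbit N \<phi> P)"
    and "vojta_conjecture N"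
  shows "(\<forall>\<epsilon>>0. \<forall>\<^sub>F m in sequentially. ratio m > ereal (c - \<epsilon>)) \<and>
         ((\<exists>n. divisor_degree (Dnc n) > N + 1) \<longrightarrow>
            (\<forall>I. integral_set N K S D I \<longrightarrow> finite (orbit N \<phi> P \<inter> I))) \<and>
         (c = 1 \<longrightarrow> ratio \<longlonglongrightarrow> 1)"
proof -
  obtain x f where "numfield K x f" using number_field_numfield[OF assms(3)] .
  then interpret numfield K x f .
  obtain z0 where "z0 \<in> coord_vectors N K" and P: "P = proj_point z0" using assms(8) by (auto simp: proj_space_def)
  interpret generic_orbit K x f N d \<phi> z0
    using assms(2,4,14) \<open>z0 \<in> coord_vectors N K\<close> P by unfold_locales auto
  note Dn = assms(5,6)
  note DK = D_hom[OF Dn] D_K[OF Dn]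
  let ?\<delta> = "real (divisor_degree D)"
  have \<delta>: "?\<delta> > 0" using assms(6) by simp
  define a where "a = (\<lambda>n. (real (divisor_degree (Dnc n)) - (real N + 1)) / (real d ^ n * ?\<delta>))"
  have a_le_1: "a n \<le> 1" for n
  proof -
    have "real (divisor_degree (Dnc n)) \<le> real (divisor_degree D * d ^ n)"
      using nc_degree_le[OF Dn assms(7)] by (intro of_nat_mono)
    then have "real (divisor_degree (Dnc n)) - (real N + 1) \<le> real d ^ n * ?\<delta>" by (simp add: mult.commute)
    then show ?thesis using d2 \<delta> unfolding a_def by (subst divide_le_eq_1_pos) auto
  qed
  have bdd: "bdd_above (range a)" using a_le_1 by (intro bdd_aboveI2[of _ _ 1])
  have c: "c = (SUP n. a n)" using assms(12) by (simp add: a_def)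
  define T where "T m = out_height N S D (pt m)" for m
  define h where "h m = height N (pt m)" for m
  \<comment> \<open>A number below the supremum lies below one of its terms, so a single
    \<open>n\<close> decides.\<close>
  have lower: "eventually (\<lambda>m. A * (?\<delta> * h m) < T m) sequentially" if "A < c" for A
  proof -
    have "A < (SUP n. a n)" using that c by simp
    then obtain n where "A < a n" using less_cSUP_iff[OF UNIV_not_empty bdd] by blast
    then show ?thesis
      using eventually_out_height_gt[OF Dn assms(7,9,10,11,15)] unfolding a_def T_def h_def by blast
  qed
  have h_top: "eventually (\<lambda>m. B < h m) sequentially" for B
    using height_at_top by (simp add: filterlim_at_top_dense h_def)
  \<comment> \<open>Once \<open>D\<close> does not vanish at the point and the height is positive,
    the quotient of extended reals is a quotient of real numbers.\<close>
  have ratio: "eventually (\<lambda>m. ratio m = ereal (T m / (?\<delta> * h m)) \<and> h m > 0) sequentially"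
    using eventually_D[OF Dn] h_top[of 0]
  proof eventually_elim
    case (elim m)
    have "ratio m = ereal (T m) / ereal (?\<delta> * h m)"
      using infsum_local_height[OF pt_in DK elim(1)]
      by (simp add: assms(13) P proj_map_pt weil_height_eq[OF pt_in] T_def h_def)
    then show ?case using elim(2) \<delta> by simp
  qed
  have part1: "eventually (\<lambda>m. ratio m > ereal (c - \<epsilon>)) sequentially" if "\<epsilon> > 0" for \<epsilon>
  proof -
    have "c - \<epsilon> < c" using that by simp
    from ratio lower[OF this] show ?thesis
    proof eventually_elim
      case (elim m)
      then show ?case using \<delta> by (simp add: pos_less_divide_eq)
    qed
  qed
  have part2: "finite (orbit N \<phi> P \<inter> I)" if n: "divisor_degree (Dnc n) > N + 1" and I: "integral_set N K S D I" for n I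
  proof -
    have "0 < a n" using n d2 \<delta> by (auto simp: a_def)
    also have "\<dots> \<le> c" unfolding c using bdd by (intro cSUP_upper) auto
    finally have c0: "c > 0" .
    obtain cv where cv: "finite {v \<in> places K. cv v \<noteq> 0}"
      "I = {P \<in> proj_space N K. \<not> vanishes_at D P \<and> (\<forall>v\<in>places K - S. local_height N K v D P \<le> ereal (cv v))}"
      using I unfolding integral_set_def by blast
    obtain B where B: "\<forall>z\<in>coord_vectors N K. poly_eval D z \<noteq> 0 \<longrightarrow>
        (\<forall>v\<in>places K - S. local_height N K v D (proj_point z) \<le> ereal (cv v)) \<longrightarrow> out_height N S D z \<le> B"
      using out_height_integral_le[OF DK cv(1)] by blast
    \<comment> \<open>Any positive number below \<open>c\<close> would do in place of
      \<open>c / 2\<close>: on an integral set \<open>T m\<close> is at most \<open>B\<close>, while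
      the lower bound for \<open>T m\<close> grows with the height beyond \<open>B\<close>.\<close>
    have "eventually (\<lambda>m. c / 2 * (?\<delta> * h m) < T m \<and> B / (c / 2 * ?\<delta>) < h m) sequentially"
      using lower[of "c / 2"] h_top c0 by (auto intro: eventually_conj)
    then obtain M where M: "\<And>m. m \<ge> M \<Longrightarrow> c / 2 * (?\<delta> * h m) < T m \<and> B / (c / 2 * ?\<delta>) < h m"
      unfolding eventually_sequentially by blast
    have "m < M" if "proj_point (pt m) \<in> I" for m
    proof (rule ccontr)
      assume "\<not> m < M"
      then have m: "c / 2 * (?\<delta> * h m) < T m" "B / (c / 2 * ?\<delta>) < h m" using M[of m] by auto
      have "T m \<le> B"
        using that B pt_in[of m] unfolding cv(2) T_def by (auto simp: vanishes_at_proj_point[OF DK(1)])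
      moreover have "B < c / 2 * (?\<delta> * h m)" using m(2) c0 \<delta> by (simp add: field_simps)
      ultimately show False using m(1) by simp
    qed
    then have "orbit N \<phi> P \<inter> I \<subseteq> (\<lambda>m. proj_point (pt m)) ` {..<M}" by (auto simp: P orbit_eq)
    then show ?thesis by (rule finite_subset) simp
  qed
  have part3: "ratio \<longlonglongrightarrow> 1" if c1: "c = 1"
  proof -
    obtain B where B: "\<forall>z\<in>coord_vectors N K. poly_eval D z \<noteq> 0 \<longrightarrow> out_height N S D z \<le> ?\<delta> * height N z + B"
      using out_height_le[OF DK] by blast
    have "((\<lambda>m. T m / (?\<delta> * h m)) \<longlongrightarrow> 1) sequentially"
    proof (rule order_tendstoI)
      fix A :: real assume "A < 1"
      then have "eventually (\<lambda>m. A * (?\<delta> * h m) < T m) sequentially" using lower c1 by simp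
      with h_top[of 0] show "eventually (\<lambda>m. A < T m / (?\<delta> * h m)) sequentially"
        by eventually_elim (use \<delta> in \<open>simp add: pos_less_divide_eq\<close>)
    next
      \<comment> \<open>Local heights of \<open>D\<close> are bounded from below, so after leaving
        out the places in \<open>S\<close> the sum exceeds the total \<open>?\<delta> * h m\<close>
        by at most the constant \<open>B\<close>.\<close>
      fix A :: real assume A: "1 < A"
      from h_top[of 0] h_top[of "B / ((A - 1) * ?\<delta>)"] eventually_D[OF Dn]
      show "eventually (\<lambda>m. T m / (?\<delta> * h m) < A) sequentially"
      proof eventually_elim
        case (elim m)
        have "T m \<le> ?\<delta> * h m + B" using B pt_in[of m] elim(3) by (simp add: T_def h_def)
        also have "B < (A - 1) * ?\<delta> * h m" using elim(2) A \<delta> by (simp add: field_simps)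
        finally have "T m < A * (?\<delta> * h m)" by (simp add: algebra_simps)
        then show ?case using elim(1) \<delta> by (simp add: pos_divide_less_eq)
      qed
    qed
    then have "((\<lambda>m. ereal (T m / (?\<delta> * h m))) \<longlongrightarrow> 1) sequentially"
      using tendsto_ereal by (metis one_ereal_def)
    moreover have "eventually (\<lambda>m. ereal (T m / (?\<delta> * h m)) = ratio m) sequentially"
      using ratio by eventually_elim simp
    ultimately show ?thesis by (rule Lim_transform_eventually)
  qed
  show ?thesis using part1 part2 part3 by blast
qed

end
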